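(* Let $G$ be a subgroup of $S_{\mathbb N}$. (1) The maximal ideal spaces of $\mathscr W_G$, $\mathscr A_G$, $W(\overline{\mathbb D}^{\mathbb O}/\widehat G_{\mathbb O})$ and $A(\overline{\mathbb D}^{\mathbb O}/\widehat G_{\mathbb O})$ are homeomorphic. (2) $M\big(A(\overline{\mathbb D}^{\mathbb O}/\widehat G_{\mathbb O})\big)=\overline{\mathbb D}^{\mathbb O}/\widehat G_{\mathbb O}$, where points of $\overline{\mathbb D}^{\mathbb O}/\widehat G_{\mathbb O}$ are identified with the evaluation homomorphisms of the algebra $A(\overline{\mathbb D}^{\mathbb O}/\widehat G_{\mathbb O})$ at these points.
   Context: For a commutative unital complex Banach algebra $B$, $M(B)$ is the maximal ideal space: the set of nonzero homomorphisms $B\to\mathbb C$ with the weak$^*$ (Gelfand) topology. Dirichlet series algebras. Let $\mathbb C_+=\{\mathrm{Re}\,s>0\}$. $\mathscr W$ is the algebra of limit functions on $\mathbb C_+$ of Dirichlet series $\sum_{n\ge1}a_nn^{-s}$ with $\sum|a_n|<\infty$, with norm $\|f\|_1=\sum|a_n|$; $\mathscr A$ is the uniform closure of $\mathscr W$ in the bounded holomorphic functions on $\mathbb C_+$ with the supremum norm (its elements are limits of unique Dirichlet series converging uniformly on each $\{\mathrm{Re}\,s>\varepsilon\}$, $\varepsilon>0$). $S_{\mathbb N}$ is the group of all permutations of $\mathbb N=\{1,2,\dots\}$; $p_1<p_2<\cdots$ are the primes, $\nu_p(n)$ the exponent of $p$ in $n$. For $\sigma\in S_{\mathbb N}$, $\hat\sigma(n)=\prod_ip_{\sigma(i)}^{\nu_{p_i}(n)}$.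 For $\mathbb A\in\{\mathscr W,\mathscr A\}$, $\mathbb A_G$ is the closed subalgebra of those $f\in\mathbb A$ whose Dirichlet series $\sum a_nn^{-s}$ satisfies $a_{\hat\sigma(n)}=a_n$ for all $n\in\mathbb N$, $\sigma\in G$. The group $\widehat G_{\mathbb O}$. $\mathbb O\subset\mathbb N$ is the union of all finite orbits of $G$ on $\mathbb N$, enumerated as $O_1,O_2,\dots$ (finitely or countably many). $Q_{\mathbb O}=\prod_iS_{O_i}$ ($S_{O_i}$ the finite group of permutations of $O_i$) with the product topology. $\widehat G_{\mathbb O}$ is the closure in $Q_{\mathbb O}$ of the image of $G$ under $g\mapsto(g|_{O_1},g|_{O_2},\dots)$. For $q=(q_1,q_2,\dots)\in Q_{\mathbb O}$, $\psi(q)$ is the permutation of $\mathbb O$ with $\psi(q)(n)=q_i(n)$ for $n\in O_i$; $Q_{\mathbb O}$ acts on $\ell^\infty(\mathbb O)$ (bounded complex functions on $\mathbb O$, supremum norm) by $\psi^*(q)(f)=f\circ\psi(q)$. Polydiscs and function algebras. $\overline{\mathbb D}^{\mathbb O}$ is the closed unit ball of $\ell^\infty(\mathbb O)$ with the product topology (compact Hausdorff); $\mathbb D^{\mathbb O}=\bigcup_{0<r<1}r\overline{\mathbb D}^{\mathbb O}$ is the open unit ball. $\overline{\mathbb D}^{\mathbb O}/\widehat G_{\mathbb O}$ is the orbit space of the action $\psi^*|_{\widehat G_{\mathbb O}}$ with the quotient topology (compact Hausdorff), and $\pi$ is the quotient map. A function $f:\mathbb D^{\mathbb O}\to\mathbb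 C$ is Gâteaux holomorphic if for all $z\in\mathbb D^{\mathbb O}$, $h\in\ell^\infty(\mathbb O)$ the function $w\mapsto f(z+wh)$ is holomorphic near $0\in\mathbb C$. $A(\mathbb D^{\mathbb O})$ is the algebra of Gâteaux holomorphic functions on $\mathbb D^{\mathbb O}$ admitting continuous extensions to $\overline{\mathbb D}^{\mathbb O}$ (product topology), with the supremum norm. $W(\mathbb D^{\mathbb O})\subset A(\mathbb D^{\mathbb O})$ consists of the pointwise limits on $\mathbb D^{\mathbb O}$ of complex power series in the coordinate functions $z_i$, $i\in\mathbb O$, absolutely convergent on $\overline{\mathbb D}^{\mathbb O}$, with norm the sum of moduli of coefficients. For $\mathcal A\in\{W(\mathbb D^{\mathbb O}),A(\mathbb D^{\mathbb O})\}$, $\mathcal A_{\widehat G_{\mathbb O}}=\{f\in\mathcal A: f\circ\psi^*(q)=f\ \forall q\in\widehat G_{\mathbb O}\}$. $W(\overline{\mathbb D}^{\mathbb O}/\widehat G_{\mathbb O})$ and $A(\overline{\mathbb D}^{\mathbb O}/\widehat G_{\mathbb O})$ are the subalgebras of $C(\overline{\mathbb D}^{\mathbb O}/\widehat G_{\mathbb O})$ whose pullbacks by $\pi$ are exactly the continuous extensions to $\overline{\mathbb D}^{\mathbb O}$ of the functions in $W(\mathbb D^{\mathbb O})_{\widehat G_{\mathbb O}}$ and $A(\mathbb D^{\mathbb O})_{\widehat G_{\mathbb O}}$ respectively, with the norms induced from these. *)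

theory Defs
  imports
    "HOL-Analysis.Analysis"
    "HOL-Computational_Algebra.Primes"
    "HOL-Library.Poly_Mapping"
    "HOL-Algebra.Group_Action"
begin

text \<open>
  The positive integers are the set \<open>{1..}\<close> of type \<^typ>\<open>nat set\<close>, and the group of all their
  permutations is \<^term>\<open>BijGroup {1..}\<close>. Functions on a set \<open>X\<close> are represented by elements
  of \<^term>\<open>extensional X\<close>, so that equality of functions on \<open>X\<close> is equality in HOL.
\<close>


section \<open>Maximal ideal spaces of function algebras\<close>

text \<open>
  \<open>B\<close> is an algebra of complex functions on \<open>X\<close> with pointwise operations. Every homomorphism from
  a Banach algebra to the complex numbers is bounded, so no norm occurs in the definition.
  As usual, homomorphisms are complex-linear and multiplicative.
\<close>

definition characters :: "'x set \<Rightarrow> ('x \<Rightarrow> complex) set \<Rightarrow> (('x \<Rightarrow> complex) \<Rightarrow> complex) set" where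
  "characters X B = {\<phi> \<in> extensional B.
     (\<forall>f\<in>B. \<forall>g\<in>B. \<phi> (\<lambda>x\<in>X. f x + g x) = \<phi> f + \<phi> g) \<and>
     (\<forall>f\<in>B. \<forall>g\<in>B. \<phi> (\<lambda>x\<in>X. f x * g x) = \<phi> f * \<phi> g) \<and>
     (\<forall>c. \<forall>f\<in>B. \<phi> (\<lambda>x\<in>X. c * f x) = c * \<phi> f) \<and>
     (\<exists>f\<in>B. \<phi> f \<noteq> 0)}"

text \<open>The Gelfand (weak-star) topology is that of pointwise convergence on \<open>B\<close>.\<close>

definition max_ideal_space ::
    "'x set \<Rightarrow> ('x \<Rightarrow> complex) set \<Rightarrow> (('x \<Rightarrow> complex) \<Rightarrow> complex) topology" where
  "max_ideal_space X B = subtopology (product_topology (\<lambda>_. euclidean) B) (characters X B)"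


section \<open>Dirichlet series algebras\<close>

definition right_half_plane :: "complex set" where
  "right_half_plane = {s. Re s > 0}"

definition dirichlet_W :: "(complex \<Rightarrow> complex) set" where
  "dirichlet_W = {f \<in> extensional right_half_plane. \<exists>a :: nat \<Rightarrow> complex.
     (\<lambda>n. norm (a n)) summable_on {1..} \<and>
     (\<forall>s\<in>right_half_plane. ((\<lambda>n. a n * of_nat n powr (- s)) has_sum f s) {1..})}"

text \<open>The closure of \<^term>\<open>dirichlet_W\<close> in the bounded holomorphic functions, supremum norm.\<close>

definition dirichlet_A :: "(complex \<Rightarrow> complex) set" where
  "dirichlet_A = {f \<in> extensional right_half_plane.
     f holomorphic_on right_half_plane \<and> bounded (f ` right_half_plane) \<and>
     (\<forall>\<epsilon>>0. \<exists>g\<in>dirichlet_W. \<forall>s\<in>right_half_plane. norm (f s - g s) \<le> \<epsilon>)}"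

text \<open>
  \<open>a\<close> is the coefficient sequence of the Dirichlet series of \<open>f\<close>; the value \<open>a 0\<close> is irrelevant.
\<close>

definition has_dirichlet_series :: "(complex \<Rightarrow> complex) \<Rightarrow> (nat \<Rightarrow> complex) \<Rightarrow> bool" where
  "has_dirichlet_series f a \<longleftrightarrow>
     (\<forall>\<epsilon>>0. uniform_limit {s. Re s > \<epsilon>} (\<lambda>N s. \<Sum>n=1..N. a n * of_nat n powr (- s)) f sequentially)"

text \<open>Primes are numbered from 1, whereas \<^term>\<open>enumerate\<close> counts from 0.\<close>

definition nth_prime :: "nat \<Rightarrow> nat" where
  "nth_prime i = enumerate {p. prime p} (i - 1)"

definition hat :: "(nat \<Rightarrow> nat) \<Rightarrow> nat \<Rightarrow> nat" where
  "hat \<sigma> n = (\<Prod>i | 1 \<le> i \<and> nth_prime i dvd n. nth_prime (\<sigma> i) ^ multiplicity (nth_prime i) n)"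

definition dirichlet_invariant ::
    "(complex \<Rightarrow> complex) set \<Rightarrow> (nat \<Rightarrow> nat) set \<Rightarrow> (complex \<Rightarrow> complex) set" where
  "dirichlet_invariant \<A> G = {f \<in> \<A>. \<exists>a. has_dirichlet_series f a \<and>
     (\<forall>\<sigma>\<in>G. \<forall>n\<ge>1. a (hat \<sigma> n) = a n)}"


section \<open>The profinite group of a permutation group\<close>

abbreviation perm_group :: "(nat \<Rightarrow> nat) set \<Rightarrow> (nat \<Rightarrow> nat) monoid" where
  "perm_group G \<equiv> (BijGroup {1..})\<lparr>carrier := G\<rparr>"

definition finite_orbits :: "(nat \<Rightarrow> nat) set \<Rightarrow> nat set set" where
  "finite_orbits G = {X \<in> orbits (perm_group G) {1..} (\<lambda>g. g). finite X}"

definition fin_orb_union :: "(nat \<Rightarrow> nat) set \<Rightarrow> nat set" where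
  "fin_orb_union G = \<Union>(finite_orbits G)"

text \<open>
  The product of the symmetric groups of the finite orbits is indexed by the finite orbits
  themselves rather than by an enumeration of them.
\<close>

definition Q_top :: "(nat \<Rightarrow> nat) set \<Rightarrow> (nat set \<Rightarrow> nat \<Rightarrow> nat) topology" where
  "Q_top G = product_topology (\<lambda>X. discrete_topology (Bij X)) (finite_orbits G)"

definition G_hat :: "(nat \<Rightarrow> nat) set \<Rightarrow> (nat set \<Rightarrow> nat \<Rightarrow> nat) set" where
  "G_hat G = Abstract_Topology.closure_of (Q_top G) ((\<lambda>g. \<lambda>X\<in>finite_orbits G. restrict g X) ` G)"

text \<open>For \<open>n\<close> in a finite orbit, the index of that orbit is the orbit of \<open>n\<close>.\<close>

definition psi :: "(nat \<Rightarrow> nat) set \<Rightarrow> (nat set \<Rightarrow> nat \<Rightarrow> nat) \<Rightarrow> nat \<Rightarrow> nat" where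
  "psi G q = (\<lambda>n\<in>fin_orb_union G. q (orbit (perm_group G) (\<lambda>g. g) n) n)"

definition psi_star ::
    "(nat \<Rightarrow> nat) set \<Rightarrow> (nat set \<Rightarrow> nat \<Rightarrow> nat) \<Rightarrow> (nat \<Rightarrow> complex) \<Rightarrow> (nat \<Rightarrow> complex)" where
  "psi_star G q z = compose (fin_orb_union G) z (psi G q)"


section \<open>Function algebras on polydiscs\<close>

definition linf :: "nat set \<Rightarrow> (nat \<Rightarrow> complex) set" where
  "linf I = {z \<in> extensional I. bounded (z ` I)}"

definition closed_polydisc :: "nat set \<Rightarrow> (nat \<Rightarrow> complex) topology" where
  "closed_polydisc I = product_topology (\<lambda>_. top_of_set (cball 0 1)) I"

text \<open>
  This is the open unit ball for the supremum norm. It is smaller than the product of the open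
  unit discs if \<open>I\<close> is infinite.
\<close>

definition open_polydisc :: "nat set \<Rightarrow> (nat \<Rightarrow> complex) set" where
  "open_polydisc I = (\<Union>r\<in>{0<..<1}. \<Pi>\<^sub>E i\<in>I. cball 0 r)"

definition gateaux_holomorphic :: "nat set \<Rightarrow> ((nat \<Rightarrow> complex) \<Rightarrow> complex) \<Rightarrow> bool" where
  "gateaux_holomorphic I f \<longleftrightarrow>
     (\<forall>z\<in>open_polydisc I. \<forall>h\<in>linf I. (\<lambda>w. f (\<lambda>i\<in>I. z i + w * h i)) analytic_on {0})"

definition continuous_extension ::
    "nat set \<Rightarrow> ((nat \<Rightarrow> complex) \<Rightarrow> complex) \<Rightarrow> ((nat \<Rightarrow> complex) \<Rightarrow> complex) \<Rightarrow> bool" where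
  "continuous_extension I f F \<longleftrightarrow>
     continuous_map (closed_polydisc I) euclidean F \<and> (\<forall>z\<in>open_polydisc I. F z = f z)"

definition polydisc_A :: "nat set \<Rightarrow> ((nat \<Rightarrow> complex) \<Rightarrow> complex) set" where
  "polydisc_A I = {f \<in> extensional (open_polydisc I).
     gateaux_holomorphic I f \<and> (\<exists>F. continuous_extension I f F)}"

text \<open>
  The multi-indices of power series in the coordinates \<open>z i\<close> for \<open>i \<in> I\<close> are the finitely supported
  functions with support in \<open>I\<close>.
\<close>

definition monomial_fun :: "(nat \<Rightarrow>\<^sub>0 nat) \<Rightarrow> (nat \<Rightarrow> complex) \<Rightarrow> complex" where
  "monomial_fun \<alpha> z = (\<Prod>i\<in>Poly_Mapping.keys \<alpha>. z i ^ Poly_Mapping.lookup \<alpha> i)"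

definition polydisc_W :: "nat set \<Rightarrow> ((nat \<Rightarrow> complex) \<Rightarrow> complex) set" where
  "polydisc_W I = {f \<in> polydisc_A I. \<exists>c :: (nat \<Rightarrow>\<^sub>0 nat) \<Rightarrow> complex.
     (\<forall>z\<in>topspace (closed_polydisc I).
        (\<lambda>\<alpha>. norm (c \<alpha> * monomial_fun \<alpha> z)) summable_on {\<alpha>. Poly_Mapping.keys \<alpha> \<subseteq> I}) \<and>
     (\<forall>z\<in>open_polydisc I.
        ((\<lambda>\<alpha>. c \<alpha> * monomial_fun \<alpha> z) has_sum f z) {\<alpha>. Poly_Mapping.keys \<alpha> \<subseteq> I})}"

definition polydisc_invariant ::
    "((nat \<Rightarrow> complex) \<Rightarrow> complex) set \<Rightarrow> (nat \<Rightarrow> nat) set \<Rightarrow> ((nat \<Rightarrow> complex) \<Rightarrow> complex) set" where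
  "polydisc_invariant \<A> G = {f \<in> \<A>.
     \<forall>q\<in>G_hat G. \<forall>z\<in>open_polydisc (fin_orb_union G). f (psi_star G q z) = f z}"


section \<open>The orbit space and its function algebras\<close>

definition quot_topology :: "'a topology \<Rightarrow> ('a \<Rightarrow> 'b) \<Rightarrow> 'b topology" where
  "quot_topology X p =
     topology (\<lambda>U. U \<subseteq> p ` topspace X \<and> openin X {x \<in> topspace X. p x \<in> U})"

lemma openin_quot_topology:
  "openin (quot_topology X p) U \<longleftrightarrow>
     U \<subseteq> p ` topspace X \<and> openin X {x \<in> topspace X. p x \<in> U}"
proof -
  have "istopology (\<lambda>U. U \<subseteq> p ` topspace X \<and> openin X {x \<in> topspace X. p x \<in> U})"
    unfolding istopology_def
  proof (intro conjI allI impI)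
    fix S T
    assume S: "S \<subseteq> p ` topspace X \<and> openin X {x \<in> topspace X. p x \<in> S}"
      and T: "T \<subseteq> p ` topspace X \<and> openin X {x \<in> topspace X. p x \<in> T}"
    show "S \<inter> T \<subseteq> p ` topspace X"
      using conjunct1[OF S] by (rule le_infI1)
    have "{x \<in> topspace X. p x \<in> S \<inter> T} =
        {x \<in> topspace X. p x \<in> S} \<inter> {x \<in> topspace X. p x \<in> T}" by blast
    then show "openin X {x \<in> topspace X. p x \<in> S \<inter> T}"
      using openin_Int[OF conjunct2[OF S] conjunct2[OF T]] by (simp only:)
  next
    fix K
    assume K: "\<forall>U\<in>K. U \<subseteq> p ` topspace X \<and> openin X {x \<in> topspace X. p x \<in> U}"
    show "\<Union>K \<subseteq> p ` topspace X"
      by (rule Union_least) (rule conjunct1[OF bspec[OF K]])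
    have eq: "{x \<in> topspace X. p x \<in> \<Union>K} = (\<Union>U\<in>K. {x \<in> topspace X. p x \<in> U})" by blast
    have "openin X (\<Union>U\<in>K. {x \<in> topspace X. p x \<in> U})"
    proof (rule openin_Union)
      fix V
      assume "V \<in> (\<lambda>U. {x \<in> topspace X. p x \<in> U}) ` K"
      then obtain U where U: "U \<in> K" "V = {x \<in> topspace X. p x \<in> U}" by (rule imageE)
      show "openin X V"
        unfolding U(2) by (rule conjunct2[OF bspec[OF K U(1)]])
    qed
    then show "openin X {x \<in> topspace X. p x \<in> \<Union>K}"
      unfolding eq .
  qed
  then show ?thesis
    by (simp only: quot_topology_def topology_inverse')
qed

lemma topspace_quot_topology: "topspace (quot_topology X p) = p ` topspace X"
proof (rule equalityI)
  show "topspace (quot_topology X p) \<subseteq> p ` topspace X"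
    using openin_topspace[of "quot_topology X p"] unfolding openin_quot_topology by (rule conjunct1)
  have "{x \<in> topspace X. p x \<in> p ` topspace X} = topspace X" by blast
  then have "openin (quot_topology X p) (p ` topspace X)"
    by (simp only: openin_quot_topology openin_topspace subset_refl simp_thms)
  then show "p ` topspace X \<subseteq> topspace (quot_topology X p)"
    by (rule openin_subset)
qed

lemma quotient_map_quot_topology: "quotient_map X (quot_topology X p) p"
  by (simp add: quotient_map_def topspace_quot_topology openin_quot_topology)

definition orbit_proj :: "(nat \<Rightarrow> nat) set \<Rightarrow> (nat \<Rightarrow> complex) \<Rightarrow> (nat \<Rightarrow> complex) set" where
  "orbit_proj G z = (\<lambda>q. psi_star G q z) ` G_hat G"

definition orbit_space :: "(nat \<Rightarrow> nat) set \<Rightarrow> (nat \<Rightarrow> complex) set topology" where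
  "orbit_space G = quot_topology (closed_polydisc (fin_orb_union G)) (orbit_proj G)"

text \<open>The continuous functions whose pullback is the continuous extension of a member of \<open>\<A>\<close>.\<close>

definition orbit_space_algebra ::
    "((nat \<Rightarrow> complex) \<Rightarrow> complex) set \<Rightarrow> (nat \<Rightarrow> nat) set \<Rightarrow> ((nat \<Rightarrow> complex) set \<Rightarrow> complex) set" where
  "orbit_space_algebra \<A> G = {F \<in> extensional (topspace (orbit_space G)).
     continuous_map (orbit_space G) euclidean F \<and>
     (\<exists>f\<in>\<A>. continuous_extension (fin_orb_union G) f (F \<circ> orbit_proj G))}"

definition orbit_space_W :: "(nat \<Rightarrow> nat) set \<Rightarrow> ((nat \<Rightarrow> complex) set \<Rightarrow> complex) set" where
  "orbit_space_W G = orbit_space_algebra (polydisc_invariant (polydisc_W (fin_orb_union G)) G) G"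

definition orbit_space_A :: "(nat \<Rightarrow> nat) set \<Rightarrow> ((nat \<Rightarrow> complex) set \<Rightarrow> complex) set" where
  "orbit_space_A G = orbit_space_algebra (polydisc_invariant (polydisc_A (fin_orb_union G)) G) G"

end

theory Submission
  imports Defs "HOL-Complex_Analysis.Complex_Analysis" "HOL-Real_Asymp.Real_Asymp"
    "HOL-Computational_Algebra.Fundamental_Theorem_Algebra"
begin

text \<open>
  All four algebras live on the compact polydisc of functions \<open>z : I \<rightarrow> cball 0 1\<close>, where \<open>I\<close> is the union
  of the finite orbits of \<open>G\<close>. Each of them consists of the functions \<open>x \<mapsto> h (\<iota> x)\<close>, where \<open>h\<close> runs through
  the \<open>G\<close>-invariant functions that are limits of polynomials in finitely many coordinates, either in the
  supremum norm or in the \<open>l1\<close> norm of the coefficients, and where \<open>\<iota>\<close> maps the domain of the algebra into the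
  polydisc such that \<open>h\<close> is determined by its values on the range of \<open>\<iota>\<close>. For the Dirichlet algebras
  \<open>\<iota> s\<close> is the point with coordinates \<open>p_i powr - s\<close>, so that a Dirichlet polynomial becomes a polynomial by
  Bohr's substitution of a variable for each prime. For the algebras on the orbit space \<open>\<iota>\<close> chooses a point
  of each orbit.

  For such an algebra every character is evaluation at a point of the polydisc, and two points give the same
  character exactly if they lie in one orbit of the profinite group. The orbit space is compact and the maximal
  ideal space is Hausdorff, so the resulting continuous bijection is a homeomorphism. Hence all four maximal
  ideal spaces are homeomorphic to the orbit space. That characters are evaluations (\<open>character_point\<close>) has
  three reasons.

  \<^item> On finitely many coordinates in \<open>I\<close> the group acts through a finite quotient. Polynomials are therefore
    integral over the invariant ones, and there is an averaging projection onto the invariant ones. So a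
    character of the invariant polynomials is evaluation at some complex vector \<open>\<zeta>\<close> (\<open>lying_over\<close>).

  \<^item> If \<open>h\<close> has norm less than 1, then \<open>h / (1 - h)\<close> belongs to the algebra, so a character is bounded by the
    norm. The vector \<open>\<zeta>\<close> then lies in the polydisc: otherwise let \<open>u\<close> be a coordinate of \<open>\<zeta>\<close> of maximal modulus
    in its orbit, with \<open>norm u > 1\<close>. The Cesaro means of the powers of \<open>z_j / u\<close>, summed over the orbit, tend to 0 in
    norm on the polydisc, but at \<open>\<zeta>\<close> they tend to the positive number of coordinates that equal \<open>u\<close>.

  \<^item> Averaging does not increase norms, so the invariant polynomials are dense in the algebra.

  It remains to realize the four algebras in this way. For the Dirichlet algebras this needs two theorems of
  Bohr. A uniform limit of Dirichlet polynomials on the half plane is the sum of a Dirichlet series that converges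
  uniformly on smaller half planes (\<open>partial_sum_bounded\<close>, \<open>has_dirichlet_series_if_poly_near\<close>), and the supremum
  of a Dirichlet polynomial on the half plane dominates the corresponding polynomial on the polydisc
  (\<open>bohr_inequality\<close>). Both rest on a kernel whose cosine transform is a trapezoid: it filters single
  coefficients and partial sums out of a Dirichlet polynomial. A coefficient \<open>a n\<close> of an invariant series vanishes
  if \<open>n\<close> has a prime factor with index in an infinite orbit, because the same value recurs at infinitely many places
  while a Dirichlet polynomial close to the series has only finitely many coefficients
  (\<open>invariant_coeff_support\<close>). For the algebras on the orbit space one needs that a Gateaux holomorphic function
  with a continuous extension is a uniform limit of polynomials (\<open>gateaux_poly_approx\<close>): compactness reduces this
  to finitely many coordinates, which are then interpolated at roots of unity one after the other.
\<close>

section \<open>Prime factorizations and monomials\<close>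

text \<open>
  Bohr's monomial: \<open>n\<close> written as a product of primes, with \<open>z i\<close> substituted for the \<open>i\<close>-th prime. It is completely
  multiplicative in \<open>n \<ge> 1\<close>. The values \<open>z i = nth_prime i powr - s\<close> give the general term of a Dirichlet
  series, and the values \<open>z i = nth_prime (\<sigma> i)\<close> give \<open>hat \<sigma> n\<close>.
\<close>

definition bohr_monomial :: "(nat \<Rightarrow> 'a::comm_semiring_1) \<Rightarrow> nat \<Rightarrow> 'a" where
  "bohr_monomial z n = (\<Prod>i | 1 \<le> i \<and> nth_prime i dvd n. z i ^ multiplicity (nth_prime i) n)"

text \<open>
  These numbers index the monomials in the coordinates from \<open>I\<close>.
\<close>

definition smooth_over :: "nat set \<Rightarrow> nat set" where
  "smooth_over I = {n. 1 \<le> n \<and> (\<forall>i\<ge>1. nth_prime i dvd n \<longrightarrow> i \<in> I)}"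

lemma bij_betw_nth_prime: "bij_betw nth_prime {1..} {p. prime p}"
proof -
  have "bij_betw (\<lambda>i. i - 1) {1..} (UNIV :: nat set)"
    by (rule bij_betwI[where g = Suc]) auto
  from bij_betw_trans[OF this bij_enumerate[OF primes_infinite]]
  show ?thesis
    by (simp add: nth_prime_def[abs_def] o_def)
qed

lemma prime_nth_prime [simp]: "i \<ge> 1 \<Longrightarrow> prime (nth_prime i)"
  using bij_betw_nth_prime by (auto dest: bij_betwE)

lemma nth_prime_eq_iff: "i \<ge> 1 \<Longrightarrow> j \<ge> 1 \<Longrightarrow> nth_prime i = nth_prime j \<longleftrightarrow> i = j"
  using bij_betw_nth_prime by (auto simp: bij_betw_def inj_on_def)

lemma prime_nth_primeE:
  assumes "prime p" obtains i where "i \<ge> 1" "p = nth_prime i"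
  using assms bij_betw_nth_prime by (auto simp: bij_betw_def image_iff set_eq_iff)

lemma nth_prime_gt_0 [simp]: "i \<ge> 1 \<Longrightarrow> nth_prime i > 0"
  using prime_nth_prime prime_gt_0_nat by blast

lemma nth_prime_ge_1 [simp]: "i \<ge> Suc 0 \<Longrightarrow> Suc 0 \<le> nth_prime i"
  by (simp add: Suc_le_eq)

text \<open>
  Completely multiplicative functions of a positive integer are compared by this induction.
\<close>

lemma nth_prime_induct [consumes 1, case_names one mult]:
  fixes n :: nat
  assumes "n \<ge> 1" "P 1" "\<And>i n. i \<ge> 1 \<Longrightarrow> n \<ge> 1 \<Longrightarrow> P n \<Longrightarrow> P (nth_prime i * n)"
  shows "P n"
proof -
  have "n \<ge> 1 \<longrightarrow> P n"
  proof (induction n rule: prime_divisors_induct)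
    case (factor p x)
    then show ?case
      by (metis One_nat_def Suc_leI assms(3) mult_is_0 neq0_conv not_one_le_zero prime_nth_primeE)
  qed (use assms in auto)
  then show ?thesis using assms(1) by blast
qed

lemma finite_prime_indices:
  assumes "n > 0" shows "finite {i. 1 \<le> i \<and> nth_prime i dvd n}"
proof (rule finite_imageD)
  show "finite (nth_prime ` {i. 1 \<le> i \<and> nth_prime i dvd n})"
    by (rule finite_subset[of _ "{d. d dvd n}"]) (use assms in auto)
  show "inj_on nth_prime {i. 1 \<le> i \<and> nth_prime i dvd n}"
    by (auto simp: inj_on_def nth_prime_eq_iff)
qed

lemma bohr_monomial_superset:
  assumes "finite J" "\<And>i. i \<ge> 1 \<Longrightarrow> nth_prime i dvd n \<Longrightarrow> i \<in> J" "J \<subseteq> {1..}"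
  shows "bohr_monomial z n = (\<Prod>i\<in>J. z i ^ multiplicity (nth_prime i) n)"
  unfolding bohr_monomial_def
proof (rule prod.mono_neutral_left)
  show "\<forall>i\<in>J - {i. 1 \<le> i \<and> nth_prime i dvd n}. z i ^ multiplicity (nth_prime i) n = 1"
    using assms(3) by (auto simp: not_dvd_imp_multiplicity_0 subset_iff)
qed (use assms in auto)

lemma bohr_monomial_1 [simp]: "bohr_monomial z (Suc 0) = 1"
proof -
  have "\<not> nth_prime i dvd 1" if "1 \<le> i" for i
    using prime_nth_prime[OF that] not_prime_unit by blast
  then have "{i. 1 \<le> i \<and> nth_prime i dvd 1} = {}" by blast
  then show ?thesis by (simp add: bohr_monomial_def)
qed

lemma bohr_monomial_mult:
  assumes "m \<ge> 1" "n \<ge> 1" shows "bohr_monomial z (m * n) = bohr_monomial z m * bohr_monomial z n"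
proof -
  let ?J = "{i. 1 \<le> i \<and> nth_prime i dvd m * n}"
  have J: "finite ?J" using finite_prime_indices assms by simp
  have 1: "bohr_monomial z m = (\<Prod>i\<in>?J. z i ^ multiplicity (nth_prime i) m)"
    by (rule bohr_monomial_superset) (use J in auto)
  have 2: "bohr_monomial z n = (\<Prod>i\<in>?J. z i ^ multiplicity (nth_prime i) n)"
    by (rule bohr_monomial_superset) (use J in auto)
  have "bohr_monomial z (m * n) = (\<Prod>i\<in>?J. z i ^ multiplicity (nth_prime i) m * z i ^ multiplicity (nth_prime i) n)"
    unfolding bohr_monomial_def
    by (rule prod.cong) (use assms in \<open>auto simp: prime_elem_multiplicity_mult_distrib power_add\<close>)
  then show ?thesis unfolding 1 2 prod.distrib .
qed

lemma nth_prime_dvd_iff: "i \<ge> 1 \<Longrightarrow> j \<ge> 1 \<Longrightarrow> nth_prime j dvd nth_prime i \<longleftrightarrow> j = i"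
  by (metis dvd_refl nth_prime_eq_iff prime_nth_prime primes_dvd_imp_eq)

lemma bohr_monomial_nth_prime:
  assumes "i \<ge> 1" shows "bohr_monomial z (nth_prime i) = z i"
proof -
  have "{j. 1 \<le> j \<and> nth_prime j dvd nth_prime i} = {i}"
    using assms nth_prime_dvd_iff by auto
  moreover have "multiplicity (nth_prime i) (nth_prime i) = 1"
    using prime_nth_prime[OF assms] by (intro multiplicity_self) auto
  ultimately show ?thesis by (simp add: bohr_monomial_def)
qed

lemma bohr_monomial_cong:
  assumes "\<And>i. i \<ge> 1 \<Longrightarrow> nth_prime i dvd n \<Longrightarrow> z i = w i" shows "bohr_monomial z n = bohr_monomial w n"
  unfolding bohr_monomial_def by (rule prod.cong) (use assms in auto)

lemma bohr_monomial_cong_smooth: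
  assumes "n \<in> smooth_over I" "\<And>i. i \<in> I \<Longrightarrow> z i = w i" shows "bohr_monomial z n = bohr_monomial w n"
  by (rule bohr_monomial_cong) (use assms in \<open>auto simp: smooth_over_def\<close>)

lemma bohr_monomial_nth_prime_self: "n \<ge> 1 \<Longrightarrow> bohr_monomial nth_prime n = n"
  by (induction n rule: nth_prime_induct) (auto simp: bohr_monomial_mult bohr_monomial_nth_prime)

lemma bohr_monomial_eq_0:
  fixes z :: "nat \<Rightarrow> 'a::idom"
  assumes "n \<ge> 1" "i \<ge> 1" "nth_prime i dvd n" "z i = 0" shows "bohr_monomial z n = 0"
proof -
  obtain m where m: "n = nth_prime i * m" using assms(3) by blast
  with assms(1) have "m \<ge> 1" by (cases m) auto
  then show ?thesis using assms m by (simp add: bohr_monomial_mult bohr_monomial_nth_prime)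
qed

lemma bohr_monomial_powr: "n \<ge> 1 \<Longrightarrow> bohr_monomial (\<lambda>i. of_nat (nth_prime i) powr s) n = (of_nat n powr s :: complex)"
  by (induction n rule: nth_prime_induct) (auto simp: bohr_monomial_mult bohr_monomial_nth_prime powr_times_real)

lemma norm_bohr_monomial_le_1:
  fixes z :: "nat \<Rightarrow> complex"
  assumes "n \<ge> 1" "\<And>i. i \<ge> 1 \<Longrightarrow> nth_prime i dvd n \<Longrightarrow> norm (z i) \<le> 1"
  shows "norm (bohr_monomial z n) \<le> 1"
  unfolding bohr_monomial_def prod_norm[symmetric]
  by (rule prod_le_1) (use assms in \<open>auto simp: norm_power power_le_one\<close>)

lemma smooth_overD: "n \<in> smooth_over I \<Longrightarrow> n \<ge> 1" by (simp add: smooth_over_def)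

lemma one_smooth [simp]: "Suc 0 \<in> smooth_over I"
proof -
  have "\<not> nth_prime i dvd 1" if "1 \<le> i" for i
    using prime_nth_prime[OF that] not_prime_unit by blast
  then show ?thesis by (auto simp: smooth_over_def)
qed

lemma smooth_mult_iff:
  "m \<ge> 1 \<Longrightarrow> n \<ge> 1 \<Longrightarrow> m * n \<in> smooth_over I \<longleftrightarrow> m \<in> smooth_over I \<and> n \<in> smooth_over I"
  by (auto simp: smooth_over_def prime_dvd_mult_iff)

lemma nth_prime_smooth_iff: "i \<ge> 1 \<Longrightarrow> nth_prime i \<in> smooth_over I \<longleftrightarrow> i \<in> I"
  using nth_prime_gt_0[of i] unfolding smooth_over_def by (auto simp: nth_prime_dvd_iff)

lemma hat_eq_bohr_monomial: "hat \<sigma> n = bohr_monomial (\<lambda>i. nth_prime (\<sigma> i)) n"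
  by (simp add: hat_def bohr_monomial_def)

lemma hat_ge_1:
  assumes "n \<ge> 1" "\<And>i. i \<ge> 1 \<Longrightarrow> \<sigma> i \<ge> 1" shows "hat \<sigma> n \<ge> 1"
proof -
  have "hat \<sigma> n > 0"
    unfolding hat_def by (rule prod_pos) (auto intro!: zero_less_power nth_prime_gt_0 assms(2) simp del: One_nat_def)
  then show ?thesis by simp
qed

lemma bohr_monomial_hat:
  assumes "n \<ge> 1" "\<And>i. i \<ge> 1 \<Longrightarrow> \<sigma> i \<ge> 1"
  shows "bohr_monomial z (hat \<sigma> n) = bohr_monomial (\<lambda>i. z (\<sigma> i)) n"
  using assms(1)
proof (induction n rule: nth_prime_induct)
  case (mult i n)
  have "hat \<sigma> (nth_prime i * n) = nth_prime (\<sigma> i) * hat \<sigma> n"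
    using mult unfolding hat_eq_bohr_monomial by (simp add: bohr_monomial_mult bohr_monomial_nth_prime Suc_le_eq)
  then show ?case using mult assms(2)[of i] hat_ge_1[of n \<sigma>, OF mult(2) assms(2)]
    by (simp add: bohr_monomial_mult bohr_monomial_nth_prime Suc_le_eq)
qed (simp add: hat_eq_bohr_monomial)

lemma hat_comp:
  assumes "n \<ge> 1" "\<And>i. i \<ge> 1 \<Longrightarrow> \<sigma> i \<ge> 1" "\<And>i. i \<ge> 1 \<Longrightarrow> \<tau> i \<ge> 1"
  shows "hat \<tau> (hat \<sigma> n) = hat (\<lambda>i. \<tau> (\<sigma> i)) n"
  using bohr_monomial_hat[of n \<sigma> "\<lambda>i. nth_prime (\<tau> i)"] assms unfolding hat_eq_bohr_monomial by simp

lemma hat_id: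
  assumes "n \<ge> 1" "\<And>i. i \<ge> 1 \<Longrightarrow> \<sigma> i = i" shows "hat \<sigma> n = n"
  using bohr_monomial_cong[of n "\<lambda>i. nth_prime (\<sigma> i)" nth_prime] bohr_monomial_nth_prime_self[of n] assms
  unfolding hat_eq_bohr_monomial by simp

section \<open>Polynomial functions\<close>

text \<open>
  Polynomials are represented as functions on all complex sequences, with an induction rule in place of a normal form;
  \<open>dpoly\<close> below is the normal form.
\<close>

inductive_set poly_fun :: "nat set \<Rightarrow> ((nat \<Rightarrow> complex) \<Rightarrow> complex) set" for I where
  const: "(\<lambda>z. c) \<in> poly_fun I"
| coord: "i \<in> I \<Longrightarrow> (\<lambda>z. z i) \<in> poly_fun I"
| add: "p \<in> poly_fun I \<Longrightarrow> q \<in> poly_fun I \<Longrightarrow> (\<lambda>z. p z + q z) \<in> poly_fun I"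
| mult: "p \<in> poly_fun I \<Longrightarrow> q \<in> poly_fun I \<Longrightarrow> (\<lambda>z. p z * q z) \<in> poly_fun I"

lemma poly_fun_scale: "p \<in> poly_fun I \<Longrightarrow> (\<lambda>z. c * p z) \<in> poly_fun I"
  using poly_fun.mult[OF poly_fun.const] by blast

lemma poly_fun_uminus: "p \<in> poly_fun I \<Longrightarrow> (\<lambda>z. - p z) \<in> poly_fun I"
  using poly_fun_scale[of p I "-1"] by simp

lemma poly_fun_diff: "p \<in> poly_fun I \<Longrightarrow> q \<in> poly_fun I \<Longrightarrow> (\<lambda>z. p z - q z) \<in> poly_fun I"
  using poly_fun.add[OF _ poly_fun_uminus] by fastforce

lemma poly_fun_sum: "(\<And>j. j \<in> J \<Longrightarrow> p j \<in> poly_fun I) \<Longrightarrow> (\<lambda>z. \<Sum>j\<in>J. p j z) \<in> poly_fun I"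
  by (induction J rule: infinite_finite_induct) (auto intro: poly_fun.intros)

lemma poly_fun_prod: "(\<And>j. j \<in> J \<Longrightarrow> p j \<in> poly_fun I) \<Longrightarrow> (\<lambda>z. \<Prod>j\<in>J. p j z) \<in> poly_fun I"
  by (induction J rule: infinite_finite_induct) (auto intro: poly_fun.intros)

lemma poly_fun_power: "p \<in> poly_fun I \<Longrightarrow> (\<lambda>z. p z ^ k) \<in> poly_fun I"
  by (induction k) (auto intro: poly_fun.intros)

lemma poly_fun_mono: assumes "I \<subseteq> J" shows "poly_fun I \<subseteq> poly_fun J"
proof
  fix p assume "p \<in> poly_fun I"
  then show "p \<in> poly_fun J" by induction (use assms in \<open>auto intro: poly_fun.intros\<close>)
qed

lemma poly_fun_cong:
  assumes "p \<in> poly_fun I" "\<And>i. i \<in> I \<Longrightarrow> z i = w i" shows "p z = p w"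
  using assms by induction auto

lemma poly_fun_finite_support:
  assumes "p \<in> poly_fun I" shows "\<exists>F. finite F \<and> F \<subseteq> I \<and> p \<in> poly_fun F"
  using assms
proof induction
  case (const c) then show ?case by (intro exI[of _ "{}"]) (auto intro: poly_fun.intros)
next
  case (coord i) then show ?case by (intro exI[of _ "{i}"]) (auto intro: poly_fun.intros)
next
  case (add p q)
  then obtain F F' where "finite F" "F \<subseteq> I" "p \<in> poly_fun F" "finite F'" "F' \<subseteq> I" "q \<in> poly_fun F'" by blast
  then show ?case using poly_fun_mono[of F "F \<union> F'"] poly_fun_mono[of F' "F \<union> F'"]
    by (intro exI[of _ "F \<union> F'"]) (auto intro!: poly_fun.intros)
next
  case (mult p q)
  then obtain F F' where "finite F" "F \<subseteq> I" "p \<in> poly_fun F" "finite F'" "F' \<subseteq> I" "q \<in> poly_fun F'" by blast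
  then show ?case using poly_fun_mono[of F "F \<union> F'"] poly_fun_mono[of F' "F \<union> F'"]
    by (intro exI[of _ "F \<union> F'"]) (auto intro!: poly_fun.intros)
qed

lemma poly_fun_comp:
  assumes "p \<in> poly_fun I" "\<And>i. i \<in> I \<Longrightarrow> \<gamma> i \<in> J"
  shows "(\<lambda>z. p (\<lambda>i. z (\<gamma> i))) \<in> poly_fun J"
  using assms(1) by induction (use assms(2) in \<open>auto intro: poly_fun.intros\<close>)

lemma bohr_monomial_poly_fun: "n \<in> smooth_over I \<Longrightarrow> (\<lambda>z. bohr_monomial z n) \<in> poly_fun I"
  unfolding bohr_monomial_def by (intro poly_fun_prod poly_fun_power poly_fun.coord) (auto simp: smooth_over_def)

text \<open>
  The polynomial that corresponds to the Dirichlet polynomial with coefficients \<open>b\<close> on \<open>S\<close>.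
\<close>

definition dpoly :: "nat set \<Rightarrow> (nat \<Rightarrow> complex) \<Rightarrow> (nat \<Rightarrow> complex) \<Rightarrow> complex" where
  "dpoly S b z = (\<Sum>n\<in>S. b n * bohr_monomial z n)"

lemma dpoly_add:
  assumes "finite S" "finite T"
  shows "dpoly S b z + dpoly T c z =
    dpoly (S \<union> T) (\<lambda>n. (if n \<in> S then b n else 0) + (if n \<in> T then c n else 0)) z"
proof -
  have "dpoly S b z = (\<Sum>n\<in>S \<union> T. (if n \<in> S then b n else 0) * bohr_monomial z n)"
    unfolding dpoly_def by (rule sum.mono_neutral_cong_left) (use assms in auto)
  moreover have "dpoly T c z = (\<Sum>n\<in>S \<union> T. (if n \<in> T then c n else 0) * bohr_monomial z n)"
    unfolding dpoly_def by (rule sum.mono_neutral_cong_left) (use assms in auto)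
  ultimately show ?thesis
    by (simp only: dpoly_def sum.distrib[symmetric] distrib_right)
qed

lemma dpoly_mult:
  assumes "finite S" "finite T" "S \<subseteq> {1..}" "T \<subseteq> {1..}"
  shows "dpoly S b z * dpoly T c z =
    dpoly ((\<lambda>(m, n). m * n) ` (S \<times> T)) (\<lambda>k. \<Sum>(m, n) | (m, n) \<in> S \<times> T \<and> m * n = k. b m * c n) z"
proof -
  have "dpoly S b z * dpoly T c z = (\<Sum>(m, n)\<in>S \<times> T. b m * c n * bohr_monomial z (m * n))"
    unfolding dpoly_def sum_product sum.cartesian_product
    by (rule sum.cong) (use assms in \<open>auto simp: bohr_monomial_mult subset_iff\<close>)
  also have "\<dots> = (\<Sum>k\<in>(\<lambda>(m, n). m * n) ` (S \<times> T).
      \<Sum>(m, n)\<in>{x \<in> S \<times> T. (\<lambda>(m, n). m * n) x = k}. b m * c n * bohr_monomial z (m * n))"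
    by (rule sum.group[symmetric]) (use assms in auto)
  also have "\<dots> = dpoly ((\<lambda>(m, n). m * n) ` (S \<times> T)) (\<lambda>k. \<Sum>(m, n) | (m, n) \<in> S \<times> T \<and> m * n = k. b m * c n) z"
    unfolding dpoly_def sum_distrib_right
    by (intro sum.cong) auto
  finally show ?thesis .
qed

lemma poly_fun_eq_dpoly:
  assumes "p \<in> poly_fun I" "I \<subseteq> {1..}"
  shows "\<exists>S b. finite S \<and> S \<subseteq> smooth_over I \<and> p = dpoly S b"
  using assms(1)
proof induction
  case (const c)
  have "(\<lambda>z. c) = dpoly {1} (\<lambda>_. c)" by (auto simp: dpoly_def)
  then show ?case by (intro exI[of _ "{1}"] exI[of _ "\<lambda>_. c"]) auto
next
  case (coord i)
  with assms have i: "i \<ge> 1" by auto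
  have "(\<lambda>z. z i) = dpoly {nth_prime i} (\<lambda>_. 1)" using i by (auto simp: dpoly_def bohr_monomial_nth_prime)
  then show ?case using i coord by (intro exI[of _ "{nth_prime i}"] exI[of _ "\<lambda>_. 1"]) (auto simp: nth_prime_smooth_iff)
next
  case (add p q)
  then obtain S b T c where *: "finite S" "S \<subseteq> smooth_over I" "p = dpoly S b"
      "finite T" "T \<subseteq> smooth_over I" "q = dpoly T c" by blast
  then show ?case
    by (intro exI[of _ "S \<union> T"] exI[of _ "\<lambda>n. (if n \<in> S then b n else 0) + (if n \<in> T then c n else 0)"])
       (auto simp: dpoly_add)
next
  case (mult p q)
  then obtain S b T c where *: "finite S" "S \<subseteq> smooth_over I" "p = dpoly S b"
      "finite T" "T \<subseteq> smooth_over I" "q = dpoly T c" by blast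
  have sub: "S \<subseteq> {1..}" "T \<subseteq> {1..}" using * by (auto dest!: subsetD smooth_overD)
  have "(\<lambda>(m, n). m * n) ` (S \<times> T) \<subseteq> smooth_over I"
    using * sub by (auto simp: smooth_mult_iff subset_iff)
  then show ?case
    using * dpoly_mult[OF *(1,4) sub]
    by (intro exI[of _ "(\<lambda>(m, n). m * n) ` (S \<times> T)"]
         exI[of _ "\<lambda>k. \<Sum>(m, n) | (m, n) \<in> S \<times> T \<and> m * n = k. b m * c n"]) auto
qed

lemma dpoly_poly_fun: "S \<subseteq> smooth_over I \<Longrightarrow> dpoly S b \<in> poly_fun I"
  unfolding dpoly_def by (intro poly_fun_sum poly_fun_scale bohr_monomial_poly_fun) auto

section \<open>A kernel with trapezoidal cosine transform\<close>

lemma has_bochner_integral_powr_tail: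
  fixes \<theta> :: real assumes "\<theta> > 0"
  shows "has_bochner_integral lborel (\<lambda>t. t powr (- 1 - \<theta>) * indicator {1..} t) (1 / \<theta>)"
proof (rule has_bochner_integral_nn_integral)
  have "(\<integral>\<^sup>+t. ennreal (t powr (- 1 - \<theta>)) * indicator {1..} t \<partial>lborel) = ennreal (0 - (- (1 powr (- \<theta>)) / \<theta>))"
  proof (rule nn_integral_FTC_atLeast)
    show "((\<lambda>t. - (t powr - \<theta>) / \<theta>) \<longlongrightarrow> 0) at_top" using assms by real_asymp
    fix t :: real assume "1 \<le> t"
    then show "((\<lambda>t. - (t powr - \<theta>) / \<theta>) has_real_derivative t powr (- 1 - \<theta>)) (at t)"
      using assms by (auto intro!: derivative_eq_intros simp: powr_diff powr_minus field_simps)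
  qed auto
  then show "(\<integral>\<^sup>+t. ennreal (t powr (- 1 - \<theta>) * indicator {1..} t) \<partial>lborel) = ennreal (1 / \<theta>)"
    by (simp add: ennreal_mult' ennreal_indicator)
qed (use assms in auto)

lemma integrable_tail_bound:
  fixes f :: "real \<Rightarrow> real"
  assumes f: "f \<in> borel_measurable borel" and \<theta>: "\<theta> > 0" and AB: "A \<ge> 0" "B \<ge> 0"
    and near: "\<And>t. \<bar>t\<bar> \<le> 1 \<Longrightarrow> \<bar>f t\<bar> \<le> A"
    and far: "\<And>t. \<bar>t\<bar> \<ge> 1 \<Longrightarrow> \<bar>f t\<bar> \<le> B * \<bar>t\<bar> powr (- 1 - \<theta>)"
  shows "integrable lborel f" "(LINT t|lborel. \<bar>f t\<bar>) \<le> 2 * A + 2 * B / \<theta>"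
proof -
  let ?tail = "\<lambda>t. t powr (- 1 - \<theta>) * indicator {1..} t"
  let ?m = "\<lambda>t. A * indicator {-1..1} t + (B * ?tail t + B * ?tail (0 + (-1) * t))"
  have tail: "has_bochner_integral lborel ?tail (1 / \<theta>)"
    by (rule has_bochner_integral_powr_tail[OF \<theta>])
  have tail': "has_bochner_integral lborel (\<lambda>t. ?tail (0 + (-1) * t)) ((1 / \<theta>) /\<^sub>R \<bar>-1\<bar>)"
    using tail by (subst lborel_has_bochner_integral_real_affine_iff[symmetric]) auto
  have ind: "has_bochner_integral lborel (indicator {-1..1} :: real \<Rightarrow> real) 2"
    using has_bochner_integral_real_indicator[of "{-1..1::real}" lborel] by simp
  have m: "has_bochner_integral lborel ?m (A * 2 + (B * (1 / \<theta>) + B * ((1 / \<theta>) /\<^sub>R \<bar>-1\<bar>)))"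
    by (intro has_bochner_integral_add has_bochner_integral_mult_right ind tail tail')
  have le: "\<bar>f t\<bar> \<le> ?m t" for t
  proof (cases "\<bar>t\<bar> \<le> 1")
    case True
    then show ?thesis using near[OF True] AB by (auto simp: indicator_def)
  next
    case False
    then have "\<bar>f t\<bar> \<le> B * \<bar>t\<bar> powr (- 1 - \<theta>)" using far by simp
    also have "\<dots> \<le> ?m t" using False AB by (auto simp: indicator_def abs_if)
    finally show ?thesis .
  qed
  have le': "norm (f t) \<le> norm (?m t)" for t
    using le[of t] unfolding real_norm_def by (meson abs_ge_self order_trans)
  show int: "integrable lborel f"
    by (rule Bochner_Integration.integrable_bound[OF integrable.intros[OF m]])
       (use le' f in auto)
  have "(LINT t|lborel. \<bar>f t\<bar>) \<le> (LINT t|lborel. ?m t)"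
    by (rule integral_mono) (use le int m in \<open>auto simp: has_bochner_integral_iff\<close>)
  also have "\<dots> = 2 * A + 2 * B / \<theta>"
    using has_bochner_integral_integral_eq[OF m] by (simp add: field_simps)
  finally show "(LINT t|lborel. \<bar>f t\<bar>) \<le> 2 * A + 2 * B / \<theta>" .
qed

lemma abs_cos_diff_le: "\<bar>cos x - cos y\<bar> \<le> 2 * \<bar>sin ((x - y) / 2)\<bar>" for x y :: real
proof -
  have "\<bar>cos x - cos y\<bar> = 2 * \<bar>sin ((x + y) / 2)\<bar> * \<bar>sin ((x - y) / 2)\<bar>"
    using sin_minus[of "(x - y) / 2"] by (simp add: cos_diff_cos abs_mult minus_divide_left)
  also have "\<dots> \<le> 2 * 1 * \<bar>sin ((x - y) / 2)\<bar>"
    by (intro mult_right_mono mult_left_mono) auto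
  finally show ?thesis by simp
qed

definition fejer_mass :: real where
  "fejer_mass = (LINT t|lborel. (1 - cos t) / t\<^sup>2)"

lemma abs_one_minus_cos_le: "\<bar>1 - cos t\<bar> \<le> t\<^sup>2 / 2" for t :: real
  using cos_double_sin[of "t / 2"] abs_sin_x_le_abs_x[of "t / 2"] power_mono[of "\<bar>sin (t/2)\<bar>" "\<bar>t/2\<bar>" 2]
  by (simp add: power_divide)

text \<open>
  The integral is proportional to \<open>\<bar>c\<bar>\<close> by scaling. The factor \<open>fejer_mass\<close> cancels in the kernel below.
\<close>

lemma has_bochner_integral_fejer: "has_bochner_integral lborel (\<lambda>t. (1 - cos (c * t)) / t\<^sup>2) (\<bar>c\<bar> * fejer_mass)"
proof (cases "c = 0")
  case False
  have "integrable lborel (\<lambda>t. (1 - cos t) / t\<^sup>2 :: real)"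
  proof (rule integrable_tail_bound(1)[where A = "1/2" and B = 2 and \<theta> = 1])
    fix t :: real
    show "\<bar>(1 - cos t) / t\<^sup>2\<bar> \<le> 1 / 2"
      using abs_one_minus_cos_le[of t] by (cases "t = 0") (simp_all add: field_simps)
    assume t: "\<bar>t\<bar> \<ge> 1"
    have "\<bar>1 - cos t\<bar> \<le> 2" using cos_ge_minus_one[of t] cos_le_one[of t] by linarith
    then have "\<bar>(1 - cos t) / t\<^sup>2\<bar> \<le> 2 / t\<^sup>2" by (simp add: divide_right_mono)
    also have "\<dots> = 2 * \<bar>t\<bar> powr (- 1 - 1)"
      using t powr_realpow[of "\<bar>t\<bar>" 2] by (simp add: powr_minus divide_inverse)
    finally show "\<bar>(1 - cos t) / t\<^sup>2\<bar> \<le> 2 * \<bar>t\<bar> powr (- 1 - 1)" .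
  qed auto
  then have "has_bochner_integral lborel (\<lambda>t. (1 - cos t) / t\<^sup>2 :: real) fejer_mass"
    unfolding fejer_mass_def by (rule has_bochner_integral_integrable)
  then have "has_bochner_integral lborel (\<lambda>t. (1 - cos (0 + c * t)) / (0 + c * t)\<^sup>2) (fejer_mass /\<^sub>R \<bar>c\<bar>)"
    by (subst (asm) lborel_has_bochner_integral_real_affine_iff[OF False, where t = 0])
  from has_bochner_integral_mult_right[OF this, of "c\<^sup>2"]
  have "has_bochner_integral lborel (\<lambda>t. c\<^sup>2 * ((1 - cos (c * t)) / (c * t)\<^sup>2)) (c\<^sup>2 * (fejer_mass / \<bar>c\<bar>))"
    by (simp add: field_simps)
  moreover have "c\<^sup>2 * (fejer_mass / \<bar>c\<bar>) = \<bar>c\<bar> * fejer_mass"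
    using False by (simp add: field_simps power2_eq_square flip: abs_mult)
  moreover have "c\<^sup>2 * ((1 - cos (c * t)) / (c * t)\<^sup>2) = (1 - cos (c * t)) / t\<^sup>2" for t
    using False by (simp add: power_mult_distrib)
  ultimately show ?thesis by simp
qed (simp add: has_bochner_integral_zero)

text \<open>
  A nonnegative function whose integral is 0 vanishes almost everywhere, but the integrand is positive on \<open>{1<..<2}\<close>.
\<close>

lemma fejer_mass_pos: "fejer_mass > 0"
proof -
  have int: "integrable lborel (\<lambda>t::real. (1 - cos t) / t\<^sup>2)"
    using has_bochner_integral_fejer[of 1] by (simp add: has_bochner_integral_iff)

  have "fejer_mass \<noteq> 0"
  proof
    assume "fejer_mass = 0"
    then have "AE t in lborel. (1 - cos t) / t\<^sup>2 = (0::real)"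
      unfolding fejer_mass_def using integral_nonneg_eq_0_iff_AE[OF int] by simp
    then obtain N where N: "{t::real. (1 - cos t) / t\<^sup>2 \<noteq> 0} \<subseteq> N" "emeasure lborel N = 0" "N \<in> sets lborel"
      by (auto elim: AE_E)
    have "{1<..<2} \<subseteq> N"
    proof
      fix t :: real assume t: "t \<in> {1<..<2}"
      then have "cos t < cos 0" using pi_gt3 by (intro cos_monotone_0_pi) auto
      with t show "t \<in> N" using N(1) by auto
    qed
    then have "emeasure lborel {1<..<2::real} \<le> emeasure lborel N" using N(3) by (intro emeasure_mono) auto
    with N(2) show False by simp
  qed
  moreover have "fejer_mass \<ge> 0" unfolding fejer_mass_def by (rule integral_nonneg_AE) auto
  ultimately show ?thesis by simp
qed

definition trapezoid_kernel :: "real \<Rightarrow> real \<Rightarrow> real \<Rightarrow> real" where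
  "trapezoid_kernel a b t = (cos (a * t) - cos (b * t)) / (fejer_mass * (b - a) * t\<^sup>2)"

text \<open>
  As a function of \<open>l\<close> the right-hand side is a trapezoid: it is 1 for \<open>\<bar>l\<bar> \<le> a\<close>, 0 for \<open>\<bar>l\<bar> \<ge> b\<close>, and linear in between.
  The product of cosines is a combination of four functions \<open>1 - cos (c * t)\<close> with \<open>c = b \<plusminus> l\<close> and \<open>c = a \<plusminus> l\<close>.
\<close>

lemma has_bochner_integral_trapezoid:
  assumes "a < b"
  shows "has_bochner_integral lborel (\<lambda>t. trapezoid_kernel a b t * cos (l * t))
    ((\<bar>b + l\<bar> + \<bar>b - l\<bar> - \<bar>a + l\<bar> - \<bar>a - l\<bar>) / (2 * (b - a)))"
proof -
  let ?F = "\<lambda>c t. (1 - cos (c * t)) / t\<^sup>2"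
  have "has_bochner_integral lborel (\<lambda>t. (?F (b + l) t + ?F (b - l) t - ?F (a + l) t - ?F (a - l) t) / (2 * fejer_mass * (b - a)))
     ((\<bar>b + l\<bar> * fejer_mass + \<bar>b - l\<bar> * fejer_mass - \<bar>a + l\<bar> * fejer_mass - \<bar>a - l\<bar> * fejer_mass) / (2 * fejer_mass * (b - a)))"
    using fejer_mass_pos assms
    by (intro has_bochner_integral_divide_zero has_bochner_integral_diff has_bochner_integral_add has_bochner_integral_fejer)
  moreover have "(\<bar>b + l\<bar> * fejer_mass + \<bar>b - l\<bar> * fejer_mass - \<bar>a + l\<bar> * fejer_mass - \<bar>a - l\<bar> * fejer_mass) / (2 * fejer_mass * (b - a))
    = (\<bar>b + l\<bar> + \<bar>b - l\<bar> - \<bar>a + l\<bar> - \<bar>a - l\<bar>) / (2 * (b - a))"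
    using fejer_mass_pos assms by (simp add: divide_simps) (simp add: algebra_simps)
  moreover have "(?F (b + l) t + ?F (b - l) t - ?F (a + l) t - ?F (a - l) t) / (2 * fejer_mass * (b - a))
      = trapezoid_kernel a b t * cos (l * t)" for t
  proof -
    have "?F (b + l) t + ?F (b - l) t - ?F (a + l) t - ?F (a - l) t
        = 2 * ((cos (a * t) - cos (b * t)) * cos (l * t)) / t\<^sup>2"
      by (simp add: ring_distribs cos_add cos_diff flip: add_divide_distrib diff_divide_distrib)
    then show ?thesis
      unfolding trapezoid_kernel_def by (simp only:) simp
  qed
  ultimately show ?thesis by simp
qed

lemma integrable_trapezoid: "a < b \<Longrightarrow> integrable lborel (trapezoid_kernel a b)"
  using has_bochner_integral_trapezoid[of a b 0] by (simp add: has_bochner_integral_iff)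

text \<open>
  For \<open>a = 0\<close> the kernel is nonnegative, so its \<open>L1\<close> norm is the value of its transform at 0.
\<close>

lemma trapezoid_norm_a0:
  assumes "b > 0" shows "(LINT t|lborel. \<bar>trapezoid_kernel 0 b t\<bar>) = 1"
proof -
  have "\<bar>trapezoid_kernel 0 b t\<bar> = trapezoid_kernel 0 b t" for t
    using assms fejer_mass_pos unfolding trapezoid_kernel_def by simp
  then show ?thesis using has_bochner_integral_trapezoid[of 0 b 0] assms by (simp add: has_bochner_integral_iff)
qed

text \<open>
  Near 0 the kernel is bounded because the difference of cosines is a product of two sines. For large \<open>t\<close> one sine is
  bounded by 1 and the other by \<open>((b - a) * \<bar>t\<bar>) powr (1 - \<theta>)\<close>, which leaves an integrable tail. The bound grows like the
  power \<open>- \<theta>\<close> of the gap \<open>b - a\<close>; with \<open>\<theta>\<close> arbitrarily small this suffices for frequencies \<open>ln n\<close>, whose gaps are about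
  \<open>1 / n\<close>.
\<close>

lemma trapezoid_norm_le:
  assumes ab: "0 \<le> a" "a < b" and \<theta>: "0 < \<theta>" "\<theta> < 1"
  shows "(LINT t|lborel. \<bar>trapezoid_kernel a b t\<bar>)
    \<le> (a + b) / fejer_mass + 4 * (b - a) powr (- \<theta>) / (fejer_mass * \<theta>)"
proof -
  let ?A = "(a + b) / (2 * fejer_mass)" and ?B = "2 * (b - a) powr (- \<theta>) / fejer_mass"
  have pos: "fejer_mass * (b - a) > 0" using ab fejer_mass_pos by simp
  have "(LINT t|lborel. \<bar>trapezoid_kernel a b t\<bar>) \<le> 2 * ?A + 2 * ?B / \<theta>"
  proof (rule integrable_tail_bound(2))
    show "trapezoid_kernel a b \<in> borel_measurable borel"
      unfolding trapezoid_kernel_def by measurable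
    fix t :: real
    have K: "\<bar>trapezoid_kernel a b t\<bar> = \<bar>cos (a * t) - cos (b * t)\<bar> / (fejer_mass * (b - a) * t\<^sup>2)"
      using abs_of_pos[OF pos] unfolding trapezoid_kernel_def by (simp only: abs_divide abs_mult abs_power2)
    show "\<bar>trapezoid_kernel a b t\<bar> \<le> ?A"
    proof (cases "t = 0")
      case False
      have "\<bar>cos (a * t) - cos (b * t)\<bar> = 2 * (\<bar>sin ((a * t + b * t) / 2)\<bar> * \<bar>sin ((b * t - a * t) / 2)\<bar>)"
        by (simp add: cos_diff_cos abs_mult)
      also have "\<dots> \<le> 2 * (\<bar>(a * t + b * t) / 2\<bar> * \<bar>(b * t - a * t) / 2\<bar>)"
        by (intro mult_left_mono mult_mono abs_sin_x_le_abs_x) auto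
      also have "\<dots> = ((a + b) / 2) * ((b - a) * t\<^sup>2)"
        using ab by (simp add: abs_mult power2_eq_square flip: distrib_right left_diff_distrib)
      finally have "\<bar>cos (a * t) - cos (b * t)\<bar> / ((b - a) * t\<^sup>2) \<le> (a + b) / 2"
        using ab False by (simp add: pos_divide_le_eq)
      from divide_right_mono[OF this less_imp_le[OF fejer_mass_pos]]
      show ?thesis unfolding K by (simp add: mult_ac)
    qed (use ab K less_imp_le[OF fejer_mass_pos] in simp)
    assume t: "\<bar>t\<bar> \<ge> 1"
    let ?x = "(b - a) * \<bar>t\<bar>"
    have x: "?x > 0" using t ab by simp
    have "\<bar>cos (a * t) - cos (b * t)\<bar> \<le> 2 * \<bar>sin ((a * t - b * t) / 2)\<bar>" by (rule abs_cos_diff_le)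
    also have "\<bar>sin ((a * t - b * t) / 2)\<bar> \<le> ?x powr (1 - \<theta>)"
    proof (cases "?x \<le> 1")
      case True
      have "\<bar>sin ((a * t - b * t) / 2)\<bar> \<le> \<bar>(a * t - b * t) / 2\<bar>" by (rule abs_sin_x_le_abs_x)
      also have "\<dots> \<le> \<bar>(a * t - b * t)\<bar>" by simp
      also have "\<dots> = ?x" using ab by (simp add: abs_mult flip: left_diff_distrib)
      also have "\<dots> = ?x powr 1" using x by simp
      also have "\<dots> \<le> ?x powr (1 - \<theta>)" using True x \<theta> by (intro powr_mono') auto
      finally show ?thesis .
    next
      case False
      have "\<bar>sin ((a * t - b * t) / 2)\<bar> \<le> 1" by simp
      also have "1 \<le> ?x powr (1 - \<theta>)" using False \<theta> by (intro ge_one_powr_ge_zero) auto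
      finally show ?thesis .
    qed
    finally have "\<bar>trapezoid_kernel a b t\<bar> \<le> 2 * ?x powr (1 - \<theta>) / (fejer_mass * (b - a) * t\<^sup>2)"
      unfolding K using pos by (intro divide_right_mono) auto
    also have "\<dots> = 2 / fejer_mass * ((b - a) powr (1 - \<theta>) / (b - a)) * (\<bar>t\<bar> powr (1 - \<theta>) / \<bar>t\<bar>\<^sup>2)"
      using ab by (simp add: powr_mult)
    also have "(b - a) powr (1 - \<theta>) / (b - a) = (b - a) powr (- \<theta>)"
      using ab by (simp add: powr_diff powr_minus field_simps)
    also have "\<bar>t\<bar> powr (1 - \<theta>) / \<bar>t\<bar>\<^sup>2 = \<bar>t\<bar> powr (- 1 - \<theta>)"
      using t powr_realpow[of "\<bar>t\<bar>" 2] powr_diff[of "\<bar>t\<bar>" "1 - \<theta>" 2] by simp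
    finally show "\<bar>trapezoid_kernel a b t\<bar> \<le> ?B * \<bar>t\<bar> powr (- 1 - \<theta>)" by simp
  qed (use ab \<theta> less_imp_le[OF fejer_mass_pos] in auto)
  moreover have "2 * ?A = (a + b) / fejer_mass" by (simp only: times_divide_eq_right)
  ultimately show ?thesis by simp
qed

text \<open>
  If no frequency lies strictly between \<open>a\<close> and \<open>b\<close>, then integration against the kernel multiplies each term by 1 or
  by 0. So a partial sum costs a factor equal to the \<open>L1\<close> norm of the kernel.
\<close>

lemma trapezoid_select:
  fixes w :: "nat \<Rightarrow> complex" and l :: "nat \<Rightarrow> real"
  assumes ab: "0 \<le> a" "a < b" and S: "finite S"
    and l: "\<And>m. m \<in> S \<Longrightarrow> \<bar>l m\<bar> \<le> a \<or> \<bar>l m\<bar> \<ge> b"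
    and C: "\<And>t. norm (\<Sum>m\<in>S. w m * of_real (cos (l m * t))) \<le> C"
  shows "norm (\<Sum>m | m \<in> S \<and> \<bar>l m\<bar> \<le> a. w m) \<le> C * (LINT t|lborel. \<bar>trapezoid_kernel a b t\<bar>)"
proof -
  let ?V = "trapezoid_kernel a b" and ?u = "\<lambda>t. \<Sum>m\<in>S. w m * of_real (cos (l m * t))"
  have "has_bochner_integral lborel (\<lambda>t. \<Sum>m\<in>S. w m * of_real (?V t * cos (l m * t)))
      (\<Sum>m\<in>S. w m * of_real ((\<bar>b + l m\<bar> + \<bar>b - l m\<bar> - \<bar>a + l m\<bar> - \<bar>a - l m\<bar>) / (2 * (b - a))))"
    by (intro has_bochner_integral_sum has_bochner_integral_mult_right has_bochner_integral_of_real
          has_bochner_integral_trapezoid ab)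
  moreover have "(\<Sum>m\<in>S. w m * of_real (?V t * cos (l m * t))) = of_real (?V t) * ?u t" for t
    by (simp add: sum_distrib_left mult_ac)
  moreover have "(\<Sum>m\<in>S. w m * of_real ((\<bar>b + l m\<bar> + \<bar>b - l m\<bar> - \<bar>a + l m\<bar> - \<bar>a - l m\<bar>) / (2 * (b - a))))
     = (\<Sum>m | m \<in> S \<and> \<bar>l m\<bar> \<le> a. w m)"
  proof -
    have "w m * of_real ((\<bar>b + l m\<bar> + \<bar>b - l m\<bar> - \<bar>a + l m\<bar> - \<bar>a - l m\<bar>) / (2 * (b - a))) = (if \<bar>l m\<bar> \<le> a then w m else 0)"
      if "m \<in> S" for m
    proof (cases "\<bar>l m\<bar> \<le> a")
      case True
      then have "0 \<le> b + l m" "0 \<le> b - l m" "0 \<le> a + l m" "0 \<le> a - l m" using ab by linarith+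
      then have "\<bar>b + l m\<bar> + \<bar>b - l m\<bar> - \<bar>a + l m\<bar> - \<bar>a - l m\<bar> = 2 * (b - a)" by simp
      then show ?thesis using True ab by simp
    next
      case False
      then have "l m \<ge> b \<or> l m \<le> - b" using l[OF that] by linarith
      then have "\<bar>b + l m\<bar> + \<bar>b - l m\<bar> - \<bar>a + l m\<bar> - \<bar>a - l m\<bar> = 0"
      proof
        assume "l m \<ge> b"
        then have "0 \<le> b + l m" "b - l m \<le> 0" "0 \<le> a + l m" "a - l m \<le> 0" using ab by linarith+
        then show ?thesis by simp
      next
        assume "l m \<le> - b"
        then have "b + l m \<le> 0" "0 \<le> b - l m" "a + l m \<le> 0" "0 \<le> a - l m" using ab by linarith+
        then show ?thesis by simp
      qed
      then show ?thesis using False by (simp only:) simp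
    qed
    then show ?thesis using S by (simp add: sum.If_cases Int_def)
  qed
  ultimately have I: "has_bochner_integral lborel (\<lambda>t. of_real (?V t) * ?u t) (\<Sum>m | m \<in> S \<and> \<bar>l m\<bar> \<le> a. w m)"
    by simp
  have "norm (LINT t|lborel. of_real (?V t) * ?u t) \<le> (LINT t|lborel. C * \<bar>?V t\<bar>)"
  proof (rule Bochner_Integration.integral_norm_bound_integral)
    fix t show "norm (of_real (?V t) * ?u t) \<le> C * \<bar>?V t\<bar>"
      using mult_left_mono[OF C[of t], of "\<bar>?V t\<bar>"] by (simp add: norm_mult mult_ac)
  qed (use I integrable_trapezoid[OF ab(2)] in \<open>auto simp: has_bochner_integral_iff\<close>)
  then show ?thesis using I by (simp add: has_bochner_integral_iff)
qed

section \<open>Coefficients and partial sums of Dirichlet polynomials\<close>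

definition dirichlet_sum :: "nat set \<Rightarrow> (nat \<Rightarrow> complex) \<Rightarrow> complex \<Rightarrow> complex" where
  "dirichlet_sum S b s = (\<Sum>n\<in>S. b n * of_nat n powr (- s))"

definition half_plane_le :: "(complex \<Rightarrow> complex) \<Rightarrow> real \<Rightarrow> bool" where
  "half_plane_le g C \<longleftrightarrow> (\<forall>s\<in>right_half_plane. norm (g s) \<le> C)"

lemma of_nat_powr_Complex:
  assumes "n \<ge> 1"
  shows "of_nat n powr (- Complex x t) = of_nat n powr (- of_real x) * cis (- (ln (real n) * t))"
proof -
  have "of_nat n powr (- Complex x t) = of_nat n powr (- of_real x + - (\<i> * of_real t))"
    by (simp add: complex_eq_iff Complex_eq)
  also have "\<dots> = of_nat n powr (- of_real x) * of_nat n powr (- (\<i> * of_real t))"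
    by (rule powr_add)
  also have "of_nat n powr (- (\<i> * of_real t)) = cis (- (ln (real n) * t))"
    using assms by (simp add: powr_def cis_conv_exp Ln_of_nat mult_ac)
  finally show ?thesis .
qed

lemma norm_of_nat_powr: "n \<ge> 1 \<Longrightarrow> norm (of_nat n powr (- s) :: complex) = real n powr (- Re s)"
  by (subst norm_powr_real_powr) auto

text \<open>
  On a vertical line, the cosine sum is the mean of two values of the Dirichlet polynomial, at heights \<open>t\<close> and \<open>- t\<close>,
  multiplied by unimodular numbers.
\<close>

lemma dirichlet_sum_cos_le:
  assumes "finite S" "S \<subseteq> {1..}" and C: "half_plane_le (dirichlet_sum S b) C" and \<sigma>: "\<sigma> > 0"
  shows "norm (\<Sum>m\<in>S. (b m * of_nat m powr (- of_real \<sigma>)) * of_real (cos ((ln (real m) - l) * t))) \<le> C"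
proof -
  let ?g = "dirichlet_sum S b"
  have "(\<Sum>m\<in>S. (b m * of_nat m powr (- of_real \<sigma>)) * of_real (cos ((ln (real m) - l) * t)))
      = (cis (l * t) * ?g (Complex \<sigma> t) + cis (- (l * t)) * ?g (Complex \<sigma> (- t))) / 2"
    unfolding dirichlet_sum_def sum_distrib_left sum.distrib[symmetric] sum_divide_distrib
  proof (rule sum.cong)
    fix m assume "m \<in> S"
    then have m: "m \<ge> 1" using assms by auto
    have "of_real (cos ((ln (real m) - l) * t)) =
        (cis (l * t) * cis (- (ln (real m) * t)) + cis (- (l * t)) * cis (- (ln (real m) * (- t)))) / 2"
      using cos_minus[of "l * t - t * ln (real m)"] sin_minus[of "l * t - t * ln (real m)"]
      by (simp add: complex_eq_iff cis_mult algebra_simps)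
    then show "b m * of_nat m powr (- of_real \<sigma>) * of_real (cos ((ln (real m) - l) * t)) =
         (cis (l * t) * (b m * of_nat m powr - Complex \<sigma> t) +
          cis (- (l * t)) * (b m * of_nat m powr - Complex \<sigma> (- t))) / 2"
      by (simp only: of_nat_powr_Complex[OF m]) (simp add: algebra_simps)
  qed simp
  moreover have "norm (cis (l * t) * ?g (Complex \<sigma> t) + cis (- (l * t)) * ?g (Complex \<sigma> (- t))) \<le> C + C"
    using C \<sigma> unfolding half_plane_le_def right_half_plane_def
    by (intro order_trans[OF norm_triangle_ineq] add_mono) (auto simp: norm_mult)
  ultimately show ?thesis by (simp only: norm_divide) simp
qed

lemma half_plane_le_nonneg: "half_plane_le g C \<Longrightarrow> C \<ge> 0"
proof -
  assume "half_plane_le g C"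
  then have "norm (g 1) \<le> C" by (auto simp: half_plane_le_def right_half_plane_def)
  then show "C \<ge> 0" by (meson norm_ge_zero order_trans)
qed

text \<open>
  The kernel with \<open>a = 0\<close> and \<open>b\<close> the distance from \<open>ln n\<close> to the other frequencies selects the single term \<open>n\<close>, and it
  has norm 1.
\<close>

lemma dirichlet_coeff_le:
  assumes S: "finite S" "S \<subseteq> {1..}" and C: "half_plane_le (dirichlet_sum S b) C" and n: "n \<in> S"
  shows "norm (b n) \<le> C"
proof -
  let ?l = "\<lambda>m. ln (real m) - ln (real n)"
  \<comment> \<open>The element 1 only serves to make the minimum exist if \<open>S = {n}\<close>.\<close>
  define d where "d = Min (insert 1 ((\<lambda>m. \<bar>?l m\<bar>) ` (S - {n})))"
  have n1: "n \<ge> 1" using S n by auto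
  have l0: "?l m \<noteq> 0" if "m \<in> S - {n}" for m
    using that S n1 by (auto simp: Suc_le_eq subset_iff)
  have d: "d > 0" unfolding d_def using S(1) l0 by (subst Min_gr_iff) auto
  have dl: "d \<le> \<bar>?l m\<bar>" if "m \<in> S - {n}" for m
    unfolding d_def by (rule Min_le) (use S(1) that in auto)
  have bound: "norm (b n) * real n powr (- \<sigma>) \<le> C" if \<sigma>: "\<sigma> > 0" for \<sigma>
  proof -
    have "norm (\<Sum>m | m \<in> S \<and> \<bar>?l m\<bar> \<le> 0. b m * of_nat m powr (- of_real \<sigma>))
        \<le> C * (LINT t|lborel. \<bar>trapezoid_kernel 0 d t\<bar>)"
    proof (rule trapezoid_select)
      show "norm (\<Sum>m\<in>S. b m * of_nat m powr (- of_real \<sigma>) * of_real (cos (?l m * t))) \<le> C" for t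
        by (rule dirichlet_sum_cos_le[OF S C \<sigma>])
      show "\<bar>?l m\<bar> \<le> 0 \<or> d \<le> \<bar>?l m\<bar>" if "m \<in> S" for m using dl[of m] that by (cases "m = n") auto
    qed (use d S in auto)
    also have "{m. m \<in> S \<and> \<bar>?l m\<bar> \<le> 0} = {n}" using l0 n by fastforce
    finally show ?thesis using n1 by (simp add: trapezoid_norm_a0[OF d] norm_mult norm_of_nat_powr)
  qed
  have "((\<lambda>\<sigma>. norm (b n) * real n powr (- \<sigma>)) \<longlongrightarrow> norm (b n) * real n powr (- 0)) (at_right 0)"
    using n1 by (intro tendsto_intros) auto
  then have "((\<lambda>\<sigma>. norm (b n) * real n powr (- \<sigma>)) \<longlongrightarrow> norm (b n)) (at_right 0)"
    using n1 by simp
  then show ?thesis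
    by (rule tendsto_upperbound) (auto simp: eventually_at_right_less intro!: bound eventually_mono[OF eventually_at_right_less[of 0]])
qed

lemma dirichlet_sum_shift:
  assumes "S \<subseteq> {1..}"
  shows "dirichlet_sum S b (s + w) = dirichlet_sum S (\<lambda>n. b n * of_nat n powr (- w)) s"
  unfolding dirichlet_sum_def
  by (rule sum.cong) (use assms in \<open>auto simp: powr_add[symmetric] algebra_simps\<close>)

text \<open>
  The kernel with \<open>a = ln N\<close> and \<open>b = ln (N + 1)\<close> selects the terms with \<open>n \<le> N\<close>. The constant does not depend
  on the Dirichlet polynomial.
\<close>

lemma partial_sum_le:
  assumes "0 < \<theta>" "\<theta> < 1"
  shows "\<exists>K\<ge>0. \<forall>S b C N s. finite S \<longrightarrow> S \<subseteq> {1..} \<longrightarrow> half_plane_le (dirichlet_sum S b) C \<longrightarrow> 1 \<le> N \<longrightarrow> Re s > 0 \<longrightarrow>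
      norm (dirichlet_sum {n\<in>S. n \<le> N} b s) \<le> K * real N powr \<theta> * C"
proof -
  let ?K = "4 / (fejer_mass * \<theta>) * 2 powr \<theta> + 4 / (fejer_mass * \<theta>) * 2 powr \<theta>"
  have K: "(LINT t|lborel. \<bar>trapezoid_kernel (ln (real N)) (ln (real N + 1)) t\<bar>) \<le> ?K * real N powr \<theta>"
    if N: "1 \<le> N" for N
  proof -
    let ?a = "ln (real N)" and ?b = "ln (real N + 1)"
    have gap: "1 / (2 * real N) \<le> ?b - ?a"
    proof -
      have "1 / (real N + 1) \<le> ?b - ?a"
        using ln_le_minus_one[of "real N / (real N + 1)"] N by (simp add: ln_div field_simps)
      moreover have "1 / (2 * real N) \<le> 1 / (real N + 1)" using N by (intro divide_left_mono) auto
      ultimately show ?thesis by linarith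
    qed
    have gap0: "?a < ?b" using N by simp
    have lnb: "?b \<le> (2 * real N) powr \<theta> / \<theta>"
    proof -
      have "\<theta> * ?b = ln ((real N + 1) powr \<theta>)" using N by (simp add: ln_powr)
      also have "\<dots> \<le> (real N + 1) powr \<theta>" using ln_le_minus_one[of "(real N + 1) powr \<theta>"] by simp
      also have "\<dots> \<le> (2 * real N) powr \<theta>" using N assms by (intro powr_mono2) auto
      finally show ?thesis using assms by (simp add: field_simps)
    qed
    have "(LINT t|lborel. \<bar>trapezoid_kernel ?a ?b t\<bar>) \<le> (?a + ?b) / fejer_mass + 4 * (?b - ?a) powr (- \<theta>) / (fejer_mass * \<theta>)"
      by (rule trapezoid_norm_le) (use N gap0 assms in auto)
    also have "(?a + ?b) / fejer_mass \<le> (4 * ((2 * real N) powr \<theta> / \<theta>)) / fejer_mass"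
    proof (rule divide_right_mono)
      have "0 \<le> ?b" by simp
      then show "?a + ?b \<le> 4 * ((2 * real N) powr \<theta> / \<theta>)" using lnb gap0 by linarith
    qed (use fejer_mass_pos in simp)
    also have "(?b - ?a) powr (- \<theta>) \<le> (1 / (2 * real N)) powr (- \<theta>)"
      using gap N assms by (intro powr_mono2') auto
    also have "(1 / (2 * real N)) powr (- \<theta>) = (2 * real N) powr \<theta>"
      using N by (simp add: powr_minus powr_divide)
    finally show ?thesis
      using fejer_mass_pos assms by (simp add: powr_mult field_simps)
  qed
  have "norm (dirichlet_sum {n\<in>S. n \<le> N} b s) \<le> ?K * real N powr \<theta> * C"
    if S: "finite S" "S \<subseteq> {1..}" and C: "half_plane_le (dirichlet_sum S b) C" and N: "1 \<le> N" and s: "Re s > 0" for S b C N s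
  proof -
    let ?w = "\<i> * of_real (Im s)"
    let ?b = "\<lambda>n. b n * of_nat n powr (- ?w)"
    have C': "half_plane_le (dirichlet_sum S ?b) C"
      using C unfolding half_plane_le_def dirichlet_sum_shift[OF S(2), symmetric] by (auto simp: right_half_plane_def)
    have "norm (\<Sum>m | m \<in> S \<and> \<bar>ln (real m) - 0\<bar> \<le> ln (real N). ?b m * of_nat m powr (- of_real (Re s)))
        \<le> C * (LINT t|lborel. \<bar>trapezoid_kernel (ln (real N)) (ln (real N + 1)) t\<bar>)"
    proof (rule trapezoid_select)
      show "norm (\<Sum>m\<in>S. ?b m * of_nat m powr (- of_real (Re s)) * of_real (cos ((ln (real m) - 0) * t))) \<le> C" for t
        by (rule dirichlet_sum_cos_le[OF S C' s])
      show "\<bar>ln (real m) - 0\<bar> \<le> ln (real N) \<or> ln (real N + 1) \<le> \<bar>ln (real m) - 0\<bar>" if "m \<in> S" for m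
      proof (cases "m \<le> N")
        case False
        then have "real N + 1 \<le> real m" by linarith
        then show ?thesis using N by (auto intro!: ln_mono order_trans[OF _ abs_ge_self])
      qed (use that S in \<open>auto simp: subset_iff\<close>)
    qed (use S N in auto)
    also have "(\<Sum>m | m \<in> S \<and> \<bar>ln (real m) - 0\<bar> \<le> ln (real N). ?b m * of_nat m powr (- of_real (Re s)))
       = dirichlet_sum {n\<in>S. n \<le> N} b s"
      unfolding dirichlet_sum_def
    proof (rule sum.cong)
      show "{m \<in> S. \<bar>ln (real m) - 0\<bar> \<le> ln (real N)} = {n\<in>S. n \<le> N}"
        using S N by (auto simp: subset_iff Suc_le_eq)
      show "b x * of_nat x powr - (\<i> * of_real (Im s)) * of_nat x powr - of_real (Re s) = b x * of_nat x powr - s" for x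
      proof -
        have "- (\<i> * of_real (Im s)) + - of_real (Re s) = - s" by (simp add: complex_eq_iff)
        then show ?thesis by (simp only: mult.assoc powr_add[symmetric])
      qed
    qed
    also have "C * (LINT t|lborel. \<bar>trapezoid_kernel (ln (real N)) (ln (real N + 1)) t\<bar>) \<le> C * (?K * real N powr \<theta>)"
      using K[OF N] half_plane_le_nonneg[OF C] by (rule mult_left_mono)
    finally show ?thesis by (simp add: mult_ac)
  qed
  moreover have "?K \<ge> 0" using fejer_mass_pos assms by simp
  ultimately show ?thesis by blast
qed

lemma abel_summation:
  fixes a :: "nat \<Rightarrow> complex" and x :: "nat \<Rightarrow> real"
  shows "(\<Sum>n=1..Suc N. a n * of_real (x n)) =
    (\<Sum>n=1..N. (\<Sum>k=1..n. a k) * of_real (x n - x (Suc n))) + (\<Sum>k=1..Suc N. a k) * of_real (x (Suc N))"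
  by (induction N) (auto simp: algebra_simps)

text \<open>
  Moving to the right by \<open>2 * \<theta>\<close> gains the factor \<open>n powr - (2 * \<theta>)\<close>, and summation by parts lets it absorb
  the growth \<open>N powr \<theta>\<close> of the partial sums.
\<close>

lemma partial_sum_bounded:
  assumes \<epsilon>: "\<epsilon> > 0"
  shows "\<exists>K\<ge>0. \<forall>S b C N s. finite S \<longrightarrow> S \<subseteq> {1..} \<longrightarrow> half_plane_le (dirichlet_sum S b) C \<longrightarrow> Re s > \<epsilon> \<longrightarrow>
      norm (dirichlet_sum {n\<in>S. n \<le> N} b s) \<le> K * C"
proof -
  \<comment> \<open>half of the shift is used up by the growth of the partial sums\<close>
  define \<theta> where "\<theta> = min (\<epsilon> / 2) (1 / 2)"
  have \<theta>: "0 < \<theta>" "\<theta> < 1" "2 * \<theta> \<le> \<epsilon>" using \<epsilon> by (auto simp: \<theta>_def)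
  obtain K where K: "K \<ge> 0" and bound: "\<And>S b C N s. finite S \<Longrightarrow> S \<subseteq> {1..} \<Longrightarrow> half_plane_le (dirichlet_sum S b) C \<Longrightarrow>
      1 \<le> N \<Longrightarrow> Re s > 0 \<Longrightarrow> norm (dirichlet_sum {n\<in>S. n \<le> N} b s) \<le> K * real N powr \<theta> * C"
    using partial_sum_le[OF \<theta>(1,2)] by blast
  \<comment> \<open>the weights \<open>n powr - (2 * \<theta>)\<close> are \<open>(y n)\<^sup>2\<close>; the factorization of their differences makes the sum telescope\<close>
  define y where "y n = real n powr (- \<theta>)" for n :: nat
  have y: "y n > 0" "y (Suc n) \<le> y n" "real n powr \<theta> = 1 / y n" if "n \<ge> 1" for n
  proof -
    show "y n > 0" "real n powr \<theta> = 1 / y n" using that by (simp_all add: y_def powr_minus_divide)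
    show "y (Suc n) \<le> y n" unfolding y_def by (rule powr_mono2') (use that \<theta> in auto)
  qed
  have "norm (dirichlet_sum {n\<in>S. n \<le> N} b s) \<le> 3 * K * C"
    if S: "finite S" "S \<subseteq> {1..}" and C: "half_plane_le (dirichlet_sum S b) C" and s: "Re s > \<epsilon>" for S b C N s
  proof (cases N)
    case 0
    then have "{n\<in>S. n \<le> N} = {}" using S(2) by auto
    then have "dirichlet_sum {n\<in>S. n \<le> N} b s = 0" unfolding dirichlet_sum_def by (simp only: sum.empty)
    then show ?thesis using half_plane_le_nonneg[OF C] K by simp
  next
    case (Suc M)
    let ?s = "s - of_real (2 * \<theta>)"
    define a where "a n = (if n \<in> S then b n * of_nat n powr (- ?s) else 0)" for n
    have part: "(\<Sum>k=1..n. a k) = dirichlet_sum {m\<in>S. m \<le> n} b ?s" for n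
      unfolding dirichlet_sum_def a_def sum.inter_restrict[OF finite_atLeastAtMost, symmetric]
      by (rule sum.cong) (use S in auto)
    have T: "norm (\<Sum>k=1..n. a k) \<le> K * C / y n" if "1 \<le> n" for n
      unfolding part using bound[OF S C that, of ?s] s \<theta> y(3)[OF that] by simp
    have KC: "K * C \<ge> 0" using K half_plane_le_nonneg[OF C] by simp
    have "dirichlet_sum {n\<in>S. n \<le> N} b s = (\<Sum>n=1..Suc M. a n * of_real ((y n)\<^sup>2))"
    proof -
      have "b n * of_nat n powr (- s) = a n * of_real ((y n)\<^sup>2)" if n: "n \<in> S" for n
      proof -
        have "of_real ((y n)\<^sup>2) = (of_nat n powr (- of_real (2 * \<theta>)) :: complex)"
          using powr_of_real[of "real n" "- (2 * \<theta>)"]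
          by (simp add: y_def power2_eq_square powr_add[symmetric])
        then show ?thesis using n by (simp add: a_def powr_add[symmetric])
      qed
      then show ?thesis
        unfolding dirichlet_sum_def
        by (intro sum.mono_neutral_cong_left) (use S Suc in \<open>auto simp: a_def\<close>)
    qed
    also have "\<dots> = (\<Sum>n=1..M. (\<Sum>k=1..n. a k) * of_real ((y n)\<^sup>2 - (y (Suc n))\<^sup>2)) + (\<Sum>k=1..Suc M. a k) * of_real ((y (Suc M))\<^sup>2)"
      by (rule abel_summation)
    also have "norm \<dots> \<le> (\<Sum>n=1..M. 2 * K * C * (y n - y (Suc n))) + K * C"
    proof (intro order_trans[OF norm_triangle_ineq] add_mono order_trans[OF norm_sum] sum_mono)
      fix n assume "n \<in> {1..M}"
      then have n: "n \<ge> 1" by auto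
      have sq: "(y n)\<^sup>2 - (y (Suc n))\<^sup>2 = (y n + y (Suc n)) * (y n - y (Suc n))"
        by (simp add: power2_eq_square algebra_simps)
      have "norm ((\<Sum>k=1..n. a k) * of_real ((y n)\<^sup>2 - (y (Suc n))\<^sup>2)) =
          norm (\<Sum>k=1..n. a k) * ((y n + y (Suc n)) * (y n - y (Suc n)))"
        using y[OF n] y(1)[of "Suc n"] unfolding sq norm_mult norm_of_real
        by (subst abs_of_nonneg) (auto intro!: mult_nonneg_nonneg)
      also have "\<dots> \<le> K * C / y n * ((y n + y n) * (y n - y (Suc n)))"
        using y[OF n] y(1)[of "Suc n"] KC by (intro mult_mono T n) auto
      also have "\<dots> = 2 * K * C * (y n - y (Suc n))" using y(1)[OF n] by (simp add: field_simps)
      finally show "norm ((\<Sum>k=1..n. a k) * of_real ((y n)\<^sup>2 - (y (Suc n))\<^sup>2)) \<le> 2 * K * C * (y n - y (Suc n))" .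
    next
      have y1: "y (Suc M) \<le> 1" "y (Suc M) > 0" using y(1)[of "Suc M"] powr_mono[of "- \<theta>" 0 "real (Suc M)"] \<theta> by (auto simp: y_def)
      have "norm ((\<Sum>k=1..Suc M. a k) * of_real ((y (Suc M))\<^sup>2)) = norm (\<Sum>k=1..Suc M. a k) * (y (Suc M))\<^sup>2"
        by (simp add: norm_mult norm_power del: sum.cl_ivl_Suc)
      also have "\<dots> \<le> K * C / y (Suc M) * (y (Suc M))\<^sup>2" by (intro mult_right_mono T) auto
      also have "\<dots> = K * C * y (Suc M)" using y1 by (simp add: power2_eq_square)
      also have "\<dots> \<le> K * C" using y1 KC by (simp add: mult_left_le)
      finally show "norm ((\<Sum>k=1..Suc M. a k) * of_real ((y (Suc M))\<^sup>2)) \<le> K * C" .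
    qed
    also have "(\<Sum>n=1..M. 2 * K * C * (y n - y (Suc n))) = 2 * K * C * (y 1 - y (Suc M))"
      unfolding sum_distrib_left[symmetric] by (induction M) (auto simp: algebra_simps)
    also have "\<dots> \<le> 2 * K * C * 1"
    proof (rule mult_left_mono)
      show "y 1 - y (Suc M) \<le> 1" using y(1)[of "Suc M"] by (simp add: y_def)
      show "0 \<le> 2 * K * C" using KC by linarith
    qed
    finally show ?thesis by (simp add: algebra_simps)
  qed
  then show ?thesis using K by (intro exI[of _ "3 * K"]) auto
qed

section \<open>Bohr's inequality\<close>

lemma dpoly_powr: "S \<subseteq> {1..} \<Longrightarrow> dpoly S b (\<lambda>i. of_nat (nth_prime i) powr (- s)) = dirichlet_sum S b s"
  unfolding dpoly_def dirichlet_sum_def by (rule sum.cong) (auto simp: bohr_monomial_powr subset_iff)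

text \<open>
  Every monomial of the \<open>k\<close>-th power is a product of \<open>k\<close> numbers from \<open>S\<close>, so it is given by exponents \<open>e d \<le> k\<close> for
  \<open>d \<in> S\<close>. The number of terms therefore grows only polynomially in \<open>k\<close>.
\<close>

lemma dpoly_power:
  assumes S: "finite S" "S \<subseteq> {1..}"
  shows "\<exists>T c. finite T \<and> T \<subseteq> {1..} \<and> card T \<le> (k + 1) ^ card S \<and> (\<forall>z. dpoly S b z ^ k = dpoly T c z)"
proof -
  define T where "T k = (\<lambda>e. \<Prod>d\<in>S. d ^ e d) ` (S \<rightarrow>\<^sub>E {..k})" for k :: nat
  have T: "finite (T k)" "T k \<subseteq> {1..}" "card (T k) \<le> (k + 1) ^ card S" for k
  proof -
    show "finite (T k)" unfolding T_def by (intro finite_imageI finite_PiE S) auto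
    show "T k \<subseteq> {1..}" using S unfolding T_def by (auto intro!: Suc_leI prod_pos simp: subset_iff Suc_le_eq)
    have "card (T k) \<le> card (S \<rightarrow>\<^sub>E {..k})" unfolding T_def by (intro card_image_le finite_PiE S) auto
    also have "\<dots> = (k + 1) ^ card S" using S by (simp add: card_PiE)
    finally show "card (T k) \<le> (k + 1) ^ card S" .
  qed
  have "\<exists>c. \<forall>z. dpoly S b z ^ k = dpoly (T k) c z" for k
  proof (induction k)
    case 0
    have 1: "T 0 = {1}" unfolding T_def by (auto simp: PiE_eq_singleton image_iff intro!: exI[of _ "\<lambda>_\<in>S. 0"])
    show ?case unfolding 1 by (intro exI[of _ "\<lambda>_. 1"]) (auto simp: dpoly_def)
  next
    case (Suc k)
    then obtain c where c: "\<And>z. dpoly S b z ^ k = dpoly (T k) c z" by blast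
    let ?M = "(\<lambda>(m, n). m * n) ` (S \<times> T k)" and ?d = "\<lambda>l. \<Sum>(m, n) | (m, n) \<in> S \<times> T k \<and> m * n = l. b m * c n"
    have "?M \<subseteq> T (Suc k)"
    proof safe
      fix m n assume m: "m \<in> S" and "n \<in> T k"
      then obtain e where e: "e \<in> S \<rightarrow>\<^sub>E {..k}" "n = (\<Prod>d\<in>S. d ^ e d)" by (auto simp: T_def)
      have "m * n = (\<Prod>d\<in>S. d ^ (e(m := Suc (e m))) d)"
        unfolding e(2) using m S by (simp add: prod.remove[of S m])
      moreover have "e(m := Suc (e m)) \<in> S \<rightarrow>\<^sub>E {..Suc k}" using e(1) m by (auto simp: PiE_iff extensional_def le_SucI)
      ultimately show "m * n \<in> T (Suc k)" unfolding T_def by blast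
    qed
    then have "dpoly S b z ^ Suc k = dpoly (T (Suc k)) (\<lambda>l. if l \<in> ?M then ?d l else 0) z" for z
      unfolding power_Suc c dpoly_mult[OF S(1) T(1) S(2) T(2)]
      unfolding dpoly_def by (intro sum.mono_neutral_cong_left T) auto
    then show ?case by blast
  qed
  then obtain c where "\<forall>z. dpoly S b z ^ k = dpoly (T k) c z" by blast
  with T[of k] show ?thesis by (intro exI[of _ "T k"] exI[of _ c]) simp
qed

lemma le_if_powers_polynomially_bounded:
  fixes x C :: real
  assumes "x \<ge> 0" "C \<ge> 0" and le: "\<And>k. x ^ k \<le> real ((k + 1) ^ d) * C ^ k"
  shows "x \<le> C"
proof (rule ccontr)
  assume "\<not> x \<le> C"
  then have xC: "x > C" by simp
  have C0: "C > 0" using le[of 1] xC assms(2) by (cases "C = 0") auto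
  define q where "q = x / C"
  have q: "q > 1" using xC C0 by (simp add: q_def)
  have "q ^ k \<le> (real k + 1) ^ d" for k
    using le[of k] C0 by (simp add: q_def power_divide field_simps)
  moreover have "filterlim (\<lambda>k::nat. q ^ k / (real k + 1) ^ d) at_top sequentially"
    using q by real_asymp
  then have "eventually (\<lambda>k. q ^ k / (real k + 1) ^ d > 1) sequentially"
    unfolding filterlim_at_top_dense by blast
  then obtain k where "q ^ k / (real k + 1) ^ d > 1" by (auto simp: eventually_sequentially)
  moreover have "(real k + 1) ^ d > 0" by simp
  ultimately show False by (smt (verit) divide_le_eq_1)
qed

text \<open>
  The trivial estimate (number of terms times the bound \<open>dirichlet_coeff_le\<close> for the coefficients) is applied to the \<open>k\<close>-th
  power. After taking \<open>k\<close>-th roots the number of terms disappears as \<open>k\<close> tends to infinity.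
\<close>

lemma bohr_inequality:
  assumes S: "finite S" "S \<subseteq> {1..}" and C: "half_plane_le (dirichlet_sum S b) C"
    and z: "\<And>i. i \<ge> 1 \<Longrightarrow> norm (z i) \<le> 1"
  shows "norm (dpoly S b z) \<le> C"
proof (rule le_if_powers_polynomially_bounded[where d = "card S"])
  fix k
  obtain T c where T: "finite T" "T \<subseteq> {1..}" "card T \<le> (k + 1) ^ card S" "\<And>z. dpoly S b z ^ k = dpoly T c z"
    using dpoly_power[OF S, of k b] by blast
  have "dirichlet_sum T c s = dirichlet_sum S b s ^ k" for s
    by (simp only: T(4) dpoly_powr[OF S(2), symmetric] dpoly_powr[OF T(2), symmetric])
  then have "half_plane_le (dirichlet_sum T c) (C ^ k)"
    using C by (auto simp: half_plane_le_def norm_power intro!: power_mono)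
  then have c: "norm (c n) \<le> C ^ k" if "n \<in> T" for n using dirichlet_coeff_le T that by blast
  have "norm (dpoly S b z) ^ k = norm (dpoly T c z)" by (simp add: T(4)[symmetric] norm_power)
  also have "\<dots> \<le> (\<Sum>n\<in>T. C ^ k * 1)"
    unfolding dpoly_def
  proof (rule order_trans[OF norm_sum sum_mono])
    fix n assume n: "n \<in> T"
    then have "n \<ge> 1" using T(2) by auto
    then have "norm (bohr_monomial z n) \<le> 1" by (rule norm_bohr_monomial_le_1) (use z in auto)
    then show "norm (c n * bohr_monomial z n) \<le> C ^ k * 1"
      unfolding norm_mult using c[OF n] half_plane_le_nonneg[OF C] by (intro mult_mono) auto
  qed
  also have "\<dots> \<le> real ((k + 1) ^ card S) * C ^ k"
  proof -
    have "real (card T) \<le> real ((k + 1) ^ card S)" using T(3) by (simp only: of_nat_le_iff)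
    then show ?thesis using half_plane_le_nonneg[OF C] by (simp add: mult_right_mono)
  qed
  finally show "norm (dpoly S b z) ^ k \<le> real ((k + 1) ^ card S) * C ^ k" .
qed (use half_plane_le_nonneg[OF C] in auto)

section \<open>Finite orbits and invariant polynomials\<close>

text \<open>
  An element \<open>g\<close> of \<open>G\<close> acts on the points of the polydisc by \<open>(act g z) i = z (g i)\<close>. The coordinates lie in \<open>I\<close>, and the
  values outside \<open>I\<close> are \<open>undefined\<close>, as for all elements of \<open>extensional I\<close>.
\<close>

locale perm_action =
  fixes G :: "(nat \<Rightarrow> nat) set"
  assumes subgroup_G: "subgroup G (BijGroup {1..})"
begin

abbreviation I where "I \<equiv> fin_orb_union G"
abbreviation orb where "orb \<equiv> orbit (perm_group G) (\<lambda>g. g)"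

definition act :: "(nat \<Rightarrow> nat) \<Rightarrow> (nat \<Rightarrow> complex) \<Rightarrow> nat \<Rightarrow> complex" where
  "act g z = (\<lambda>i\<in>I. z (g i))"

lemma G_Bij: "g \<in> G \<Longrightarrow> g \<in> Bij {1..}"
  using subgroup.subset[OF subgroup_G] by (auto simp: BijGroup_def)

lemma G_bij: "g \<in> G \<Longrightarrow> bij_betw g {1..} {1..}"
  using G_Bij by (auto simp: Bij_def)

lemma G_ge_1: "g \<in> G \<Longrightarrow> i \<ge> 1 \<Longrightarrow> g i \<ge> 1"
  using bij_betwE[OF G_bij] by auto

lemma G_inj: "g \<in> G \<Longrightarrow> i \<ge> 1 \<Longrightarrow> j \<ge> 1 \<Longrightarrow> g i = g j \<longleftrightarrow> i = j"
  using G_bij by (auto simp: bij_betw_def inj_on_def)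

lemma id_G: "(\<lambda>i\<in>{1..}. i) \<in> G"
  using subgroup.one_closed[OF subgroup_G] by (simp add: BijGroup_def)

lemma comp_G: "g \<in> G \<Longrightarrow> h \<in> G \<Longrightarrow> compose {1..} g h \<in> G"
  using subgroup.m_closed[OF subgroup_G, of g h] G_Bij by (simp add: BijGroup_def)

lemma inv_G:
  assumes "g \<in> G"
  obtains g' where "g' \<in> G" "\<And>i. i \<ge> 1 \<Longrightarrow> g' (g i) = i" "\<And>i. i \<ge> 1 \<Longrightarrow> g (g' i) = i"
proof
  let ?g' = "\<lambda>i\<in>{1..}. inv_into {1..} g i"
  show "?g' \<in> G"
    using subgroup.m_inv_closed[OF subgroup_G assms] inv_BijGroup[OF G_Bij[OF assms]] by simp
  show "?g' (g i) = i" if "i \<ge> 1" for i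
    using that G_ge_1[OF assms that] G_bij[OF assms] by (auto simp: bij_betw_def)
  show "g (?g' i) = i" if "i \<ge> 1" for i
    using that G_bij[OF assms] by (auto simp: bij_betw_def intro!: f_inv_into_f)
qed

lemma orb_eq: "orb i = {g i | g. g \<in> G}"
  by (simp add: orbit_def)

lemma orb_self: "i \<ge> 1 \<Longrightarrow> i \<in> orb i"
  unfolding orb_eq using id_G by (intro CollectI exI[of _ "\<lambda>i\<in>{1..}. i"]) simp

lemma mem_orb2: "g \<in> G \<Longrightarrow> h \<in> G \<Longrightarrow> i \<ge> 1 \<Longrightarrow> g (h i) \<in> orb i"
  unfolding orb_eq using comp_G[of g h] compose_eq[of i "{1..}" g h]
  by (intro CollectI exI[of _ "compose {1..} g h"]) simp

lemma orb_move:
  assumes "g \<in> G" "i \<ge> 1" shows "orb (g i) = orb i"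
proof -
  obtain g' where g': "g' \<in> G" "\<And>i. i \<ge> 1 \<Longrightarrow> g' (g i) = i" using inv_G[OF assms(1)] by metis
  have "h (g i) \<in> orb i" if "h \<in> G" for h
    using mem_orb2[OF that assms] .
  moreover have "h i \<in> orb (g i)" if "h \<in> G" for h
    using comp_G[OF that g'(1)] assms g'(2)[OF assms(2)] G_ge_1[OF assms] unfolding orb_eq
    by (auto simp: compose_def intro!: exI[of _ "compose {1..} h g'"])
  ultimately show ?thesis unfolding orb_eq by blast
qed

lemma finite_orbits_eq: "finite_orbits G = {orb i | i. i \<ge> 1 \<and> finite (orb i)}"
  by (auto simp: finite_orbits_def orbits_def)

lemma orb_ge_1: "i \<ge> 1 \<Longrightarrow> j \<in> orb i \<Longrightarrow> j \<ge> 1"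
  using G_ge_1 unfolding orb_eq by blast

lemma mem_I_iff: "i \<in> I \<longleftrightarrow> i \<ge> 1 \<and> finite (orb i)"
proof
  assume "i \<in> I"
  then obtain j where j: "j \<ge> 1" "finite (orb j)" "i \<in> orb j"
    unfolding fin_orb_union_def finite_orbits_eq by blast
  then obtain g where "g \<in> G" "i = g j" unfolding orb_eq by blast
  then show "i \<ge> 1 \<and> finite (orb i)" using orb_move[of g j] j orb_ge_1 by auto
next
  assume "i \<ge> 1 \<and> finite (orb i)"
  then show "i \<in> I" unfolding fin_orb_union_def finite_orbits_eq using orb_self by blast
qed

lemma I_ge_1: "i \<in> I \<Longrightarrow> i \<ge> 1" by (simp add: mem_I_iff)

lemma I_sub: "I \<subseteq> {1..}" by (auto simp: mem_I_iff)

lemma G_I: "g \<in> G \<Longrightarrow> i \<in> I \<Longrightarrow> g i \<in> I"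
  using orb_move[of g i] G_ge_1[of g i] unfolding mem_I_iff by auto

lemma orb_finite_orbits: "i \<in> I \<Longrightarrow> orb i \<in> finite_orbits G"
  unfolding finite_orbits_eq mem_I_iff by blast

lemma orb_subset_I: "i \<in> I \<Longrightarrow> orb i \<subseteq> I"
  using G_I unfolding orb_eq by blast

lemma act_apply [simp]: "i \<in> I \<Longrightarrow> act g z i = z (g i)"
  by (simp add: act_def)

lemma poly_act: "p \<in> poly_fun I \<Longrightarrow> p (act g z) = p (\<lambda>i. z (g i))"
  by (rule poly_fun_cong) auto

lemma poly_fun_act: "p \<in> poly_fun I \<Longrightarrow> g \<in> G \<Longrightarrow> (\<lambda>z. p (act g z)) \<in> poly_fun I"
  by (simp add: poly_act poly_fun_comp G_I)

definition inv_poly :: "((nat \<Rightarrow> complex) \<Rightarrow> complex) set" where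
  "inv_poly = {p \<in> poly_fun I. \<forall>g\<in>G. \<forall>z. p (act g z) = p z}"

lemma inv_poly_const: "(\<lambda>z. c) \<in> inv_poly"
  by (auto simp: inv_poly_def intro: poly_fun.intros)

lemma inv_poly_add: "p \<in> inv_poly \<Longrightarrow> q \<in> inv_poly \<Longrightarrow> (\<lambda>z. p z + q z) \<in> inv_poly"
  by (auto simp: inv_poly_def intro: poly_fun.intros)

lemma inv_poly_mult: "p \<in> inv_poly \<Longrightarrow> q \<in> inv_poly \<Longrightarrow> (\<lambda>z. p z * q z) \<in> inv_poly"
  by (auto simp: inv_poly_def intro: poly_fun.intros)

lemma inv_poly_poly: "p \<in> inv_poly \<Longrightarrow> p \<in> poly_fun I" by (simp add: inv_poly_def)

lemma inv_poly_inv: "p \<in> inv_poly \<Longrightarrow> g \<in> G \<Longrightarrow> p (act g z) = p z" by (simp add: inv_poly_def)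

section \<open>Averages over finite quotients\<close>

text \<open>
  A finite substitute for \<open>G\<close>: representatives, including one of the identity, of the restrictions of the elements of \<open>G\<close> to
  the finite set \<open>F\<close>. Composition with any \<open>h \<in> G\<close> permutes their restrictions.
\<close>

definition transversal :: "nat set \<Rightarrow> (nat \<Rightarrow> nat) set \<Rightarrow> bool" where
  "transversal F \<Gamma> \<longleftrightarrow> finite \<Gamma> \<and> \<Gamma> \<subseteq> G \<and> (\<exists>e\<in>\<Gamma>. \<forall>i\<in>F. e i = i) \<and>
     (\<forall>h\<in>G. \<exists>\<pi>. bij_betw \<pi> \<Gamma> \<Gamma> \<and> (\<forall>\<gamma>\<in>\<Gamma>. \<forall>i\<in>F. \<pi> \<gamma> i = h (\<gamma> i)))"

lemma transversal_mono: "transversal F \<Gamma> \<Longrightarrow> F' \<subseteq> F \<Longrightarrow> transversal F' \<Gamma>"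
  unfolding transversal_def by blast

text \<open>
  One representative is chosen for each of the finitely many restrictions of elements of \<open>G\<close> to the invariant set \<open>F\<close>.
\<close>

lemma ex_transversal_invariant:
  assumes "finite F" "F \<subseteq> I" and inv: "\<And>g i. g \<in> G \<Longrightarrow> i \<in> F \<Longrightarrow> g i \<in> F"
  shows "\<exists>\<Gamma>. transversal F \<Gamma>"
proof -
  let ?r = "\<lambda>g. restrict g F"
  define s where "s = inv_into G ?r"
  let ?\<Gamma> = "s ` ?r ` G"
  have F1: "i \<ge> 1" if "i \<in> F" for i using that assms(2) I_ge_1 by blast
  have s: "s (?r g) \<in> G" "?r (s (?r g)) = ?r g" if "g \<in> G" for g
    using that f_inv_into_f[of "restrict g F" ?r G] unfolding s_def by (auto intro: inv_into_into)
  have s': "s (?r g) i = g i" if "g \<in> G" "i \<in> F" for g i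
    using fun_cong[OF s(2)[OF that(1)], of i] that(2) by simp
  have "finite (?r ` G)"
    by (rule finite_subset[OF _ finite_PiE[OF assms(1), of "\<lambda>_. F"]]) (use inv assms(1) in auto)
  then have fin: "finite ?\<Gamma>" by simp
  have inj: "\<gamma> = \<gamma>'" if \<gamma>: "\<gamma> \<in> ?\<Gamma>" "\<gamma>' \<in> ?\<Gamma>" and "\<And>i. i \<in> F \<Longrightarrow> \<gamma> i = \<gamma>' i" for \<gamma> \<gamma>'
  proof -
    obtain g g' where g: "g \<in> G" "\<gamma> = s (?r g)" "g' \<in> G" "\<gamma>' = s (?r g')" using \<gamma> by blast
    have "?r g = ?r g'"
      using that(3) s' g by (intro restrict_ext) metis
    then show ?thesis using g by simp
  qed
  show ?thesis unfolding transversal_def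
  proof (intro exI[of _ ?\<Gamma>] conjI ballI)
    show "finite ?\<Gamma>" by (rule fin)
    show "?\<Gamma> \<subseteq> G" using s by blast
    show "\<exists>e\<in>?\<Gamma>. \<forall>i\<in>F. e i = i"
    proof (rule bexI[of _ "s (?r (\<lambda>i\<in>{1..}. i))"])
      show "\<forall>i\<in>F. s (?r (\<lambda>i\<in>{1..}. i)) i = i" using s'[OF id_G] F1 by simp
    qed (use id_G in blast)
  next
    fix h assume h: "h \<in> G"
    let ?\<pi> = "\<lambda>\<gamma>. s (?r (compose {1..} h \<gamma>))"
    have \<pi>: "?\<pi> \<gamma> \<in> ?\<Gamma>" "\<And>i. i \<in> F \<Longrightarrow> ?\<pi> \<gamma> i = h (\<gamma> i)" if "\<gamma> \<in> ?\<Gamma>" for \<gamma>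
    proof -
      have c: "compose {1..} h \<gamma> \<in> G" using comp_G[OF h] that s by blast
      then show "?\<pi> \<gamma> \<in> ?\<Gamma>" by blast
      show "?\<pi> \<gamma> i = h (\<gamma> i)" if "i \<in> F" for i using s'[OF c that] F1[OF that] by (simp add: compose_def)
    qed
    have "inj_on ?\<pi> ?\<Gamma>"
    proof (rule inj_onI, rule inj)
      fix \<gamma> \<gamma>' i assume *: "\<gamma> \<in> ?\<Gamma>" "\<gamma>' \<in> ?\<Gamma>" "?\<pi> \<gamma> = ?\<pi> \<gamma>'" and i: "i \<in> F"
      have "h (\<gamma> i) = h (\<gamma>' i)" using \<pi>(2)[OF *(1) i] \<pi>(2)[OF *(2) i] *(3) by simp
      moreover have "\<gamma> i \<ge> 1" "\<gamma>' i \<ge> 1" using * s G_ge_1 F1[OF i] by blast+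
      ultimately show "\<gamma> i = \<gamma>' i" using G_inj[OF h] by blast
    qed
    moreover have "?\<pi> ` ?\<Gamma> \<subseteq> ?\<Gamma>" using \<pi>(1) by blast
    ultimately have "bij_betw ?\<pi> ?\<Gamma> ?\<Gamma>" using fin by (simp add: bij_betw_def endo_inj_surj)
    then show "\<exists>\<pi>. bij_betw \<pi> ?\<Gamma> ?\<Gamma> \<and> (\<forall>\<gamma>\<in>?\<Gamma>. \<forall>i\<in>F. \<pi> \<gamma> i = h (\<gamma> i))" using \<pi>(2) by blast
  qed
qed

lemma ex_transversal:
  assumes "finite F" "F \<subseteq> I" shows "\<exists>\<Gamma>. transversal F \<Gamma>"
proof -
  let ?F = "\<Union>i\<in>F. orb i"
  have "finite ?F" using assms mem_I_iff by auto
  moreover have "?F \<subseteq> I" using assms orb_subset_I by blast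
  moreover have "g i \<in> ?F" if "g \<in> G" and i: "i \<in> ?F" for g i
  proof -
    obtain j where j: "j \<in> F" "i \<in> orb j" using i by blast
    then obtain h where h: "h \<in> G" "i = h j" unfolding orb_eq by blast
    have "j \<ge> 1" using j assms I_ge_1 by blast
    then have "g i \<in> orb j" using mem_orb2[OF that(1) h(1)] h(2) by simp
    then show ?thesis using j by blast
  qed
  ultimately obtain \<Gamma> where "transversal ?F \<Gamma>" using ex_transversal_invariant by blast
  moreover have "F \<subseteq> ?F"
  proof
    fix i assume i: "i \<in> F"
    then have "i \<in> orb i" using assms I_ge_1 by (intro orb_self) blast
    with i show "i \<in> ?F" by blast
  qed
  ultimately show ?thesis using transversal_mono by blast
qed

lemma transversal_poly:
  assumes \<Gamma>: "transversal F \<Gamma>" and F: "F \<subseteq> I" and h: "h \<in> G"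
  obtains \<pi> where "bij_betw \<pi> \<Gamma> \<Gamma>"
    "\<And>p \<gamma> z. p \<in> poly_fun F \<Longrightarrow> \<gamma> \<in> \<Gamma> \<Longrightarrow> p (act \<gamma> (act h z)) = p (act (\<pi> \<gamma>) z)"
proof -
  obtain \<pi> where \<pi>: "bij_betw \<pi> \<Gamma> \<Gamma>" "\<And>\<gamma> i. \<gamma> \<in> \<Gamma> \<Longrightarrow> i \<in> F \<Longrightarrow> \<pi> \<gamma> i = h (\<gamma> i)"
    using \<Gamma> h unfolding transversal_def by blast
  have "p (act \<gamma> (act h z)) = p (act (\<pi> \<gamma>) z)" if p: "p \<in> poly_fun F" and \<gamma>: "\<gamma> \<in> \<Gamma>" for p \<gamma> z
  proof (rule poly_fun_cong[OF p])
    fix i assume i: "i \<in> F"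
    have "\<gamma> \<in> G" using \<gamma> \<Gamma> unfolding transversal_def by blast
    then show "act \<gamma> (act h z) i = act (\<pi> \<gamma>) z i" using i F \<pi>(2)[OF \<gamma> i] G_I by auto
  qed
  with \<pi>(1) show thesis by (rule that)
qed

definition average :: "(nat \<Rightarrow> nat) set \<Rightarrow> ((nat \<Rightarrow> complex) \<Rightarrow> complex) \<Rightarrow> (nat \<Rightarrow> complex) \<Rightarrow> complex" where
  "average \<Gamma> f z = (\<Sum>\<gamma>\<in>\<Gamma>. f (act \<gamma> z)) / of_nat (card \<Gamma>)"

lemma transversal_card: "transversal F \<Gamma> \<Longrightarrow> card \<Gamma> > 0"
  unfolding transversal_def by (auto simp: card_gt_0_iff)

text \<open>
  The action of \<open>h\<close> permutes the summands.
\<close>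

lemma average_inv_poly:
  assumes \<Gamma>: "transversal F \<Gamma>" and F: "F \<subseteq> I" and p: "p \<in> poly_fun F"
  shows "average \<Gamma> p \<in> inv_poly"
proof -
  have pI: "p \<in> poly_fun I" using p poly_fun_mono[OF F] by blast
  have "(\<lambda>z. (\<Sum>\<gamma>\<in>\<Gamma>. p (act \<gamma> z)) * inverse (of_nat (card \<Gamma>))) \<in> poly_fun I"
    by (rule poly_fun.mult[OF poly_fun_sum poly_fun.const]) (use poly_fun_act[OF pI] \<Gamma> in \<open>auto simp: transversal_def\<close>)
  moreover have "average \<Gamma> p (act h z) = average \<Gamma> p z" if h: "h \<in> G" for h z
  proof -
    obtain \<pi> where \<pi>: "bij_betw \<pi> \<Gamma> \<Gamma>" "\<And>\<gamma>. \<gamma> \<in> \<Gamma> \<Longrightarrow> p (act \<gamma> (act h z)) = p (act (\<pi> \<gamma>) z)"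
      using transversal_poly[OF \<Gamma> F h] p by metis
    have "(\<Sum>\<gamma>\<in>\<Gamma>. p (act \<gamma> (act h z))) = (\<Sum>\<gamma>\<in>\<Gamma>. p (act (\<pi> \<gamma>) z))" using \<pi>(2) by (rule sum.cong[OF refl])
    also have "\<dots> = (\<Sum>\<gamma>\<in>\<Gamma>. p (act \<gamma> z))" by (rule sum.reindex_bij_betw[OF \<pi>(1)])
    finally show ?thesis by (simp add: average_def)
  qed
  ultimately show ?thesis by (simp add: inv_poly_def average_def[abs_def] divide_inverse)
qed

text \<open>
  The monic polynomial in one variable whose roots are the conjugates of \<open>r\<close>. Its coefficients are invariant, so it shows that
  \<open>r\<close> is integral over the invariant polynomials.
\<close>

definition orbit_poly :: "(nat \<Rightarrow> nat) set \<Rightarrow> ((nat \<Rightarrow> complex) \<Rightarrow> complex) \<Rightarrow> (nat \<Rightarrow> complex) \<Rightarrow> complex poly" where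
  "orbit_poly \<Gamma> r z = (\<Prod>\<gamma>\<in>\<Gamma>. [:- r (act \<gamma> z), 1:])"

lemma coeff_orbit_poly:
  assumes "finite \<Gamma>" "\<Gamma> \<subseteq> G" "r \<in> poly_fun I"
  shows "(\<lambda>z. coeff (orbit_poly \<Gamma> r z) k) \<in> poly_fun I"
  using assms(1,2)
proof (induction \<Gamma> arbitrary: k)
  case empty
  then show ?case by (cases k) (auto simp: orbit_poly_def intro: poly_fun.const)
next
  case (insert g \<Gamma>)
  have "coeff (orbit_poly (insert g \<Gamma>) r z) k =
      - r (act g z) * coeff (orbit_poly \<Gamma> r z) k + (case k of 0 \<Rightarrow> 0 | Suc j \<Rightarrow> coeff (orbit_poly \<Gamma> r z) j)" for z
    using insert.hyps by (cases k) (simp_all add: orbit_poly_def)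
  moreover have "(\<lambda>z. - r (act g z)) \<in> poly_fun I"
    using poly_fun_uminus[OF poly_fun_act[OF assms(3)], of g] insert.prems by simp
  moreover have "(\<lambda>z. coeff (orbit_poly \<Gamma> r z) l) \<in> poly_fun I" for l
    using insert by simp
  moreover from this have "(\<lambda>z. case k of 0 \<Rightarrow> 0 | Suc j \<Rightarrow> coeff (orbit_poly \<Gamma> r z) j) \<in> poly_fun I"
    by (cases k) (simp_all add: poly_fun.const)
  ultimately show ?case by (simp only: poly_fun.add poly_fun.mult)
qed

lemma coeff_orbit_poly_inv:
  assumes \<Gamma>: "transversal F \<Gamma>" and F: "F \<subseteq> I" and r: "r \<in> poly_fun F"
  shows "(\<lambda>z. coeff (orbit_poly \<Gamma> r z) k) \<in> inv_poly"
proof -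
  have rI: "r \<in> poly_fun I" using r poly_fun_mono[OF F] by blast
  have "orbit_poly \<Gamma> r (act h z) = orbit_poly \<Gamma> r z" if h: "h \<in> G" for h z
  proof -
    obtain \<pi> where \<pi>: "bij_betw \<pi> \<Gamma> \<Gamma>" "\<And>\<gamma>. \<gamma> \<in> \<Gamma> \<Longrightarrow> r (act \<gamma> (act h z)) = r (act (\<pi> \<gamma>) z)"
      using transversal_poly[OF \<Gamma> F h] r by metis
    have "orbit_poly \<Gamma> r (act h z) = (\<Prod>\<gamma>\<in>\<Gamma>. [:- r (act (\<pi> \<gamma>) z), 1:])"
      unfolding orbit_poly_def using \<pi>(2) by (intro prod.cong) auto
    also have "\<dots> = orbit_poly \<Gamma> r z"
      unfolding orbit_poly_def by (rule prod.reindex_bij_betw[OF \<pi>(1)])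
    finally show ?thesis .
  qed
  then show ?thesis using coeff_orbit_poly[OF _ _ rI] \<Gamma> by (auto simp: inv_poly_def transversal_def)
qed

lemma degree_orbit_poly: "finite \<Gamma> \<Longrightarrow> degree (orbit_poly \<Gamma> r z) = card \<Gamma> \<and> coeff (orbit_poly \<Gamma> r z) (card \<Gamma>) = 1"
proof -
  assume "finite \<Gamma>"
  then have "degree (orbit_poly \<Gamma> r z) = card \<Gamma>"
    unfolding orbit_poly_def by (subst degree_prod_eq_sum_degree) auto
  moreover have "lead_coeff (orbit_poly \<Gamma> r z) = 1"
    unfolding orbit_poly_def by (simp add: lead_coeff_prod)
  ultimately show ?thesis by auto
qed

lemma poly_orbit_poly: "finite \<Gamma> \<Longrightarrow> poly (orbit_poly \<Gamma> r z) t = (\<Prod>\<gamma>\<in>\<Gamma>. t - r (act \<gamma> z))"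
  unfolding orbit_poly_def by (simp add: poly_prod)

text \<open>
  If no \<open>\<gamma>\<close> in the transversal maps \<open>z\<close> to \<open>w\<close> on \<open>F\<close>, then the product of one nonvanishing factor for each \<open>\<gamma>\<close> is a polynomial
  \<open>r\<close> that vanishes at all conjugates of \<open>z\<close> but not at \<open>w\<close>. The orbit polynomials of \<open>r\<close> at \<open>z\<close> and at \<open>w\<close> have invariant
  coefficients, so they agree; but the first is a power of the variable and the second has the nonzero root \<open>r w\<close>.
\<close>

lemma inv_poly_separate_finite:
  assumes eq: "\<And>p. p \<in> inv_poly \<Longrightarrow> p z = p w" and F: "finite F" "F \<subseteq> I"
  shows "\<exists>g\<in>G. \<forall>i\<in>F. z (g i) = w i"
proof (rule ccontr)
  assume neg: "\<not> ?thesis"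
  obtain \<Gamma> where \<Gamma>: "transversal F \<Gamma>" using ex_transversal[OF F] by blast
  then have fin: "finite \<Gamma>" "\<Gamma> \<subseteq> G" unfolding transversal_def by auto
  obtain e where e: "e \<in> \<Gamma>" "\<And>i. i \<in> F \<Longrightarrow> e i = i" using \<Gamma> unfolding transversal_def by blast
  have "\<forall>\<gamma>\<in>\<Gamma>. \<exists>i\<in>F. z (\<gamma> i) \<noteq> w i" using neg fin by blast
  then obtain j where j: "\<And>\<gamma>. \<gamma> \<in> \<Gamma> \<Longrightarrow> j \<gamma> \<in> F \<and> z (\<gamma> (j \<gamma>)) \<noteq> w (j \<gamma>)" by metis
  define r where "r u = (\<Prod>\<gamma>\<in>\<Gamma>. u (j \<gamma>) - z (\<gamma> (j \<gamma>)))" for u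
  have r: "r \<in> poly_fun F"
    unfolding r_def[abs_def] using j by (intro poly_fun_prod poly_fun_diff poly_fun.coord poly_fun.const) auto
  have rw: "r w \<noteq> 0" using j fin unfolding r_def by (metis (no_types, lifting) prod_zero_iff right_minus_eq)
  have rz: "r (act \<gamma> z) = 0" if "\<gamma> \<in> \<Gamma>" for \<gamma>
    unfolding r_def using fin that j[OF that] F(2) by (auto simp: prod_zero_iff intro!: bexI[of _ \<gamma>])
  have "orbit_poly \<Gamma> r z = orbit_poly \<Gamma> r w"
    using eq[OF coeff_orbit_poly_inv[OF \<Gamma> F(2) r]] by (intro poly_eqI)
  moreover have "r (act e w) = r w"
    by (rule poly_fun_cong[OF r]) (use e F in auto)
  then have "poly (orbit_poly \<Gamma> r w) (r w) = 0"
    using poly_orbit_poly[OF fin(1)] e(1) fin(1) by (auto simp: prod_zero_iff intro!: bexI[of _ e])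
  moreover have "poly (orbit_poly \<Gamma> r z) (r w) \<noteq> 0"
    using poly_orbit_poly[OF fin(1)] rz rw fin(1) by (simp add: prod_zero_iff)
  ultimately show False by simp
qed

section \<open>Orbits of the profinite group\<close>

text \<open>
  The homomorphism from \<open>G\<close> to the product of the symmetric groups of the finite orbits.
\<close>

definition embed :: "(nat \<Rightarrow> nat) \<Rightarrow> nat set \<Rightarrow> nat \<Rightarrow> nat" where
  "embed g = (\<lambda>X\<in>finite_orbits G. restrict g X)"

lemma G_hat_eq: "G_hat G = Q_top G closure_of (embed ` G)"
  by (simp add: G_hat_def embed_def[abs_def])

lemma topspace_Q: "topspace (Q_top G) = (\<Pi>\<^sub>E X\<in>finite_orbits G. Bij X)"
  by (simp add: Q_top_def)

lemma restrict_orbit_Bij: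
  assumes "g \<in> G" "X \<in> finite_orbits G" shows "restrict g X \<in> Bij X"
proof -
  obtain i where i: "i \<ge> 1" "X = orb i" "finite X" using assms(2) unfolding finite_orbits_eq by blast
  have "g ` X \<subseteq> X"
  proof
    fix y assume "y \<in> g ` X"
    then obtain h where h: "h \<in> G" "y = g (h i)" unfolding i(2) orb_eq by blast
    then show "y \<in> X" using mem_orb2[OF assms(1) h(1) i(1)] i(2) by simp
  qed
  moreover have "inj_on g X" using i orb_ge_1 G_inj[OF assms(1)] by (auto simp: inj_on_def)
  ultimately show ?thesis using i(3) by (auto simp: Bij_def bij_betw_def endo_inj_surj inj_on_def)
qed

lemma embed_topspace: "g \<in> G \<Longrightarrow> embed g \<in> topspace (Q_top G)"
  unfolding topspace_Q embed_def using restrict_orbit_Bij by auto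

lemma embed_G_hat: "g \<in> G \<Longrightarrow> embed g \<in> G_hat G"
  using closure_of_subset[of "embed ` G" "Q_top G"] embed_topspace unfolding G_hat_eq by blast

lemma psi_apply: "i \<in> I \<Longrightarrow> psi G q i = q (orb i) i"
  by (simp add: psi_def)

lemma psi_embed: "g \<in> G \<Longrightarrow> i \<in> I \<Longrightarrow> psi G (embed g) i = g i"
  using orb_finite_orbits[of i] orb_self[of i] I_ge_1[of i] by (simp add: psi_apply embed_def)

lemma psi_star_apply: "i \<in> I \<Longrightarrow> psi_star G q z i = z (psi G q i)"
  by (simp add: psi_star_def compose_def)

lemma psi_star_embed: "g \<in> G \<Longrightarrow> psi_star G (embed g) z = act g z"
  unfolding psi_star_def compose_def act_def by (rule restrict_ext) (simp add: psi_embed)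

text \<open>
  Finitely many coordinates of \<open>I\<close> involve only finitely many orbits, and the topology on each factor is discrete. So on a finite
  set every element of the closure agrees with an element of \<open>G\<close>.
\<close>

lemma G_hat_approx:
  assumes q: "q \<in> G_hat G" and F: "finite F" "F \<subseteq> I"
  shows "\<exists>g\<in>G. \<forall>i\<in>F. psi G q i = g i"
proof -
  let ?U = "\<Pi>\<^sub>E X\<in>finite_orbits G. if X \<in> orb ` F then {q X} else Bij X"
  have q': "q \<in> topspace (Q_top G)" using q unfolding G_hat_eq in_closure_of by blast
  have "openin (Q_top G) ?U"
    unfolding Q_top_def openin_PiE_gen
  proof (intro disjI2 conjI ballI)
    show "finite {X \<in> finite_orbits G. (if X \<in> orb ` F then {q X} else Bij X) \<noteq> topspace (discrete_topology (Bij X))}"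
      by (rule finite_subset[of _ "orb ` F"]) (use F in auto)
    show "openin (discrete_topology (Bij X)) (if X \<in> orb ` F then {q X} else Bij X)" if "X \<in> finite_orbits G" for X
      using q' that unfolding topspace_Q by auto
  qed
  moreover have "q \<in> ?U" using q' unfolding topspace_Q by (auto simp: PiE_iff)
  ultimately obtain g where g: "g \<in> G" "embed g \<in> ?U" using q unfolding G_hat_eq in_closure_of by blast
  have "psi G q i = g i" if "i \<in> F" for i
  proof -
    have i: "i \<in> I" using that F by blast
    then have "embed g (orb i) = q (orb i)" using g(2) that orb_finite_orbits[OF i] by (auto simp: PiE_iff dest: bspec)
    then show ?thesis using psi_embed[OF g(1) i] psi_apply[OF i] by (metis psi_apply)
  qed
  then show ?thesis using g(1) by blast
qed

lemma psi_I: "q \<in> G_hat G \<Longrightarrow> i \<in> I \<Longrightarrow> psi G q i \<in> I"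
  using G_hat_approx[of q "{i}"] G_I by force

lemma poly_psi_star:
  assumes "p \<in> inv_poly" "q \<in> G_hat G" shows "p (psi_star G q z) = p z"
proof -
  obtain F where F: "finite F" "F \<subseteq> I" "p \<in> poly_fun F"
    using poly_fun_finite_support[OF inv_poly_poly[OF assms(1)]] by blast
  obtain g where g: "g \<in> G" "\<And>i. i \<in> F \<Longrightarrow> psi G q i = g i" using G_hat_approx[OF assms(2) F(1,2)] by blast
  have "p (psi_star G q z) = p (act g z)"
    by (rule poly_fun_cong[OF F(3)]) (use F g in \<open>auto simp: psi_star_apply\<close>)
  then show ?thesis using inv_poly_inv[OF assms(1) g(1)] by simp
qed

lemma compact_Q: "compact_space (Q_top G)"
  unfolding Q_top_def
proof (rule compact_space_product_topology[THEN iffD2], intro disjI2 ballI)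
  fix X assume "X \<in> finite_orbits G"
  then have "finite X" by (auto simp: finite_orbits_def)
  then have "finite (Bij X)"
    by (intro finite_subset[OF _ finite_PiE[of X "\<lambda>_. X"]]) (auto simp: Bij_def PiE_def bij_betw_def)
  then show "compact_space (discrete_topology (Bij X))" by (simp add: compact_space_discrete_topology)
qed

text \<open>
  The conditions on single coordinates are closed and have the finite intersection property, and the product of finite groups is
  compact.
\<close>

lemma ex_G_hat_of_finite:
  assumes fin: "\<And>F. finite F \<Longrightarrow> F \<subseteq> I \<Longrightarrow> \<exists>g\<in>G. \<forall>i\<in>F. z (g i) = w i"
  shows "\<exists>q\<in>G_hat G. \<forall>i\<in>I. z (psi G q i) = w i"
proof -
  define C where "C i = {q \<in> topspace (Q_top G). q (orb i) \<in> {f \<in> Bij (orb i). z (f i) = w i}}" for i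
  have cl: "closedin (Q_top G) (C i)" if "i \<in> I" for i
    unfolding C_def Q_top_def
  proof (rule closedin_continuous_map_preimage)
    show "continuous_map (product_topology (\<lambda>X. discrete_topology (Bij X)) (finite_orbits G))
        (discrete_topology (Bij (orb i))) (\<lambda>q. q (orb i))"
      using continuous_map_product_projection[OF orb_finite_orbits[OF that], of "\<lambda>X. discrete_topology (Bij X)"] by simp
  qed auto
  have "\<Inter> (insert (G_hat G) (C ` I)) \<noteq> {}"
  proof (rule compact_space_fip[THEN iffD1, OF compact_Q, rule_format], intro conjI ballI allI impI)
    fix A assume "A \<in> insert (G_hat G) (C ` I)"
    then show "closedin (Q_top G) A" using cl by (auto simp: G_hat_eq)
  next
    fix \<F> assume \<F>: "finite \<F> \<and> \<F> \<subseteq> insert (G_hat G) (C ` I)"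
    then have "finite (\<F> - {G_hat G})" "\<F> - {G_hat G} \<subseteq> C ` I" by auto
    from finite_subset_image[OF this]
    obtain F where F: "finite F" "F \<subseteq> I" "\<F> - {G_hat G} = C ` F" by metis
    obtain g where g: "g \<in> G" "\<And>i. i \<in> F \<Longrightarrow> z (g i) = w i" using fin[OF F(1,2)] by blast
    have "embed g \<in> C i" if "i \<in> F" for i
    proof -
      have i: "i \<in> I" using that F by blast
      show ?thesis
        using embed_topspace[OF g(1)] psi_embed[OF g(1) i] g(2)[OF that] psi_apply[OF i, of "embed g"] orb_finite_orbits[OF i]
        by (auto simp: C_def topspace_Q)
    qed
    then have "embed g \<in> \<Inter> (insert (G_hat G) (\<F> - {G_hat G}))"
      using embed_G_hat[OF g(1)] unfolding F(3) by blast
    then show "\<Inter> \<F> \<noteq> {}" by auto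
  qed
  then obtain q where q: "q \<in> G_hat G" "\<And>i. i \<in> I \<Longrightarrow> q \<in> C i" by blast
  then have "z (psi G q i) = w i" if "i \<in> I" for i using that by (simp add: psi_apply C_def)
  then show ?thesis using q(1) by blast
qed

lemma inv_poly_separate:
  assumes "\<And>p. p \<in> inv_poly \<Longrightarrow> p z = p w"
  shows "\<exists>q\<in>G_hat G. \<forall>i\<in>I. psi_star G q z i = w i"
  using ex_G_hat_of_finite[of z w] inv_poly_separate_finite[of z w] assms by (simp add: psi_star_apply)

section \<open>Characters of the invariant polynomials\<close>

definition poly_ideal :: "((nat \<Rightarrow> complex) \<Rightarrow> complex) set \<Rightarrow> bool" where
  "poly_ideal M \<longleftrightarrow> M \<subseteq> poly_fun I \<and> (\<lambda>z. 0) \<in> M \<and> (\<forall>p\<in>M. \<forall>q\<in>M. (\<lambda>z. p z + q z) \<in> M) \<and>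
     (\<forall>r\<in>poly_fun I. \<forall>p\<in>M. (\<lambda>z. r z * p z) \<in> M)"

lemma poly_ideal_poly: "poly_ideal M \<Longrightarrow> p \<in> M \<Longrightarrow> p \<in> poly_fun I"
  unfolding poly_ideal_def by (drule conjunct1) (erule subsetD)

lemma poly_ideal_0: "poly_ideal M \<Longrightarrow> (\<lambda>z. 0) \<in> M"
  by (simp add: poly_ideal_def)

lemma poly_ideal_add: "poly_ideal M \<Longrightarrow> p \<in> M \<Longrightarrow> q \<in> M \<Longrightarrow> (\<lambda>z. p z + q z) \<in> M"
  by (simp add: poly_ideal_def)

lemma poly_ideal_mult: "poly_ideal M \<Longrightarrow> r \<in> poly_fun I \<Longrightarrow> p \<in> M \<Longrightarrow> (\<lambda>z. r z * p z) \<in> M"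
  by (simp add: poly_ideal_def)

lemma poly_ideal_diff: "poly_ideal M \<Longrightarrow> p \<in> M \<Longrightarrow> q \<in> M \<Longrightarrow> (\<lambda>z. p z - q z) \<in> M"
  using poly_ideal_add[OF _ _ poly_ideal_mult[OF _ poly_fun.const[of "- 1"]], of M p q] by simp

text \<open>
  Zorn's lemma, with maximality in the form that the quotient ring is a field.
\<close>

lemma maximal_ideal_exists:
  assumes J: "poly_ideal J" "(\<lambda>z. 1) \<notin> J"
  shows "\<exists>M. poly_ideal M \<and> J \<subseteq> M \<and> (\<lambda>z. 1) \<notin> M \<and>
    (\<forall>p\<in>poly_fun I. p \<notin> M \<longrightarrow> (\<exists>r\<in>poly_fun I. (\<lambda>z. p z * r z - 1) \<in> M))"
proof -
  let ?A = "{M. poly_ideal M \<and> J \<subseteq> M \<and> (\<lambda>z. 1) \<notin> M}"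
  have "\<exists>M\<in>?A. \<forall>X\<in>?A. M \<subseteq> X \<longrightarrow> X = M"
  proof (rule subset_Zorn_nonempty)
    show "?A \<noteq> {}" using J by blast
    fix \<C> assume ne: "\<C> \<noteq> {}" and ch: "subset.chain ?A \<C>"
    have sub: "M \<in> \<C> \<Longrightarrow> poly_ideal M \<and> J \<subseteq> M \<and> (\<lambda>z. 1) \<notin> M" for M
      using ch by (auto simp: subset.chain_def)
    have tot: "M \<in> \<C> \<Longrightarrow> N \<in> \<C> \<Longrightarrow> M \<subseteq> N \<or> N \<subseteq> M" for M N
      using ch by (auto simp: subset.chain_def)
    have "poly_ideal (\<Union>\<C>)"
      unfolding poly_ideal_def
    proof (intro conjI ballI)
      show "\<Union>\<C> \<subseteq> poly_fun I" using sub poly_ideal_poly by (meson Union_least subsetI)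
      show "(\<lambda>z. 0) \<in> \<Union>\<C>" using sub ne poly_ideal_0 by (meson Union_iff ex_in_conv)
      fix p assume p: "p \<in> \<Union>\<C>"
      show "(\<lambda>z. p z + q z) \<in> \<Union>\<C>" if q: "q \<in> \<Union>\<C>" for q
      proof -
        obtain M N where "M \<in> \<C>" "p \<in> M" "N \<in> \<C>" "q \<in> N" using p q by blast
        then obtain L where "L \<in> \<C>" "p \<in> L" "q \<in> L" using tot[of M N] by blast
        then show ?thesis using sub[of L] poly_ideal_add[of L p q] by (meson UnionI)
      qed
      show "(\<lambda>z. r z * p z) \<in> \<Union>\<C>" if "r \<in> poly_fun I" for r
        using p sub that poly_ideal_mult by (meson Union_iff)
    qed
    then show "\<Union>\<C> \<in> ?A" using sub ne by blast
  qed
  then obtain M where M0: "M \<in> ?A" and max0: "\<forall>X\<in>?A. M \<subseteq> X \<longrightarrow> X = M" by (rule bexE)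
  have M: "poly_ideal M" "J \<subseteq> M" "(\<lambda>z. 1) \<notin> M" using M0 by simp_all
  have max: "X = M" if "poly_ideal X" "(\<lambda>z. 1) \<notin> X" "M \<subseteq> X" for X
    using bspec[OF max0, of X] that M(2) by simp
  have "\<exists>r\<in>poly_fun I. (\<lambda>z. p z * r z - 1) \<in> M" if p: "p \<in> poly_fun I" "p \<notin> M" for p
  proof -
    let ?X = "{f. \<exists>m\<in>M. \<exists>r\<in>poly_fun I. f = (\<lambda>z. m z + p z * r z)}"
    have X: "poly_ideal ?X"
      unfolding poly_ideal_def
    proof (intro conjI ballI)
      show "?X \<subseteq> poly_fun I" using p(1) poly_ideal_poly[OF M(1)] by (auto intro!: poly_fun.add poly_fun.mult)
      show "(\<lambda>z. 0) \<in> ?X"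
        using poly_ideal_0[OF M(1)] poly_fun.const[of 0 I]
        by (intro CollectI bexI[of _ "\<lambda>z. 0"]) auto
      fix f assume "f \<in> ?X"
      then obtain m r where f: "m \<in> M" "r \<in> poly_fun I" "f = (\<lambda>z. m z + p z * r z)" by blast
      show "(\<lambda>z. f z + g z) \<in> ?X" if g: "g \<in> ?X" for g
      proof -
        obtain m' r' where g: "m' \<in> M" "r' \<in> poly_fun I" "g = (\<lambda>z. m' z + p z * r' z)" using g by blast
        have "(\<lambda>z. m z + m' z) \<in> M" by (rule poly_ideal_add[OF M(1) f(1) g(1)])
        moreover have "(\<lambda>z. r z + r' z) \<in> poly_fun I" using f g by (intro poly_fun.add)
        moreover have "(\<lambda>z. f z + g z) = (\<lambda>z. (m z + m' z) + p z * (r z + r' z))"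
          unfolding f g by (auto simp: algebra_simps)
        ultimately show ?thesis by (intro CollectI bexI[of _ "\<lambda>z. m z + m' z"] bexI[of _ "\<lambda>z. r z + r' z"])
      qed
      show "(\<lambda>z. s z * f z) \<in> ?X" if s: "s \<in> poly_fun I" for s
      proof -
        have "(\<lambda>z. s z * m z) \<in> M" by (rule poly_ideal_mult[OF M(1) s f(1)])
        moreover have "(\<lambda>z. s z * r z) \<in> poly_fun I" using f s by (intro poly_fun.mult)
        moreover have "(\<lambda>z. s z * f z) = (\<lambda>z. (s z * m z) + p z * (s z * r z))"
          unfolding f by (auto simp: algebra_simps)
        ultimately show ?thesis by (intro CollectI bexI[of _ "\<lambda>z. s z * m z"] bexI[of _ "\<lambda>z. s z * r z"])
      qed
    qed
    have MX: "M \<subseteq> ?X"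
    proof
      fix m assume "m \<in> M"
      then show "m \<in> ?X" using poly_fun.const[of 0 I] by (intro CollectI bexI[of _ m] bexI[of _ "\<lambda>z. 0"]) auto
    qed
    have "p \<in> ?X" using poly_fun.const[of 1 I] poly_ideal_0[OF M(1)]
      by (intro CollectI bexI[of _ "\<lambda>z. 0"] bexI[of _ "\<lambda>z. 1"]) auto
    with p(2) have "?X \<noteq> M" by metis
    with max[OF X _ MX] have "(\<lambda>z. 1) \<in> ?X" by metis
    then obtain m r where mr: "m \<in> M" "r \<in> poly_fun I" "(\<lambda>z. 1) = (\<lambda>z. m z + p z * r z)"
      by (elim CollectE bexE)
    have "(\<lambda>z. p z * r z - 1) = (\<lambda>z. 0 - m z)"
      using fun_cong[OF mr(3)] by (auto simp: algebra_simps)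
    moreover have "(\<lambda>z. 0 - m z) \<in> M"
      by (rule poly_ideal_diff[OF M(1) poly_ideal_0[OF M(1)] mr(1)])
    ultimately have "(\<lambda>z. p z * r z - 1) \<in> M" by (simp only:)
    then show ?thesis by (rule bexI[where x = r, OF _ mr(2)])
  qed
  with M show ?thesis by (intro exI[of _ M] conjI ballI impI)
qed

text \<open>
  The ideal of all polynomials generated by a set \<open>m\<close> of invariant polynomials, written so that induction exposes one generator
  at a time.
\<close>

inductive_set gen_ideal for m :: "((nat \<Rightarrow> complex) \<Rightarrow> complex) set" where
  zero: "(\<lambda>z. 0) \<in> gen_ideal m"
| step: "a \<in> m \<Longrightarrow> r \<in> poly_fun I \<Longrightarrow> p \<in> gen_ideal m \<Longrightarrow> (\<lambda>z. a z * r z + p z) \<in> gen_ideal m"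

lemma gen_ideal_ideal:
  assumes "m \<subseteq> inv_poly" shows "poly_ideal (gen_ideal m)"
  unfolding poly_ideal_def
proof (intro conjI ballI)
  show "gen_ideal m \<subseteq> poly_fun I"
  proof
    fix p assume "p \<in> gen_ideal m"
    then show "p \<in> poly_fun I"
      by induction (use assms inv_poly_poly in \<open>auto intro!: poly_fun.const poly_fun.add poly_fun.mult\<close>)
  qed
  show "(\<lambda>z. 0) \<in> gen_ideal m" by (rule gen_ideal.zero)
  fix p assume p: "p \<in> gen_ideal m"
  show "(\<lambda>z. p z + q z) \<in> gen_ideal m" if "q \<in> gen_ideal m" for q
    using p
  proof induction
    case (step a r p)
    then show ?case using gen_ideal.step[of a m r "\<lambda>z. p z + q z"] by (simp add: add.assoc)
  qed (use that in simp)
  show "(\<lambda>z. s z * p z) \<in> gen_ideal m" if "s \<in> poly_fun I" for s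
    using p
  proof induction
    case (step a r p)
    then have "(\<lambda>z. a z * (s z * r z) + s z * p z) \<in> gen_ideal m"
      using that by (intro gen_ideal.step poly_fun.mult)
    then show ?case by (simp add: algebra_simps)
  qed (simp add: gen_ideal.zero)
qed

text \<open>
  An algebra homomorphism from the invariant polynomials to the complex numbers.
\<close>

definition poly_char :: "(((nat \<Rightarrow> complex) \<Rightarrow> complex) \<Rightarrow> complex) \<Rightarrow> bool" where
  "poly_char \<phi> \<longleftrightarrow> (\<forall>p\<in>inv_poly. \<forall>q\<in>inv_poly. \<phi> (\<lambda>z. p z + q z) = \<phi> p + \<phi> q) \<and>
     (\<forall>p\<in>inv_poly. \<forall>q\<in>inv_poly. \<phi> (\<lambda>z. p z * q z) = \<phi> p * \<phi> q) \<and> (\<forall>c. \<phi> (\<lambda>z. c) = c)"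

lemma poly_char_add: "poly_char \<phi> \<Longrightarrow> p \<in> inv_poly \<Longrightarrow> q \<in> inv_poly \<Longrightarrow> \<phi> (\<lambda>z. p z + q z) = \<phi> p + \<phi> q"
  by (simp add: poly_char_def)

lemma poly_char_mult: "poly_char \<phi> \<Longrightarrow> p \<in> inv_poly \<Longrightarrow> q \<in> inv_poly \<Longrightarrow> \<phi> (\<lambda>z. p z * q z) = \<phi> p * \<phi> q"
  by (simp add: poly_char_def)

lemma poly_char_const: "poly_char \<phi> \<Longrightarrow> \<phi> (\<lambda>z. c) = c"
  by (simp add: poly_char_def)

lemma inv_poly_diff_const: "p \<in> inv_poly \<Longrightarrow> (\<lambda>z. c - p z) \<in> inv_poly"
  using inv_poly_add[OF inv_poly_const[of c] inv_poly_mult[OF inv_poly_const[of "-1"]], of p] by simp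

lemma poly_char_diff_const:
  assumes "poly_char \<phi>" "p \<in> inv_poly" shows "\<phi> (\<lambda>z. c - p z) = c - \<phi> p"
proof -
  have *: "(\<lambda>z. (- 1) * p z) \<in> inv_poly" by (rule inv_poly_mult[OF inv_poly_const assms(2)])
  have "\<phi> (\<lambda>z. c + (- 1) * p z) = c + (- 1) * \<phi> p"
    by (simp only: poly_char_add[OF assms(1) inv_poly_const *] poly_char_const[OF assms(1)]
          poly_char_mult[OF assms(1) inv_poly_const assms(2)])
  then show ?thesis by simp
qed

text \<open>
  Averaging is linear over the invariant polynomials, so it maps the ideal generated by the kernel of \<open>\<phi>\<close> into the kernel. The
  transversal must be taken over a set \<open>F\<close> that contains all coordinates of the element in question.
\<close>

lemma average_gen_ideal:
  assumes \<phi>: "poly_char \<phi>" and "p \<in> gen_ideal {a \<in> inv_poly. \<phi> a = 0}"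
  shows "\<exists>F. finite F \<and> F \<subseteq> I \<and> (\<forall>\<Gamma>. transversal F \<Gamma> \<longrightarrow> average \<Gamma> p \<in> inv_poly \<and> \<phi> (average \<Gamma> p) = 0)"
  using assms(2)
proof induction
  case zero
  have "average \<Gamma> (\<lambda>z. 0) = (\<lambda>z. 0)" for \<Gamma> by (auto simp: average_def)
  then show ?case using poly_char_const[OF \<phi>, of 0] inv_poly_const[of 0] by (intro exI[of _ "{}"]) simp
next
  case (step a r p)
  then obtain F where F: "finite F" "F \<subseteq> I" "\<And>\<Gamma>. transversal F \<Gamma> \<Longrightarrow> average \<Gamma> p \<in> inv_poly \<and> \<phi> (average \<Gamma> p) = 0"
    by blast
  obtain F' where F': "finite F'" "F' \<subseteq> I" "r \<in> poly_fun F'"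
    using poly_fun_finite_support[OF step.hyps(2)] by blast
  have a: "a \<in> inv_poly" "\<phi> a = 0" using step.hyps by auto
  have "average \<Gamma> (\<lambda>z. a z * r z + p z) \<in> inv_poly \<and> \<phi> (average \<Gamma> (\<lambda>z. a z * r z + p z)) = 0"
    if \<Gamma>: "transversal (F \<union> F') \<Gamma>" for \<Gamma>
  proof -
    have r: "average \<Gamma> r \<in> inv_poly"
      using average_inv_poly[OF transversal_mono[OF \<Gamma>] F'(2,3)] by blast
    have p: "average \<Gamma> p \<in> inv_poly" "\<phi> (average \<Gamma> p) = 0"
      using F(3)[OF transversal_mono[OF \<Gamma>]] by auto
    have "average \<Gamma> (\<lambda>z. a z * r z + p z) z = a z * average \<Gamma> r z + average \<Gamma> p z" for z
    proof -
      have "(\<Sum>\<gamma>\<in>\<Gamma>. a (act \<gamma> z) * r (act \<gamma> z)) = (\<Sum>\<gamma>\<in>\<Gamma>. a z * r (act \<gamma> z))"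
        using \<Gamma> inv_poly_inv[OF a(1)] unfolding transversal_def by (intro sum.cong) auto
      then show ?thesis by (simp add: average_def sum.distrib sum_distrib_left add_divide_distrib)
    qed
    then have eq: "average \<Gamma> (\<lambda>z. a z * r z + p z) = (\<lambda>z. (a z * average \<Gamma> r z) + average \<Gamma> p z)" by auto
    have ar: "(\<lambda>z. a z * average \<Gamma> r z) \<in> inv_poly" by (rule inv_poly_mult[OF a(1) r])
    have "\<phi> (average \<Gamma> (\<lambda>z. a z * r z + p z)) = \<phi> a * \<phi> (average \<Gamma> r) + \<phi> (average \<Gamma> p)"
      unfolding eq by (simp only: poly_char_add[OF \<phi> ar p(1)] poly_char_mult[OF \<phi> a(1) r])
    then show ?thesis unfolding eq using inv_poly_add[OF ar p(1)] a(2) p(2) by simp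
  qed
  then show ?case using F F' by (intro exI[of _ "F \<union> F'"]) auto
qed

text \<open>
  The average of 1 is 1, on which \<open>\<phi>\<close> does not vanish.
\<close>

lemma gen_ideal_proper:
  assumes \<phi>: "poly_char \<phi>" shows "(\<lambda>z. 1) \<notin> gen_ideal {a \<in> inv_poly. \<phi> a = 0}"
proof
  assume "(\<lambda>z. 1) \<in> gen_ideal {a \<in> inv_poly. \<phi> a = 0}"
  from average_gen_ideal[OF \<phi> this] obtain F where F: "finite F" "F \<subseteq> I"
    "\<And>\<Gamma>. transversal F \<Gamma> \<Longrightarrow> \<phi> (average \<Gamma> (\<lambda>z. 1)) = 0" by blast
  obtain \<Gamma> where \<Gamma>: "transversal F \<Gamma>" using ex_transversal[OF F(1,2)] by blast
  have "average \<Gamma> (\<lambda>z. 1) = (\<lambda>z. 1)" using transversal_card[OF \<Gamma>] by (auto simp: average_def)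
  then show False using F(3)[OF \<Gamma>] poly_char_const[OF \<phi>, of 1] by simp
qed

text \<open>
  Let \<open>M\<close> be a maximal ideal of the polynomial ring that contains the kernel of \<open>\<phi>\<close>. Every polynomial is a root of its orbit
  polynomial, whose coefficients are congruent to constants modulo \<open>M\<close>; the complex numbers being algebraically closed and \<open>M\<close>
  being prime, every polynomial is congruent to a constant modulo \<open>M\<close>. The constants belonging to the coordinates form the point
  \<open>\<zeta>\<close>.
\<close>

lemma lying_over:
  assumes \<phi>: "poly_char \<phi>"
  obtains \<zeta> where "\<And>p. p \<in> inv_poly \<Longrightarrow> \<phi> p = p \<zeta>"
proof -
  let ?m = "{a \<in> inv_poly. \<phi> a = 0}"
  have "poly_ideal (gen_ideal ?m)" by (rule gen_ideal_ideal) auto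
  from maximal_ideal_exists[OF this gen_ideal_proper[OF \<phi>]] obtain M where
    M: "poly_ideal M" and JM: "gen_ideal ?m \<subseteq> M" and M1: "(\<lambda>z. 1) \<notin> M" and
    max: "\<forall>p\<in>poly_fun I. p \<notin> M \<longrightarrow> (\<exists>r\<in>poly_fun I. (\<lambda>z. p z * r z - 1) \<in> M)"
    by (elim exE conjE)
  have Mmult: "(\<lambda>z. r z * p z) \<in> M" if "r \<in> poly_fun I" "p \<in> M" for r p
    by (rule poly_ideal_mult[OF M that])
  have Madd: "(\<lambda>z. p z + q z) \<in> M" if "p \<in> M" "q \<in> M" for p q
    by (rule poly_ideal_add[OF M that])
  have M0: "(\<lambda>z. 0) \<in> M" by (rule poly_ideal_0[OF M])
  have Mconst: "c = 0" if "(\<lambda>z. c) \<in> M" for c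
    using Mmult[OF poly_fun.const[of "1 / c"] that] M1 by (cases "c = 0") auto
  have prime: "q \<in> M" if pq: "(\<lambda>z. p z * q z) \<in> M" and p: "p \<in> poly_fun I" "p \<notin> M" and q: "q \<in> poly_fun I" for p q
  proof -
    obtain r where r: "r \<in> poly_fun I" "(\<lambda>z. p z * r z - 1) \<in> M" using mp[OF bspec[OF max p(1)] p(2)] by (rule bexE)
    have "(\<lambda>z. r z * (p z * q z) - q z * (p z * r z - 1)) \<in> M"
      by (rule poly_ideal_diff[OF M Mmult[OF r(1) pq] Mmult[OF q r(2)]])
    then show ?thesis by (simp add: algebra_simps)
  qed
  have mM: "a \<in> M" if "a \<in> inv_poly" "\<phi> a = 0" for a
    using gen_ideal.step[OF _ poly_fun.const[of 1 I] gen_ideal.zero, of a ?m] that subsetD[OF JM] by simp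
  have comp: "(\<lambda>z. poly q (r z)) \<in> poly_fun I" if "r \<in> poly_fun I" for q r
    unfolding poly_altdef by (intro poly_fun_sum poly_fun_scale poly_fun_power that)
  \<comment> \<open>an element that is algebraic over the complex numbers modulo \<open>M\<close> is a constant modulo \<open>M\<close>: split off linear factors\<close>
  have root: "\<exists>c. (\<lambda>z. r z - c) \<in> M" if r: "r \<in> poly_fun I" and q: "q \<noteq> 0" "(\<lambda>z. poly q (r z)) \<in> M" for r q
    using q
  proof (induction "degree q" arbitrary: q)
    case 0
    then obtain c where "q = [:c:]" using degree_eq_zeroE[of q] by metis
    then show ?case using 0 Mconst[of c] by auto
  next
    case (Suc n)
    then have "\<not> constant (poly q)" by (simp add: constant_degree)
    then obtain c where "poly q c = 0" using fundamental_theorem_of_algebra by blast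
    then obtain q' where q': "q = [:- c, 1:] * q'" by (auto simp: poly_eq_0_iff_dvd)
    show ?case
    proof (cases "(\<lambda>z. r z - c) \<in> M")
      case False
      have "(\<lambda>z. (r z - c) * poly q' (r z)) \<in> M" using Suc.prems(2) q' by (simp add: algebra_simps)
      then have "(\<lambda>z. poly q' (r z)) \<in> M"
        by (rule prime[OF _ poly_fun_diff[OF r poly_fun.const] False comp[OF r]])
      moreover have "q' \<noteq> 0" using q' Suc.prems by auto
      moreover from this have "degree q = 1 + degree q'" unfolding q' by (subst degree_mult_eq) auto
      then have "degree q' = n" using Suc.hyps(2) by simp
      ultimately show ?thesis using Suc.hyps(1)[of q'] by blast
    qed blast
  qed
  have eval: "\<exists>c. (\<lambda>z. r z - c) \<in> M" if r: "r \<in> poly_fun I" for r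
  proof -
    obtain F where F: "finite F" "F \<subseteq> I" "r \<in> poly_fun F" using poly_fun_finite_support[OF r] by blast
    obtain \<Gamma> where \<Gamma>: "transversal F \<Gamma>" using ex_transversal[OF F(1,2)] by blast
    then have fin: "finite \<Gamma>" unfolding transversal_def by blast
    obtain e where e: "e \<in> \<Gamma>" "\<And>i. i \<in> F \<Longrightarrow> e i = i" using \<Gamma> unfolding transversal_def by blast
    let ?n = "card \<Gamma>"
    define E where "E k = (\<lambda>z. coeff (orbit_poly \<Gamma> r z) k)" for k
    have E: "E k \<in> inv_poly" for k unfolding E_def by (rule coeff_orbit_poly_inv[OF \<Gamma> F(2,3)])
    have zero: "(\<Sum>k\<le>?n. E k z * r z ^ k) = 0" for z
    proof -
      have "r (act e z) = r z" by (rule poly_fun_cong[OF F(3)]) (use e F in auto)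
      then have "poly (orbit_poly \<Gamma> r z) (r z) = 0"
        using poly_orbit_poly[OF fin] e(1) fin by (auto simp: prod_zero_iff intro!: bexI[of _ e])
      then show ?thesis using degree_orbit_poly[OF fin, of r z] by (simp add: poly_altdef E_def)
    qed
    \<comment> \<open>the orbit polynomial with its coefficients replaced by the constants to which they are congruent modulo \<open>M\<close>\<close>
    define q where "q = (\<Sum>k\<le>?n. monom (\<phi> (E k)) k)"
    have "E ?n = (\<lambda>z. 1)" using degree_orbit_poly[OF fin] by (simp add: E_def)
    then have "\<phi> (E ?n) = 1" using poly_char_const[OF \<phi>, of 1] by simp
    then have "coeff q ?n = 1" by (simp add: q_def coeff_sum sum.delta)
    then have "q \<noteq> 0" by auto
    moreover have "(\<lambda>z. poly q (r z)) \<in> M"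
    proof -
      have t: "(\<lambda>z. r z ^ k * (\<phi> (E k) - E k z)) \<in> M" for k
        by (rule Mmult[OF poly_fun_power[OF r] mM])
           (simp_all add: inv_poly_diff_const[OF E] poly_char_diff_const[OF \<phi> E])
      have "(\<lambda>z. \<Sum>k\<in>K. r z ^ k * (\<phi> (E k) - E k z)) \<in> M" if "finite K" for K
        using that
      proof induction
        case (insert k K)
        then show ?case using Madd[OF t insert.IH, of k] by simp
      qed (simp add: M0)
      moreover have "poly q (r z) = (\<Sum>k\<le>?n. r z ^ k * (\<phi> (E k) - E k z))" for z
        using zero[of z] by (simp add: q_def poly_sum poly_monom right_diff_distrib sum_subtractf mult.commute)
      ultimately show ?thesis by simp
    qed
    ultimately show ?thesis by (rule root[OF r])
  qed
  define \<zeta> where "\<zeta> i = (SOME c. (\<lambda>z. z i - c) \<in> M)" for i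
  have \<zeta>: "(\<lambda>z. z i - \<zeta> i) \<in> M" if "i \<in> I" for i
    unfolding \<zeta>_def by (rule someI_ex[OF eval[OF poly_fun.coord[OF that]]])
  have ev: "(\<lambda>z. p z - p \<zeta>) \<in> M" if "p \<in> poly_fun I" for p
    using that
  proof induction
    case (add p q)
    then have "(\<lambda>z. (p z - p \<zeta>) + (q z - q \<zeta>)) \<in> M" by (intro Madd)
    then show ?case by (simp add: algebra_simps)
  next
    case (mult p q)
    have "(\<lambda>z. q z * (p z - p \<zeta>) + p \<zeta> * (q z - q \<zeta>)) \<in> M"
      by (intro Madd Mmult poly_fun.const mult)
    then show ?case by (simp add: algebra_simps)
  qed (use \<zeta> M0 in auto)
  have "\<phi> p = p \<zeta>" if p: "p \<in> inv_poly" for p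
  proof -
    have "(\<lambda>z. \<phi> p - p z) \<in> M"
      by (rule mM) (simp_all add: inv_poly_diff_const[OF p] poly_char_diff_const[OF \<phi> p])
    from Madd[OF this ev[OF inv_poly_poly[OF p]]] have "(\<lambda>z. \<phi> p - p \<zeta>) \<in> M" by simp
    then show ?thesis using Mconst[of "\<phi> p - p \<zeta>"] by simp
  qed
  then show thesis by (rule that)
qed

end

section \<open>Limits of invariant polynomials on the polydisc\<close>

lemma continuous_map_euclidean_iff:
  "continuous_map X euclidean f \<longleftrightarrow> (\<forall>x\<in>topspace X. (f \<longlongrightarrow> f x) (atin X x))"
  by (simp add: continuous_map_atin limitin_canonical_iff)

lemma topspace_closed_polydisc: "topspace (closed_polydisc I) = (\<Pi>\<^sub>E i\<in>I. cball 0 1)"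
  by (simp add: closed_polydisc_def)

lemma closed_polydisc_norm_le: "z \<in> topspace (closed_polydisc I) \<Longrightarrow> i \<in> I \<Longrightarrow> norm (z i) \<le> 1"
  by (auto simp: topspace_closed_polydisc PiE_iff)

lemma closed_polydiscI: "z \<in> extensional I \<Longrightarrow> (\<And>i. i \<in> I \<Longrightarrow> norm (z i) \<le> 1) \<Longrightarrow> z \<in> topspace (closed_polydisc I)"
  by (auto simp: topspace_closed_polydisc PiE_iff)

lemma compact_closed_polydisc: "compact_space (closed_polydisc I)"
  unfolding closed_polydisc_def
  by (rule compact_space_product_topology[THEN iffD2], intro disjI2 ballI)
     (simp add: compact_space_subtopology compactin_euclidean_iff)

lemma continuous_map_coord:
  assumes "i \<in> I" shows "continuous_map (closed_polydisc I) euclidean (\<lambda>z. z i)"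
  unfolding closed_polydisc_def
  using continuous_map_product_projection[OF assms, of "\<lambda>_. top_of_set (cball 0 1 :: complex set)"]
  by (simp add: continuous_map_in_subtopology)

lemma continuous_map_poly_fun:
  assumes "p \<in> poly_fun I" shows "continuous_map (closed_polydisc I) euclidean p"
  using assms
proof induction
  case (coord i)
  then show ?case by (rule continuous_map_coord)
qed (auto simp: continuous_map_euclidean_iff intro!: tendsto_add tendsto_mult)

lemma continuous_map_approx:
  fixes h :: "'a \<Rightarrow> complex"
  assumes "\<And>e. e > 0 \<Longrightarrow> \<exists>k. continuous_map X euclidean k \<and> (\<forall>x\<in>topspace X. norm (h x - k x) \<le> e)"
  shows "continuous_map X euclidean h"
proof -
  have "\<forall>n. \<exists>k. continuous_map X euclidean k \<and> (\<forall>x\<in>topspace X. norm (h x - k x) \<le> inverse (real (Suc n)))"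
    using assms by simp
  then obtain k where k: "\<And>n. continuous_map X euclidean (k n)"
    "\<And>n x. x \<in> topspace X \<Longrightarrow> norm (h x - k n x) \<le> inverse (real (Suc n))" by metis
  have "continuous_map X Met_TC.mtopology h"
  proof (rule Met_TC.continuous_map_uniform_limit_alt[where f = k and F = sequentially])
    show "\<forall>\<^sub>F n in sequentially. continuous_map X Met_TC.mtopology (k n)" using k(1) by simp
    fix e :: real assume "e > 0"
    then have "\<forall>\<^sub>F n in sequentially. inverse (real (Suc n)) < e"
      using LIMSEQ_inverse_real_of_nat order_tendstoD(2) by blast
    then show "\<forall>\<^sub>F n in sequentially. \<forall>x\<in>topspace X. dist (k n x) (h x) < e"
    proof eventually_elim
      case (elim n)
      then show ?case using k(2)[of _ n] by (metis dist_commute dist_norm order_le_less_trans)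
    qed
  qed auto
  then show ?thesis by simp
qed

text \<open>
  The Cesaro means of the powers of \<open>w\<close> in the closed unit disc detect whether \<open>w = 1\<close>.
\<close>

lemma cesaro_power_tendsto:
  fixes w :: complex assumes "norm w \<le> 1"
  shows "(\<lambda>L. (\<Sum>l<L. w ^ l) / of_nat L) \<longlonglongrightarrow> (if w = 1 then 1 else 0)"
proof (cases "w = 1")
  case True
  have "\<forall>\<^sub>F L in sequentially. (\<Sum>l<L. w ^ l) / of_nat L = 1"
    using eventually_gt_at_top[of 0] by eventually_elim (simp add: True)
  then show ?thesis using True by (simp add: tendsto_eventually)
next
  case False
  have "(\<lambda>L. 2 / norm (1 - w) * inverse (real L)) \<longlonglongrightarrow> 0"
    using tendsto_mult[OF tendsto_const lim_inverse_n, of "2 / norm (1 - w)"] by simp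
  then have "(\<lambda>L. (\<Sum>l<L. w ^ l) / of_nat L) \<longlonglongrightarrow> 0"
  proof (rule Lim_null_comparison[rotated])
    show "\<forall>\<^sub>F L in sequentially. norm ((\<Sum>l<L. w ^ l) / of_nat L) \<le> 2 / norm (1 - w) * inverse (real L)"
    proof (rule always_eventually, rule allI)
      fix L
      have "norm (1 - w ^ L) \<le> norm (1 :: complex) + norm (w ^ L)" by (rule norm_triangle_ineq4)
      also have "\<dots> \<le> 2" using assms by (simp add: norm_power power_le_one)
      finally have le: "norm ((1 - w ^ L) / (1 - w)) \<le> 2 / norm (1 - w)"
        by (simp add: norm_divide divide_right_mono)
      have "norm ((\<Sum>l<L. w ^ l) / of_nat L) \<le> (2 / norm (1 - w)) / real L"
      proof -
        have "(\<Sum>l<L. w ^ l) = (1 - w ^ L) / (1 - w)" using False by (simp add: sum_gp_strict)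
        then have "norm ((\<Sum>l<L. w ^ l) / of_nat L) = norm ((1 - w ^ L) / (1 - w)) / real L"
          by (simp only: norm_divide norm_of_nat)
        then show ?thesis using divide_right_mono[OF le, of "real L"] by simp
      qed
      then show "norm ((\<Sum>l<L. w ^ l) / of_nat L) \<le> 2 / norm (1 - w) * inverse (real L)"
        by (simp add: divide_inverse)
    qed
  qed
  then show ?thesis using False by simp
qed

text \<open>
  The argument is the same for both norms. A norm is given by the relation \<open>bd h r\<close>, meaning that \<open>h\<close> has finite norm at most
  \<open>r\<close> on the closed polydisc, so that no norm has to be assigned to other functions. The assumption
  \<open>bd_resolvent\<close> expresses completeness as far as it is used: the geometric series of \<open>h\<close> converges.
\<close>

locale polydisc_norm = perm_action G for G +
  fixes bd :: "((nat \<Rightarrow> complex) \<Rightarrow> complex) \<Rightarrow> real \<Rightarrow> bool"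
  assumes bd_cong: "(\<And>z. z \<in> topspace (closed_polydisc (fin_orb_union G)) \<Longrightarrow> h z = k z) \<Longrightarrow> bd h r \<Longrightarrow> bd k r"
    and bd_const: "bd (\<lambda>z. c) (norm c)"
    and bd_coord: "i \<in> fin_orb_union G \<Longrightarrow> bd (\<lambda>z. z i) 1"
    and bd_add: "bd h r \<Longrightarrow> bd k s \<Longrightarrow> bd (\<lambda>z. h z + k z) (r + s)"
    and bd_mult: "bd h r \<Longrightarrow> bd k s \<Longrightarrow> bd (\<lambda>z. h z * k z) (r * s)"
    and bd_norm_le: "bd h r \<Longrightarrow> z \<in> topspace (closed_polydisc (fin_orb_union G)) \<Longrightarrow> norm (h z) \<le> r"
    and bd_act: "g \<in> G \<Longrightarrow> bd h r \<Longrightarrow> bd (\<lambda>z. h (act g z)) r"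
    and bd_resolvent: "bd h r \<Longrightarrow> r < 1 \<Longrightarrow> \<exists>s. bd (\<lambda>z. h z / (1 - h z)) s"
    and bd_mono: "bd h r \<Longrightarrow> r \<le> s \<Longrightarrow> bd h s"
begin

abbreviation D where "D \<equiv> topspace (closed_polydisc I)"

definition approx :: "((nat \<Rightarrow> complex) \<Rightarrow> complex) set" where
  "approx = {h. \<forall>e>0. \<exists>p\<in>poly_fun I. bd (\<lambda>z. h z - p z) e}"

text \<open>
  The abstract algebra behind the four concrete ones: limits of polynomials that are invariant on the closed polydisc.
\<close>

definition inv_approx :: "((nat \<Rightarrow> complex) \<Rightarrow> complex) set" where
  "inv_approx = {h \<in> approx. \<forall>g\<in>G. \<forall>z\<in>D. h (act g z) = h z}"

lemma zero_D: "(\<lambda>i\<in>I. 0) \<in> D"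
  by (rule closed_polydiscI) auto

lemma act_D: "z \<in> D \<Longrightarrow> g \<in> G \<Longrightarrow> act g z \<in> D"
  using closed_polydisc_norm_le[of z I] G_I by (intro closed_polydiscI) (auto simp: act_def)

lemma psi_star_D: "z \<in> D \<Longrightarrow> q \<in> G_hat G \<Longrightarrow> psi_star G q z \<in> D"
  using closed_polydisc_norm_le[of z I] psi_I
  by (intro closed_polydiscI) (auto simp: psi_star_apply, simp add: psi_star_def)

lemma bd_nonneg: "bd h r \<Longrightarrow> 0 \<le> r"
  using bd_norm_le[OF _ zero_D] norm_ge_zero order_trans by blast

lemma bd_scale: "bd h r \<Longrightarrow> bd (\<lambda>z. c * h z) (norm c * r)"
  by (rule bd_mult[OF bd_const])

lemma bd_power: "bd h r \<Longrightarrow> bd (\<lambda>z. h z ^ k) (r ^ k)"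
  using bd_const[of 1] by (induction k) (auto intro: bd_mult)

lemma bd_sum:
  assumes "finite J" "\<And>j. j \<in> J \<Longrightarrow> bd (h j) (r j)" shows "bd (\<lambda>z. \<Sum>j\<in>J. h j z) (\<Sum>j\<in>J. r j)"
  using assms bd_const[of 0] by (induction J) (auto intro: bd_add)

lemma bd_poly: "p \<in> poly_fun I \<Longrightarrow> \<exists>r. bd p r"
proof (induction rule: poly_fun.induct)
  case (const c) show ?case using bd_const by blast
next
  case (coord i) then show ?case using bd_coord by blast
next
  case (add p q) then show ?case using bd_add by metis
next
  case (mult p q) then show ?case using bd_mult by metis
qed

lemma approxI: "(\<And>e. e > 0 \<Longrightarrow> \<exists>p\<in>poly_fun I. bd (\<lambda>z. h z - p z) e) \<Longrightarrow> h \<in> approx"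
  by (simp add: approx_def)

lemma approxD: "h \<in> approx \<Longrightarrow> e > 0 \<Longrightarrow> \<exists>p\<in>poly_fun I. bd (\<lambda>z. h z - p z) e"
  by (simp add: approx_def)

lemma poly_approx: assumes "p \<in> poly_fun I" shows "p \<in> approx"
proof (rule approxI)
  fix e :: real assume "e > 0"
  then have "bd (\<lambda>z. p z - p z) e" using bd_mono[OF bd_const[of 0]] by simp
  then show "\<exists>q\<in>poly_fun I. bd (\<lambda>z. p z - q z) e" by (rule bexI[where x = p]) (rule assms)
qed

lemma approx_bd: assumes "h \<in> approx" shows "\<exists>r. bd h r"
proof -
  obtain p where p: "p \<in> poly_fun I" "bd (\<lambda>z. h z - p z) 1" by (rule bexE[OF approxD[OF assms zero_less_one]])
  obtain r where "bd p r" using bd_poly[OF p(1)] by blast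
  from bd_add[OF p(2) this] show ?thesis by auto
qed

lemma approx_closed:
  assumes "\<And>e. e > 0 \<Longrightarrow> \<exists>k\<in>approx. bd (\<lambda>z. h z - k z) e" shows "h \<in> approx"
proof (rule approxI)
  fix e :: real assume e: "e > 0"
  obtain k where k: "k \<in> approx" "bd (\<lambda>z. h z - k z) (e / 2)" by (rule bexE[OF assms[OF half_gt_zero[OF e]]])
  obtain p where p: "p \<in> poly_fun I" "bd (\<lambda>z. k z - p z) (e / 2)" by (rule bexE[OF approxD[OF k(1) half_gt_zero[OF e]]])
  have "bd (\<lambda>z. h z - p z) e" using bd_add[OF k(2) p(2)] by simp
  then show "\<exists>p\<in>poly_fun I. bd (\<lambda>z. h z - p z) e" by (rule bexI[where x = p]) (rule p(1))
qed

lemma approx_add: assumes "h \<in> approx" "k \<in> approx" shows "(\<lambda>z. h z + k z) \<in> approx"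
proof (rule approxI)
  fix e :: real assume e: "e > 0"
  obtain p where p: "p \<in> poly_fun I" "bd (\<lambda>z. h z - p z) (e / 2)" by (rule bexE[OF approxD[OF assms(1) half_gt_zero[OF e]]])
  obtain q where q: "q \<in> poly_fun I" "bd (\<lambda>z. k z - q z) (e / 2)" by (rule bexE[OF approxD[OF assms(2) half_gt_zero[OF e]]])
  have "bd (\<lambda>z. (h z + k z) - (p z + q z)) e" using bd_add[OF p(2) q(2)] by (simp add: algebra_simps)
  then show "\<exists>p\<in>poly_fun I. bd (\<lambda>z. h z + k z - p z) e"
    by (rule bexI[where x = "\<lambda>z. p z + q z"]) (rule poly_fun.add[OF p(1) q(1)])
qed

lemma approx_mult: assumes "h \<in> approx" "k \<in> approx" shows "(\<lambda>z. h z * k z) \<in> approx"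
proof (rule approxI)
  fix e :: real assume e: "e > 0"
  obtain R where R: "bd k R" using approx_bd[OF assms(2)] by blast
  note R0 = bd_nonneg[OF R]
  have "e / 2 / (R + 1) > 0" using e R0 by simp
  then obtain p where p: "p \<in> poly_fun I" "bd (\<lambda>z. h z - p z) (e / 2 / (R + 1))"
    by (rule bexE[OF approxD[OF assms(1)]])
  obtain P where P: "bd p P" using bd_poly[OF p(1)] by blast
  note P0 = bd_nonneg[OF P]
  have "e / 2 / (P + 1) > 0" using e P0 by simp
  then obtain q where q: "q \<in> poly_fun I" "bd (\<lambda>z. k z - q z) (e / 2 / (P + 1))"
    by (rule bexE[OF approxD[OF assms(2)]])
  have "e / 2 / (R + 1) * R \<le> e / 2" "P * (e / 2 / (P + 1)) \<le> e / 2"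
    using e R0 P0 by (auto simp: field_simps)
  then have "e / 2 / (R + 1) * R + P * (e / 2 / (P + 1)) \<le> e" by linarith
  from bd_mono[OF bd_add[OF bd_mult[OF p(2) R] bd_mult[OF P q(2)]] this]
  have "bd (\<lambda>z. (h z * k z) - (p z * q z)) e" by (simp add: algebra_simps)
  then show "\<exists>p\<in>poly_fun I. bd (\<lambda>z. h z * k z - p z) e"
    by (rule bexI[where x = "\<lambda>z. p z * q z"]) (rule poly_fun.mult[OF p(1) q(1)])
qed

lemma approx_const: "(\<lambda>z. c) \<in> approx"
  by (rule poly_approx[OF poly_fun.const])

lemma approx_sum: "(\<And>j. j \<in> J \<Longrightarrow> h j \<in> approx) \<Longrightarrow> (\<lambda>z. \<Sum>j\<in>J. h j z) \<in> approx"
  by (induction J rule: infinite_finite_induct) (auto intro: approx_const approx_add)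

lemma approx_power: "h \<in> approx \<Longrightarrow> (\<lambda>z. h z ^ k) \<in> approx"
  by (induction k) (auto intro: approx_const approx_mult)

lemma approx_resolvent:
  assumes h: "h \<in> approx" "bd h r" "r < 1" shows "(\<lambda>z. h z / (1 - h z)) \<in> approx"
proof -
  obtain s where s: "bd (\<lambda>z. h z / (1 - h z)) s" using bd_resolvent[OF h(2,3)] by blast
  note r0 = bd_nonneg[OF h(2)] and s0 = bd_nonneg[OF s]
  show ?thesis
  proof (rule approx_closed)
    fix e :: real assume e: "e > 0"
    have "(\<lambda>J. r ^ J * s) \<longlonglongrightarrow> 0 * s" by (intro tendsto_intros LIMSEQ_realpow_zero r0 h(3))
    then have "\<forall>\<^sub>F J in sequentially. r ^ J * s < e" using e by (intro order_tendstoD) auto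
    then obtain J where J: "r ^ J * s < e" by (auto simp: eventually_sequentially)
    have "bd (\<lambda>z. h z / (1 - h z) - (\<Sum>j<J. h z * h z ^ j)) (r ^ J * s)"
    proof (rule bd_cong[OF _ bd_mult[OF bd_power[OF h(2)] s]])
      fix z assume "z \<in> D"
      then have "norm (h z) < 1" using bd_norm_le[OF h(2)] h(3) by fastforce
      then have n: "1 - h z \<noteq> 0" by auto
      have "(\<Sum>j<J. h z * h z ^ j) = h z * ((1 - h z ^ J) / (1 - h z))"
        using n by (simp add: sum_distrib_left[symmetric] sum_gp_strict)
      then show "h z ^ J * (h z / (1 - h z)) = h z / (1 - h z) - (\<Sum>j<J. h z * h z ^ j)"
        using n by (simp add: field_simps)
    qed
    then have "bd (\<lambda>z. h z / (1 - h z) - (\<Sum>j<J. h z * h z ^ j)) e" by (rule bd_mono) (use J in simp)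
    moreover have "(\<lambda>z. \<Sum>j<J. h z * h z ^ j) \<in> approx"
      by (intro approx_sum approx_mult[OF h(1) approx_power[OF h(1)]])
    ultimately show "\<exists>k\<in>approx. bd (\<lambda>z. h z / (1 - h z) - k z) e"
      by (rule bexI[where x = "\<lambda>z. \<Sum>j<J. h z * h z ^ j"])
  qed
qed

lemma inv_approx_approx: "h \<in> inv_approx \<Longrightarrow> h \<in> approx" by (simp add: inv_approx_def)

lemma inv_approx_inv: "h \<in> inv_approx \<Longrightarrow> g \<in> G \<Longrightarrow> z \<in> D \<Longrightarrow> h (act g z) = h z" by (simp add: inv_approx_def)

lemma inv_approx_add: "h \<in> inv_approx \<Longrightarrow> k \<in> inv_approx \<Longrightarrow> (\<lambda>z. h z + k z) \<in> inv_approx"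
  using approx_add[of h k] by (simp add: inv_approx_def)

lemma inv_approx_mult: "h \<in> inv_approx \<Longrightarrow> k \<in> inv_approx \<Longrightarrow> (\<lambda>z. h z * k z) \<in> inv_approx"
  using approx_mult[of h k] by (simp add: inv_approx_def)

lemma inv_poly_inv_approx: "p \<in> inv_poly \<Longrightarrow> p \<in> inv_approx"
  using poly_approx[of p] by (simp add: inv_approx_def inv_poly_def)

lemma inv_approx_const: "(\<lambda>z. c) \<in> inv_approx"
  by (rule inv_poly_inv_approx[OF inv_poly_const])

lemma inv_approx_scale: "h \<in> inv_approx \<Longrightarrow> (\<lambda>z. c * h z) \<in> inv_approx"
  by (rule inv_approx_mult[OF inv_approx_const])

lemma inv_approx_diff: "h \<in> inv_approx \<Longrightarrow> k \<in> inv_approx \<Longrightarrow> (\<lambda>z. h z - k z) \<in> inv_approx"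
  using inv_approx_add[OF _ inv_approx_scale[of k "-1"], of h] by simp

lemma inv_approx_resolvent: "h \<in> inv_approx \<Longrightarrow> bd h r \<Longrightarrow> r < 1 \<Longrightarrow> (\<lambda>z. h z / (1 - h z)) \<in> inv_approx"
  using approx_resolvent[of h r] by (simp add: inv_approx_def)

text \<open>
  The average of a polynomial that approximates \<open>h\<close> is invariant, and it approximates the average of \<open>h\<close>, which is \<open>h\<close>.
\<close>

lemma inv_approx_inv_poly_dense:
  assumes h: "h \<in> inv_approx" and e: "e > 0"
  shows "\<exists>p\<in>inv_poly. bd (\<lambda>z. h z - p z) e"
proof -
  obtain p where p: "p \<in> poly_fun I" "bd (\<lambda>z. h z - p z) e" by (rule bexE[OF approxD[OF inv_approx_approx[OF h] e]])
  obtain F where F: "finite F" "F \<subseteq> I" "p \<in> poly_fun F" using poly_fun_finite_support[OF p(1)] by blast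
  obtain \<Gamma> where \<Gamma>: "transversal F \<Gamma>" using ex_transversal[OF F(1,2)] by blast
  then have fin: "finite \<Gamma>" and sub: "\<Gamma> \<subseteq> G" unfolding transversal_def by auto
  note card = transversal_card[OF \<Gamma>]
  have "bd (\<lambda>z. \<Sum>\<gamma>\<in>\<Gamma>. h (act \<gamma> z) - p (act \<gamma> z)) (\<Sum>\<gamma>\<in>\<Gamma>. e)"
    using bd_act[OF _ p(2)] sub by (intro bd_sum fin) auto
  from bd_scale[OF this, of "1 / of_nat (card \<Gamma>)"]
  have "bd (\<lambda>z. 1 / of_nat (card \<Gamma>) * (\<Sum>\<gamma>\<in>\<Gamma>. h (act \<gamma> z) - p (act \<gamma> z))) e"
    using card by (simp add: norm_divide)
  then have "bd (\<lambda>z. h z - average \<Gamma> p z) e"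
  proof (rule bd_cong[rotated])
    fix z assume z: "z \<in> D"
    have "(\<Sum>\<gamma>\<in>\<Gamma>. h (act \<gamma> z) - p (act \<gamma> z)) = of_nat (card \<Gamma>) * h z - (\<Sum>\<gamma>\<in>\<Gamma>. p (act \<gamma> z))"
      using inv_approx_inv[OF h _ z] sub by (simp add: sum_subtractf subset_iff)
    then show "1 / of_nat (card \<Gamma>) * (\<Sum>\<gamma>\<in>\<Gamma>. h (act \<gamma> z) - p (act \<gamma> z)) = h z - average \<Gamma> p z"
      using card by (simp add: average_def field_simps)
  qed
  then show ?thesis by (rule bexI[where x = "average \<Gamma> p"]) (rule average_inv_poly[OF \<Gamma> F(2,3)])
qed

lemma approx_continuous: assumes "h \<in> approx" shows "continuous_map (closed_polydisc I) euclidean h"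
proof (rule continuous_map_approx)
  fix e :: real assume e: "e > 0"
  obtain p where p: "p \<in> poly_fun I" "bd (\<lambda>z. h z - p z) e" by (rule bexE[OF approxD[OF assms e]])
  then show "\<exists>k. continuous_map (closed_polydisc I) euclidean k \<and> (\<forall>z\<in>D. norm (h z - k z) \<le> e)"
    using bd_norm_le[OF p(2)] continuous_map_poly_fun[OF p(1)] by (intro exI[of _ p]) blast
qed

lemma inv_approx_psi_star:
  assumes h: "h \<in> inv_approx" and q: "q \<in> G_hat G" and z: "z \<in> D" shows "h (psi_star G q z) = h z"
proof -
  have "norm (h (psi_star G q z) - h z) \<le> e" if e: "e > 0" for e
  proof -
    obtain p where p: "p \<in> inv_poly" "bd (\<lambda>z. h z - p z) (e / 2)"
      by (rule bexE[OF inv_approx_inv_poly_dense[OF h half_gt_zero[OF e]]])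
    have "norm (h (psi_star G q z) - p (psi_star G q z)) \<le> e / 2" "norm (h z - p z) \<le> e / 2"
      using bd_norm_le[OF p(2)] z psi_star_D[OF z q] by auto
    then show ?thesis unfolding poly_psi_star[OF p(1) q]
      using norm_triangle_ineq4[of "h (psi_star G q z) - p z" "h z - p z"] by simp
  qed
  then have "norm (h (psi_star G q z) - h z) \<le> 0" by (rule field_le_epsilon[of _ 0, simplified add_0_left])
  then show ?thesis by simp
qed

lemma orbit_proj_self: assumes "z \<in> D" shows "z \<in> orbit_proj G z"
proof -
  have "act (\<lambda>i\<in>{1..}. i) z i = z i" for i
    using I_ge_1 assms by (cases "i \<in> I") (auto simp: act_def topspace_closed_polydisc PiE_iff extensional_def)
  then have "z = psi_star G (embed (\<lambda>i\<in>{1..}. i)) z" using psi_star_embed[OF id_G] by auto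
  then show ?thesis unfolding orbit_proj_def using embed_G_hat[OF id_G] by blast
qed

text \<open>
  Invariant limits are constant on the orbits of the profinite group by \<open>G_hat_approx\<close>, and different orbits are separated already
  by invariant polynomials.
\<close>

lemma orbit_proj_eq_iff:
  assumes z: "z \<in> D" and w: "w \<in> D"
  shows "orbit_proj G z = orbit_proj G w \<longleftrightarrow> (\<forall>h\<in>inv_approx. h z = h w)"
proof
  assume "orbit_proj G z = orbit_proj G w"
  then obtain q where "q \<in> G_hat G" "z = psi_star G q w"
    using orbit_proj_self[OF z] unfolding orbit_proj_def by auto
  then show "\<forall>h\<in>inv_approx. h z = h w" using inv_approx_psi_star[OF _ _ w] by blast
next
  have sub: "orbit_proj G z \<subseteq> orbit_proj G w" if z: "z \<in> D" and w: "w \<in> D" and eq: "\<forall>h\<in>inv_approx. h z = h w" for z w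
  proof
    fix u assume "u \<in> orbit_proj G z"
    then obtain q where q: "q \<in> G_hat G" "u = psi_star G q z" unfolding orbit_proj_def by blast
    have "p w = p u" if "p \<in> inv_poly" for p
      using bspec[OF eq inv_poly_inv_approx[OF that]] unfolding q(2) poly_psi_star[OF that q(1)] by (rule sym)
    then obtain q' where q': "q' \<in> G_hat G" "\<And>i. i \<in> I \<Longrightarrow> psi_star G q' w i = u i"
      using inv_poly_separate[of w u] by blast
    have "psi_star G q' w = u"
      using q'(2) psi_star_D[OF w q'(1)] psi_star_D[OF z q(1)] unfolding q(2)
      by (intro PiE_ext) (auto simp: topspace_closed_polydisc)
    then show "u \<in> orbit_proj G w" unfolding orbit_proj_def using q'(1) by blast
  qed
  assume eq: "\<forall>h\<in>inv_approx. h z = h w"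
  have eq': "\<forall>h\<in>inv_approx. h w = h z" by (rule ballI) (rule sym[OF bspec[OF eq]])
  show "orbit_proj G z = orbit_proj G w" by (rule equalityI[OF sub[OF z w eq] sub[OF w z eq']])
qed

lemma topspace_orbit_space: "topspace (orbit_space G) = orbit_proj G ` D"
  by (simp add: orbit_space_def topspace_quot_topology)

lemma quotient_map_orbit_proj: "quotient_map (closed_polydisc I) (orbit_space G) (orbit_proj G)"
  unfolding orbit_space_def by (rule quotient_map_quot_topology)

lemma compact_orbit_space: "compact_space (orbit_space G)"
  using image_compactin[OF compact_closed_polydisc[unfolded compact_space_def]
      quotient_imp_continuous_map[OF quotient_map_orbit_proj]]
  by (simp add: compact_space_def topspace_orbit_space)

end

section \<open>Characters of algebras of invariant limits\<close>

text \<open>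
  \<open>B\<close> is an algebra of functions on an arbitrary set \<open>X\<close> that is isomorphic to the invariant limits of polynomials by
  composition with \<open>\<iota>\<close>. The assumption \<open>inj\<close> says that the range of \<open>\<iota>\<close> is large enough.
\<close>

locale realized_algebra = polydisc_norm +
  fixes X :: "'x set" and \<iota> :: "'x \<Rightarrow> nat \<Rightarrow> complex" and B :: "('x \<Rightarrow> complex) set"
  assumes \<iota>_D: "x \<in> X \<Longrightarrow> \<iota> x \<in> D"
    and B_eq: "B = (\<lambda>h. \<lambda>x\<in>X. h (\<iota> x)) ` inv_approx"
    and inj: "h \<in> inv_approx \<Longrightarrow> (\<And>x. x \<in> X \<Longrightarrow> h (\<iota> x) = 0) \<Longrightarrow> z \<in> D \<Longrightarrow> h z = 0"
begin

abbreviation S where "S h \<equiv> (\<lambda>x\<in>X. h (\<iota> x))"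

lemma S_B: "h \<in> inv_approx \<Longrightarrow> S h \<in> B" using B_eq by blast

lemma S_inj: assumes "h \<in> inv_approx" "k \<in> inv_approx" "S h = S k" "z \<in> D" shows "h z = k z"
proof -
  have "h (\<iota> x) - k (\<iota> x) = 0" if "x \<in> X" for x using fun_cong[OF assms(3), of x] that by simp
  then show ?thesis using inj[OF inv_approx_diff[OF assms(1,2)] _ assms(4)] by simp
qed

context
  fixes \<phi> assumes \<phi>: "\<phi> \<in> characters X B"
begin

lemma \<phi>_add: "h \<in> inv_approx \<Longrightarrow> k \<in> inv_approx \<Longrightarrow> \<phi> (S (\<lambda>z. h z + k z)) = \<phi> (S h) + \<phi> (S k)"
proof -
  assume "h \<in> inv_approx" "k \<in> inv_approx"
  then have "\<phi> (\<lambda>x\<in>X. S h x + S k x) = \<phi> (S h) + \<phi> (S k)" using \<phi> S_B unfolding characters_def by blast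
  moreover have "(\<lambda>x\<in>X. S h x + S k x) = S (\<lambda>z. h z + k z)" by auto
  ultimately show ?thesis by simp
qed

lemma \<phi>_mult: "h \<in> inv_approx \<Longrightarrow> k \<in> inv_approx \<Longrightarrow> \<phi> (S (\<lambda>z. h z * k z)) = \<phi> (S h) * \<phi> (S k)"
proof -
  assume "h \<in> inv_approx" "k \<in> inv_approx"
  then have "\<phi> (\<lambda>x\<in>X. S h x * S k x) = \<phi> (S h) * \<phi> (S k)" using \<phi> S_B unfolding characters_def by blast
  moreover have "(\<lambda>x\<in>X. S h x * S k x) = S (\<lambda>z. h z * k z)" by auto
  ultimately show ?thesis by simp
qed

lemma \<phi>_scale: "h \<in> inv_approx \<Longrightarrow> \<phi> (S (\<lambda>z. c * h z)) = c * \<phi> (S h)"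
proof -
  assume "h \<in> inv_approx"
  then have "\<phi> (\<lambda>x\<in>X. c * S h x) = c * \<phi> (S h)" using \<phi> S_B unfolding characters_def by blast
  moreover have "(\<lambda>x\<in>X. c * S h x) = S (\<lambda>z. c * h z)" by auto
  ultimately show ?thesis by simp
qed

lemma \<phi>_const: "\<phi> (S (\<lambda>z. c)) = c"
proof -
  obtain f where "f \<in> B" "\<phi> f \<noteq> 0" using \<phi> unfolding characters_def by blast
  then obtain h where h: "h \<in> inv_approx" "\<phi> (S h) \<noteq> 0" unfolding B_eq by blast
  have "\<phi> (S h) = \<phi> (S (\<lambda>z. 1)) * \<phi> (S h)" using \<phi>_mult[OF inv_approx_const h(1), of 1] by simp
  then have "\<phi> (S (\<lambda>z. 1)) = 1" using h(2) by simp
  then show ?thesis using \<phi>_scale[OF inv_approx_const, of c 1] by simp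
qed

text \<open>
  If \<open>norm (\<phi> h) > r\<close>, then after scaling \<open>\<phi> h = 1\<close> and \<open>h\<close> has norm less than 1. So \<open>k = h / (1 - h)\<close> belongs to the
  algebra, and applying \<open>\<phi>\<close> to \<open>k = h + h * k\<close> gives \<open>0 = 1\<close>.
\<close>

lemma \<phi>_norm_le: assumes h: "h \<in> inv_approx" and r: "bd h r" shows "norm (\<phi> (S h)) \<le> r"
proof (rule ccontr)
  assume neg: "\<not> ?thesis"
  define c where "c = \<phi> (S h)"
  have c: "norm c > r" "c \<noteq> 0" using neg bd_nonneg[OF r] unfolding c_def by auto
  \<comment> \<open>the scaled function is sent to 1 but has norm less than 1\<close>
  define h1 where "h1 = (\<lambda>z. (1 / c) * h z)"
  define k1 where "k1 = (\<lambda>z. h1 z / (1 - h1 z))"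
  have h': "h1 \<in> inv_approx" unfolding h1_def by (rule inv_approx_scale[OF h])
  have r': "bd h1 (norm (1 / c) * r)" unfolding h1_def by (rule bd_scale[OF r])
  have r1: "norm (1 / c) * r < 1" using c by (simp add: norm_divide field_simps)
  have k: "k1 \<in> inv_approx" unfolding k1_def by (rule inv_approx_resolvent[OF h' r' r1])
  have "\<phi> (S h1) = 1" unfolding h1_def using \<phi>_scale[OF h, of "1 / c"] c by (simp add: c_def)
  moreover have "S k1 = S (\<lambda>z. h1 z + h1 z * k1 z)"
  proof (rule restrict_ext)
    fix x assume "x \<in> X"
    then have "norm (h1 (\<iota> x)) < 1" using bd_norm_le[OF r' \<iota>_D] r1 by fastforce
    then have "1 - h1 (\<iota> x) \<noteq> 0" by auto
    then show "k1 (\<iota> x) = h1 (\<iota> x) + h1 (\<iota> x) * k1 (\<iota> x)" unfolding k1_def by (simp add: field_simps)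
  qed
  then have "\<phi> (S k1) = \<phi> (S h1) + \<phi> (S h1) * \<phi> (S k1)"
    using \<phi>_add[OF h' inv_approx_mult[OF h' k]] \<phi>_mult[OF h' k] by simp
  ultimately show False by simp
qed

text \<open>
  The restriction of \<open>\<phi>\<close> to the invariant polynomials is evaluation at some \<open>\<zeta>0\<close> by \<open>lying_over\<close>. The Cesaro means \<open>P L\<close> show that
  \<open>\<zeta>0\<close> lies in the closed polydisc; evaluation at \<open>\<zeta>0\<close> and \<open>\<phi>\<close> are then both bounded by the norm and agree on a dense set.
\<close>

lemma character_point: obtains \<zeta> where "\<zeta> \<in> D" "\<And>h. h \<in> inv_approx \<Longrightarrow> \<phi> (S h) = h \<zeta>"
proof -
  have "poly_char (\<lambda>p. \<phi> (S p))"
    unfolding poly_char_def using \<phi>_add \<phi>_mult \<phi>_const inv_poly_inv_approx by blast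
  then obtain \<zeta>0 where \<zeta>0: "\<And>p. p \<in> inv_poly \<Longrightarrow> \<phi> (S p) = p \<zeta>0" using lying_over by blast
  have le1: "norm (\<zeta>0 i) \<le> 1" if i: "i \<in> I" for i
  proof (rule ccontr)
    assume neg: "\<not> norm (\<zeta>0 i) \<le> 1"
    have fin: "finite (orb i)" and ne: "i \<in> orb i" and sub: "orb i \<subseteq> I"
      using i mem_I_iff orb_self orb_subset_I by auto
    have "Max ((\<lambda>j. norm (\<zeta>0 j)) ` orb i) \<in> (\<lambda>j. norm (\<zeta>0 j)) ` orb i"
      using fin ne by (intro Max_in) auto
    then obtain m where m: "m \<in> orb i" "norm (\<zeta>0 m) = Max ((\<lambda>j. norm (\<zeta>0 j)) ` orb i)" by force
    define u where "u = \<zeta>0 m"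
    have u: "norm (\<zeta>0 j) \<le> norm u" if "j \<in> orb i" for j
      unfolding u_def m(2) using fin that by (intro Max_ge) auto
    have u1: "norm u > 1" using u[OF ne] neg by simp
    \<comment> \<open>the sum over the whole orbit makes the Cesaro mean invariant\<close>
    define P where "P L z = (\<Sum>j\<in>orb i. (\<Sum>l<L. (z j / u) ^ l) / of_nat L)" for L and z :: "nat \<Rightarrow> complex"
    have P_poly: "P L \<in> poly_fun I" for L
    proof -
      have "(\<lambda>z. z j * (1 / u)) \<in> poly_fun I" if "j \<in> orb i" for j
        using that sub by (intro poly_fun.mult poly_fun.coord poly_fun.const) auto
      then have "(\<lambda>z. \<Sum>j\<in>orb i. (\<Sum>l<L. (z j * (1 / u)) ^ l) * (1 / of_nat L)) \<in> poly_fun I"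
        by (intro poly_fun_sum poly_fun.mult[OF poly_fun_sum[OF poly_fun_power] poly_fun.const])
      then show ?thesis unfolding P_def[abs_def] by simp
    qed
    have P_inv: "P L \<in> inv_poly" for L
    proof -
      have "P L (act g z) = P L z" if g: "g \<in> G" for g z
      proof -
        have "P L (act g z) = (\<Sum>j\<in>orb i. (\<Sum>l<L. (z (g j) / u) ^ l) / of_nat L)"
          unfolding P_def using sub by (intro sum.cong) auto
        also have "\<dots> = P L z" unfolding P_def
        proof (rule sum.reindex_bij_betw)
          have "inj_on g (orb i)" using G_inj[OF g] sub I_ge_1 by (auto simp: inj_on_def subset_iff)
          moreover have "g ` orb i \<subseteq> orb i" using mem_orb2[OF g] I_ge_1[OF i] unfolding orb_eq by auto
          ultimately show "bij_betw g (orb i) (orb i)" using fin by (simp add: bij_betw_def endo_inj_surj)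
        qed
        finally show ?thesis .
      qed
      then show ?thesis using P_poly by (simp add: inv_poly_def)
    qed
    \<comment> \<open>on the polydisc the geometric series of \<open>z j / u\<close> is bounded, so division by \<open>L\<close> gives decay\<close>
    define C where "C = real (card (orb i)) * (1 / (1 - 1 / norm u))"
    have P_bd: "bd (P L) (C * inverse (real L))" for L
    proof -
      have 1: "bd (\<lambda>z. 1 / of_nat L * (\<Sum>l<L. (1 / u * z j) ^ l)) (norm (1 / of_nat L :: complex) * (\<Sum>l<L. (norm (1 / u) * 1) ^ l))"
        if "j \<in> orb i" for j
        using that sub by (intro bd_scale bd_sum bd_power bd_coord) auto
      have "norm (1 / of_nat L :: complex) * (\<Sum>l<L. (norm (1 / u) * 1) ^ l) \<le> 1 / (1 - 1 / norm u) * inverse (real L)"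
      proof -
        have "norm (1 / norm u) < 1" using u1 by (simp add: divide_less_eq)
        then have "(\<Sum>l<L. (1 / norm u) ^ l) \<le> 1 / (1 - 1 / norm u)"
          by (subst suminf_geometric[symmetric, of "1 / norm u"]) (auto intro!: sum_le_suminf summable_geometric)
        from mult_left_mono[OF this, of "inverse (real L)"] show ?thesis
          by (simp add: norm_inverse divide_inverse mult.commute)
      qed
      from bd_mono[OF 1 this] have "bd (\<lambda>z. \<Sum>j\<in>orb i. 1 / of_nat L * (\<Sum>l<L. (1 / u * z j) ^ l))
          (\<Sum>j\<in>orb i. 1 / (1 - 1 / norm u) * inverse (real L))" by (intro bd_sum fin)
      moreover have "(\<lambda>z. \<Sum>j\<in>orb i. 1 / of_nat L * (\<Sum>l<L. (1 / u * z j) ^ l)) = P L"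
        by (auto simp: P_def)
      ultimately show ?thesis by (simp add: C_def)
    qed
    have "(\<lambda>L. P L \<zeta>0) \<longlonglongrightarrow> (\<Sum>j\<in>orb i. if \<zeta>0 j / u = 1 then 1 else 0)"
      unfolding P_def using u u1 by (intro tendsto_sum cesaro_power_tendsto) (auto simp: norm_divide divide_le_eq)
    moreover have "(\<lambda>L. P L \<zeta>0) \<longlonglongrightarrow> 0"
    proof (rule Lim_null_comparison)
      show "\<forall>\<^sub>F L in sequentially. norm (P L \<zeta>0) \<le> C * inverse (real L)"
        using \<phi>_norm_le[OF inv_poly_inv_approx[OF P_inv] P_bd] \<zeta>0[OF P_inv] by simp
      show "(\<lambda>L. C * inverse (real L)) \<longlonglongrightarrow> 0" using tendsto_mult[OF tendsto_const lim_inverse_n, of C] by simp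
    qed
    ultimately have "(\<Sum>j\<in>orb i. if \<zeta>0 j / u = 1 then 1 else 0) = (0 :: complex)" by (rule LIMSEQ_unique)
    then have "of_nat (card {j \<in> orb i. \<zeta>0 j / u = 1}) = (0 :: complex)"
      using fin by (simp add: sum.If_cases Int_def)
    then have "{j \<in> orb i. \<zeta>0 j / u = 1} = {}" using fin by simp
    moreover have "m \<in> {j \<in> orb i. \<zeta>0 j / u = 1}" using m(1) u1 by (auto simp: u_def)
    ultimately show False by blast
  qed
  define \<zeta> where "\<zeta> = restrict \<zeta>0 I"
  have \<zeta>: "\<zeta> \<in> D" unfolding \<zeta>_def by (rule closed_polydiscI) (use le1 in auto)
  have "\<phi> (S h) = h \<zeta>" if h: "h \<in> inv_approx" for h
  proof -
    have "norm (\<phi> (S h) - h \<zeta>) \<le> e" if e: "e > 0" for e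
    proof -
      obtain p where p: "p \<in> inv_poly" "bd (\<lambda>z. h z - p z) (e / 2)"
        by (rule bexE[OF inv_approx_inv_poly_dense[OF h half_gt_zero[OF e]]])
      note pB = inv_poly_inv_approx[OF p(1)]
      have hp: "(\<lambda>z. h z - p z) \<in> inv_approx" by (rule inv_approx_diff[OF h pB])
      have "\<phi> (S (\<lambda>z. (h z - p z) + p z)) = \<phi> (S (\<lambda>z. h z - p z)) + \<phi> (S p)" by (rule \<phi>_add[OF hp pB])
      then have "\<phi> (S h) - \<phi> (S p) = \<phi> (S (\<lambda>z. h z - p z))" by simp
      then have "norm (\<phi> (S h) - \<phi> (S p)) \<le> e / 2" using \<phi>_norm_le[OF hp p(2)] by simp
      moreover have "\<phi> (S p) = p \<zeta>"
        unfolding \<zeta>0[OF p(1)] by (rule poly_fun_cong[OF inv_poly_poly[OF p(1)]]) (simp add: \<zeta>_def)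
      moreover have "norm (h \<zeta> - p \<zeta>) \<le> e / 2" by (rule bd_norm_le[OF p(2) \<zeta>])
      ultimately show ?thesis using norm_triangle_ineq4[of "\<phi> (S h) - p \<zeta>" "h \<zeta> - p \<zeta>"] by simp
    qed
    then have "norm (\<phi> (S h) - h \<zeta>) \<le> 0" by (rule field_le_epsilon[of _ 0, simplified add_0_left])
    then show ?thesis by simp
  qed
  with \<zeta> show thesis by (rule that)
qed

end

lemma topspace_max_ideal_space: "topspace (max_ideal_space X B) = characters X B"
  by (auto simp: max_ideal_space_def characters_def PiE_def)

text \<open>
  Continuity follows from the universal property of the quotient topology, since each \<open>h\<close> is continuous on the polydisc. The map is
  surjective by \<open>character_point\<close> and injective by \<open>orbit_proj_eq_iff\<close>, from a compact space to a Hausdorff space. The map \<open>\<Phi>\<close> is a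
  parameter because on the algebras of the orbit space it is literally evaluation at points.
\<close>

lemma homeomorphic_map_evaluation:
  assumes ext: "\<And>x. x \<in> topspace (orbit_space G) \<Longrightarrow> \<Phi> x \<in> extensional B"
    and \<Phi>: "\<And>h z. h \<in> inv_approx \<Longrightarrow> z \<in> D \<Longrightarrow> \<Phi> (orbit_proj G z) (S h) = h z"
  shows "homeomorphic_map (orbit_space G) (max_ideal_space X B) \<Phi>"
proof (rule continuous_imp_homeomorphic_map)
  have char: "\<Phi> x \<in> characters X B" if x: "x \<in> topspace (orbit_space G)" for x
  proof -
    obtain z where z: "z \<in> D" "x = orbit_proj G z" using x unfolding topspace_orbit_space by blast
    have ev: "\<Phi> x (S h) = h z" if "h \<in> inv_approx" for h using \<Phi>[OF that z(1)] z(2) by simp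
    have 1: "(\<lambda>x\<in>X. S h x + S k x) = S (\<lambda>z. h z + k z)" "(\<lambda>x\<in>X. S h x * S k x) = S (\<lambda>z. h z * k z)"
      "(\<lambda>x\<in>X. c * S h x) = S (\<lambda>z. c * h z)" for h k c by auto
    show ?thesis
      unfolding characters_def B_eq
    proof (intro CollectI conjI ballI allI; (elim imageE; hypsubst)?)
      show "\<Phi> x \<in> extensional ((\<lambda>h. S h) ` inv_approx)" using ext[OF x] unfolding B_eq .
      show "\<exists>f\<in>(\<lambda>h. S h) ` inv_approx. \<Phi> x f \<noteq> 0" using ev[OF inv_approx_const[of 1]] inv_approx_const[of 1] by force
      fix h assume h: "h \<in> inv_approx"
      show "\<Phi> x (\<lambda>x\<in>X. c * S h x) = c * \<Phi> x (S h)" for c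
        unfolding 1 ev[OF h] ev[OF inv_approx_scale[OF h]] ..
      fix k assume k: "k \<in> inv_approx"
      show "\<Phi> x (\<lambda>x\<in>X. S h x + S k x) = \<Phi> x (S h) + \<Phi> x (S k)"
        unfolding 1 ev[OF h] ev[OF k] ev[OF inv_approx_add[OF h k]] ..
      show "\<Phi> x (\<lambda>x\<in>X. S h x * S k x) = \<Phi> x (S h) * \<Phi> x (S k)"
        unfolding 1 ev[OF h] ev[OF k] ev[OF inv_approx_mult[OF h k]] ..
    qed
  qed
  show "continuous_map (orbit_space G) (max_ideal_space X B) \<Phi>"
    unfolding max_ideal_space_def continuous_map_in_subtopology continuous_map_componentwise
  proof (intro conjI ballI)
    show "\<Phi> ` topspace (orbit_space G) \<subseteq> extensional B" using ext by blast
    show "\<Phi> \<in> topspace (orbit_space G) \<rightarrow> characters X B" using char by blast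
    fix f assume "f \<in> B"
    then obtain h where h: "h \<in> inv_approx" "f = S h" unfolding B_eq by blast
    have "continuous_map (closed_polydisc I) euclidean ((\<lambda>x. \<Phi> x f) \<circ> orbit_proj G)"
      by (rule continuous_map_eq[OF approx_continuous[OF inv_approx_approx[OF h(1)]]]) (simp add: h(2) \<Phi>[OF h(1)])
    then show "continuous_map (orbit_space G) euclidean (\<lambda>x. \<Phi> x f)"
      using continuous_compose_quotient_map_eq[OF quotient_map_orbit_proj] by blast
  qed
  show "compact_space (orbit_space G)" by (rule compact_orbit_space)
  show "Hausdorff_space (max_ideal_space X B)"
    unfolding max_ideal_space_def by (intro Hausdorff_space_subtopology) (simp add: Hausdorff_space_product_topology)
  show "\<Phi> ` topspace (orbit_space G) = topspace (max_ideal_space X B)"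
    unfolding topspace_max_ideal_space
  proof (intro equalityI subsetI)
    fix \<phi> assume \<phi>: "\<phi> \<in> characters X B"
    obtain \<zeta> where \<zeta>: "\<zeta> \<in> D" "\<And>h. h \<in> inv_approx \<Longrightarrow> \<phi> (S h) = h \<zeta>" using character_point[OF \<phi>] by blast
    have K: "orbit_proj G \<zeta> \<in> topspace (orbit_space G)" using \<zeta>(1) unfolding topspace_orbit_space by blast
    have "\<phi> = \<Phi> (orbit_proj G \<zeta>)"
    proof (rule extensionalityI)
      show "\<phi> \<in> extensional B" using \<phi> unfolding characters_def by blast
      show "\<Phi> (orbit_proj G \<zeta>) \<in> extensional B" by (rule ext[OF K])
      fix f assume "f \<in> B"
      then obtain h where "h \<in> inv_approx" "f = S h" unfolding B_eq by blast
      then show "\<phi> f = \<Phi> (orbit_proj G \<zeta>) f" using \<zeta> \<Phi> by simp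
    qed
    then show "\<phi> \<in> \<Phi> ` topspace (orbit_space G)" using K by blast
  qed (use char in blast)
  show "inj_on \<Phi> (topspace (orbit_space G))"
  proof (rule inj_onI)
    fix x y assume xy: "x \<in> topspace (orbit_space G)" "y \<in> topspace (orbit_space G)" "\<Phi> x = \<Phi> y"
    obtain z w where zw: "z \<in> D" "x = orbit_proj G z" "w \<in> D" "y = orbit_proj G w"
      using xy unfolding topspace_orbit_space by blast
    have "h z = h w" if "h \<in> inv_approx" for h using \<Phi>[OF that] zw xy(3) by metis
    then show "x = y" using orbit_proj_eq_iff[OF zw(1,3)] zw by simp
  qed
qed

text \<open>
  In general \<open>X\<close> does not contain the points of the orbit space, so a function in \<open>B\<close> is evaluated at a point after lifting it to
  the polydisc.
\<close>

lemma homeomorphic_orbit_space: "orbit_space G homeomorphic_space max_ideal_space X B"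
proof -
  define sec where "sec x = (SOME z. z \<in> D \<and> orbit_proj G z = x)" for x
  have sec: "sec (orbit_proj G z) \<in> D" "orbit_proj G (sec (orbit_proj G z)) = orbit_proj G z" if "z \<in> D" for z
    using someI[of "\<lambda>z'. z' \<in> D \<and> orbit_proj G z' = orbit_proj G z" z] that unfolding sec_def by auto
  define pre where "pre f = (SOME h. h \<in> inv_approx \<and> S h = f)" for f
  have pre: "pre (S h) \<in> inv_approx" "S (pre (S h)) = S h" if "h \<in> inv_approx" for h
    using someI[of "\<lambda>k. k \<in> inv_approx \<and> S k = S h" h] that unfolding pre_def by auto
  have "homeomorphic_map (orbit_space G) (max_ideal_space X B) (\<lambda>x. \<lambda>f\<in>B. pre f (sec x))"
  proof (rule homeomorphic_map_evaluation)
    fix h z assume h: "h \<in> inv_approx" and z: "z \<in> D"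
    have "pre (S h) (sec (orbit_proj G z)) = h (sec (orbit_proj G z))"
      by (rule S_inj[OF pre(1)[OF h] h pre(2)[OF h] sec(1)[OF z]])
    also have "\<dots> = h z" using orbit_proj_eq_iff[OF sec(1)[OF z] z] sec(2)[OF z] h by blast
    finally show "(\<lambda>f\<in>B. pre f (sec (orbit_proj G z))) (S h) = h z" using S_B[OF h] by simp
  qed simp
  then show ?thesis by (rule homeomorphic_map_imp_homeomorphic_space)
qed

end

section \<open>The supremum norm and the sum of the moduli of the coefficients\<close>

definition sup_bd :: "nat set \<Rightarrow> ((nat \<Rightarrow> complex) \<Rightarrow> complex) \<Rightarrow> real \<Rightarrow> bool" where
  "sup_bd I h r \<longleftrightarrow> (\<forall>z\<in>topspace (closed_polydisc I). norm (h z) \<le> r)"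

text \<open>
  The coefficients of a power series in the coordinates from \<open>I\<close>, with multi-indices encoded by prime factorization.
\<close>

definition l1_coeffs :: "nat set \<Rightarrow> (nat \<Rightarrow> complex) \<Rightarrow> real \<Rightarrow> bool" where
  "l1_coeffs I a r \<longleftrightarrow> (\<forall>n. n \<notin> smooth_over I \<longrightarrow> a n = 0) \<and> (\<forall>F. finite F \<longrightarrow> (\<Sum>n\<in>F. norm (a n)) \<le> r)"

definition l1_bd :: "nat set \<Rightarrow> ((nat \<Rightarrow> complex) \<Rightarrow> complex) \<Rightarrow> real \<Rightarrow> bool" where
  "l1_bd I h r \<longleftrightarrow> (\<exists>a. l1_coeffs I a r \<and>
     (\<forall>z\<in>topspace (closed_polydisc I). ((\<lambda>n. a n * bohr_monomial z n) has_sum h z) UNIV))"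

lemma l1_coeffs_0: "l1_coeffs I a r \<Longrightarrow> n \<notin> smooth_over I \<Longrightarrow> a n = 0"
  by (simp add: l1_coeffs_def)

lemma l1_coeffs_sum_le: "l1_coeffs I a r \<Longrightarrow> finite F \<Longrightarrow> (\<Sum>n\<in>F. norm (a n)) \<le> r"
  by (simp add: l1_coeffs_def)

lemma l1_bdI: "l1_coeffs I a r \<Longrightarrow>
    (\<And>z. z \<in> topspace (closed_polydisc I) \<Longrightarrow> ((\<lambda>n. a n * bohr_monomial z n) has_sum h z) UNIV) \<Longrightarrow> l1_bd I h r"
  unfolding l1_bd_def by (intro exI[of _ a] conjI ballI)

lemma l1_bdE:
  assumes "l1_bd I h r"
  obtains a where "l1_coeffs I a r"
    "\<And>z. z \<in> topspace (closed_polydisc I) \<Longrightarrow> ((\<lambda>n. a n * bohr_monomial z n) has_sum h z) UNIV"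
proof -
  from assms obtain a where a: "l1_coeffs I a r" "\<forall>z\<in>topspace (closed_polydisc I). ((\<lambda>n. a n * bohr_monomial z n) has_sum h z) UNIV"
    unfolding l1_bd_def by (elim exE conjE)
  show thesis by (rule that[OF a(1) bspec[OF a(2)]])
qed

lemma zero_not_smooth: "0 \<notin> smooth_over I" by (simp add: smooth_over_def)

lemma norm_bohr_monomial_D:
  assumes "z \<in> topspace (closed_polydisc I)" "n \<in> smooth_over I" shows "norm (bohr_monomial z n) \<le> 1"
  by (rule norm_bohr_monomial_le_1) (use assms closed_polydisc_norm_le[OF assms(1)] in \<open>auto simp: smooth_over_def\<close>)

lemma l1_term_le:
  assumes "l1_coeffs I a r" "z \<in> topspace (closed_polydisc I)"
  shows "norm (a n * bohr_monomial z n) \<le> norm (a n)"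
proof (cases "n \<in> smooth_over I")
  case True
  then show ?thesis using norm_bohr_monomial_D[OF assms(2) True] by (simp add: norm_mult mult_left_le)
qed (use assms(1) in \<open>simp add: l1_coeffs_def\<close>)

lemma l1_coeffs_summable: assumes "l1_coeffs I a r" shows "(\<lambda>n. norm (a n)) summable_on UNIV"
  by (rule nonneg_bdd_above_summable_on) (use assms in \<open>auto simp: l1_coeffs_def bdd_above_def\<close>)

lemma l1_summable:
  assumes "l1_coeffs I a r" "z \<in> topspace (closed_polydisc I)"
  shows "(\<lambda>n. norm (a n * bohr_monomial z n)) summable_on UNIV"
proof -
  have "(\<lambda>n. norm (a n)) summable_on UNIV" by (rule l1_coeffs_summable[OF assms(1)])
  then show ?thesis
    by (rule Infinite_Sum.abs_summable_on_comparison_test) (rule l1_term_le[OF assms])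
qed

lemma l1_has_sum:
  assumes "l1_coeffs I a r" "z \<in> topspace (closed_polydisc I)"
  shows "((\<lambda>n. a n * bohr_monomial z n) has_sum (\<Sum>\<^sub>\<infinity>n. a n * bohr_monomial z n)) UNIV"
  using abs_summable_summable[OF l1_summable[OF assms]] by (simp add: summable_iff_has_sum_infsum)

lemma l1_has_sum_norm_le:
  assumes "l1_coeffs I a r" "z \<in> topspace (closed_polydisc I)" "((\<lambda>n. a n * bohr_monomial z n) has_sum x) UNIV"
  shows "norm x \<le> r"
proof -
  have s: "((\<lambda>n. norm (a n * bohr_monomial z n)) has_sum (\<Sum>\<^sub>\<infinity>n. norm (a n * bohr_monomial z n))) UNIV"
    using l1_summable[OF assms(1,2)] by (simp add: summable_iff_has_sum_infsum)
  have "norm x \<le> (\<Sum>\<^sub>\<infinity>n. norm (a n * bohr_monomial z n))" by (rule norm_has_sum_bound[OF s assms(3)])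
  also have "\<dots> \<le> r"
  proof (rule has_sum_le_finite_sums[OF s])
    fix F :: "nat set" assume "finite F"
    then have "(\<Sum>n\<in>F. norm (a n)) \<le> r" using assms(1) by (simp add: l1_coeffs_def)
    then show "(\<Sum>n\<in>F. norm (a n * bohr_monomial z n)) \<le> r"
      using sum_mono[of F "\<lambda>n. norm (a n * bohr_monomial z n)" "\<lambda>n. norm (a n)"] l1_term_le[OF assms(1,2)] by force
  qed
  finally show ?thesis .
qed

lemma l1_coeffs_finite_support:
  assumes "finite S" "S \<subseteq> smooth_over I" "\<And>n. n \<notin> S \<Longrightarrow> a n = 0"
  shows "l1_coeffs I a (\<Sum>n\<in>S. norm (a n))"
  unfolding l1_coeffs_def
proof (intro conjI allI impI)
  fix F :: "nat set" assume "finite F"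
  have "(\<Sum>n\<in>F. norm (a n)) = (\<Sum>n\<in>F \<inter> S. norm (a n))"
    by (rule sum.mono_neutral_right) (use \<open>finite F\<close> assms(3) in auto)
  also have "\<dots> \<le> (\<Sum>n\<in>S. norm (a n))" by (rule sum_mono2) (use assms(1) in auto)
  finally show "(\<Sum>n\<in>F. norm (a n)) \<le> (\<Sum>n\<in>S. norm (a n))" .
qed (use assms in blast)

lemma l1_bd_monomial:
  assumes "n \<in> smooth_over I" shows "l1_bd I (\<lambda>z. c * bohr_monomial z n) (norm c)"
  unfolding l1_bd_def
proof (intro exI[of _ "\<lambda>m. if m = n then c else 0"] conjI ballI)
  show "l1_coeffs I (\<lambda>m. if m = n then c else 0) (norm c)"
    using l1_coeffs_finite_support[of "{n}" I "\<lambda>m. if m = n then c else 0"] assms by simp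
  fix z :: "nat \<Rightarrow> complex"
  have "((\<lambda>m. (if m = n then c else 0) * bohr_monomial z m) has_sum (\<Sum>m\<in>{n}. (if m = n then c else 0) * bohr_monomial z m)) {n}"
    by (rule has_sum_finite) simp
  then show "((\<lambda>m. (if m = n then c else 0) * bohr_monomial z m) has_sum c * bohr_monomial z n) UNIV"
    by (subst has_sum_cong_neutral[where T = "{n}" and g = "\<lambda>m. (if m = n then c else 0) * bohr_monomial z m"]) auto
qed

text \<open>
  Products of power series, with multi-indices encoded as integers. The number 0 encodes no multi-index.
\<close>

definition dirichlet_conv :: "(nat \<Rightarrow> 'a::comm_semiring_1) \<Rightarrow> (nat \<Rightarrow> 'a) \<Rightarrow> nat \<Rightarrow> 'a" where
  "dirichlet_conv a b n = (if n = 0 then 0 else \<Sum>d | d dvd n. a d * b (n div d))"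

lemma divisor_bounds:
  fixes n :: nat assumes "d dvd n" "1 \<le> n"
  shows "1 \<le> d" "d \<le> n" "1 \<le> n div d" "n div d \<le> n" "d * (n div d) = n"
  using assms by (auto simp: Suc_le_eq intro!: Nat.gr0I dvd_imp_le)

text \<open>
  The pairs \<open>(d, n div d)\<close> with \<open>d dvd n\<close> and \<open>n \<le> N\<close> are different pairs of numbers up to \<open>N\<close>.
\<close>

lemma sum_dirichlet_conv_le:
  fixes a b :: "nat \<Rightarrow> real"
  assumes "\<And>n. 0 \<le> a n" "\<And>n. 0 \<le> b n"
  shows "(\<Sum>n=1..N. dirichlet_conv a b n) \<le> (\<Sum>n=1..N. a n) * (\<Sum>n=1..N. b n)"
proof -
  let ?P = "Sigma {1..N} (\<lambda>n. {d. d dvd n})" and ?j = "\<lambda>(n, d). (d, n div d :: nat)"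
  have inj: "inj_on ?j ?P" by (auto simp: inj_on_def)
  have img: "?j ` ?P \<subseteq> {1..N} \<times> {1..N}"
  proof
    fix p assume "p \<in> ?j ` ?P"
    then obtain n d where p: "p = (d, n div d)" "1 \<le> n" "n \<le> N" "d dvd n" by auto
    then show "p \<in> {1..N} \<times> {1..N}" using divisor_bounds[OF p(4,2)] order_trans[OF div_le_dividend p(3)] by simp
  qed
  have "(\<Sum>n=1..N. dirichlet_conv a b n) = (\<Sum>n=1..N. \<Sum>d\<in>{d. d dvd n}. a d * b (n div d))"
    by (rule sum.cong) (auto simp: dirichlet_conv_def)
  also have "\<dots> = (\<Sum>(n, d)\<in>?P. a d * b (n div d))" by (rule sum.Sigma) auto
  also have "\<dots> = (\<Sum>(d, m)\<in>?j ` ?P. a d * b m)" by (subst sum.reindex[OF inj]) (auto intro!: sum.cong)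
  also have "\<dots> \<le> (\<Sum>(d, m)\<in>{1..N} \<times> {1..N}. a d * b m)"
    by (rule sum_mono2) (use img assms in auto)
  also have "\<dots> = (\<Sum>n=1..N. a n) * (\<Sum>n=1..N. b n)" by (simp add: sum_product sum.cartesian_product)
  finally show ?thesis .
qed

lemma norm_dirichlet_conv_le:
  fixes a b :: "nat \<Rightarrow> complex"
  shows "norm (dirichlet_conv a b n) \<le> dirichlet_conv (\<lambda>n. norm (a n)) (\<lambda>n. norm (b n)) n"
  unfolding dirichlet_conv_def by (auto simp: norm_mult intro!: sum_norm_le)

lemma l1_coeffsI:
  assumes "\<And>n. n \<notin> smooth_over I \<Longrightarrow> a n = 0" "\<And>N. (\<Sum>n=1..N. norm (a n)) \<le> r"
  shows "l1_coeffs I a r"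
  unfolding l1_coeffs_def
proof (intro conjI allI impI)
  fix F :: "nat set" assume F: "finite F"
  have "(\<Sum>n\<in>F. norm (a n)) = (\<Sum>n\<in>F - {0}. norm (a n))"
    by (rule sum.mono_neutral_right) (use F assms(1)[OF zero_not_smooth] in auto)
  also have "\<dots> \<le> (\<Sum>n=1..Max (insert 0 F). norm (a n))"
    by (rule sum_mono2) (use F in \<open>auto simp: Suc_le_eq\<close>)
  also have "\<dots> \<le> r" by (rule assms(2))
  finally show "(\<Sum>n\<in>F. norm (a n)) \<le> r" .
qed (use assms in blast)

lemma dirichlet_conv_support:
  assumes "\<And>n. n \<notin> smooth_over I \<Longrightarrow> a n = (0::complex)" "\<And>n. n \<notin> smooth_over I \<Longrightarrow> b n = 0" "n \<notin> smooth_over I"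
  shows "dirichlet_conv a b n = 0"
proof (cases "n = 0")
  case False
  have "a d * b (n div d) = 0" if d: "d dvd n" for d
  proof -
    have "d * (n div d) = n" "d \<ge> 1" "n div d \<ge> 1" using d False by (auto simp: Suc_le_eq intro!: Nat.gr0I)
    then have "d \<notin> smooth_over I \<or> n div d \<notin> smooth_over I" using assms(3) smooth_mult_iff[of d "n div d" I] by auto
    then show ?thesis using assms(1,2) by auto
  qed
  then have "(\<Sum>d | d dvd n. a d * b (n div d)) = 0" by (intro sum.neutral) blast
  then show ?thesis by (simp add: dirichlet_conv_def)
qed (simp add: dirichlet_conv_def)

lemma l1_coeffs_conv:
  assumes a: "l1_coeffs I a r" and b: "l1_coeffs I b s" shows "l1_coeffs I (dirichlet_conv a b) (r * s)"
proof (rule l1_coeffsI)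
  show "dirichlet_conv a b n = 0" if "n \<notin> smooth_over I" for n
    using dirichlet_conv_support[OF _ _ that] a b unfolding l1_coeffs_def by blast
  fix N
  have r: "0 \<le> r" using a unfolding l1_coeffs_def by (metis finite.emptyI sum.empty)
  have "(\<Sum>n=1..N. norm (dirichlet_conv a b n)) \<le> (\<Sum>n=1..N. dirichlet_conv (\<lambda>n. norm (a n)) (\<lambda>n. norm (b n)) n)"
    by (rule sum_mono) (rule norm_dirichlet_conv_le)
  also have "\<dots> \<le> (\<Sum>n=1..N. norm (a n)) * (\<Sum>n=1..N. norm (b n))" by (rule sum_dirichlet_conv_le) auto
  also have "\<dots> \<le> r * s"
    using a b r unfolding l1_coeffs_def by (intro mult_mono sum_nonneg) auto
  finally show "(\<Sum>n=1..N. norm (dirichlet_conv a b n)) \<le> r * s" .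
qed

text \<open>
  The product of two absolutely convergent series, with the terms grouped by the product of the indices.
\<close>

lemma has_sum_dirichlet_conv:
  assumes a: "l1_coeffs I a r" and b: "l1_coeffs I b s" and z: "z \<in> topspace (closed_polydisc I)"
    and x: "((\<lambda>n. a n * bohr_monomial z n) has_sum x) UNIV" and y: "((\<lambda>n. b n * bohr_monomial z n) has_sum y) UNIV"
  shows "((\<lambda>n. dirichlet_conv a b n * bohr_monomial z n) has_sum x * y) UNIV"
proof -
  have a0: "a 0 = 0" "b 0 = 0" using a b zero_not_smooth unfolding l1_coeffs_def by blast+
  have r: "0 \<le> r" using a unfolding l1_coeffs_def by (metis finite.emptyI sum.empty)
  let ?g = "\<lambda>(d, m). (a d * bohr_monomial z d) * (b m * bohr_monomial z m)"
  have sum: "(\<lambda>p. norm (?g p)) summable_on UNIV \<times> UNIV"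
  proof (rule nonneg_bdd_above_summable_on)
    show "bdd_above (sum (\<lambda>p. norm (?g p)) ` {F. F \<subseteq> UNIV \<times> UNIV \<and> finite F})"
    proof (rule bdd_aboveI2)
      fix F :: "(nat \<times> nat) set" assume "F \<in> {F. F \<subseteq> UNIV \<times> UNIV \<and> finite F}"
      then have F: "finite F" by simp
      have "(\<Sum>p\<in>F. norm (?g p)) \<le> (\<Sum>p\<in>fst ` F \<times> snd ` F. norm (?g p))"
        by (rule sum_mono2) (use F in force)+
      also have "\<dots> = (\<Sum>d\<in>fst ` F. norm (a d * bohr_monomial z d)) * (\<Sum>m\<in>snd ` F. norm (b m * bohr_monomial z m))"
        unfolding sum_product sum.cartesian_product by (rule sum.cong) (auto simp: norm_mult)
      also have "\<dots> \<le> (\<Sum>d\<in>fst ` F. norm (a d)) * (\<Sum>m\<in>snd ` F. norm (b m))"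
        by (intro mult_mono sum_mono l1_term_le[OF a z] l1_term_le[OF b z] sum_nonneg) auto
      also have "\<dots> \<le> r * s" using a b F r unfolding l1_coeffs_def by (intro mult_mono sum_nonneg) auto
      finally show "(\<Sum>p\<in>F. norm (?g p)) \<le> r * s" .
    qed
  qed auto
  have "infsum ?g (UNIV \<times> UNIV) = (\<Sum>\<^sub>\<infinity>d. \<Sum>\<^sub>\<infinity>m. (a d * bohr_monomial z d) * (b m * bohr_monomial z m))"
    using infsum_Sigma_banach[OF abs_summable_summable[OF sum]] by simp
  also have "\<dots> = x * y"
    using infsumI[OF has_sum_cmult_right[OF y]] infsumI[OF has_sum_cmult_left[OF x]] by simp
  finally have "infsum ?g (UNIV \<times> UNIV) = x * y" .
  then have "(?g has_sum x * y) (UNIV \<times> UNIV)"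
    using has_sum_infsum[OF abs_summable_summable[OF sum]] by (simp only:)
  then have g: "(?g has_sum x * y) ({1..} \<times> {1..})"
    by (subst has_sum_cong_neutral[where T = "UNIV \<times> UNIV" and g = ?g])
       (auto simp: Suc_le_eq intro!: Nat.gr0I, simp_all add: a0)
  let ?P = "Sigma {1..} (\<lambda>n. {d. d dvd n})" and ?j = "\<lambda>(n, d). (d, n div d :: nat)"
  have inj: "inj_on ?j ?P" by (auto simp: inj_on_def)
  have img: "?j ` ?P = {1..} \<times> {1..}"
  proof (intro equalityI subsetI)
    fix p :: "nat \<times> nat" assume "p \<in> {1..} \<times> {1..}"
    then obtain d m where p: "p = (d, m)" "d \<ge> 1" "m \<ge> 1" by auto
    then have "p = ?j (d * m, d)" "(d * m, d) \<in> ?P" by auto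
    then show "p \<in> ?j ` ?P" by blast
  next
    fix p assume "p \<in> ?j ` ?P"
    then obtain n d where p: "p = (d, n div d)" "1 \<le> n" "d dvd n" by auto
    then show "p \<in> {1..} \<times> {1..}" using divisor_bounds[OF p(3,2)] by auto
  qed
  have "((?g \<circ> ?j) has_sum x * y) ?P"
    using g unfolding img[symmetric] has_sum_reindex[OF inj] .
  then have "((\<lambda>n. \<Sum>d | d dvd n. (?g \<circ> ?j) (n, d)) has_sum x * y) {1..}"
    by (rule has_sum_Sigma') (rule has_sum_finite, auto)
  then show ?thesis
  proof (subst has_sum_cong_neutral[where T = "{1..}" and g = "\<lambda>n. \<Sum>d | d dvd n. (?g \<circ> ?j) (n, d)"])
    fix n :: nat assume "n \<in> UNIV \<inter> {1..}"
    then have n: "n \<ge> 1" by simp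
    have "a d * bohr_monomial z d * (b (n div d) * bohr_monomial z (n div d)) = a d * b (n div d) * bohr_monomial z n" if "d dvd n" for d
    proof -
      have "d \<ge> 1" "n div d \<ge> 1" "d * (n div d) = n" using that n by (auto simp: Suc_le_eq intro!: Nat.gr0I)
      then have "bohr_monomial z n = bohr_monomial z d * bohr_monomial z (n div d)" by (metis bohr_monomial_mult)
      then show ?thesis by simp
    qed
    then have "(\<Sum>d | d dvd n. (?g \<circ> ?j) (n, d)) = (\<Sum>d | d dvd n. a d * b (n div d) * bohr_monomial z n)"
      by (intro sum.cong refl) (simp only: o_def split mem_Collect_eq)
    then show "dirichlet_conv a b n * bohr_monomial z n = (\<Sum>d | d dvd n. (?g \<circ> ?j) (n, d))"
      using n by (simp add: dirichlet_conv_def sum_distrib_right)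
  qed (auto simp: dirichlet_conv_def)
qed

text \<open>
  The coefficients of \<open>k = h / (1 - h)\<close>, obtained by solving \<open>k = h + k * h\<close> for one coefficient after the other in the order of
  divisibility. The term \<open>d = n\<close> of the convolution contributes the denominator.
\<close>

function dirichlet_resolvent :: "(nat \<Rightarrow> complex) \<Rightarrow> nat \<Rightarrow> complex" where
  "dirichlet_resolvent a n =
     (a n + (\<Sum>d\<in>{d. d dvd n \<and> d < n}. dirichlet_resolvent a d * a (n div d))) / (1 - a 1)"
  by auto
termination by (relation "Wellfounded.measure snd") auto

declare dirichlet_resolvent.simps [simp del]

lemma dirichlet_resolvent_eq:
  assumes "a 1 \<noteq> 1" "n \<noteq> 0"
  shows "dirichlet_resolvent a n = a n + dirichlet_conv (dirichlet_resolvent a) a n"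
proof -
  let ?k = "dirichlet_resolvent a"
  have "{d. d dvd n} = insert n {d. d dvd n \<and> d < n}" using assms(2) by (auto dest: dvd_imp_le)
  then have "dirichlet_conv ?k a n = ?k n * a 1 + (\<Sum>d\<in>{d. d dvd n \<and> d < n}. ?k d * a (n div d))"
    using assms(2) by (simp add: dirichlet_conv_def)
  moreover have "?k n * (1 - a 1) = a n + (\<Sum>d\<in>{d. d dvd n \<and> d < n}. ?k d * a (n div d))"
    using assms(1) by (subst dirichlet_resolvent.simps) simp
  ultimately show ?thesis by (simp add: algebra_simps)
qed

text \<open>
  The recursion determines the coefficients without any convergence. Summing its moduli up to \<open>N\<close> gives
  \<open>K \<le> r + K * r\<close> for the finite partial sum \<open>K\<close>, and hence the bound uniformly in \<open>N\<close>.
\<close>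

lemma l1_coeffs_resolvent:
  assumes a: "l1_coeffs I a r" and r: "r < 1"
  shows "l1_coeffs I (dirichlet_resolvent a) (r / (1 - r))"
    and "\<And>n. dirichlet_resolvent a n = a n + dirichlet_conv (dirichlet_resolvent a) a n"
proof -
  let ?k = "dirichlet_resolvent a"
  have supp: "a n = 0" if "n \<notin> smooth_over I" for n using a that unfolding l1_coeffs_def by blast
  have "(\<Sum>n\<in>{1}. norm (a n)) \<le> r" using a unfolding l1_coeffs_def by blast
  then have a1: "a 1 \<noteq> 1" using r by auto
  have ksupp: "?k n = 0" if "n \<notin> smooth_over I" for n
    using that
  proof (induction n rule: less_induct)
    case (less n)
    have "?k d * a (n div d) = 0" if d: "d dvd n" "d < n" for d
    proof (cases "d \<in> smooth_over I")
      case True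
      have "d * (n div d) = n" "d \<ge> 1" "n div d \<ge> 1" using d by (auto simp: Suc_le_eq intro!: Nat.gr0I)
      then have "n div d \<notin> smooth_over I" using True less.prems smooth_mult_iff[of d "n div d" I] by auto
      then show ?thesis by (simp add: supp)
    qed (use less.IH d in simp)
    then have "(\<Sum>d\<in>{d. d dvd n \<and> d < n}. ?k d * a (n div d)) = 0" by (intro sum.neutral) blast
    then show ?case using supp[OF less.prems] by (subst dirichlet_resolvent.simps) simp
  qed
  show eq: "?k n = a n + dirichlet_conv ?k a n" for n
  proof (cases "n = 0")
    case True
    then show ?thesis using ksupp[OF zero_not_smooth] supp[OF zero_not_smooth] by (simp add: dirichlet_conv_def)
  qed (use dirichlet_resolvent_eq[of a n] a1 in simp)
  show "l1_coeffs I ?k (r / (1 - r))"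
  proof (rule l1_coeffsI[OF ksupp])
    fix N
    let ?K = "\<Sum>n=1..N. norm (?k n)"
    have ar: "(\<Sum>n=1..N. norm (a n)) \<le> r" using a unfolding l1_coeffs_def by blast
    have "?K \<le> (\<Sum>n=1..N. norm (a n) + dirichlet_conv (\<lambda>n. norm (?k n)) (\<lambda>n. norm (a n)) n)"
      by (rule sum_mono, subst eq)
         (intro order_trans[OF norm_triangle_ineq] add_left_mono norm_dirichlet_conv_le)
    also have "\<dots> \<le> (\<Sum>n=1..N. norm (a n)) + ?K * (\<Sum>n=1..N. norm (a n))"
      unfolding sum.distrib by (intro add_left_mono sum_dirichlet_conv_le) auto
    also have "\<dots> \<le> r + ?K * r" by (intro add_mono mult_left_mono ar sum_nonneg) auto
    finally have "?K * (1 - r) \<le> r" by (simp add: algebra_simps)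
    then show "?K \<le> r / (1 - r)" using r by (simp add: pos_le_divide_eq)
  qed
qed

context perm_action
begin

lemma hat_smooth:
  assumes "g \<in> G" "n \<in> smooth_over I" shows "hat g n \<in> smooth_over I"
proof -
  have "n \<ge> 1" using assms(2) by (rule smooth_overD)
  then have "n \<in> smooth_over I \<longrightarrow> hat g n \<in> smooth_over I"
  proof (induction n rule: nth_prime_induct)
    case (mult i n)
    have i: "1 \<le> g i" using G_ge_1[OF assms(1)] mult by simp
    have h: "hat g (nth_prime i * n) = nth_prime (g i) * hat g n"
      using mult unfolding hat_eq_bohr_monomial by (simp add: bohr_monomial_mult bohr_monomial_nth_prime Suc_le_eq)
    have n1: "1 \<le> hat g n" using hat_ge_1 mult G_ge_1[OF assms(1)] by blast
    show ?case
      using mult i n1 G_I[OF assms(1)] unfolding h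
      by (simp add: smooth_mult_iff nth_prime_smooth_iff)
  qed (simp add: hat_eq_bohr_monomial)
  then show ?thesis using assms(2) by blast
qed

lemma hat_inverse:
  assumes "g \<in> G" "\<And>i. i \<ge> 1 \<Longrightarrow> g' (g i) = i" "g' \<in> G" "n \<ge> 1" shows "hat g' (hat g n) = n"
  using hat_comp[of n g g'] hat_id[of n "\<lambda>i. g' (g i)"] assms G_ge_1 by simp

lemma bohr_monomial_act:
  assumes "g \<in> G" "n \<in> smooth_over I" shows "bohr_monomial (act g z) n = bohr_monomial z (hat g n)"
proof -
  have "bohr_monomial (act g z) n = bohr_monomial (\<lambda>i. z (g i)) n"
    by (rule bohr_monomial_cong_smooth[OF assms(2)]) simp
  then show ?thesis using bohr_monomial_hat[of n g z] smooth_overD[OF assms(2)] G_ge_1[OF assms(1)] by simp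
qed

lemma hat_image_smooth:
  assumes g: "g \<in> G" shows "inj_on (hat g) (smooth_over I)" "hat g ` smooth_over I = smooth_over I"
proof -
  obtain g' where g': "g' \<in> G" "\<And>i. i \<ge> 1 \<Longrightarrow> g' (g i) = i" "\<And>i. i \<ge> 1 \<Longrightarrow> g (g' i) = i" using inv_G[OF g] by metis
  have 1: "hat g' (hat g n) = n" "hat g (hat g' n) = n" if "n \<in> smooth_over I" for n
    using hat_inverse[OF g g'(2,1)] hat_inverse[OF g'(1,3) g] smooth_overD[OF that] by auto
  show "inj_on (hat g) (smooth_over I)" using 1 by (metis inj_onI)
  show "hat g ` smooth_over I = smooth_over I"
  proof (intro equalityI subsetI)
    fix n assume "n \<in> smooth_over I"
    then show "n \<in> hat g ` smooth_over I"
      using 1(2)[of n] hat_smooth[OF g'(1), of n] by (intro image_eqI[where x = "hat g' n"]) auto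
  qed (use hat_smooth[OF g] in blast)
qed

text \<open>
  The action on points permutes the monomials, hence the coefficients, by \<open>hat\<close>.
\<close>

lemma l1_act:
  assumes g: "g \<in> G" and g': "g' \<in> G" "\<And>i. i \<ge> 1 \<Longrightarrow> g' (g i) = i"
    and a: "l1_coeffs I a r"
  shows "l1_coeffs I (\<lambda>m. if m \<in> smooth_over I then a (hat g' m) else 0) r"
    and "((\<lambda>n. a n * bohr_monomial (act g z) n) has_sum x) UNIV \<Longrightarrow>
      ((\<lambda>m. (if m \<in> smooth_over I then a (hat g' m) else 0) * bohr_monomial z m) has_sum x) UNIV"
proof -
  let ?a = "\<lambda>m. if m \<in> smooth_over I then a (hat g' m) else 0"
  show "l1_coeffs I ?a r"
    unfolding l1_coeffs_def
  proof (intro conjI allI impI)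
    fix F :: "nat set" assume F: "finite F"
    have "(\<Sum>n\<in>F. norm (?a n)) = (\<Sum>n\<in>F \<inter> smooth_over I. norm (a (hat g' n)))"
      by (rule sum.mono_neutral_cong_right) (use F in auto)
    also have "\<dots> = (\<Sum>n\<in>hat g' ` (F \<inter> smooth_over I). norm (a n))"
      using inj_on_subset[OF hat_image_smooth(1)[OF g'(1)]] by (subst sum.reindex) auto
    also have "\<dots> \<le> r" by (rule l1_coeffs_sum_le[OF a]) (use F in simp)
    finally show "(\<Sum>n\<in>F. norm (?a n)) \<le> r" .
  qed auto
  assume "((\<lambda>n. a n * bohr_monomial (act g z) n) has_sum x) UNIV"
  then have hs: "((\<lambda>n. a n * bohr_monomial (act g z) n) has_sum x) (smooth_over I)"
    using a by (subst has_sum_cong_neutral[where T = UNIV and g = "\<lambda>n. a n * bohr_monomial (act g z) n"])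
      (auto simp: l1_coeffs_def)
  have eq: "a n * bohr_monomial (act g z) n = ((\<lambda>m. ?a m * bohr_monomial z m) \<circ> hat g) n" if "n \<in> smooth_over I" for n
    using that hat_smooth[OF g that] bohr_monomial_act[OF g that] hat_inverse[OF g g'(2,1)] smooth_overD[OF that] by simp
  have "(((\<lambda>m. ?a m * bohr_monomial z m) \<circ> hat g) has_sum x) (smooth_over I)"
    by (rule has_sum_cong[THEN iffD1, OF eq hs])
  then have "((\<lambda>m. ?a m * bohr_monomial z m) has_sum x) (smooth_over I)"
    using has_sum_reindex[OF hat_image_smooth(1)[OF g], of "\<lambda>m. ?a m * bohr_monomial z m" x] hat_image_smooth(2)[OF g] by simp
  then show "((\<lambda>m. ?a m * bohr_monomial z m) has_sum x) UNIV"
    by (subst has_sum_cong_neutral[where T = "smooth_over I" and g = "\<lambda>m. ?a m * bohr_monomial z m"]) auto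
qed

lemma sup_norm_polydisc: "polydisc_norm G (sup_bd I)"
proof unfold_locales
  let ?D = "topspace (closed_polydisc I)"
  have act: "act g z \<in> ?D" if "z \<in> ?D" "g \<in> G" for z g
    using closed_polydisc_norm_le[OF that(1)] G_I[OF that(2)] by (intro closed_polydiscI) (auto simp: act_def)
  fix h k :: "(nat \<Rightarrow> complex) \<Rightarrow> complex" and r s :: real
  show "sup_bd I k r" if "\<And>z. z \<in> ?D \<Longrightarrow> h z = k z" "sup_bd I h r"
    using that by (simp add: sup_bd_def)
  show "sup_bd I (\<lambda>z. c) (norm c)" for c by (simp add: sup_bd_def)
  show "sup_bd I (\<lambda>z. z i) 1" if "i \<in> I" for i
    using closed_polydisc_norm_le[OF _ that] by (auto simp: sup_bd_def)
  show "sup_bd I (\<lambda>z. h z + k z) (r + s)" if "sup_bd I h r" "sup_bd I k s"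
    using that unfolding sup_bd_def by (meson add_mono norm_triangle_ineq order_trans)
  show "sup_bd I (\<lambda>z. h z * k z) (r * s)" if "sup_bd I h r" "sup_bd I k s"
    using that unfolding sup_bd_def norm_mult by (meson mult_mono norm_ge_zero order_trans)
  show "norm (h z) \<le> r" if "sup_bd I h r" "z \<in> ?D" for z using that by (simp add: sup_bd_def)
  show "sup_bd I (\<lambda>z. h (act g z)) r" if "g \<in> G" "sup_bd I h r" for g
    using that act by (simp add: sup_bd_def)
  show "\<exists>s. sup_bd I (\<lambda>z. h z / (1 - h z)) s" if h: "sup_bd I h r" and r: "r < 1"
  proof (intro exI, unfold sup_bd_def, rule ballI)
    fix z assume z: "z \<in> ?D"
    have hz: "norm (h z) \<le> r" using h z by (simp add: sup_bd_def)
    have "1 - r \<le> norm (1 - h z)" using norm_triangle_ineq2[of 1 "h z"] hz by simp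
    then show "norm (h z / (1 - h z)) \<le> r / (1 - r)"
      using hz r by (simp add: norm_divide frac_le order_trans[OF norm_ge_zero])
  qed
  show "sup_bd I h s" if "sup_bd I h r" "r \<le> s" using that by (force simp: sup_bd_def)
qed

lemma l1_norm_polydisc: "polydisc_norm G (l1_bd I)"
proof unfold_locales
  let ?D = "topspace (closed_polydisc I)"
  fix h k :: "(nat \<Rightarrow> complex) \<Rightarrow> complex" and r s :: real
  show "l1_bd I k r" if "\<And>z. z \<in> ?D \<Longrightarrow> h z = k z" "l1_bd I h r"
    using that by (simp add: l1_bd_def)
  show "l1_bd I (\<lambda>z. c) (norm c)" for c
    using l1_bd_monomial[OF one_smooth, of I c] by simp
  show "l1_bd I (\<lambda>z. z i) 1" if "i \<in> I" for i
    using l1_bd_monomial[of "nth_prime i" I 1] that I_ge_1[OF that]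
    by (simp add: nth_prime_smooth_iff bohr_monomial_nth_prime)
  show "l1_bd I (\<lambda>z. h z + k z) (r + s)" if hk: "l1_bd I h r" "l1_bd I k s"
  proof -
    obtain a where a: "l1_coeffs I a r" "\<And>z. z \<in> ?D \<Longrightarrow> ((\<lambda>n. a n * bohr_monomial z n) has_sum h z) UNIV"
      by (rule l1_bdE[OF hk(1)]) (rule that)
    obtain b where b: "l1_coeffs I b s" "\<And>z. z \<in> ?D \<Longrightarrow> ((\<lambda>n. b n * bohr_monomial z n) has_sum k z) UNIV"
      by (rule l1_bdE[OF hk(2)]) (rule that)
    have "(\<Sum>n\<in>F. norm (a n + b n)) \<le> r + s" if "finite F" for F
    proof -
      have "(\<Sum>n\<in>F. norm (a n + b n)) \<le> (\<Sum>n\<in>F. norm (a n)) + (\<Sum>n\<in>F. norm (b n))"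
        unfolding sum.distrib[symmetric] by (rule sum_mono) (rule norm_triangle_ineq)
      moreover have "(\<Sum>n\<in>F. norm (a n)) \<le> r" "(\<Sum>n\<in>F. norm (b n)) \<le> s"
        using l1_coeffs_sum_le[OF a(1) that] l1_coeffs_sum_le[OF b(1) that] .
      ultimately show ?thesis by linarith
    qed
    then have "l1_coeffs I (\<lambda>n. a n + b n) (r + s)" using a(1) b(1) by (simp add: l1_coeffs_def)
    moreover have "((\<lambda>n. (a n + b n) * bohr_monomial z n) has_sum h z + k z) UNIV" if "z \<in> ?D" for z
      using has_sum_add[OF a(2) b(2), OF that that] by (simp add: algebra_simps)
    ultimately show ?thesis by (rule l1_bdI)
  qed
  show "l1_bd I (\<lambda>z. h z * k z) (r * s)" if hk: "l1_bd I h r" "l1_bd I k s"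
  proof -
    obtain a where a: "l1_coeffs I a r" "\<And>z. z \<in> ?D \<Longrightarrow> ((\<lambda>n. a n * bohr_monomial z n) has_sum h z) UNIV"
      by (rule l1_bdE[OF hk(1)]) (rule that)
    obtain b where b: "l1_coeffs I b s" "\<And>z. z \<in> ?D \<Longrightarrow> ((\<lambda>n. b n * bohr_monomial z n) has_sum k z) UNIV"
      by (rule l1_bdE[OF hk(2)]) (rule that)
    show ?thesis
      by (rule l1_bdI[OF l1_coeffs_conv[OF a(1) b(1)] has_sum_dirichlet_conv[OF a(1) b(1) _ a(2) b(2)]])
  qed
  show "norm (h z) \<le> r" if h: "l1_bd I h r" and z: "z \<in> ?D" for z
  proof -
    obtain a where a: "l1_coeffs I a r" "\<And>z. z \<in> ?D \<Longrightarrow> ((\<lambda>n. a n * bohr_monomial z n) has_sum h z) UNIV"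
      by (rule l1_bdE[OF h]) (rule that)
    show ?thesis by (rule l1_has_sum_norm_le[OF a(1) z a(2)[OF z]])
  qed
  show "l1_bd I (\<lambda>z. h (act g z)) r" if g: "g \<in> G" and h: "l1_bd I h r" for g
  proof -
    obtain g' where g': "g' \<in> G" "\<And>i. i \<ge> 1 \<Longrightarrow> g' (g i) = i" using inv_G[OF g] by metis
    obtain a where a: "l1_coeffs I a r" "\<And>z. z \<in> ?D \<Longrightarrow> ((\<lambda>n. a n * bohr_monomial z n) has_sum h z) UNIV"
      by (rule l1_bdE[OF h]) (rule that)
    have D: "act g z \<in> ?D" if "z \<in> ?D" for z
      using closed_polydisc_norm_le[OF that] G_I[OF g] by (intro closed_polydiscI) (auto simp: act_def)
    show ?thesis
    proof (rule l1_bdI)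
      show "l1_coeffs I (\<lambda>m. if m \<in> smooth_over I then a (hat g' m) else 0) r"
        by (rule l1_act(1)[OF g g'(1) _ a(1)]) (rule g'(2))
      fix z assume z: "z \<in> ?D"
      show "((\<lambda>m. (if m \<in> smooth_over I then a (hat g' m) else 0) * bohr_monomial z m) has_sum h (act g z)) UNIV"
        by (rule l1_act(2)[OF g g'(1) _ a(1) a(2)[OF D[OF z]]]) (rule g'(2))
    qed
  qed
  show "\<exists>s. l1_bd I (\<lambda>z. h z / (1 - h z)) s" if h: "l1_bd I h r" and r: "r < 1"
  proof -
    obtain a where a: "l1_coeffs I a r" "\<And>z. z \<in> ?D \<Longrightarrow> ((\<lambda>n. a n * bohr_monomial z n) has_sum h z) UNIV"
      by (rule l1_bdE[OF h]) (rule that)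
    let ?k = "dirichlet_resolvent a"
    note k = l1_coeffs_resolvent[OF a(1) r]
    have "((\<lambda>n. ?k n * bohr_monomial z n) has_sum h z / (1 - h z)) UNIV" if z: "z \<in> ?D" for z
    proof -
      define y where "y = (\<Sum>\<^sub>\<infinity>n. ?k n * bohr_monomial z n)"
      have y: "((\<lambda>n. ?k n * bohr_monomial z n) has_sum y) UNIV" unfolding y_def by (rule l1_has_sum[OF k(1) z])
      have "((\<lambda>n. a n * bohr_monomial z n + dirichlet_conv ?k a n * bohr_monomial z n) has_sum h z + y * h z) UNIV"
        by (rule has_sum_add[OF a(2)[OF z] has_sum_dirichlet_conv[OF k(1) a(1) z y a(2)[OF z]]])
      moreover have "a n * bohr_monomial z n + dirichlet_conv ?k a n * bohr_monomial z n = ?k n * bohr_monomial z n" for n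
        by (simp only: distrib_right[symmetric] k(2)[symmetric])
      ultimately have "((\<lambda>n. ?k n * bohr_monomial z n) has_sum h z + y * h z) UNIV" by simp
      with y have "y = h z + y * h z" by (rule has_sum_unique)
      moreover have "norm (h z) \<le> r" by (rule l1_has_sum_norm_le[OF a(1) z a(2)[OF z]])
      then have "1 - h z \<noteq> 0" using r by auto
      ultimately have "y = h z / (1 - h z)" by (simp add: field_simps)
      with y show ?thesis by simp
    qed
    with k(1) have "l1_bd I (\<lambda>z. h z / (1 - h z)) (r / (1 - r))" by (rule l1_bdI)
    then show ?thesis by (rule exI)
  qed
  show "l1_bd I h s" if h: "l1_bd I h r" and rs: "r \<le> s"
  proof -
    obtain a where a: "l1_coeffs I a r" "\<And>z. z \<in> ?D \<Longrightarrow> ((\<lambda>n. a n * bohr_monomial z n) has_sum h z) UNIV"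
      by (rule l1_bdE[OF h]) (rule that)
    have "l1_coeffs I a s" using a(1) rs unfolding l1_coeffs_def by force
    then show ?thesis using a(2) by (rule l1_bdI)
  qed
qed

end

section \<open>Dirichlet series and uniform limits of Dirichlet polynomials\<close>

text \<open>
  Uniform approximability by Dirichlet polynomials on the half plane. It makes no reference to a series, and together with
  extensionality it describes \<open>dirichlet_A\<close>.
\<close>

definition poly_near :: "(complex \<Rightarrow> complex) \<Rightarrow> bool" where
  "poly_near f \<longleftrightarrow> (\<forall>e>0. \<exists>S b. finite S \<and> S \<subseteq> {1..} \<and> half_plane_le (\<lambda>s. f s - dirichlet_sum S b s) e)"

lemma poly_nearE:
  assumes "poly_near f" "e > 0"
  obtains S b where "finite S" "S \<subseteq> {1..}" "half_plane_le (\<lambda>s. f s - dirichlet_sum S b s) e"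
  using assms unfolding poly_near_def by metis

lemma dirichlet_sum_extend:
  assumes "finite T" "S \<subseteq> T"
  shows "dirichlet_sum S b s = dirichlet_sum T (\<lambda>n. if n \<in> S then b n else 0) s"
  unfolding dirichlet_sum_def by (rule sum.mono_neutral_cong_left) (use assms in auto)

lemma dirichlet_sum_diff: "dirichlet_sum S a s - dirichlet_sum S b s = dirichlet_sum S (\<lambda>n. a n - b n) s"
  by (simp add: dirichlet_sum_def sum_subtractf left_diff_distrib)

lemma has_dirichlet_seriesD:
  assumes "has_dirichlet_series f a" "\<delta> > 0" "\<eta> > 0"
  shows "\<forall>\<^sub>F N in sequentially. \<forall>s. Re s > \<delta> \<longrightarrow> norm (dirichlet_sum {1..N} a s - f s) < \<eta>"
  using assms unfolding has_dirichlet_series_def uniform_limit_iff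
  by (auto simp: dirichlet_sum_def dist_norm)

lemma has_dirichlet_seriesI:
  assumes "\<And>\<delta> \<eta>. \<delta> > 0 \<Longrightarrow> \<eta> > 0 \<Longrightarrow> \<forall>\<^sub>F N in sequentially. \<forall>s. Re s > \<delta> \<longrightarrow> norm (dirichlet_sum {1..N} a s - f s) < \<eta>"
  shows "has_dirichlet_series f a"
  using assms unfolding has_dirichlet_series_def uniform_limit_iff
  by (auto simp: dirichlet_sum_def dist_norm)

text \<open>
  The coefficient bound for Dirichlet polynomials is applied to partial sums after moving to the right by \<open>\<delta>\<close>, where they converge
  uniformly; then \<open>\<delta>\<close> tends to 0.
\<close>

lemma dirichlet_coeff_close:
  assumes f: "has_dirichlet_series f a" and f': "has_dirichlet_series f' a'"
    and e: "half_plane_le (\<lambda>s. f s - f' s) e" and n: "n \<ge> 1"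
  shows "norm (a n - a' n) \<le> e"
proof -
  have *: "norm (a n - a' n) * real n powr (- \<delta>) \<le> e" if \<delta>: "\<delta> > 0" for \<delta>
  proof (rule field_le_epsilon)
    fix \<eta> :: real assume \<eta>: "\<eta> > 0"
    have "\<forall>\<^sub>F N in sequentially. (\<forall>s. Re s > \<delta> / 2 \<longrightarrow> norm (dirichlet_sum {1..N} a s - f s) < \<eta> / 2) \<and>
        (\<forall>s. Re s > \<delta> / 2 \<longrightarrow> norm (dirichlet_sum {1..N} a' s - f' s) < \<eta> / 2) \<and> n \<le> N"
      using \<delta> \<eta> by (intro eventually_conj has_dirichlet_seriesD f f' eventually_ge_at_top) auto
    then obtain N where N: "\<And>s. Re s > \<delta> / 2 \<Longrightarrow> norm (dirichlet_sum {1..N} a s - f s) < \<eta> / 2"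
      "\<And>s. Re s > \<delta> / 2 \<Longrightarrow> norm (dirichlet_sum {1..N} a' s - f' s) < \<eta> / 2" "n \<le> N"
      by (auto simp: eventually_sequentially)
    let ?c = "\<lambda>m. (a m - a' m) * of_nat m powr (- of_real \<delta>)"
    have "norm (?c n) \<le> e + \<eta>"
    proof (rule dirichlet_coeff_le)
      show "half_plane_le (dirichlet_sum {1..N} ?c) (e + \<eta>)"
        unfolding half_plane_le_def
      proof
        fix s assume "s \<in> right_half_plane"
        then have s: "Re s > 0" by (simp add: right_half_plane_def)
        let ?s = "s + of_real \<delta>"
        have s': "Re ?s > \<delta> / 2" using s \<delta> by simp
        have "norm (f ?s - f' ?s) \<le> e" using e s \<delta> by (simp add: half_plane_le_def right_half_plane_def)
        moreover have "dirichlet_sum {1..N} ?c s = (dirichlet_sum {1..N} a ?s - f ?s) - (dirichlet_sum {1..N} a' ?s - f' ?s) + (f ?s - f' ?s)"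
          by (subst dirichlet_sum_shift[symmetric]) (auto simp: dirichlet_sum_diff[symmetric])
        ultimately show "norm (dirichlet_sum {1..N} ?c s) \<le> e + \<eta>"
          using N(1)[OF s'] N(2)[OF s'] norm_triangle_ineq[of "(dirichlet_sum {1..N} a ?s - f ?s) - (dirichlet_sum {1..N} a' ?s - f' ?s)" "f ?s - f' ?s"]
            norm_triangle_ineq4[of "dirichlet_sum {1..N} a ?s - f ?s" "dirichlet_sum {1..N} a' ?s - f' ?s"] by simp
      qed
    qed (use n N in auto)
    then show "norm (a n - a' n) * real n powr (- \<delta>) \<le> e + \<eta>" using n by (simp add: norm_mult norm_of_nat_powr)
  qed
  have "((\<lambda>\<delta>. norm (a n - a' n) * real n powr (- \<delta>)) \<longlongrightarrow> norm (a n - a' n) * real n powr (- 0)) (at_right 0)"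
    using n by (intro tendsto_intros) auto
  then have "((\<lambda>\<delta>. norm (a n - a' n) * real n powr (- \<delta>)) \<longlongrightarrow> norm (a n - a' n)) (at_right 0)"
    using n by simp
  then show ?thesis
    by (rule tendsto_upperbound) (auto intro!: * eventually_mono[OF eventually_at_right_less[of 0]])
qed

lemma dirichlet_coeff_unique:
  assumes "has_dirichlet_series f a" "has_dirichlet_series f' a'" "\<And>s. s \<in> right_half_plane \<Longrightarrow> f s = f' s" "n \<ge> 1"
  shows "a n = a' n"
  using dirichlet_coeff_close[OF assms(1,2) _ assms(4), of 0] assms(3) by (simp add: half_plane_le_def)

lemma dirichlet_sum_series:
  assumes "finite S" "S \<subseteq> {1..}"
  shows "has_dirichlet_series (dirichlet_sum S b) (\<lambda>n. if n \<in> S then b n else 0)"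
proof (rule has_dirichlet_seriesI)
  fix \<delta> \<eta> :: real assume \<eta>: "\<eta> > 0"
  show "\<forall>\<^sub>F N in sequentially. \<forall>s. Re s > \<delta> \<longrightarrow> norm (dirichlet_sum {1..N} (\<lambda>n. if n \<in> S then b n else 0) s - dirichlet_sum S b s) < \<eta>"
    using eventually_ge_at_top[of "Max (insert 0 S)"]
  proof eventually_elim
    case (elim N)
    then have "S \<subseteq> {1..N}" using assms by auto
    then show ?case using dirichlet_sum_extend[of "{1..N}" S b] \<eta> by simp
  qed
qed

lemma dirichlet_series_unique_fun:
  assumes "has_dirichlet_series f a" "has_dirichlet_series f' a'" "\<And>n. n \<ge> 1 \<Longrightarrow> a n = a' n" "s \<in> right_half_plane"
  shows "f s = f' s"
proof (rule ccontr)
  assume neg: "f s \<noteq> f' s"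
  define \<eta> where "\<eta> = norm (f s - f' s) / 2"
  have \<eta>: "\<eta> > 0" using neg by (simp add: \<eta>_def)
  have s: "Re s > Re s / 2" "Re s / 2 > 0" using assms(4) by (auto simp: right_half_plane_def)
  have "\<forall>\<^sub>F N in sequentially. (\<forall>s'. Re s' > Re s / 2 \<longrightarrow> norm (dirichlet_sum {1..N} a s' - f s') < \<eta>) \<and>
        (\<forall>s'. Re s' > Re s / 2 \<longrightarrow> norm (dirichlet_sum {1..N} a' s' - f' s') < \<eta>)"
    by (intro eventually_conj has_dirichlet_seriesD assms(1,2) s \<eta>)
  then have "\<forall>\<^sub>F N in sequentially. norm (dirichlet_sum {1..N} a s - f s) < \<eta> \<and> norm (dirichlet_sum {1..N} a' s - f' s) < \<eta>"
    by (rule eventually_mono) (use s in blast)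
  then obtain N where N: "norm (dirichlet_sum {1..N} a s - f s) < \<eta>" "norm (dirichlet_sum {1..N} a' s - f' s) < \<eta>"
    by (auto simp: eventually_sequentially)
  have "dirichlet_sum {1..N} a s = dirichlet_sum {1..N} a' s"
    unfolding dirichlet_sum_def by (rule sum.cong) (use assms(3) in auto)
  then show False
    using N norm_triangle_ineq4[of "dirichlet_sum {1..N} a s - f' s" "dirichlet_sum {1..N} a s - f s"]
    by (simp add: \<eta>_def)
qed

text \<open>
  The coefficients of the approximating Dirichlet polynomials are Cauchy sequences. By \<open>partial_sum_bounded\<close> their partial sums are
  close on \<open>Re s > \<delta>\<close> uniformly in the length, so the limit series converges uniformly there, and to \<open>f\<close>.
\<close>

lemma has_dirichlet_series_if_poly_near:
  assumes "poly_near f" obtains a where "has_dirichlet_series f a"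
proof -
  have "\<exists>S b. finite S \<and> S \<subseteq> {1..} \<and> half_plane_le (\<lambda>s. f s - dirichlet_sum S b s) (inverse (real (Suc k)))" for k
    using assms by (simp add: poly_near_def)
  then obtain S b where Sb: "\<And>k. finite (S k)" "\<And>k. S k \<subseteq> {1..}"
    "\<And>k. half_plane_le (\<lambda>s. f s - dirichlet_sum (S k) (b k) s) (inverse (real (Suc k)))" by metis
  define c where "c k n = (if n \<in> S k then b k n else 0)" for k n
  let ?e = "\<lambda>k. inverse (real (Suc k))"
  have diff: "half_plane_le (\<lambda>s. dirichlet_sum (S k) (b k) s - dirichlet_sum (S l) (b l) s) (?e k + ?e l)" for k l
    unfolding half_plane_le_def
  proof
    fix s assume s: "s \<in> right_half_plane"
    show "norm (dirichlet_sum (S k) (b k) s - dirichlet_sum (S l) (b l) s) \<le> ?e k + ?e l"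
      using bspec[OF Sb(3)[of k, unfolded half_plane_le_def] s] bspec[OF Sb(3)[of l, unfolded half_plane_le_def] s]
        norm_triangle_ineq4[of "f s - dirichlet_sum (S l) (b l) s" "f s - dirichlet_sum (S k) (b k) s"] by simp
  qed
  have cc: "norm (c k n - c l n) \<le> ?e k + ?e l" if "n \<ge> 1" for k l n
    unfolding c_def by (rule dirichlet_coeff_close[OF dirichlet_sum_series[OF Sb(1,2)] dirichlet_sum_series[OF Sb(1,2)] diff that])
  have e0: "?e \<longlonglongrightarrow> 0" by (rule LIMSEQ_inverse_real_of_nat)
  have conv: "convergent (\<lambda>k. c k n)" if n: "n \<ge> 1" for n
  proof (rule Cauchy_convergent, rule CauchyI)
    fix e :: real assume "e > 0"
    then have "\<forall>\<^sub>F k in sequentially. ?e k < e / 2" using e0 by (intro order_tendstoD) auto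
    then obtain M where M: "\<And>k. k \<ge> M \<Longrightarrow> ?e k < e / 2" by (auto simp: eventually_sequentially)
    show "\<exists>M. \<forall>k\<ge>M. \<forall>l\<ge>M. norm (c k n - c l n) < e"
    proof (intro exI[of _ M] allI impI)
      fix k l assume "M \<le> k" "M \<le> l"
      then show "norm (c k n - c l n) < e" using M[of k] M[of l] cc[OF n, of k l] by linarith
    qed
  qed
  define a where "a n = lim (\<lambda>k. c k n)" for n
  have lim: "(\<lambda>k. c k n) \<longlonglongrightarrow> a n" if "n \<ge> 1" for n
    unfolding a_def using conv[OF that] by (simp add: convergent_LIMSEQ_iff)
  have "has_dirichlet_series f a"
  proof (rule has_dirichlet_seriesI)
    fix \<delta> \<eta> :: real assume \<delta>: "\<delta> > 0" and \<eta>: "\<eta> > 0"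
    obtain K where K: "K \<ge> 0" "\<And>S b C N s. finite S \<Longrightarrow> S \<subseteq> {1..} \<Longrightarrow> half_plane_le (dirichlet_sum S b) C \<Longrightarrow> Re s > \<delta> \<Longrightarrow>
        norm (dirichlet_sum {n\<in>S. n \<le> N} b s) \<le> K * C" using partial_sum_bounded[OF \<delta>] by metis
    have "(\<lambda>k. K * ?e k + ?e k) \<longlonglongrightarrow> K * 0 + 0" by (intro tendsto_intros e0)
    then have "\<forall>\<^sub>F k in sequentially. K * ?e k + ?e k < \<eta>" using \<eta> by (intro order_tendstoD) auto
    then obtain k where k: "K * ?e k + ?e k < \<eta>" by (auto simp: eventually_sequentially)
    show "\<forall>\<^sub>F N in sequentially. \<forall>s. Re s > \<delta> \<longrightarrow> norm (dirichlet_sum {1..N} a s - f s) < \<eta>"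
      using eventually_ge_at_top[of "Max (insert 0 (S k))"]
    proof (eventually_elim, intro allI impI)
      fix N s assume N: "Max (insert 0 (S k)) \<le> N" and s: "Re s > \<delta>"
      have SkN: "S k \<subseteq> {1..N}" using N Sb(1,2)[of k] by auto
      have le: "norm (dirichlet_sum {1..N} (\<lambda>n. c l n - c k n) s) \<le> K * (?e l + ?e k)" for l
      proof -
        let ?T = "S l \<union> S k"
        have "dirichlet_sum ?T (\<lambda>n. c l n - c k n) s' = dirichlet_sum (S l) (b l) s' - dirichlet_sum (S k) (b k) s'" for s'
          unfolding dirichlet_sum_diff[symmetric] c_def using Sb(1) by (subst (1 2) dirichlet_sum_extend[of ?T]) auto
        then have "half_plane_le (dirichlet_sum ?T (\<lambda>n. c l n - c k n)) (?e l + ?e k)" using diff[of l k] by (simp add: half_plane_le_def)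
        then have "norm (dirichlet_sum {n \<in> ?T. n \<le> N} (\<lambda>n. c l n - c k n) s) \<le> K * (?e l + ?e k)"
          using Sb(1,2) s by (intro K(2)) auto
        moreover have "dirichlet_sum {n \<in> ?T. n \<le> N} (\<lambda>n. c l n - c k n) s = dirichlet_sum {1..N} (\<lambda>n. c l n - c k n) s"
          unfolding dirichlet_sum_def using Sb(2) by (intro sum.mono_neutral_left) (auto simp: c_def subset_iff)
        ultimately show ?thesis by simp
      qed
      have "(\<lambda>l. norm (dirichlet_sum {1..N} (\<lambda>n. c l n - c k n) s)) \<longlonglongrightarrow> norm (dirichlet_sum {1..N} (\<lambda>n. a n - c k n) s)"
        unfolding dirichlet_sum_def by (intro tendsto_intros lim) auto
      moreover have "(\<lambda>l. K * (?e l + ?e k)) \<longlonglongrightarrow> K * (0 + ?e k)" by (intro tendsto_intros e0)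
      ultimately have 1: "norm (dirichlet_sum {1..N} (\<lambda>n. a n - c k n) s) \<le> K * (0 + ?e k)"
        using le by (intro LIMSEQ_le) auto
      have "s \<in> right_half_plane" using s \<delta> by (simp add: right_half_plane_def)
      then have 2: "norm (f s - dirichlet_sum (S k) (b k) s) \<le> ?e k" using Sb(3)[of k] by (simp add: half_plane_le_def)
      have eq: "dirichlet_sum {1..N} a s - f s = dirichlet_sum {1..N} (\<lambda>n. a n - c k n) s - (f s - dirichlet_sum (S k) (b k) s)"
        unfolding dirichlet_sum_diff[symmetric] c_def using dirichlet_sum_extend[OF _ SkN, of "b k" s] by simp
      show "norm (dirichlet_sum {1..N} a s - f s) < \<eta>"
        unfolding eq
        using 1[unfolded add_0_left] 2 k norm_triangle_ineq4[of "dirichlet_sum {1..N} (\<lambda>n. a n - c k n) s" "f s - dirichlet_sum (S k) (b k) s"]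
        by linarith
    qed
  qed
  then show thesis by (rule that)
qed

lemma dirichlet_coeff_near:
  assumes "has_dirichlet_series f a" "finite S" "S \<subseteq> {1..}" "half_plane_le (\<lambda>s. f s - dirichlet_sum S b s) e" "n \<ge> 1"
  shows "norm (a n - (if n \<in> S then b n else 0)) \<le> e"
  by (rule dirichlet_coeff_close[OF assms(1) dirichlet_sum_series[OF assms(2,3)] assms(4,5)])

text \<open>
  On the half plane the terms are bounded by the moduli of their coefficients, so the tails are uniformly small.
\<close>

lemma abs_conv_dirichlet_tail:
  assumes a: "(\<lambda>n. norm (a n)) summable_on {1..}"
    and f: "\<And>s. s \<in> right_half_plane \<Longrightarrow> ((\<lambda>n. a n * of_nat n powr (- s)) has_sum f s) {1..}"
    and e: "e > 0"
  shows "\<exists>M. \<forall>N\<ge>M. half_plane_le (\<lambda>s. f s - dirichlet_sum {1..N} a s) e"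
proof -
  obtain T where T: "((\<lambda>n. norm (a n)) has_sum T) {1..}" using a by (auto simp: summable_on_def)
  then have "\<forall>\<^sub>F F in finite_subsets_at_top {1..}. dist (\<Sum>n\<in>F. norm (a n)) T < e"
    unfolding has_sum_def using e by (rule tendstoD)
  then obtain F where F: "finite F" "F \<subseteq> {1..}"
    "\<And>Y. finite Y \<Longrightarrow> F \<subseteq> Y \<Longrightarrow> Y \<subseteq> {1..} \<Longrightarrow> dist (\<Sum>n\<in>Y. norm (a n)) T < e"
    unfolding eventually_finite_subsets_at_top by metis
  have "half_plane_le (\<lambda>s. f s - dirichlet_sum {1..N} a s) e" if N: "N \<ge> Max (insert 0 F)" for N
    unfolding half_plane_le_def
  proof
    fix s assume s: "s \<in> right_half_plane"
    have "F \<subseteq> {1..N}" using N F by auto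
    then have d: "dist (\<Sum>n\<in>{1..N}. norm (a n)) T < e" by (intro F(3)) auto
    let ?R = "{1..} - {1..N}"
    have tail: "((\<lambda>n. a n * of_nat n powr (- s)) has_sum (f s - dirichlet_sum {1..N} a s)) ?R"
      unfolding dirichlet_sum_def by (rule has_sum_Diff[OF f[OF s] has_sum_finite]) auto
    have "((\<lambda>n. norm (a n)) has_sum (T - (\<Sum>n\<in>{1..N}. norm (a n)))) ?R"
      by (rule has_sum_Diff[OF T has_sum_finite]) auto
    then have tailn: "(\<Sum>n\<in>Y. norm (a n)) \<le> T - (\<Sum>n\<in>{1..N}. norm (a n))" if "finite Y" "Y \<subseteq> ?R" for Y
      using that by (intro finite_sum_le_has_sum) auto
    have "norm (f s - dirichlet_sum {1..N} a s) \<le> T - (\<Sum>n\<in>{1..N}. norm (a n))"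
    proof (rule tendsto_upperbound[OF tendsto_norm[OF tail[unfolded has_sum_def]]])
      show "\<forall>\<^sub>F Y in finite_subsets_at_top ?R. norm (\<Sum>n\<in>Y. a n * of_nat n powr (- s)) \<le> T - (\<Sum>n\<in>{1..N}. norm (a n))"
      proof (rule eventually_finite_subsets_at_top_weakI)
        fix Y :: "nat set" assume Y: "finite Y" "Y \<subseteq> ?R"
        have "norm (\<Sum>n\<in>Y. a n * of_nat n powr (- s)) \<le> (\<Sum>n\<in>Y. norm (a n))"
        proof (rule sum_norm_le)
          fix n assume "n \<in> Y"
          then have n: "n \<ge> 1" using Y by auto
          have "real n powr (- Re s) \<le> real n powr 0"
            using n s by (intro powr_mono) (auto simp: right_half_plane_def)
          then show "norm (a n * of_nat n powr (- s)) \<le> norm (a n)"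
            using n by (simp add: norm_mult norm_of_nat_powr mult_left_le)
        qed
        then show "norm (\<Sum>n\<in>Y. a n * of_nat n powr (- s)) \<le> T - (\<Sum>n\<in>{1..N}. norm (a n))"
          using tailn[OF Y] by linarith
      qed
    qed simp
    then show "norm (f s - dirichlet_sum {1..N} a s) \<le> e" using d by (simp add: dist_real_def)
  qed
  then show ?thesis by blast
qed

lemma abs_conv_dirichlet_series:
  assumes a: "(\<lambda>n. norm (a n)) summable_on {1..}"
    and f: "\<And>s. s \<in> right_half_plane \<Longrightarrow> ((\<lambda>n. a n * of_nat n powr (- s)) has_sum f s) {1..}"
  shows "has_dirichlet_series f a" "poly_near f"
proof -
  show "has_dirichlet_series f a"
  proof (rule has_dirichlet_seriesI)
    fix \<delta> \<eta> :: real assume d: "\<delta> > 0" and \<eta>: "\<eta> > 0"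
    obtain M where M: "\<And>N. N \<ge> M \<Longrightarrow> half_plane_le (\<lambda>s. f s - dirichlet_sum {1..N} a s) (\<eta> / 2)"
      using abs_conv_dirichlet_tail[OF a f, of "\<eta> / 2"] \<eta> by auto
    show "\<forall>\<^sub>F N in sequentially. \<forall>s. Re s > \<delta> \<longrightarrow> norm (dirichlet_sum {1..N} a s - f s) < \<eta>"
      using eventually_ge_at_top[of M]
    proof (eventually_elim, intro allI impI)
      fix N s assume "M \<le> N" and s: "Re s > \<delta>"
      then have "norm (f s - dirichlet_sum {1..N} a s) \<le> \<eta> / 2" using M d by (simp add: half_plane_le_def right_half_plane_def)
      then show "norm (dirichlet_sum {1..N} a s - f s) < \<eta>" using \<eta> by (simp add: norm_minus_commute)
    qed
  qed
  show "poly_near f"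
    unfolding poly_near_def
  proof (intro allI impI)
    fix e :: real assume "e > 0"
    then obtain M where "\<And>N. N \<ge> M \<Longrightarrow> half_plane_le (\<lambda>s. f s - dirichlet_sum {1..N} a s) e"
      using abs_conv_dirichlet_tail[OF a f] by metis
    then show "\<exists>S b. finite S \<and> S \<subseteq> {1..} \<and> half_plane_le (\<lambda>s. f s - dirichlet_sum S b s) e"
      by (intro exI[of _ "{1..M}"] exI[of _ a]) auto
  qed
qed

lemma dirichlet_W_poly_near: "f \<in> dirichlet_W \<Longrightarrow> poly_near f"
  unfolding dirichlet_W_def using abs_conv_dirichlet_series(2) by blast

lemma dirichlet_A_poly_near:
  assumes "f \<in> dirichlet_A" shows "poly_near f"
  unfolding poly_near_def
proof (intro allI impI)
  fix e :: real assume e: "e > 0"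
  then have "\<exists>g\<in>dirichlet_W. \<forall>s\<in>right_half_plane. norm (f s - g s) \<le> e / 2"
    using assms half_gt_zero[OF e] unfolding dirichlet_A_def by blast
  then obtain g where g: "g \<in> dirichlet_W" "\<And>s. s \<in> right_half_plane \<Longrightarrow> norm (f s - g s) \<le> e / 2" by blast
  obtain S b where S: "finite S" "S \<subseteq> {1..}" "half_plane_le (\<lambda>s. g s - dirichlet_sum S b s) (e / 2)"
    using poly_nearE[OF dirichlet_W_poly_near[OF g(1)] half_gt_zero[OF e]] by metis
  have "norm (f s - dirichlet_sum S b s) \<le> e" if "s \<in> right_half_plane" for s
    using g(2)[OF that] bspec[OF S(3)[unfolded half_plane_le_def] that] norm_triangle_ineq[of "f s - g s" "g s - dirichlet_sum S b s"] by simp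
  then show "\<exists>S b. finite S \<and> S \<subseteq> {1..} \<and> half_plane_le (\<lambda>s. f s - dirichlet_sum S b s) e"
    using S(1,2) by (intro exI[of _ S] exI[of _ b]) (simp add: half_plane_le_def)
qed

lemma dirichlet_sum_holomorphic: "S \<subseteq> {1..} \<Longrightarrow> dirichlet_sum S b holomorphic_on A"
  unfolding dirichlet_sum_def[abs_def] by (intro holomorphic_intros) auto

lemma open_right_half_plane: "open right_half_plane"
  unfolding right_half_plane_def by (rule open_halfspace_Re_gt)

lemma dirichlet_sum_W:
  assumes S: "finite S" "S \<subseteq> {1..}" shows "restrict (dirichlet_sum S b) right_half_plane \<in> dirichlet_W"
proof -
  let ?a = "\<lambda>n. if n \<in> S then b n else 0"
  have "(\<lambda>n. norm (?a n)) summable_on S" using S by (intro summable_on_finite)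
  then have "(\<lambda>n. norm (?a n)) summable_on {1..}"
    by (subst summable_on_cong_neutral[where T = S and g = "\<lambda>n. norm (?a n)"]) (use S in auto)
  moreover have "((\<lambda>n. ?a n * of_nat n powr (- s)) has_sum dirichlet_sum S b s) {1..}" for s
  proof -
    have "((\<lambda>n. b n * of_nat n powr (- s)) has_sum dirichlet_sum S b s) S"
      unfolding dirichlet_sum_def using S by (intro has_sum_finite)
    then show ?thesis
      by (subst has_sum_cong_neutral[where T = S and g = "\<lambda>n. b n * of_nat n powr (- s)"]) (use S in auto)
  qed
  ultimately show ?thesis unfolding dirichlet_W_def by (intro CollectI conjI exI[of _ ?a]) auto
qed

text \<open>
  Holomorphy and boundedness pass from the Dirichlet polynomials to the uniform limit.
\<close>

lemma poly_near_dirichlet_A: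
  assumes near: "poly_near f" and ext: "f \<in> extensional right_half_plane" shows "f \<in> dirichlet_A"
proof -
  have "\<exists>S b. finite S \<and> S \<subseteq> {1..} \<and> half_plane_le (\<lambda>s. f s - dirichlet_sum S b s) (inverse (real (Suc k)))" for k
    using near by (simp add: poly_near_def)
  then obtain S b where Sb: "\<And>k. finite (S k)" "\<And>k. S k \<subseteq> {1..}"
    "\<And>k. half_plane_le (\<lambda>s. f s - dirichlet_sum (S k) (b k) s) (inverse (real (Suc k)))" by metis
  have lim: "uniform_limit right_half_plane (\<lambda>k. dirichlet_sum (S k) (b k)) f sequentially"
    unfolding uniform_limit_iff
  proof (intro allI impI)
    fix e :: real assume "e > 0"
    then have "\<forall>\<^sub>F k in sequentially. inverse (real (Suc k)) < e"
      using LIMSEQ_inverse_real_of_nat order_tendstoD(2) by blast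
    then show "\<forall>\<^sub>F k in sequentially. \<forall>s\<in>right_half_plane. dist (dirichlet_sum (S k) (b k) s) (f s) < e"
    proof (eventually_elim, intro ballI)
      fix k s assume "inverse (real (Suc k)) < e" "s \<in> right_half_plane"
      then show "dist (dirichlet_sum (S k) (b k) s) (f s) < e"
        using bspec[OF Sb(3)[of k, unfolded half_plane_le_def]] by (fastforce simp: dist_norm norm_minus_commute)
    qed
  qed
  have "f holomorphic_on right_half_plane"
  proof (rule holomorphic_uniform_sequence[OF open_right_half_plane])
    show "dirichlet_sum (S k) (b k) holomorphic_on right_half_plane" for k
      by (rule dirichlet_sum_holomorphic[OF Sb(2)])
    fix x assume "x \<in> right_half_plane"
    then obtain d where "d > 0" "cball x d \<subseteq> right_half_plane"
      using open_right_half_plane open_contains_cball by blast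
    then show "\<exists>d>0. cball x d \<subseteq> right_half_plane \<and> uniform_limit (cball x d) (\<lambda>k. dirichlet_sum (S k) (b k)) f sequentially"
      using uniform_limit_on_subset[OF lim] by blast
  qed
  moreover have "bounded (f ` right_half_plane)"
  proof (rule boundedI)
    fix w assume "w \<in> f ` right_half_plane"
    then obtain s where s: "s \<in> right_half_plane" "w = f s" by blast
    have "norm (dirichlet_sum (S 0) (b 0) s) \<le> (\<Sum>n\<in>S 0. norm (b 0 n))"
      unfolding dirichlet_sum_def
    proof (rule sum_norm_le)
      fix n assume "n \<in> S 0"
      then have n: "n \<ge> 1" using Sb(2)[of 0] by auto
      have "real n powr (- Re s) \<le> real n powr 0" using n s by (intro powr_mono) (auto simp: right_half_plane_def)
      then show "norm (b 0 n * of_nat n powr (- s)) \<le> norm (b 0 n)"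
        using n by (simp add: norm_mult norm_of_nat_powr mult_left_le)
    qed
    moreover have "norm (f s - dirichlet_sum (S 0) (b 0) s) \<le> 1"
      using bspec[OF Sb(3)[of 0, unfolded half_plane_le_def] s(1)] by simp
    ultimately show "norm w \<le> (\<Sum>n\<in>S 0. norm (b 0 n)) + 1"
      using norm_triangle_ineq[of "f s - dirichlet_sum (S 0) (b 0) s" "dirichlet_sum (S 0) (b 0) s"] s(2) by simp
  qed
  moreover have "\<exists>g\<in>dirichlet_W. \<forall>s\<in>right_half_plane. norm (f s - g s) \<le> e" if e: "e > 0" for e
  proof -
    obtain S b where S: "finite S" "S \<subseteq> {1..}" "half_plane_le (\<lambda>s. f s - dirichlet_sum S b s) e"
      using poly_nearE[OF near e] by metis
    then show ?thesis using dirichlet_sum_W[OF S(1,2), of b]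
      by (intro bexI[of _ "restrict (dirichlet_sum S b) right_half_plane"]) (auto simp: half_plane_le_def)
  qed
  ultimately show ?thesis using ext unfolding dirichlet_A_def by simp
qed

section \<open>The Dirichlet algebras as algebras on the polydisc\<close>

context perm_action
begin

sublocale sup_norm: polydisc_norm G "sup_bd I" by (rule sup_norm_polydisc)

sublocale l1_norm: polydisc_norm G "l1_bd I" by (rule l1_norm_polydisc)

text \<open>
  At these points the monomials take the values of the terms of a Dirichlet series.
\<close>

definition bohr_point :: "complex \<Rightarrow> nat \<Rightarrow> complex" where
  "bohr_point s = (\<lambda>i\<in>I. of_nat (nth_prime i) powr (- s))"

lemma bohr_monomial_bohr_point: assumes "n \<in> smooth_over I" shows "bohr_monomial (bohr_point s) n = of_nat n powr (- s)"
proof -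
  have "bohr_monomial (bohr_point s) n = bohr_monomial (\<lambda>i. of_nat (nth_prime i) powr (- s)) n"
    by (rule bohr_monomial_cong_smooth[OF assms]) (simp add: bohr_point_def)
  then show ?thesis using bohr_monomial_powr[OF smooth_overD[OF assms]] by simp
qed

lemma bohr_point_D: assumes "s \<in> right_half_plane" shows "bohr_point s \<in> topspace (closed_polydisc I)"
proof (rule closed_polydiscI)
  fix i assume i: "i \<in> I"
  have p: "nth_prime i \<ge> 1" using I_ge_1[OF i] by simp
  have "real (nth_prime i) powr (- Re s) \<le> real (nth_prime i) powr 0"
    using p assms by (intro powr_mono) (auto simp: right_half_plane_def)
  then show "norm (bohr_point s i) \<le> 1" using i p by (simp add: bohr_point_def norm_of_nat_powr)
qed (simp add: bohr_point_def)

lemma dpoly_bohr_point: "S \<subseteq> smooth_over I \<Longrightarrow> dpoly S b (bohr_point s) = dirichlet_sum S b s"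
  unfolding dpoly_def dirichlet_sum_def by (rule sum.cong) (auto simp: bohr_monomial_bohr_point subset_iff)

lemma smooth_subset_ge_1: "S \<subseteq> smooth_over I \<Longrightarrow> S \<subseteq> {1..}"
  using smooth_overD by auto

text \<open>
  Terms that involve a coordinate outside \<open>I\<close> disappear when this coordinate is set to 0, and Bohr's inequality allows all points of
  the polydisc.
\<close>

lemma bohr_inequality_D:
  assumes S: "finite S" "S \<subseteq> {1..}" and C: "half_plane_le (dirichlet_sum S b) C"
    and z: "z \<in> topspace (closed_polydisc I)"
  shows "norm (dpoly (S \<inter> smooth_over I) b z) \<le> C"
proof -
  let ?z = "\<lambda>i. if i \<in> I then z i else 0"
  have "dpoly (S \<inter> smooth_over I) b z = dpoly S b ?z"
    unfolding dpoly_def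
  proof (rule sum.mono_neutral_cong_left)
    show "\<forall>n\<in>S - S \<inter> smooth_over I. b n * bohr_monomial ?z n = 0"
    proof
      fix n assume n: "n \<in> S - S \<inter> smooth_over I"
      then have "n \<ge> 1" using S by auto
      then obtain i where "i \<ge> 1" "nth_prime i dvd n" "i \<notin> I" using n unfolding smooth_over_def by blast
      then have "bohr_monomial ?z n = 0" using \<open>n \<ge> 1\<close> by (intro bohr_monomial_eq_0) auto
      then show "b n * bohr_monomial ?z n = 0" by simp
    qed
    show "b n * bohr_monomial z n = b n * bohr_monomial ?z n" if "n \<in> S \<inter> smooth_over I" for n
      using bohr_monomial_cong_smooth[of n I z ?z] that by simp
  qed (use S in auto)
  moreover have "norm (?z i) \<le> 1" for i using closed_polydisc_norm_le[OF z] by simp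
  ultimately show ?thesis using bohr_inequality[OF S C, of ?z] by simp
qed

lemma approxE_dpoly:
  assumes "h \<in> sup_norm.approx" "e > 0"
  obtains S b where "finite S" "S \<subseteq> smooth_over I" "sup_bd I (\<lambda>z. h z - dpoly S b z) e"
proof -
  obtain p where p: "p \<in> poly_fun I" "sup_bd I (\<lambda>z. h z - p z) e" by (rule bexE[OF sup_norm.approxD[OF assms]])
  obtain S b where "finite S" "S \<subseteq> smooth_over I" "p = dpoly S b" using poly_fun_eq_dpoly[OF p(1) I_sub] by blast
  then show thesis using that p(2) by blast
qed

lemma half_plane_le_bohr_point:
  assumes "sup_bd I (\<lambda>z. h z - dpoly S b z) e" "S \<subseteq> smooth_over I"
  shows "half_plane_le (\<lambda>s. h (bohr_point s) - dirichlet_sum S b s) e"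
  using assms bohr_point_D by (auto simp: half_plane_le_def sup_bd_def dpoly_bohr_point[symmetric])

lemma approx_poly_near: assumes h: "h \<in> sup_norm.approx" shows "poly_near (\<lambda>s. h (bohr_point s))"
  unfolding poly_near_def
proof (intro allI impI)
  fix e :: real assume e: "e > 0"
  obtain S b where S: "finite S" "S \<subseteq> smooth_over I" "sup_bd I (\<lambda>z. h z - dpoly S b z) e"
    by (rule approxE_dpoly[OF h e]) (rule that)
  show "\<exists>S b. finite S \<and> S \<subseteq> {1..} \<and> half_plane_le (\<lambda>s. h (bohr_point s) - dirichlet_sum S b s) e"
    by (rule exI[of _ S], rule exI[of _ b]) (intro conjI S(1) smooth_subset_ge_1[OF S(2)] half_plane_le_bohr_point[OF S(3,2)])
qed

text \<open>
  Bohr's inequality for approximating polynomials shows that the Bohr points determine a function on the whole polydisc.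
\<close>

lemma approx_eq_0:
  assumes h: "h \<in> sup_norm.approx" and 0: "\<And>s. s \<in> right_half_plane \<Longrightarrow> h (bohr_point s) = 0"
    and z: "z \<in> topspace (closed_polydisc I)"
  shows "h z = 0"
proof -
  have "norm (h z) \<le> e" if e: "e > 0" for e
  proof -
    obtain S b where S: "finite S" "S \<subseteq> smooth_over I" "sup_bd I (\<lambda>z. h z - dpoly S b z) (e / 2)"
      by (rule approxE_dpoly[OF h half_gt_zero[OF e]]) (rule that)
    have "half_plane_le (dirichlet_sum S b) (e / 2)"
      using half_plane_le_bohr_point[OF S(3,2)] 0 by (simp add: half_plane_le_def)
    then have "norm (dpoly (S \<inter> smooth_over I) b z) \<le> e / 2"
      using bohr_inequality_D[OF S(1) smooth_subset_ge_1[OF S(2)] _ z] by blast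
    moreover have "S \<inter> smooth_over I = S" using S(2) by blast
    moreover have "norm (h z - dpoly S b z) \<le> e / 2" using S(3) z by (simp add: sup_bd_def)
    ultimately show ?thesis using norm_triangle_ineq[of "h z - dpoly S b z" "dpoly S b z"] by simp
  qed
  then have "norm (h z) \<le> 0" by (rule field_le_epsilon[of _ 0, simplified add_0_left])
  then show ?thesis by simp
qed

lemma approx_coeff_support:
  assumes h: "h \<in> sup_norm.approx" and a: "has_dirichlet_series (\<lambda>s. h (bohr_point s)) a"
    and n: "n \<ge> 1" "n \<notin> smooth_over I"
  shows "a n = 0"
proof -
  have "norm (a n) \<le> e" if e: "e > 0" for e
  proof -
    obtain S b where S: "finite S" "S \<subseteq> smooth_over I" "sup_bd I (\<lambda>z. h z - dpoly S b z) e"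
      by (rule approxE_dpoly[OF h e]) (rule that)
    have "norm (a n - (if n \<in> S then b n else 0)) \<le> e"
      by (rule dirichlet_coeff_near[OF a S(1) smooth_subset_ge_1[OF S(2)] half_plane_le_bohr_point[OF S(3,2)] n(1)])
    moreover have "n \<notin> S" using n S by blast
    ultimately show ?thesis by simp
  qed
  then have "norm (a n) \<le> 0" by (rule field_le_epsilon[of _ 0, simplified add_0_left])
  then show ?thesis by simp
qed

lemma approx_act: assumes "h \<in> sup_norm.approx" "g \<in> G" shows "(\<lambda>z. h (act g z)) \<in> sup_norm.approx"
proof (rule sup_norm.approxI)
  fix e :: real assume e: "e > 0"
  obtain p where p: "p \<in> poly_fun I" "sup_bd I (\<lambda>z. h z - p z) e" by (rule bexE[OF sup_norm.approxD[OF assms(1) e]])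
  show "\<exists>p\<in>poly_fun I. sup_bd I (\<lambda>z. h (act g z) - p z) e"
    by (rule bexI[where x = "\<lambda>z. p (act g z)"])
       (rule sup_norm.bd_act[OF assms(2) p(2)], rule poly_fun_act[OF p(1) assms(2)])
qed

text \<open>
  True for polynomials, and the coefficients depend continuously on the function.
\<close>

lemma approx_coeff_act:
  assumes h: "h \<in> sup_norm.approx" and a: "has_dirichlet_series (\<lambda>s. h (bohr_point s)) a"
    and g: "g \<in> G" and a1: "has_dirichlet_series (\<lambda>s. h (act g (bohr_point s))) a1"
    and n: "n \<in> smooth_over I"
  shows "a1 (hat g n) = a n"
proof -
  obtain g' where g': "g' \<in> G" "\<And>i. i \<ge> 1 \<Longrightarrow> g' (g i) = i" using inv_G[OF g] by metis
  note inj = hat_image_smooth(1)[OF g]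
  have "norm (a1 (hat g n) - a n) \<le> e" if e: "e > 0" for e
  proof -
    obtain S b where S: "finite S" "S \<subseteq> smooth_over I" "sup_bd I (\<lambda>z. h z - dpoly S b z) (e / 2)"
      by (rule approxE_dpoly[OF h half_gt_zero[OF e]]) (rule that)
    let ?S = "hat g ` S" and ?b = "\<lambda>m. b (hat g' m)"
    have inv: "hat g' (hat g m) = m" if "m \<in> smooth_over I" for m
      using hat_inverse[OF g g'(2,1)] smooth_overD[OF that] by blast
    have S': "?S \<subseteq> smooth_over I" using S(2) hat_smooth[OF g] by blast
    have "dpoly S b (act g z) = dpoly ?S ?b z" for z
    proof -
      have "dpoly ?S ?b z = (\<Sum>m\<in>S. b (hat g' (hat g m)) * bohr_monomial z (hat g m))"
        unfolding dpoly_def using inj_on_subset[OF inj S(2)] by (subst sum.reindex) auto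
      also have "\<dots> = dpoly S b (act g z)"
        unfolding dpoly_def using S(2) by (intro sum.cong) (auto simp: inv bohr_monomial_act[OF g] subset_iff)
      finally show ?thesis ..
    qed
    then have "sup_bd I (\<lambda>z. h (act g z) - dpoly ?S ?b z) (e / 2)"
      using sup_norm.bd_act[OF g S(3)] by simp
    from half_plane_le_bohr_point[OF this S']
    have "norm (a1 (hat g n) - (if hat g n \<in> ?S then ?b (hat g n) else 0)) \<le> e / 2"
      using S(1) smooth_subset_ge_1[OF S'] smooth_overD[OF hat_smooth[OF g n]]
      by (intro dirichlet_coeff_near[OF a1]) auto
    moreover have "norm (a n - (if n \<in> S then b n else 0)) \<le> e / 2"
      by (rule dirichlet_coeff_near[OF a S(1) smooth_subset_ge_1[OF S(2)] half_plane_le_bohr_point[OF S(3,2)] smooth_overD[OF n]])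
    moreover have "hat g n \<in> ?S \<longleftrightarrow> n \<in> S"
      using inj_on_image_mem_iff[OF inj n S(2)] .
    ultimately show ?thesis
      using inv[OF n] norm_triangle_ineq4[of "a1 (hat g n) - (if n \<in> S then b n else 0)" "a n - (if n \<in> S then b n else 0)"]
      by (cases "n \<in> S") simp_all
  qed
  then have "norm (a1 (hat g n) - a n) \<le> 0" by (rule field_le_epsilon[of _ 0, simplified add_0_left])
  then show ?thesis by simp
qed

lemma hat_smooth_iff:
  assumes "g \<in> G" "n \<ge> 1" shows "hat g n \<in> smooth_over I \<longleftrightarrow> n \<in> smooth_over I"
proof -
  obtain g' where g': "g' \<in> G" "\<And>i. i \<ge> 1 \<Longrightarrow> g' (g i) = i" using inv_G[OF assms(1)] by metis
  have "hat g' (hat g n) = n" by (rule hat_inverse[OF assms(1) g'(2,1) assms(2)])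
  then show ?thesis using hat_smooth[OF assms(1)] hat_smooth[OF g'(1)] by metis
qed

text \<open>
  The series of \<open>h\<close> and of its translate by \<open>g\<close> coincide, and the second arises from the first by permuting the coefficients.
\<close>

lemma inv_approx_coeff_invariant:
  assumes h: "h \<in> sup_norm.inv_approx" and a: "has_dirichlet_series (\<lambda>s. h (bohr_point s)) a"
    and g: "g \<in> G" and n: "n \<ge> 1"
  shows "a (hat g n) = a n"
proof (cases "n \<in> smooth_over I")
  case True
  obtain a1 where a1: "has_dirichlet_series (\<lambda>s. h (act g (bohr_point s))) a1"
    by (rule has_dirichlet_series_if_poly_near[OF approx_poly_near[OF approx_act[OF sup_norm.inv_approx_approx[OF h] g]]])
  have "a1 (hat g n) = a n" by (rule approx_coeff_act[OF sup_norm.inv_approx_approx[OF h] a g a1 True])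
  moreover have "a1 (hat g n) = a (hat g n)"
    by (rule dirichlet_coeff_unique[OF a1 a])
       (use sup_norm.inv_approx_inv[OF h g] bohr_point_D smooth_overD[OF hat_smooth[OF g True]] in auto)
  ultimately show ?thesis by simp
next
  case False
  have "hat g n \<ge> 1" using hat_ge_1[OF n] G_ge_1[OF g] by blast
  then show ?thesis
    using approx_coeff_support[OF sup_norm.inv_approx_approx[OF h] a] False n hat_smooth_iff[OF g n] by simp
qed

lemma inv_approx_dirichlet_A:
  assumes h: "h \<in> sup_norm.inv_approx"
  shows "(\<lambda>s\<in>right_half_plane. h (bohr_point s)) \<in> dirichlet_invariant dirichlet_A G"
proof -
  let ?f = "\<lambda>s\<in>right_half_plane. h (bohr_point s)"
  have near: "poly_near (\<lambda>s. h (bohr_point s))" by (rule approx_poly_near[OF sup_norm.inv_approx_approx[OF h]])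
  then have "poly_near ?f" by (simp add: poly_near_def half_plane_le_def)
  then have A: "?f \<in> dirichlet_A" by (rule poly_near_dirichlet_A) simp
  obtain a where a: "has_dirichlet_series (\<lambda>s. h (bohr_point s)) a"
    by (rule has_dirichlet_series_if_poly_near[OF near])
  have "has_dirichlet_series ?f a"
  proof (rule has_dirichlet_seriesI)
    fix \<delta> \<eta> :: real assume d: "\<delta> > 0" "\<eta> > 0"
    from has_dirichlet_seriesD[OF a d]
    show "\<forall>\<^sub>F N in sequentially. \<forall>s. Re s > \<delta> \<longrightarrow> norm (dirichlet_sum {1..N} a s - ?f s) < \<eta>"
      by (rule eventually_mono) (use d in \<open>auto simp: right_half_plane_def\<close>)
  qed
  then show ?thesis using A inv_approx_coeff_invariant[OF h a] unfolding dirichlet_invariant_def by blast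
qed

lemma nth_prime_dvd_hat:
  assumes "g \<in> G" "n \<ge> 1" "i \<ge> 1" "nth_prime i dvd n" shows "nth_prime (g i) dvd hat g n"
proof -
  obtain m where m: "n = nth_prime i * m" using assms(4) by blast
  with assms(2) have "m \<ge> 1" by (cases m) auto
  then have "hat g n = nth_prime (g i) * hat g m"
    unfolding m hat_eq_bohr_monomial using assms by (simp add: bohr_monomial_mult bohr_monomial_nth_prime)
  then show ?thesis by simp
qed

text \<open>
  If \<open>i\<close> lies in an infinite orbit and \<open>nth_prime i\<close> divides \<open>n\<close>, then the numbers \<open>hat g n\<close> have infinitely many different prime
  factors. They all carry the same coefficient, so a nonzero value would force infinitely many nonzero coefficients in a
  sufficiently close Dirichlet polynomial.
\<close>

lemma invariant_coeff_support:
  assumes near: "poly_near f" and a: "has_dirichlet_series f a"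
    and inv: "\<forall>g\<in>G. \<forall>n\<ge>1. a (hat g n) = a n"
    and n: "n \<ge> 1" "n \<notin> smooth_over I"
  shows "a n = 0"
proof (rule ccontr)
  assume a0: "a n \<noteq> 0"
  obtain i where i: "i \<ge> 1" "nth_prime i dvd n" "i \<notin> I" using n unfolding smooth_over_def by blast
  obtain S b where S: "finite S" "S \<subseteq> {1..}" "half_plane_le (\<lambda>s. f s - dirichlet_sum S b s) (norm (a n) / 2)"
    using poly_nearE[OF near, of "norm (a n) / 2"] a0 by auto
  have hatS: "hat g n \<in> S" if g: "g \<in> G" for g
  proof (rule ccontr)
    assume "hat g n \<notin> S"
    moreover have h1: "hat g n \<ge> 1" using hat_ge_1[OF n(1)] G_ge_1[OF g] by blast
    ultimately have "norm (a (hat g n)) \<le> norm (a n) / 2"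
      using dirichlet_coeff_near[OF a S h1] by simp
    then show False using inv g n(1) a0 by simp
  qed
  have "orb i \<subseteq> (\<Union>m\<in>S. {j. 1 \<le> j \<and> nth_prime j dvd m})"
  proof
    fix j assume "j \<in> orb i"
    then obtain g where g: "g \<in> G" "j = g i" unfolding orb_eq by blast
    then show "j \<in> (\<Union>m\<in>S. {j. 1 \<le> j \<and> nth_prime j dvd m})"
      using hatS[OF g(1)] nth_prime_dvd_hat[OF g(1) n(1) i(1,2)] G_ge_1[OF g(1) i(1)] by blast
  qed
  moreover have "finite (\<Union>m\<in>S. {j. 1 \<le> j \<and> nth_prime j dvd m})"
    using S(1,2) by (intro finite_UN_I finite_prime_indices) (auto simp: subset_iff Suc_le_eq)
  ultimately have "finite (orb i)" by (rule finite_subset)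
  then show False using i mem_I_iff by blast
qed

text \<open>
  The translate of \<open>h\<close> by \<open>g\<close> has the same Dirichlet series as \<open>h\<close>, so both agree at the Bohr points and hence everywhere.
\<close>

lemma approx_invariant_if_coeff_invariant:
  assumes h: "h \<in> sup_norm.approx" and a: "has_dirichlet_series (\<lambda>s. h (bohr_point s)) a"
    and inv: "\<And>g n. g \<in> G \<Longrightarrow> n \<ge> 1 \<Longrightarrow> a (hat g n) = a n"
  shows "h \<in> sup_norm.inv_approx"
proof -
  have "h (act g z) = h z" if g: "g \<in> G" and z: "z \<in> topspace (closed_polydisc I)" for g z
  proof -
    have hg: "(\<lambda>z. h (act g z)) \<in> sup_norm.approx" by (rule approx_act[OF h g])
    obtain a1 where a1: "has_dirichlet_series (\<lambda>s. h (act g (bohr_point s))) a1"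
      by (rule has_dirichlet_series_if_poly_near[OF approx_poly_near[OF hg]])
    have "a1 n = a n" if n: "n \<ge> 1" for n
    proof (cases "n \<in> smooth_over I")
      case True
      then obtain m where m: "m \<in> smooth_over I" "n = hat g m" using hat_image_smooth(2)[OF g] by blast
      then show ?thesis using approx_coeff_act[OF h a g a1 m(1)] inv[OF g smooth_overD[OF m(1)]] by simp
    next
      case False
      then show ?thesis using approx_coeff_support[OF h a n] approx_coeff_support[OF hg a1 n] by simp
    qed
    then have eq: "h (act g (bohr_point s)) = h (bohr_point s)" if "s \<in> right_half_plane" for s
      by (rule dirichlet_series_unique_fun[OF a1 a _ that])
    have "(\<lambda>z. h (act g z) - h z) \<in> sup_norm.approx"
      using sup_norm.approx_add[OF hg sup_norm.approx_mult[OF sup_norm.approx_const[of "-1"] h]] by simp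
    from approx_eq_0[OF this _ z] show ?thesis using eq by simp
  qed
  then show ?thesis using h by (simp add: sup_norm.inv_approx_def)
qed

text \<open>
  By Bohr's inequality the polynomials that arise from Dirichlet polynomials close to \<open>f\<close> by dropping the coordinates outside \<open>I\<close> form a
  Cauchy sequence in the supremum norm of the polydisc. The limit \<open>h\<close> keeps the coefficients of \<open>f\<close> at the numbers that are
  smooth over \<open>I\<close>.
\<close>

lemma poly_near_lift:
  assumes near: "poly_near f"
  obtains h where "h \<in> sup_norm.approx"
    "\<And>a a' n. has_dirichlet_series f a \<Longrightarrow> has_dirichlet_series (\<lambda>s. h (bohr_point s)) a' \<Longrightarrow>
      n \<in> smooth_over I \<Longrightarrow> a n = a' n"
proof -
  let ?e = "\<lambda>k. inverse (real (Suc k))"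
  have "\<exists>S b. finite S \<and> S \<subseteq> {1..} \<and> half_plane_le (\<lambda>s. f s - dirichlet_sum S b s) (inverse (real (Suc k)))" for k
    using near by (simp add: poly_near_def)
  then obtain S b where Sb: "\<And>k. finite (S k)" "\<And>k. S k \<subseteq> {1..}"
    "\<And>k. half_plane_le (\<lambda>s. f s - dirichlet_sum (S k) (b k) s) (?e k)" by metis
  define c where "c k n = (if n \<in> S k then b k n else 0)" for k n
  define p where "p k = dpoly (S k \<inter> smooth_over I) (b k)" for k
  have e0: "?e \<longlonglongrightarrow> 0" by (rule LIMSEQ_inverse_real_of_nat)
  have diff: "norm (p k z - p l z) \<le> ?e k + ?e l" if z: "z \<in> topspace (closed_polydisc I)" for k l z
  proof -
    let ?T = "S k \<union> S l" and ?d = "\<lambda>n. c k n - c l n"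
    have "dirichlet_sum ?T ?d s = dirichlet_sum (S k) (b k) s - dirichlet_sum (S l) (b l) s" for s
      unfolding dirichlet_sum_diff[symmetric] c_def using Sb(1) by (subst (1 2) dirichlet_sum_extend[of ?T]) auto
    then have "norm (dirichlet_sum ?T ?d s) \<le> ?e k + ?e l" if "s \<in> right_half_plane" for s
      using bspec[OF Sb(3)[of k, unfolded half_plane_le_def] that] bspec[OF Sb(3)[of l, unfolded half_plane_le_def] that]
        norm_triangle_ineq4[of "f s - dirichlet_sum (S l) (b l) s" "f s - dirichlet_sum (S k) (b k) s"] by simp
    then have "norm (dpoly (?T \<inter> smooth_over I) ?d z) \<le> ?e k + ?e l"
      using Sb(1,2) by (intro bohr_inequality_D z) (auto simp: half_plane_le_def)
    moreover have "dpoly (?T \<inter> smooth_over I) ?d z = p k z - p l z"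
    proof -
      have "p j z = dpoly (?T \<inter> smooth_over I) (c j) z" if "j \<in> {k, l}" for j
        unfolding p_def dpoly_def using that Sb(1) by (intro sum.mono_neutral_cong_left) (auto simp: c_def)
      then show ?thesis by (simp add: dpoly_def sum_subtractf left_diff_distrib)
    qed
    ultimately show ?thesis by simp
  qed
  define h where "h z = lim (\<lambda>k. p k z)" for z
  have lim: "(\<lambda>k. p k z) \<longlonglongrightarrow> h z" if z: "z \<in> topspace (closed_polydisc I)" for z
  proof -
    have "Cauchy (\<lambda>k. p k z)"
    proof (rule CauchyI)
      fix e :: real assume "e > 0"
      then have "\<forall>\<^sub>F k in sequentially. ?e k < e / 2" using e0 by (intro order_tendstoD) auto
      then obtain M where M: "\<And>k. k \<ge> M \<Longrightarrow> ?e k < e / 2" by (auto simp: eventually_sequentially)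
      show "\<exists>M. \<forall>k\<ge>M. \<forall>l\<ge>M. norm (p k z - p l z) < e"
      proof (intro exI[of _ M] allI impI)
        fix k l assume "M \<le> k" "M \<le> l"
        then show "norm (p k z - p l z) < e" using M[of k] M[of l] diff[OF z, of k l] by linarith
      qed
    qed
    then show ?thesis unfolding h_def by (simp add: Cauchy_convergent_iff convergent_LIMSEQ_iff)
  qed
  have hp: "sup_bd I (\<lambda>z. h z - p k z) (?e k)" for k
    unfolding sup_bd_def
  proof
    fix z assume z: "z \<in> topspace (closed_polydisc I)"
    have "(\<lambda>l. norm (p l z - p k z)) \<longlonglongrightarrow> norm (h z - p k z)" by (intro tendsto_intros lim z)
    moreover have "(\<lambda>l. ?e l + ?e k) \<longlonglongrightarrow> 0 + ?e k" by (intro tendsto_intros e0)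
    ultimately have "norm (h z - p k z) \<le> 0 + ?e k" using diff[OF z] by (intro LIMSEQ_le) auto
    then show "norm (h z - p k z) \<le> ?e k" by simp
  qed
  have small: "\<exists>k. ?e k < e" if "e > 0" for e
    using reals_Archimedean[OF that] by simp
  have h: "h \<in> sup_norm.approx"
  proof (rule sup_norm.approxI)
    fix e :: real assume "e > 0"
    then obtain k where k: "?e k < e" using small by blast
    show "\<exists>p\<in>poly_fun I. sup_bd I (\<lambda>z. h z - p z) e"
      by (rule bexI[where x = "p k"]) (use sup_norm.bd_mono[OF hp[of k]] k dpoly_poly_fun in \<open>auto simp: p_def\<close>)
  qed
  have "a n = a' n" if a: "has_dirichlet_series f a" and a': "has_dirichlet_series (\<lambda>s. h (bohr_point s)) a'"
    and n: "n \<in> smooth_over I" for a a' n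
  proof -
    have "norm (a n - a' n) \<le> e" if e: "e > 0" for e
    proof -
      obtain k where k: "?e k < e / 2" using small[OF half_gt_zero[OF e]] by blast
      have "norm (a n - (if n \<in> S k then b k n else 0)) \<le> ?e k"
        by (rule dirichlet_coeff_near[OF a Sb(1,2,3) smooth_overD[OF n]])
      moreover have "norm (a' n - (if n \<in> S k \<inter> smooth_over I then b k n else 0)) \<le> ?e k"
        using Sb(1,2) smooth_overD[OF n]
        by (intro dirichlet_coeff_near[OF a'] half_plane_le_bohr_point hp[unfolded p_def]) auto
      ultimately show ?thesis
        using k n norm_triangle_ineq4[of "a n - (if n \<in> S k then b k n else 0)" "a' n - (if n \<in> S k then b k n else 0)"]
        by simp
    qed
    then have "norm (a n - a' n) \<le> 0" by (rule field_le_epsilon[of _ 0, simplified add_0_left])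
    then show ?thesis by simp
  qed
  with h show thesis by (rule that)
qed

text \<open>
  For an invariant series nothing is lost in \<open>poly_near_lift\<close>, since all other coefficients vanish.
\<close>

lemma invariant_lift:
  assumes near: "poly_near f" and a: "has_dirichlet_series f a"
    and inv: "\<forall>g\<in>G. \<forall>n\<ge>1. a (hat g n) = a n"
  obtains h where "h \<in> sup_norm.inv_approx" "\<And>s. s \<in> right_half_plane \<Longrightarrow> f s = h (bohr_point s)"
proof -
  obtain h where h: "h \<in> sup_norm.approx"
    and co: "\<And>a a' n. has_dirichlet_series f a \<Longrightarrow> has_dirichlet_series (\<lambda>s. h (bohr_point s)) a' \<Longrightarrow>
      n \<in> smooth_over I \<Longrightarrow> a n = a' n"
    by (rule poly_near_lift[OF near]) (rule that)
  obtain a' where a': "has_dirichlet_series (\<lambda>s. h (bohr_point s)) a'"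
    by (rule has_dirichlet_series_if_poly_near[OF approx_poly_near[OF h]])
  have eq: "a n = a' n" if n: "n \<ge> 1" for n
  proof (cases "n \<in> smooth_over I")
    case False
    then show ?thesis using invariant_coeff_support[OF near a inv n] approx_coeff_support[OF h a' n] by simp
  qed (use co[OF a a'] in blast)
  have "a' (hat g n) = a' n" if g: "g \<in> G" and n: "n \<ge> 1" for g n
    using inv g n eq[OF n] eq[of "hat g n"] hat_ge_1[OF n G_ge_1[OF g]] by simp
  then have "h \<in> sup_norm.inv_approx" by (rule approx_invariant_if_coeff_invariant[OF h a'])
  moreover have "f s = h (bohr_point s)" if "s \<in> right_half_plane" for s
    by (rule dirichlet_series_unique_fun[OF a a' eq that])
  ultimately show thesis by (rule that)
qed

lemma realized_dirichlet_A:
  "realized_algebra G (sup_bd I) right_half_plane bohr_point (dirichlet_invariant dirichlet_A G)"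
proof unfold_locales
  show "bohr_point x \<in> topspace (closed_polydisc I)" if "x \<in> right_half_plane" for x by (rule bohr_point_D[OF that])
  show "dirichlet_invariant dirichlet_A G = (\<lambda>h. \<lambda>s\<in>right_half_plane. h (bohr_point s)) ` sup_norm.inv_approx"
  proof (intro equalityI subsetI)
    fix f assume f: "f \<in> dirichlet_invariant dirichlet_A G"
    then have fA: "f \<in> dirichlet_A" and "\<exists>a. has_dirichlet_series f a \<and> (\<forall>\<sigma>\<in>G. \<forall>n\<ge>1. a (hat \<sigma> n) = a n)"
      by (auto simp: dirichlet_invariant_def)
    then obtain a where a: "has_dirichlet_series f a" "\<forall>g\<in>G. \<forall>n\<ge>1. a (hat g n) = a n" by blast
    obtain h where h: "h \<in> sup_norm.inv_approx" "\<And>s. s \<in> right_half_plane \<Longrightarrow> f s = h (bohr_point s)"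
      by (rule invariant_lift[OF dirichlet_A_poly_near[OF fA] a]) (rule that)
    have "f \<in> extensional right_half_plane" using fA by (simp add: dirichlet_A_def)
    then have "f = (\<lambda>s\<in>right_half_plane. h (bohr_point s))"
      using h(2) by (intro extensionalityI[of _ right_half_plane]) auto
    then show "f \<in> (\<lambda>h. \<lambda>s\<in>right_half_plane. h (bohr_point s)) ` sup_norm.inv_approx" using h(1) by (rule image_eqI)
  next
    fix f assume "f \<in> (\<lambda>h. \<lambda>s\<in>right_half_plane. h (bohr_point s)) ` sup_norm.inv_approx"
    then show "f \<in> dirichlet_invariant dirichlet_A G" by (elim imageE) (simp only: inv_approx_dirichlet_A)
  qed
  show "h z = 0" if "h \<in> sup_norm.inv_approx" "\<And>x. x \<in> right_half_plane \<Longrightarrow> h (bohr_point x) = 0" "z \<in> topspace (closed_polydisc I)" for h z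
    by (rule approx_eq_0[OF sup_norm.inv_approx_approx[OF that(1)] that(2,3)])
qed

lemma l1_bd_sup_bd: assumes "l1_bd I h r" shows "sup_bd I h r"
  unfolding sup_bd_def using l1_norm.bd_norm_le[OF assms] by blast

lemma l1_approx_approx: assumes "h \<in> l1_norm.approx" shows "h \<in> sup_norm.approx"
proof (rule sup_norm.approxI)
  fix e :: real assume e: "e > 0"
  obtain p where p: "p \<in> poly_fun I" "l1_bd I (\<lambda>z. h z - p z) e" by (rule bexE[OF l1_norm.approxD[OF assms e]])
  show "\<exists>p\<in>poly_fun I. sup_bd I (\<lambda>z. h z - p z) e"
    by (rule bexI[where x = p]) (rule l1_bd_sup_bd[OF p(2)], rule p(1))
qed

lemma l1_inv_approx_sup: "h \<in> l1_norm.inv_approx \<Longrightarrow> h \<in> sup_norm.inv_approx"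
  using l1_approx_approx[of h] by (simp add: l1_norm.inv_approx_def sup_norm.inv_approx_def)

text \<open>
  An absolutely convergent power series is the \<open>l1\<close> limit of its partial sums.
\<close>

lemma l1_bd_approx: assumes "l1_bd I h r" shows "h \<in> l1_norm.approx"
proof (rule l1_norm.approxI)
  fix e :: real assume e: "e > 0"
  obtain a where a: "l1_coeffs I a r" "\<And>z. z \<in> topspace (closed_polydisc I) \<Longrightarrow> ((\<lambda>n. a n * bohr_monomial z n) has_sum h z) UNIV"
    by (rule l1_bdE[OF assms]) (rule that)
  obtain T where T: "((\<lambda>n. norm (a n)) has_sum T) UNIV" using l1_coeffs_summable[OF a(1)] by (auto simp: summable_on_def)
  then have "\<forall>\<^sub>F F in finite_subsets_at_top UNIV. dist (\<Sum>n\<in>F. norm (a n)) T < e"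
    unfolding has_sum_def using e by (rule tendstoD)
  then obtain F where F: "finite F" "\<And>Y. finite Y \<Longrightarrow> F \<subseteq> Y \<Longrightarrow> dist (\<Sum>n\<in>Y. norm (a n)) T < e"
    unfolding eventually_finite_subsets_at_top by (metis subset_UNIV)
  let ?b = "\<lambda>n. if n \<in> F then 0 else a n" and ?S = "F \<inter> smooth_over I"
  have b: "l1_coeffs I ?b e"
    unfolding l1_coeffs_def
  proof (intro conjI allI impI)
    fix Y :: "nat set" assume Y: "finite Y"
    have "(\<Sum>n\<in>Y. norm (?b n)) + (\<Sum>n\<in>F. norm (a n)) = (\<Sum>n\<in>Y - F. norm (a n)) + (\<Sum>n\<in>F. norm (a n))"
      using Y by (simp add: sum.If_cases if_distrib[of norm] Diff_eq cong: if_cong)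
    also have "\<dots> = (\<Sum>n\<in>Y \<union> F. norm (a n))"
      using Y F(1) by (subst sum.union_disjoint[symmetric]) (auto simp: Un_commute)
    also have "\<dots> \<le> T" using T Y F(1) by (intro finite_sum_le_has_sum[OF T]) auto
    finally show "(\<Sum>n\<in>Y. norm (?b n)) \<le> e" using F(2)[OF F(1)] by (simp add: dist_real_def)
  qed (use l1_coeffs_0[OF a(1)] in simp)
  have "l1_bd I (\<lambda>z. h z - dpoly ?S a z) e"
  proof (rule l1_bdI[OF b])
    fix z assume z: "z \<in> topspace (closed_polydisc I)"
    have "((\<lambda>n. (if n \<in> F then a n else 0) * bohr_monomial z n) has_sum dpoly ?S a z) ?S"
      unfolding dpoly_def using F(1) by (intro has_sum_finiteI) (auto intro: sum.cong)
    then have "((\<lambda>n. (if n \<in> F then a n else 0) * bohr_monomial z n) has_sum dpoly ?S a z) UNIV"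
      by (subst has_sum_cong_neutral[where T = ?S and g = "\<lambda>n. (if n \<in> F then a n else 0) * bohr_monomial z n"])
         (auto simp: l1_coeffs_0[OF a(1)])
    note hs = has_sum_add[OF a(2)[OF z] has_sum_cmult_right[OF this, of "- 1"]]
    have eqf: "(\<lambda>n. a n * bohr_monomial z n + - 1 * ((if n \<in> F then a n else 0) * bohr_monomial z n)) = (\<lambda>n. ?b n * bohr_monomial z n)"
      by auto
    show "((\<lambda>n. ?b n * bohr_monomial z n) has_sum h z - dpoly ?S a z) UNIV"
      using hs unfolding eqf by simp
  qed
  then show "\<exists>p\<in>poly_fun I. l1_bd I (\<lambda>z. h z - p z) e"
    by (rule bexI[where x = "dpoly ?S a"]) (rule dpoly_poly_fun, simp)
qed

lemma l1_bd_dirichlet_W: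
  assumes "l1_bd I h r" shows "(\<lambda>s\<in>right_half_plane. h (bohr_point s)) \<in> dirichlet_W"
proof -
  obtain a where a: "l1_coeffs I a r" "\<And>z. z \<in> topspace (closed_polydisc I) \<Longrightarrow> ((\<lambda>n. a n * bohr_monomial z n) has_sum h z) UNIV"
    by (rule l1_bdE[OF assms]) (rule that)
  have "(\<lambda>n. norm (a n)) summable_on {1..}"
    using l1_coeffs_summable[OF a(1)] summable_on_subset_banach by blast
  moreover have "((\<lambda>n. a n * of_nat n powr (- s)) has_sum h (bohr_point s)) {1..}" if s: "s \<in> right_half_plane" for s
  proof (subst has_sum_cong_neutral[where T = UNIV and g = "\<lambda>n. a n * bohr_monomial (bohr_point s) n"])
    show "((\<lambda>n. a n * bohr_monomial (bohr_point s) n) has_sum h (bohr_point s)) UNIV" by (rule a(2)[OF bohr_point_D[OF s]])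
    show "a n * of_nat n powr (- s) = a n * bohr_monomial (bohr_point s) n" for n
      using l1_coeffs_0[OF a(1)] bohr_monomial_bohr_point by (cases "n \<in> smooth_over I") auto
    show "a n * bohr_monomial (bohr_point s) n = 0" if "n \<in> UNIV - {1..}" for n
      using that l1_coeffs_0[OF a(1), of n] by (cases n) (auto simp: zero_not_smooth)
  qed auto
  ultimately show ?thesis unfolding dirichlet_W_def by (intro CollectI conjI exI[of _ a]) auto
qed

text \<open>
  An invariant element of \<open>dirichlet_W\<close> has an absolutely summable coefficient sequence supported on numbers that are smooth over \<open>I\<close>. The
  power series with these coefficients agrees with the lift from \<open>invariant_lift\<close> at the Bohr points, hence everywhere, and so
  it inherits invariance.
\<close>

lemma realized_dirichlet_W:
  "realized_algebra G (l1_bd I) right_half_plane bohr_point (dirichlet_invariant dirichlet_W G)"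
proof unfold_locales
  show "bohr_point x \<in> topspace (closed_polydisc I)" if "x \<in> right_half_plane" for x by (rule bohr_point_D[OF that])
  show "dirichlet_invariant dirichlet_W G = (\<lambda>h. \<lambda>s\<in>right_half_plane. h (bohr_point s)) ` l1_norm.inv_approx"
  proof (intro equalityI subsetI)
    fix f assume f: "f \<in> dirichlet_invariant dirichlet_W G"
    then have fW: "f \<in> dirichlet_W" and "\<exists>a. has_dirichlet_series f a \<and> (\<forall>\<sigma>\<in>G. \<forall>n\<ge>1. a (hat \<sigma> n) = a n)"
      by (auto simp: dirichlet_invariant_def)
    then obtain a' where a': "has_dirichlet_series f a'" "\<forall>g\<in>G. \<forall>n\<ge>1. a' (hat g n) = a' n" by blast
    obtain h where h: "h \<in> sup_norm.inv_approx" "\<And>s. s \<in> right_half_plane \<Longrightarrow> f s = h (bohr_point s)"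
      by (rule invariant_lift[OF dirichlet_W_poly_near[OF fW] a']) (rule that)
    obtain a where a: "(\<lambda>n. norm (a n)) summable_on {1..}"
      "\<And>s. s \<in> right_half_plane \<Longrightarrow> ((\<lambda>n. a n * of_nat n powr (- s)) has_sum f s) {1..}"
      using fW unfolding dirichlet_W_def by auto
    have aa': "a n = a' n" if "n \<ge> 1" for n
      by (rule dirichlet_coeff_unique[OF abs_conv_dirichlet_series(1)[OF a] a'(1) refl that])
    have a0: "a n = 0" if "n \<ge> 1" "n \<notin> smooth_over I" for n
      using invariant_coeff_support[OF dirichlet_W_poly_near[OF fW] a' that] aa'[OF that(1)] by simp
    define c where "c n = (if n \<in> smooth_over I then a n else 0)" for n
    obtain T where T: "((\<lambda>n. norm (a n)) has_sum T) {1..}" using a(1) by (auto simp: summable_on_def)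
    have c: "l1_coeffs I c T"
      unfolding l1_coeffs_def
    proof (intro conjI allI impI)
      fix F :: "nat set" assume F: "finite F"
      have "(\<Sum>n\<in>F. norm (c n)) = (\<Sum>n\<in>F \<inter> smooth_over I. norm (a n))"
        by (rule sum.mono_neutral_cong_right) (use F in \<open>auto simp: c_def\<close>)
      also have "\<dots> \<le> T" using F smooth_overD by (intro finite_sum_le_has_sum[OF T]) auto
      finally show "(\<Sum>n\<in>F. norm (c n)) \<le> T" .
    qed (simp add: c_def)
    define k where "k z = (\<Sum>\<^sub>\<infinity>n. c n * bohr_monomial z n)" for z
    have k: "l1_bd I k T" by (rule l1_bdI[OF c]) (simp add: k_def l1_has_sum[OF c])
    have fk: "k (bohr_point s) = f s" if s: "s \<in> right_half_plane" for s
    proof -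
      have "((\<lambda>n. c n * bohr_monomial (bohr_point s) n) has_sum f s) UNIV"
      proof (subst has_sum_cong_neutral[where T = "{1..}" and g = "\<lambda>n. a n * of_nat n powr (- s)"])
        show "((\<lambda>n. a n * of_nat n powr (- s)) has_sum f s) {1..}" by (rule a(2)[OF s])
        show "c n * bohr_monomial (bohr_point s) n = a n * of_nat n powr (- s)" if "n \<in> UNIV \<inter> {1..}" for n
          using that a0 by (cases "n \<in> smooth_over I") (auto simp: c_def bohr_monomial_bohr_point)
        show "c n * bohr_monomial (bohr_point s) n = 0" if "n \<in> UNIV - {1..}" for n
          using that zero_not_smooth by (cases n) (auto simp: c_def)
      qed auto
      moreover have "((\<lambda>n. c n * bohr_monomial (bohr_point s) n) has_sum k (bohr_point s)) UNIV"
        unfolding k_def by (rule l1_has_sum[OF c bohr_point_D[OF s]])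
      ultimately show ?thesis by (rule has_sum_unique[symmetric])
    qed
    have ka: "k \<in> l1_norm.approx" by (rule l1_bd_approx[OF k])
    have khz: "k z = h z" if z: "z \<in> topspace (closed_polydisc I)" for z
    proof -
      have "(\<lambda>z. k z - h z) \<in> sup_norm.approx"
        using sup_norm.approx_add[OF l1_approx_approx[OF ka] sup_norm.approx_mult[OF sup_norm.approx_const[of "-1"] sup_norm.inv_approx_approx[OF h(1)]]] by simp
      from approx_eq_0[OF this _ z] show ?thesis using fk h(2) by simp
    qed
    have "k (act g z) = k z" if "g \<in> G" "z \<in> topspace (closed_polydisc I)" for g z
      using khz[OF that(2)] khz[OF sup_norm.act_D[OF that(2,1)]] sup_norm.inv_approx_inv[OF h(1) that] by simp
    then have kB: "k \<in> l1_norm.inv_approx" using ka by (simp add: l1_norm.inv_approx_def)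
    have "f \<in> extensional right_half_plane" using fW by (simp add: dirichlet_W_def)
    then have "f = (\<lambda>s\<in>right_half_plane. k (bohr_point s))"
      using fk by (intro extensionalityI[of _ right_half_plane]) auto
    then show "f \<in> (\<lambda>h. \<lambda>s\<in>right_half_plane. h (bohr_point s)) ` l1_norm.inv_approx" using kB by (rule image_eqI)
  next
    fix f assume "f \<in> (\<lambda>h. \<lambda>s\<in>right_half_plane. h (bohr_point s)) ` l1_norm.inv_approx"
    then obtain h where h: "h \<in> l1_norm.inv_approx" "f = (\<lambda>s\<in>right_half_plane. h (bohr_point s))" by (elim imageE)
    obtain r where r: "l1_bd I h r" using l1_norm.approx_bd[OF l1_norm.inv_approx_approx[OF h(1)]] by blast
    have "f \<in> dirichlet_W" unfolding h(2) by (rule l1_bd_dirichlet_W[OF r])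
    moreover have "f \<in> dirichlet_invariant dirichlet_A G" unfolding h(2) by (rule inv_approx_dirichlet_A[OF l1_inv_approx_sup[OF h(1)]])
    ultimately show "f \<in> dirichlet_invariant dirichlet_W G" by (simp add: dirichlet_invariant_def)
  qed
  show "h z = 0" if "h \<in> l1_norm.inv_approx" "\<And>x. x \<in> right_half_plane \<Longrightarrow> h (bohr_point x) = 0" "z \<in> topspace (closed_polydisc I)" for h z
    by (rule approx_eq_0[OF sup_norm.inv_approx_approx[OF l1_inv_approx_sup[OF that(1)]] that(2,3)])
qed

end

section \<open>Continuous functions on the polydisc\<close>

lemma open_polydisc_iff:
  "z \<in> open_polydisc I \<longleftrightarrow> z \<in> extensional I \<and> (\<exists>r. 0 < r \<and> r < 1 \<and> (\<forall>i\<in>I. norm (z i) \<le> r))"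
  by (auto simp: open_polydisc_def PiE_iff)

lemma open_polydisc_subset: "z \<in> open_polydisc I \<Longrightarrow> z \<in> topspace (closed_polydisc I)"
  by (force simp: open_polydisc_iff intro!: closed_polydiscI)

lemma open_polydisc_upd:
  assumes "z \<in> open_polydisc I" "i \<in> I" "norm w < 1" shows "z(i := w) \<in> open_polydisc I"
proof -
  obtain r where r: "z \<in> extensional I" "0 < r" "r < 1" "\<And>i. i \<in> I \<Longrightarrow> norm (z i) \<le> r"
    using assms(1) unfolding open_polydisc_iff by blast
  have "z(i := w) \<in> extensional I" using r(1) assms(2) by (auto simp: extensional_def)
  moreover have "\<forall>j\<in>I. norm ((z(i := w)) j) \<le> max r (norm w)" using r(4) by (auto simp: le_max_iff_disj)
  ultimately show ?thesis using r(2,3) assms(3) unfolding open_polydisc_iff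
    by (intro conjI exI[of _ "max r (norm w)"]) auto
qed

text \<open>
  A Lebesgue number argument for the product topology: up to \<open>e\<close> the function depends on finitely many coordinates only.
\<close>

lemma polydisc_uniformly_continuous:
  fixes h :: "(nat \<Rightarrow> complex) \<Rightarrow> complex"
  assumes h: "continuous_map (closed_polydisc I) euclidean h" and e: "e > 0"
  obtains F \<delta> where "finite F" "F \<subseteq> I" "\<delta> > 0"
    "\<And>z w. z \<in> topspace (closed_polydisc I) \<Longrightarrow> w \<in> topspace (closed_polydisc I) \<Longrightarrow>
      \<forall>i\<in>F. norm (z i - w i) < \<delta> \<Longrightarrow> norm (h z - h w) < e"
proof -
  let ?D = "topspace (closed_polydisc I)"
  have loc: "\<exists>F \<delta>. finite F \<and> F \<subseteq> I \<and> \<delta> > 0 \<and> (\<forall>w\<in>?D. (\<forall>i\<in>F. norm (w i - z i) < 2 * \<delta>) \<longrightarrow> norm (h w - h z) < e / 2)"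
    if z: "z \<in> ?D" for z
  proof -
    have "openin (closed_polydisc I) {w \<in> ?D. h w \<in> ball (h z) (e / 2)}"
      by (rule openin_continuous_map_preimage[OF h]) simp
    moreover have "z \<in> {w \<in> ?D. h w \<in> ball (h z) (e / 2)}" using z e by simp
    ultimately obtain U where U: "finite {i \<in> I. U i \<noteq> topspace (top_of_set (cball 0 1 :: complex set))}"
      "\<And>i. i \<in> I \<Longrightarrow> openin (top_of_set (cball 0 1)) (U i)" "z \<in> Pi\<^sub>E I U"
      "Pi\<^sub>E I U \<subseteq> {w \<in> ?D. h w \<in> ball (h z) (e / 2)}"
      unfolding closed_polydisc_def openin_product_topology_alt by meson
    define F where "F = {i \<in> I. U i \<noteq> cball 0 1}"
    have F: "finite F" "F \<subseteq> I" using U(1) by (auto simp: F_def)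
    have "\<exists>d>0. \<forall>x\<in>cball 0 1. dist x (z i) < d \<longrightarrow> x \<in> U i" if "i \<in> F" for i
    proof -
      have "i \<in> I" using that F by blast
      then have "z i \<in> U i" "openin (top_of_set (cball 0 1)) (U i)" using U(2,3) by (auto simp: PiE_iff)
      then show ?thesis unfolding openin_euclidean_subtopology_iff by (meson)
    qed
    then obtain d where d: "\<And>i. i \<in> F \<Longrightarrow> d i > 0" "\<And>i x. i \<in> F \<Longrightarrow> x \<in> cball 0 1 \<Longrightarrow> dist x (z i) < d i \<Longrightarrow> x \<in> U i"
      by metis
    define \<delta> where "\<delta> = Min (insert 1 (d ` F)) / 2"
    have \<delta>: "\<delta> > 0" "\<And>i. i \<in> F \<Longrightarrow> 2 * \<delta> \<le> d i" using F(1) d(1) by (auto simp: \<delta>_def)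
    have "norm (h w - h z) < e / 2" if w: "w \<in> ?D" and close: "\<forall>i\<in>F. norm (w i - z i) < 2 * \<delta>" for w
    proof -
      have "w i \<in> U i" if i: "i \<in> I" for i
      proof (cases "i \<in> F")
        case True
        then show ?thesis
          using d(2)[OF True, of "w i"] closed_polydisc_norm_le[OF w i] close \<delta>(2)[OF True] by (force simp: dist_norm)
      next
        case False
        then show ?thesis using i closed_polydisc_norm_le[OF w i] by (auto simp: F_def)
      qed
      then have "w \<in> Pi\<^sub>E I U" using w by (auto simp: topspace_closed_polydisc PiE_iff)
      then show ?thesis using U(4) by (auto simp: dist_norm norm_minus_commute)
    qed
    then show ?thesis using F \<delta>(1) by blast
  qed
  then obtain F \<delta> where F: "\<And>z. z \<in> ?D \<Longrightarrow> finite (F z)" "\<And>z. z \<in> ?D \<Longrightarrow> F z \<subseteq> I" "\<And>z. z \<in> ?D \<Longrightarrow> \<delta> z > (0::real)"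
    "\<And>z w. z \<in> ?D \<Longrightarrow> w \<in> ?D \<Longrightarrow> (\<forall>i\<in>F z. norm (w i - z i) < 2 * \<delta> z) \<Longrightarrow> norm (h w - h z) < e / 2"
    by metis
  define V where "V z = {w \<in> ?D. \<forall>i\<in>F z. w i \<in> ball (z i) (\<delta> z)}" for z
  have V: "openin (closed_polydisc I) (V z)" if z: "z \<in> ?D" for z
  proof -
    have "openin (closed_polydisc I) ((\<Inter>i\<in>F z. {w \<in> ?D. w i \<in> ball (z i) (\<delta> z)}) \<inter> ?D)"
      using F(1,2)[OF z]
      by (intro openin_INT openin_continuous_map_preimage[OF continuous_map_coord]) auto
    moreover have "(\<Inter>i\<in>F z. {w \<in> ?D. w i \<in> ball (z i) (\<delta> z)}) \<inter> ?D = V z" by (auto simp: V_def)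
    ultimately show ?thesis by simp
  qed
  have "?D \<subseteq> \<Union> (V ` ?D)" using F(3) by (force simp: V_def)
  then obtain \<F> where \<F>: "finite \<F>" "\<F> \<subseteq> V ` ?D" "?D \<subseteq> \<Union> \<F>"
    using compact_closed_polydisc[of I] V unfolding compact_space_def compactin_def by (metis (no_types, lifting) imageE)
  from finite_subset_image[OF \<F>(1,2)] obtain Z where Z: "Z \<subseteq> ?D" "finite Z" "\<F> = V ` Z" by metis
  show thesis
  proof (rule that[of "\<Union> (F ` Z)" "Min (insert 1 (\<delta> ` Z))"])
    show "finite (\<Union> (F ` Z))" "\<Union> (F ` Z) \<subseteq> I" using Z F(1,2) by blast+
    show "Min (insert 1 (\<delta> ` Z)) > 0" using Z F(3) by auto
    fix z w assume z: "z \<in> ?D" and w: "w \<in> ?D" and close: "\<forall>i\<in>\<Union> (F ` Z). norm (z i - w i) < Min (insert 1 (\<delta> ` Z))"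
    obtain x where x: "x \<in> Z" "z \<in> V x" using \<F>(3) z Z(3) by blast
    have xD: "x \<in> ?D" using x Z by blast
    have zx: "norm (z i - x i) < \<delta> x" if "i \<in> F x" for i
      using x(2) that by (auto simp: V_def dist_norm norm_minus_commute)
    have "Min (insert 1 (\<delta> ` Z)) \<le> \<delta> x" using Z(2) x(1) by (intro Min_le) auto
    then have wx: "norm (w i - x i) < 2 * \<delta> x" if "i \<in> F x" for i
      using zx[OF that] bspec[OF close, of i] that x(1) norm_triangle_ineq4[of "z i - x i" "z i - w i"] by fastforce
    have "norm (h z - h x) < e / 2"
      using F(4)[OF xD z] zx F(3)[OF xD] by force
    moreover have "norm (h w - h x) < e / 2" using F(4)[OF xD w] wx by blast
    ultimately show "norm (h z - h w) < e" using norm_triangle_ineq4[of "h z - h x" "h w - h x"] by simp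
  qed
qed

text \<open>
  The points \<open>r * z\<close> with \<open>r < 1\<close> lie in the open polydisc and tend to \<open>z\<close> uniformly in all coordinates.
\<close>

lemma continuous_agree_on_open_polydisc:
  assumes "continuous_map (closed_polydisc I) euclidean h" "\<And>z. z \<in> open_polydisc I \<Longrightarrow> h z = (0::complex)"
    and z: "z \<in> topspace (closed_polydisc I)"
  shows "h z = 0"
proof -
  have "norm (h z) \<le> e" if e: "e > 0" for e
  proof -
    obtain F \<delta> where F: "finite F" "F \<subseteq> I" "\<delta> > 0" "\<And>z w. z \<in> topspace (closed_polydisc I) \<Longrightarrow> w \<in> topspace (closed_polydisc I) \<Longrightarrow>
      \<forall>i\<in>F. norm (z i - w i) < \<delta> \<Longrightarrow> norm (h z - h w) < e"
      by (rule polydisc_uniformly_continuous[OF assms(1) e]) (rule that)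
    define r where "r = max (1 / 2) (1 - \<delta> / 2)"
    have r: "0 < r" "r < 1" "1 - r < \<delta>" using F(3) by (auto simp: r_def)
    let ?w = "\<lambda>i\<in>I. of_real r * z i"
    have le: "norm (?w i) \<le> r" if "i \<in> I" for i
      using closed_polydisc_norm_le[OF z that] that r by (simp add: norm_mult mult_left_le)
    then have w: "?w \<in> open_polydisc I" using r by (auto simp: open_polydisc_iff)
    have "norm (h z - h ?w) < e"
    proof (rule F(4)[OF z open_polydisc_subset[OF w]], rule ballI)
      fix i assume "i \<in> F"
      then have i: "i \<in> I" using F(2) by blast
      have "norm (z i - ?w i) = (1 - r) * norm (z i)"
      proof -
        have "z i - ?w i = of_real (1 - r) * z i" using i by (simp add: algebra_simps)
        then show ?thesis using r by (simp only: norm_mult norm_of_real)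
      qed
      also have "\<dots> \<le> 1 - r" using closed_polydisc_norm_le[OF z i] r by (intro mult_left_le) auto
      finally show "norm (z i - ?w i) < \<delta>" using r by simp
    qed
    then show ?thesis using assms(2)[OF w] by simp
  qed
  then have "norm (h z) \<le> 0" by (rule field_le_epsilon[of _ 0, simplified add_0_left])
  then show ?thesis by simp
qed

section \<open>Polynomial approximation of holomorphic functions\<close>

definition root_unity :: "nat \<Rightarrow> nat \<Rightarrow> complex" where
  "root_unity m j = exp (2 * of_real pi * \<i> * of_nat j / of_nat m)"

lemma root_unity_power: "m \<ge> 1 \<Longrightarrow> root_unity m j ^ l = root_unity m l ^ j"
  by (simp add: root_unity_def exp_of_nat_mult[symmetric] mult_ac)

lemma norm_root_unity [simp]: "norm (root_unity m j) = 1"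
  by (simp add: root_unity_def norm_exp_eq_Re)

lemma root_unity_nz [simp]: "root_unity m j \<noteq> 0"
  by (simp add: root_unity_def)

lemma root_unity_orthogonal:
  assumes m: "m \<ge> 1" and kl: "k < m" "l < m"
  shows "(\<Sum>j<m. root_unity m j ^ l / root_unity m j ^ k) = (if l = k then of_nat m else 0)"
proof -
  let ?x = "root_unity m l / root_unity m k"
  have eq: "root_unity m j ^ l / root_unity m j ^ k = ?x ^ j" for j
    using root_unity_power[OF m] by (simp add: power_divide)
  show ?thesis
  proof (cases "l = k")
    case False
    have "root_unity m l \<noteq> root_unity m k"
      using complex_root_unity_eq[OF m, of l k] False kl unfolding root_unity_def by simp
    then have x1: "?x \<noteq> 1" by simp
    have "root_unity m n ^ m = 1" for n
      using complex_root_unity[of m n] m unfolding root_unity_def by (simp add: mult_ac)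
    then have "?x ^ m = 1" by (simp add: power_divide)
    then have "(\<Sum>j<m. ?x ^ j) = 0" using x1 by (simp add: sum_gp_strict)
    then show ?thesis using False by (simp add: eq)
  qed (simp add: eq)
qed

text \<open>
  The discretization of Cauchy's integral for the \<open>k\<close>-th Taylor coefficient of \<open>g\<close> on the circle of radius \<open>r\<close> with \<open>m\<close> nodes.
  It is a finite combination of values of \<open>g\<close>, so it preserves holomorphic dependence on further variables.
\<close>

definition interp_coeff :: "real \<Rightarrow> nat \<Rightarrow> (complex \<Rightarrow> complex) \<Rightarrow> nat \<Rightarrow> complex" where
  "interp_coeff r m g k = (\<Sum>j<m. g (of_real r * root_unity m j) / (of_real r * root_unity m j) ^ k) / of_nat m"

lemma interp_coeff_poly:
  assumes m: "m \<ge> 1" and r: "r > 0" and k: "k < m"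
  shows "interp_coeff r m (\<lambda>w. \<Sum>l<m. c l * w ^ l) k = c k"
proof -
  have "(\<Sum>j<m. (\<Sum>l<m. c l * (of_real r * root_unity m j) ^ l) / (of_real r * root_unity m j) ^ k) =
      (\<Sum>l<m. \<Sum>j<m. c l * (of_real r ^ l / of_real r ^ k) * (root_unity m j ^ l / root_unity m j ^ k))"
    by (subst sum.swap) (simp add: sum_divide_distrib power_mult_distrib mult_ac)
  also have "\<dots> = (\<Sum>l<m. c l * (of_real r ^ l / of_real r ^ k) * (if l = k then of_nat m else 0))"
    unfolding sum_distrib_left[symmetric] by (intro sum.cong refl) (simp only: root_unity_orthogonal[OF m k] lessThan_iff)
  also have "\<dots> = (\<Sum>l<m. if l = k then c k * of_nat m else 0)"
    using r by (intro sum.cong) auto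
  also have "\<dots> = c k * of_nat m" using k by simp
  finally show ?thesis using m by (simp add: interp_coeff_def)
qed

lemma interp_coeff_norm_le:
  assumes m: "m \<ge> 1" and r: "r > 0" and u: "\<And>w. norm w = r \<Longrightarrow> norm (u w) \<le> C"
  shows "norm (interp_coeff r m u k) \<le> C / r ^ k"
proof -
  have "norm (\<Sum>j<m. u (of_real r * root_unity m j) / (of_real r * root_unity m j) ^ k) \<le> (\<Sum>j<m. C / r ^ k)"
  proof (rule sum_norm_le)
    fix j
    have "norm (u (of_real r * root_unity m j)) \<le> C" using r by (intro u) (simp add: norm_mult)
    then show "norm (u (of_real r * root_unity m j) / (of_real r * root_unity m j) ^ k) \<le> C / r ^ k"
      using r by (simp add: norm_divide norm_power norm_mult divide_right_mono)
  qed
  then show ?thesis using m by (simp add: interp_coeff_def norm_divide divide_le_eq mult.commute)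
qed

text \<open>
  The error is governed by the Taylor remainder of order \<open>m\<close> on the disc of radius \<open>r\<close>, since polynomials of smaller degree are
  reproduced. By Cauchy's estimate on a larger circle the remainder decays geometrically, with a rate depending only on \<open>r\<close>, and
  only \<open>m + 1\<close> such terms occur. So \<open>m\<close> works for all \<open>g\<close> with the same bound \<open>M\<close>.
\<close>

lemma interpolation_error:
  assumes r: "0 < r" "r < 1" and e: "e > 0"
  shows "\<exists>m\<ge>1. \<forall>g. g holomorphic_on ball 0 1 \<longrightarrow> (\<forall>w\<in>ball 0 1. norm (g w) \<le> M) \<longrightarrow>
    (\<forall>w. norm w \<le> r \<longrightarrow> norm (g w - (\<Sum>k<m. w ^ k * interp_coeff r m g k)) \<le> e)"
proof -
  \<comment> \<open>any radius strictly between \<open>r\<close> and 1 would do\<close>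
  define R where "R = (1 + r) / 2"
  have R: "r < R" "R < 1" "0 < R" using r by (auto simp: R_def)
  define q where "q = r / R"
  have q: "0 < q" "q < 1" using r R by (auto simp: q_def)
  have "(\<lambda>m. (real m + 1) * (\<bar>M\<bar> / (1 - q) * q ^ m)) \<longlonglongrightarrow> 0"
    using q by real_asymp
  then have "\<forall>\<^sub>F m in sequentially. (real m + 1) * (\<bar>M\<bar> / (1 - q) * q ^ m) < e" using e by (rule order_tendstoD)
  then obtain m0 where m0: "\<And>m. m \<ge> m0 \<Longrightarrow> (real m + 1) * (\<bar>M\<bar> / (1 - q) * q ^ m) < e"
    by (auto simp: eventually_sequentially)
  define m where "m = max 1 m0"
  have m: "m \<ge> 1" and small: "(real m + 1) * (\<bar>M\<bar> / (1 - q) * q ^ m) < e" using m0 by (auto simp: m_def)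
  let ?E = "\<bar>M\<bar> / (1 - q) * q ^ m"
  have "norm (g w - (\<Sum>k<m. w ^ k * interp_coeff r m g k)) \<le> e"
    if g: "g holomorphic_on ball 0 1" and M: "\<forall>w\<in>ball 0 1. norm (g w) \<le> M" and w: "norm w \<le> r" for g w
  proof -
    define c where "c l = (deriv ^^ l) g 0 / fact l" for l
    have sums: "(\<lambda>l. c l * x ^ l) sums g x" if "norm x \<le> r" for x
      using holomorphic_power_series[OF g, of x] that r by (simp add: c_def)
    have c: "norm (c l) \<le> \<bar>M\<bar> / R ^ l" for l
    proof -
      have "norm ((deriv ^^ l) g 0) \<le> fact l * \<bar>M\<bar> / R ^ l"
      proof (rule Cauchy_inequality)
        show "g holomorphic_on ball 0 R" using R by (intro holomorphic_on_subset[OF g]) auto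
        show "continuous_on (cball 0 R) g"
          using R by (intro continuous_on_subset[OF holomorphic_on_imp_continuous_on[OF g]]) auto
        fix x :: complex assume "norm (0 - x) = R"
        then have "norm (g x) \<le> M" using M R by simp
        then show "norm (g x) \<le> \<bar>M\<bar>" by linarith
      qed (use R in auto)
      then show ?thesis by (simp add: c_def norm_divide field_simps)
    qed
    define t where "t x = (\<Sum>l<m. c l * x ^ l)" for x
    have tail: "norm (g x - t x) \<le> ?E" if x: "norm x \<le> r" for x
    proof -
      have s: "(\<lambda>l. c (l + m) * x ^ (l + m)) sums (g x - t x)"
        unfolding t_def using sums_split_initial_segment[OF sums[OF x], of m] .
      have le: "norm (c (l + m) * x ^ (l + m)) \<le> \<bar>M\<bar> * q ^ m * q ^ l" for l
      proof -
        have "norm (c (l + m) * x ^ (l + m)) \<le> \<bar>M\<bar> / R ^ (l + m) * r ^ (l + m)"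
          unfolding norm_mult norm_power using c x R by (intro mult_mono power_mono) auto
        also have "\<dots> = \<bar>M\<bar> * q ^ m * q ^ l" by (simp add: q_def power_divide power_add mult_ac)
        finally show ?thesis .
      qed
      have geo: "(\<lambda>l. \<bar>M\<bar> * q ^ m * q ^ l) sums (\<bar>M\<bar> * q ^ m * (1 / (1 - q)))"
        using q by (intro sums_mult geometric_sums) auto
      have "norm (suminf (\<lambda>l. c (l + m) * x ^ (l + m))) \<le> suminf (\<lambda>l. \<bar>M\<bar> * q ^ m * q ^ l)"
        by (rule norm_suminf_le[OF le sums_summable[OF geo]])
      then show ?thesis using s geo by (simp add: sums_iff)
    qed
    have co: "interp_coeff r m g k = interp_coeff r m (\<lambda>x. g x - t x) k + c k" if "k < m" for k
      using interp_coeff_poly[OF m r(1) that, of c]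
      by (simp add: interp_coeff_def t_def diff_divide_distrib sum_subtractf add_divide_distrib[symmetric])
    have "g w - (\<Sum>k<m. w ^ k * interp_coeff r m g k) = (g w - t w) - (\<Sum>k<m. w ^ k * interp_coeff r m (\<lambda>x. g x - t x) k)"
      using co by (simp add: t_def distrib_left sum.distrib mult.commute)
    also have "norm \<dots> \<le> ?E + (\<Sum>k<m. ?E)"
    proof (rule order_trans[OF norm_triangle_ineq4 add_mono[OF tail[OF w] sum_norm_le]])
      fix k
      have E0: "0 \<le> ?E" using q by simp
      have "norm (w ^ k * interp_coeff r m (\<lambda>x. g x - t x) k) \<le> r ^ k * (?E / r ^ k)"
        unfolding norm_mult norm_power
        by (intro mult_mono power_mono w interp_coeff_norm_le m r tail) (use r E0 in auto)
      then show "norm (w ^ k * interp_coeff r m (\<lambda>x. g x - t x) k) \<le> ?E" using r by simp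
    qed
    also have "\<dots> = (real m + 1) * ?E" by (simp add: algebra_simps add_divide_distrib)
    finally show ?thesis using small by linarith
  qed
  then show ?thesis using m by blast
qed

definition separately_holomorphic :: "nat set \<Rightarrow> real \<Rightarrow> ((nat \<Rightarrow> complex) \<Rightarrow> complex) \<Rightarrow> bool" where
  "separately_holomorphic I M h \<longleftrightarrow> (\<forall>z\<in>open_polydisc I. norm (h z) \<le> M \<and>
     (\<forall>i\<in>I. (\<lambda>w. h (z(i := w))) holomorphic_on ball 0 1))"

text \<open>
  The coefficient of interpolation in the variable \<open>i\<close> is a function of the same kind in the remaining variables.
\<close>

lemma separately_holomorphic_interp:
  assumes h: "separately_holomorphic I M h" and i: "i \<in> I" and r: "0 < r" "r < 1" and m: "m \<ge> 1"
  shows "separately_holomorphic I (M / r ^ k) (\<lambda>z. interp_coeff r m (\<lambda>w. h (z(i := w))) k)"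
  unfolding separately_holomorphic_def
proof (intro ballI conjI)
  fix z assume z: "z \<in> open_polydisc I"
  show "norm (interp_coeff r m (\<lambda>w. h (z(i := w))) k) \<le> M / r ^ k"
  proof (rule interp_coeff_norm_le[OF m r(1)])
    fix w :: complex assume "norm w = r"
    then show "norm (h (z(i := w))) \<le> M"
      using open_polydisc_upd[OF z i, of w] r h by (simp add: separately_holomorphic_def)
  qed
  fix l assume l: "l \<in> I"
  show "(\<lambda>w. interp_coeff r m (\<lambda>x. h ((z(l := w))(i := x))) k) holomorphic_on ball 0 1"
  proof (cases "l = i")
    case False
    have "(\<lambda>w. h ((z(l := w))(i := of_real r * root_unity m j))) holomorphic_on ball 0 1" for j
    proof -
      have "z(i := of_real r * root_unity m j) \<in> open_polydisc I"
        using r by (intro open_polydisc_upd z i) (simp add: norm_mult)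
      then have "(\<lambda>w. h ((z(i := of_real r * root_unity m j))(l := w))) holomorphic_on ball 0 1"
        using h l by (simp add: separately_holomorphic_def)
      then show ?thesis using False by (simp add: fun_upd_twist)
    qed
    then show ?thesis unfolding interp_coeff_def using r m by (intro holomorphic_intros) auto
  qed simp
qed

text \<open>
  Induction on the number of variables: interpolation in one variable has coefficients that depend on the other variables, and these
  are approximated by polynomials. The degree \<open>m\<close> is fixed before the accuracy \<open>e / (2 * m)\<close> of the coefficients.
\<close>

lemma polynomial_approx_finite:
  assumes "finite F" "F \<subseteq> I" "separately_holomorphic I M h" and r: "0 < r" "r < 1" and "e > 0"
  shows "\<exists>p\<in>poly_fun F. \<forall>z\<in>extensional I. (\<forall>i\<in>F. norm (z i) \<le> r) \<longrightarrow> (\<forall>i\<in>I - F. z i = 0) \<longrightarrow> norm (h z - p z) \<le> e"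
  using assms(1,2,3,6)
proof (induction F arbitrary: h M e rule: finite_induct)
  case empty
  have "z = (\<lambda>i\<in>I. 0)" if "z \<in> extensional I" "\<forall>i\<in>I - {}. z i = 0" for z :: "nat \<Rightarrow> complex"
    using that by (intro extensionalityI[of _ I]) auto
  then show ?case using \<open>e > 0\<close> by (intro bexI[of _ "\<lambda>z. h (\<lambda>i\<in>I. 0)"] poly_fun.const) auto
next
  case (insert i F)
  have i: "i \<in> I" using insert.prems by blast
  obtain m where m: "m \<ge> 1" and interp: "\<And>g w. g holomorphic_on ball 0 1 \<Longrightarrow> (\<forall>w\<in>ball 0 1. norm (g w) \<le> M) \<Longrightarrow>
      norm w \<le> r \<Longrightarrow> norm (g w - (\<Sum>k<m. w ^ k * interp_coeff r m g k)) \<le> e / 2"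
    using interpolation_error[OF r half_gt_zero[OF insert.prems(3)]] by blast
  define hk where "hk k z = interp_coeff r m (\<lambda>w. h (z(i := w))) k" for k z
  have "\<exists>p\<in>poly_fun F. \<forall>z\<in>extensional I. (\<forall>i\<in>F. norm (z i) \<le> r) \<longrightarrow> (\<forall>i\<in>I - F. z i = 0) \<longrightarrow>
      norm (hk k z - p z) \<le> e / (2 * real m)" for k
  proof (rule insert.IH)
    show "separately_holomorphic I (M / r ^ k) (hk k)"
      unfolding hk_def[abs_def] by (rule separately_holomorphic_interp[OF insert.prems(2) i r m])
  qed (use insert.prems m in auto)
  then have "\<forall>k. \<exists>p. p \<in> poly_fun F \<and> (\<forall>z\<in>extensional I. (\<forall>i\<in>F. norm (z i) \<le> r) \<longrightarrow> (\<forall>i\<in>I - F. z i = 0) \<longrightarrow>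
      norm (hk k z - p z) \<le> e / (2 * real m))" by (simp add: Bex_def)
  then obtain p where p: "\<And>k. p k \<in> poly_fun F" "\<And>k z. z \<in> extensional I \<Longrightarrow> (\<forall>i\<in>F. norm (z i) \<le> r) \<Longrightarrow> (\<forall>i\<in>I - F. z i = 0) \<Longrightarrow>
      norm (hk k z - p k z) \<le> e / (2 * real m)" unfolding choice_iff by blast
  define P where "P z = (\<Sum>k<m. z i ^ k * p k z)" for z
  have P: "P \<in> poly_fun (insert i F)"
    unfolding P_def[abs_def]
    by (rule poly_fun_sum, rule poly_fun.mult[OF poly_fun_power[OF poly_fun.coord]])
       (use p(1) poly_fun_mono[of F "insert i F"] in auto)
  have "norm (h z - P z) \<le> e"
    if z: "z \<in> extensional I" and le: "\<forall>j\<in>insert i F. norm (z j) \<le> r" and z0: "\<forall>j\<in>I - insert i F. z j = 0" for z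
  proof -
    have zo: "z \<in> open_polydisc I"
      unfolding open_polydisc_iff
    proof (intro conjI exI[of _ r] ballI)
      fix j assume "j \<in> I"
      then show "norm (z j) \<le> r" using le z0 r by (cases "j \<in> insert i F") auto
    qed (use z r in auto)
    let ?g = "\<lambda>w. h (z(i := w))"
    have g1: "?g holomorphic_on ball 0 1"
      using insert.prems(2) zo i unfolding separately_holomorphic_def by blast
    have g2: "\<forall>w\<in>ball 0 1. norm (?g w) \<le> M"
    proof
      fix w :: complex assume "w \<in> ball 0 1"
      then have "z(i := w) \<in> open_polydisc I" by (intro open_polydisc_upd zo i) simp
      then show "norm (?g w) \<le> M" using insert.prems(2) unfolding separately_holomorphic_def by blast
    qed
    have "norm (?g (z i) - (\<Sum>k<m. z i ^ k * interp_coeff r m ?g k)) \<le> e / 2"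
      by (rule interp[OF g1 g2]) (use le in simp)
    then have 1: "norm (h z - (\<Sum>k<m. z i ^ k * hk k z)) \<le> e / 2" by (simp add: hk_def)
    have "norm (\<Sum>k<m. z i ^ k * (hk k z - p k z)) \<le> (\<Sum>k<m. e / (2 * real m))"
    proof (rule sum_norm_le)
      fix k
      \<comment> \<open>the polynomial for the coefficient was chosen on points whose \<open>i\<close>-th coordinate is 0; neither side depends on this coordinate\<close>
      let ?z = "z(i := 0)"
      have "norm (hk k ?z - p k ?z) \<le> e / (2 * real m)"
      proof (rule p(2))
        show "?z \<in> extensional I" using z i by (auto simp: extensional_def)
        show "\<forall>j\<in>F. norm (?z j) \<le> r" using le r by auto
        show "\<forall>j\<in>I - F. ?z j = 0" using z0 by auto
      qed
      moreover have "hk k ?z = hk k z" by (simp add: hk_def)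
      moreover have "p k ?z = p k z" by (rule poly_fun_cong[OF p(1)]) (use insert.hyps in auto)
      moreover have "norm (z i ^ k) \<le> 1" using le r by (simp add: norm_power power_le_one)
      ultimately show "norm (z i ^ k * (hk k z - p k z)) \<le> e / (2 * real m)"
        unfolding norm_mult using mult_mono[of "norm (z i ^ k)" 1 "norm (hk k z - p k z)" "e / (2 * real m)"] by simp
    qed
    also have "\<dots> = e / 2" using m by simp
    also have "(\<Sum>k<m. z i ^ k * (hk k z - p k z)) = (\<Sum>k<m. z i ^ k * hk k z) - P z"
      by (simp add: P_def right_diff_distrib sum_subtractf)
    finally show ?thesis
      using 1 norm_triangle_ineq[of "h z - (\<Sum>k<m. z i ^ k * hk k z)" "(\<Sum>k<m. z i ^ k * hk k z) - P z"] by simp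
  qed
  then show ?case by (intro bexI[OF _ P]) blast
qed

lemma gateaux_separately_holomorphic:
  assumes f: "gateaux_holomorphic I f" and z: "z \<in> open_polydisc I" and i: "i \<in> I"
  shows "(\<lambda>w. f (z(i := w))) holomorphic_on ball 0 1"
proof (rule analytic_imp_holomorphic, rule analytic_on_analytic_at[THEN iffD2], rule ballI)
  fix w0 :: complex assume w0: "w0 \<in> ball 0 1"
  let ?z = "z(i := w0)" and ?v = "\<lambda>j\<in>I. if j = i then 1 else (0::complex)"
  have z': "?z \<in> open_polydisc I" using w0 by (intro open_polydisc_upd z i) simp
  have "?v ` I \<subseteq> {0, 1}" by auto
  then have "bounded (?v ` I)" by (rule bounded_subset[rotated]) simp
  then have "?v \<in> linf I" by (simp add: linf_def)
  then have "(\<lambda>w. f (\<lambda>j\<in>I. ?z j + w * ?v j)) analytic_on {0}"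
    using f z' unfolding gateaux_holomorphic_def by blast
  moreover have "(\<lambda>j\<in>I. ?z j + w * ?v j) = z(i := w0 + w)" for w
    using z i by (intro extensionalityI[of _ I]) (auto simp: open_polydisc_iff extensional_def)
  ultimately have "(\<lambda>w. f (z(i := w0 + w))) analytic_on {0}" by simp
  then have "((\<lambda>w. f (z(i := w0 + w))) \<circ> (\<lambda>w. w - w0)) analytic_on {w0}"
    by (intro analytic_on_compose analytic_intros) auto
  then show "(\<lambda>w. f (z(i := w))) analytic_on {w0}" by (simp add: o_def)
qed

lemma poly_fun_dilate: "p \<in> poly_fun I \<Longrightarrow> (\<lambda>z. p (\<lambda>i. c * z i)) \<in> poly_fun I"
  by (induction rule: poly_fun.induct) (auto intro: poly_fun.intros poly_fun_scale)

text \<open>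
  Setting all but finitely many coordinates to 0 and shrinking the others by a factor \<open>r\<close> changes \<open>h\<close> by a small amount. The dilated
  restriction to finitely many variables is holomorphic on a larger polydisc, where \<open>polynomial_approx_finite\<close> applies.
\<close>

lemma gateaux_poly_approx:
  assumes f: "gateaux_holomorphic I f" and h: "continuous_extension I f h" and e: "e > 0"
  shows "\<exists>p\<in>poly_fun I. \<forall>z\<in>topspace (closed_polydisc I). norm (h z - p z) \<le> e"
proof -
  let ?D = "topspace (closed_polydisc I)"
  have cont: "continuous_map (closed_polydisc I) euclidean h" and hf: "\<And>z. z \<in> open_polydisc I \<Longrightarrow> h z = f z"
    using h unfolding continuous_extension_def by auto
  have "compactin euclidean (h ` ?D)"
    by (rule image_compactin[OF compact_closed_polydisc[unfolded compact_space_def] cont])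
  then have "bounded (h ` ?D)" by (simp add: compact_imp_bounded compactin_euclidean_iff)
  then obtain M where M: "\<And>z. z \<in> ?D \<Longrightarrow> norm (h z) \<le> M" unfolding bounded_iff by auto
  have sep: "separately_holomorphic I M f"
    unfolding separately_holomorphic_def
    using M open_polydisc_subset hf gateaux_separately_holomorphic[OF f] by (metis)
  obtain F \<delta> where F: "finite F" "F \<subseteq> I" "\<delta> > 0" "\<And>z w. z \<in> ?D \<Longrightarrow> w \<in> ?D \<Longrightarrow>
      \<forall>i\<in>F. norm (z i - w i) < \<delta> \<Longrightarrow> norm (h z - h w) < e / 2"
    by (rule polydisc_uniformly_continuous[OF cont half_gt_zero[OF e]]) (rule that)
  define r where "r = max (1 / 2) (1 - \<delta> / 2)"
  have r: "0 < r" "r < 1" "1 - r < \<delta>" using F(3) by (auto simp: r_def)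
  obtain p where p: "p \<in> poly_fun F" "\<forall>z\<in>extensional I. (\<forall>i\<in>F. norm (z i) \<le> r) \<longrightarrow> (\<forall>i\<in>I - F. z i = 0) \<longrightarrow> norm (f z - p z) \<le> e / 2"
    by (rule bexE[OF polynomial_approx_finite[OF F(1,2) sep r(1,2) half_gt_zero[OF e]]])
  let ?p = "\<lambda>z. p (\<lambda>i. of_real r * z i)"
  have "norm (h z - ?p z) \<le> e" if z: "z \<in> ?D" for z
  proof -
    let ?w = "\<lambda>i\<in>I. if i \<in> F then of_real r * z i else 0"
    have le: "norm (?w i) \<le> r" if "i \<in> I" for i
      using closed_polydisc_norm_le[OF z that] that r by (simp add: norm_mult mult_left_le)
    then have w: "?w \<in> open_polydisc I"
      unfolding open_polydisc_iff using r by (intro conjI exI[of _ r] ballI) auto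
    have "norm (h z - h ?w) < e / 2"
    proof (rule F(4)[OF z open_polydisc_subset[OF w]], rule ballI)
      fix i assume iF: "i \<in> F"
      then have i: "i \<in> I" using F(2) by blast
      have "norm (z i - ?w i) = (1 - r) * norm (z i)"
      proof -
        have "z i - ?w i = of_real (1 - r) * z i" using i iF by (simp add: algebra_simps)
        then show ?thesis using r by (simp only: norm_mult norm_of_real)
      qed
      also have "\<dots> \<le> 1 - r" using closed_polydisc_norm_le[OF z i] r by (intro mult_left_le) auto
      finally show "norm (z i - ?w i) < \<delta>" using r by simp
    qed
    moreover have "norm (f ?w - p ?w) \<le> e / 2"
    proof (rule p(2)[rule_format])
      show "norm (?w i) \<le> r" if "i \<in> F" for i using le that F(2) by blast
    qed auto
    moreover have "p ?w = ?p z" by (rule poly_fun_cong[OF p(1)]) (use F(2) in auto)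
    ultimately show ?thesis
      using hf[OF w] norm_triangle_ineq[of "h z - h ?w" "f ?w - p ?w"] by simp
  qed
  moreover have "?p \<in> poly_fun I" using poly_fun_dilate[OF p(1)] poly_fun_mono[OF F(2)] by blast
  ultimately show ?thesis by (intro bexI[where x = ?p] ballI)
qed

lemma poly_fun_line_holomorphic:
  "p \<in> poly_fun I \<Longrightarrow> (\<lambda>w. p (\<lambda>i\<in>I. z i + w * v i)) holomorphic_on A"
  by (induction rule: poly_fun.induct) (auto intro!: holomorphic_intros)

text \<open>
  On a complex line through the open polydisc a polynomial is holomorphic, and so is a uniform limit of polynomials.
\<close>

lemma gateaux_if_poly_approx:
  assumes approx: "\<And>e. e > 0 \<Longrightarrow> \<exists>p\<in>poly_fun I. \<forall>z\<in>topspace (closed_polydisc I). norm (h z - p z) \<le> e"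
    and hf: "\<And>z. z \<in> open_polydisc I \<Longrightarrow> f z = h z"
  shows "gateaux_holomorphic I f"
  unfolding gateaux_holomorphic_def
proof (intro ballI)
  fix z v assume z: "z \<in> open_polydisc I" and v: "v \<in> linf I"
  obtain r where r: "0 < r" "r < 1" "\<And>i. i \<in> I \<Longrightarrow> norm (z i) \<le> r" using z unfolding open_polydisc_iff by blast
  obtain B where B: "B > 0" "\<And>i. i \<in> I \<Longrightarrow> norm (v i) \<le> B"
    using v unfolding linf_def bounded_pos by auto
  \<comment> \<open>the line stays in the polydisc of radius \<open>(1 + r) / 2\<close> for parameters of modulus less than \<open>d\<close>\<close>
  define d where "d = (1 - r) / (2 * B)"
  have d: "d > 0" using r B by (simp add: d_def)
  let ?l = "\<lambda>w. \<lambda>i\<in>I. z i + w * v i"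
  have line: "?l w \<in> open_polydisc I" if w: "w \<in> ball 0 d" for w
    unfolding open_polydisc_iff
  proof (intro conjI exI[of _ "(1 + r) / 2"] ballI)
    fix i assume i: "i \<in> I"
    have "norm (w * v i) \<le> d * B" unfolding norm_mult using w B(2)[OF i] B(1) d by (intro mult_mono) auto
    also have "\<dots> = (1 - r) / 2" using B by (simp add: d_def)
    finally show "norm (?l w i) \<le> (1 + r) / 2"
      using norm_triangle_ineq[of "z i" "w * v i"] r(3)[OF i] i by (simp add: field_simps)
  qed (use r in auto)
  have "\<forall>k. \<exists>p. p \<in> poly_fun I \<and> (\<forall>z\<in>topspace (closed_polydisc I). norm (h z - p z) \<le> inverse (real (Suc k)))"
    using approx[of "inverse (real (Suc _))"] by (simp add: Bex_def)
  then obtain p where p: "\<And>k. p k \<in> poly_fun I" "\<And>k z. z \<in> topspace (closed_polydisc I) \<Longrightarrow> norm (h z - p k z) \<le> inverse (real (Suc k))"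
    unfolding choice_iff by blast
  have lim: "uniform_limit (ball 0 d) (\<lambda>k w. p k (?l w)) (\<lambda>w. f (?l w)) sequentially"
    unfolding uniform_limit_iff
  proof (intro allI impI)
    fix e :: real assume "e > 0"
    then have "\<forall>\<^sub>F k in sequentially. inverse (real (Suc k)) < e"
      using LIMSEQ_inverse_real_of_nat order_tendstoD(2) by blast
    then show "\<forall>\<^sub>F k in sequentially. \<forall>w\<in>ball 0 d. dist (p k (?l w)) (f (?l w)) < e"
    proof (eventually_elim, intro ballI)
      fix k and w :: complex assume k: "inverse (real (Suc k)) < e" and w: "w \<in> ball 0 d"
      have "norm (h (?l w) - p k (?l w)) \<le> inverse (real (Suc k))"
        by (rule p(2)[OF open_polydisc_subset[OF line[OF w]]])
      then show "dist (p k (?l w)) (f (?l w)) < e" using k hf[OF line[OF w]] by (simp add: dist_norm norm_minus_commute)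
    qed
  qed
  have "(\<lambda>w. f (?l w)) holomorphic_on ball 0 d"
  proof (rule holomorphic_uniform_sequence[OF open_ball])
    show "(\<lambda>w. p k (?l w)) holomorphic_on ball 0 d" for k by (rule poly_fun_line_holomorphic[OF p(1)])
    fix x :: complex assume "x \<in> ball 0 d"
    then obtain d' where "d' > 0" "cball x d' \<subseteq> ball 0 d" using open_ball open_contains_cball by blast
    then show "\<exists>d'>0. cball x d' \<subseteq> ball 0 d \<and> uniform_limit (cball x d') (\<lambda>k w. p k (?l w)) (\<lambda>w. f (?l w)) sequentially"
      using uniform_limit_on_subset[OF lim] by blast
  qed
  then have "(\<lambda>w. f (?l w)) analytic_on ball 0 d" by (simp add: analytic_on_open)
  then show "(\<lambda>w. f (?l w)) analytic_on {0}" by (rule analytic_on_subset) (use d in simp)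
qed

section \<open>Power series and multi-indices\<close>

text \<open>
  Prime factorization identifies multi-indices with positive integers.
\<close>

definition index_num :: "(nat \<Rightarrow>\<^sub>0 nat) \<Rightarrow> nat" where
  "index_num \<alpha> = (\<Prod>i\<in>Poly_Mapping.keys \<alpha>. nth_prime i ^ Poly_Mapping.lookup \<alpha> i)"

lemma bohr_monomial_power: "n \<ge> 1 \<Longrightarrow> bohr_monomial z (n ^ k) = bohr_monomial z n ^ k"
  by (induction k) (simp_all add: bohr_monomial_mult)

lemma bohr_monomial_prod:
  assumes "finite J" "\<And>j. j \<in> J \<Longrightarrow> f j \<ge> 1" shows "bohr_monomial z (\<Prod>j\<in>J. f j) = (\<Prod>j\<in>J. bohr_monomial z (f j))"
  using assms
proof (induction J)
  case (insert j J)
  have "(\<Prod>j\<in>J. f j) \<ge> 1" using insert.prems by (simp add: Suc_le_eq prod_pos)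
  then show ?case using insert by (simp add: bohr_monomial_mult)
qed simp

lemma bohr_monomial_index_num:
  assumes "Poly_Mapping.keys \<alpha> \<subseteq> {1..}" shows "bohr_monomial z (index_num \<alpha>) = monomial_fun \<alpha> z"
proof -
  have "bohr_monomial z (index_num \<alpha>) = (\<Prod>i\<in>Poly_Mapping.keys \<alpha>. bohr_monomial z (nth_prime i ^ Poly_Mapping.lookup \<alpha> i))"
    unfolding index_num_def using assms by (intro bohr_monomial_prod) (auto simp: Suc_le_eq subset_iff)
  also have "\<dots> = monomial_fun \<alpha> z"
    unfolding monomial_fun_def using assms by (intro prod.cong) (auto simp: bohr_monomial_power bohr_monomial_nth_prime subset_iff)
  finally show ?thesis .
qed

lemma index_num_smooth:
  assumes "Poly_Mapping.keys \<alpha> \<subseteq> I" "I \<subseteq> {1..}" shows "index_num \<alpha> \<in> smooth_over I"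
proof -
  have pow: "nth_prime i ^ k \<in> smooth_over I \<and> nth_prime i ^ k \<ge> 1" if "i \<in> I" for i k
    using that assms(2) by (induction k) (auto simp: smooth_mult_iff nth_prime_smooth_iff subset_iff)
  have "(\<Prod>i\<in>J. nth_prime i ^ Poly_Mapping.lookup \<alpha> i) \<in> smooth_over I \<and> (\<Prod>i\<in>J. nth_prime i ^ Poly_Mapping.lookup \<alpha> i) \<ge> 1"
    if "finite J" "J \<subseteq> I" for J
    using that
  proof (induction J)
    case (insert i J)
    then show ?case using pow[of i "Poly_Mapping.lookup \<alpha> i"] by (auto simp: smooth_mult_iff)
  qed simp
  then show ?thesis unfolding index_num_def using assms(1) by simp
qed

text \<open>
  The exponent of coordinate \<open>i\<close> is read off from the value of the monomial at the point with value 2 at \<open>i\<close> and 1 elsewhere.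
\<close>

lemma index_num_inj:
  assumes "Poly_Mapping.keys \<alpha> \<subseteq> {1..}" "Poly_Mapping.keys \<beta> \<subseteq> {1..}" "index_num \<alpha> = index_num \<beta>"
  shows "\<alpha> = \<beta>"
proof (rule poly_mapping_eqI)
  fix i
  have mono: "monomial_fun \<gamma> (\<lambda>j. if j = i then 2 else 1) = 2 ^ Poly_Mapping.lookup \<gamma> i" for \<gamma>
  proof -
    have "monomial_fun \<gamma> (\<lambda>j. if j = i then 2 else 1) =
        (\<Prod>j\<in>Poly_Mapping.keys \<gamma>. if j = i then 2 ^ Poly_Mapping.lookup \<gamma> i else 1)"
      unfolding monomial_fun_def by (intro prod.cong) auto
    then show ?thesis by (auto simp: in_keys_iff)
  qed
  have "(2::complex) ^ Poly_Mapping.lookup \<alpha> i = 2 ^ Poly_Mapping.lookup \<beta> i"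
    using bohr_monomial_index_num[OF assms(1), of "\<lambda>j. if j = i then 2 else 1"]
      bohr_monomial_index_num[OF assms(2), of "\<lambda>j. if j = i then 2 else 1"] assms(3) by (simp add: mono)
  then have "(of_nat (2 ^ Poly_Mapping.lookup \<alpha> i) :: complex) = of_nat (2 ^ Poly_Mapping.lookup \<beta> i)" by simp
  then show "Poly_Mapping.lookup \<alpha> i = Poly_Mapping.lookup \<beta> i" by (simp only: of_nat_eq_iff) simp
qed

lemma index_num_surj:
  assumes "n \<in> smooth_over I" "I \<subseteq> {1..}"
  shows "\<exists>\<alpha>. Poly_Mapping.keys \<alpha> \<subseteq> I \<and> index_num \<alpha> = n"
proof -
  let ?f = "\<lambda>i. if 1 \<le> i then multiplicity (nth_prime i) n else 0"
  have n: "n \<ge> 1" by (rule smooth_overD[OF assms(1)])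
  have supp: "{i. ?f i \<noteq> 0} = {i. 1 \<le> i \<and> nth_prime i dvd n}"
  proof -
    have "multiplicity (nth_prime i) n \<noteq> 0 \<longleftrightarrow> nth_prime i dvd n" if "1 \<le> i" for i
      using prime_nth_prime[OF that] n by (simp add: prime_multiplicity_gt_zero_iff[symmetric])
    then show ?thesis by auto
  qed
  have fin: "finite {i. ?f i \<noteq> 0}" unfolding supp using n by (intro finite_prime_indices) simp
  define \<alpha> where "\<alpha> = Abs_poly_mapping ?f"
  have look: "Poly_Mapping.lookup \<alpha> = ?f" unfolding \<alpha>_def using fin by simp
  have keys: "Poly_Mapping.keys \<alpha> = {i. 1 \<le> i \<and> nth_prime i dvd n}"
    unfolding supp[symmetric] by (simp add: keys.rep_eq look)
  have "index_num \<alpha> = bohr_monomial nth_prime n"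
    unfolding index_num_def bohr_monomial_def keys by (intro prod.cong) (auto simp: look)
  then have "index_num \<alpha> = n" using bohr_monomial_nth_prime_self[OF n] by simp
  moreover have "Poly_Mapping.keys \<alpha> \<subseteq> I" unfolding keys using assms(1) by (auto simp: smooth_over_def)
  ultimately show ?thesis by blast
qed

lemma index_num_bij:
  assumes "I \<subseteq> {1..}"
  shows "inj_on index_num {\<alpha>. Poly_Mapping.keys \<alpha> \<subseteq> I}" "index_num ` {\<alpha>. Poly_Mapping.keys \<alpha> \<subseteq> I} = smooth_over I"
proof -
  show "inj_on index_num {\<alpha>. Poly_Mapping.keys \<alpha> \<subseteq> I}"
    by (rule inj_onI) (use assms index_num_inj in blast)
  show "index_num ` {\<alpha>. Poly_Mapping.keys \<alpha> \<subseteq> I} = smooth_over I"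
    using index_num_surj[OF _ assms] index_num_smooth[OF _ assms] by blast
qed

text \<open>
  Power series in the coordinates are the same as sums over the positive integers that are smooth over \<open>I\<close>.
\<close>

lemma has_sum_multi_index:
  fixes a :: "nat \<Rightarrow> complex"
  assumes I: "I \<subseteq> {1..}" and a: "\<And>n. n \<notin> smooth_over I \<Longrightarrow> a n = 0"
  shows "((\<lambda>n. a n * bohr_monomial z n) has_sum x) UNIV \<longleftrightarrow>
    ((\<lambda>\<alpha>. a (index_num \<alpha>) * monomial_fun \<alpha> z) has_sum x) {\<alpha>. Poly_Mapping.keys \<alpha> \<subseteq> I}"
proof -
  let ?A = "{\<alpha>. Poly_Mapping.keys \<alpha> \<subseteq> I}"
  have "((\<lambda>n. a n * bohr_monomial z n) has_sum x) UNIV \<longleftrightarrow> ((\<lambda>n. a n * bohr_monomial z n) has_sum x) (index_num ` ?A)"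
    unfolding index_num_bij(2)[OF I] by (rule has_sum_cong_neutral) (auto simp: a)
  also have "\<dots> \<longleftrightarrow> (((\<lambda>n. a n * bohr_monomial z n) \<circ> index_num) has_sum x) ?A"
    by (rule has_sum_reindex[OF index_num_bij(1)[OF I]])
  also have "\<dots> \<longleftrightarrow> ((\<lambda>\<alpha>. a (index_num \<alpha>) * monomial_fun \<alpha> z) has_sum x) ?A"
    by (rule has_sum_cong) (use bohr_monomial_index_num I in auto)
  finally show ?thesis .
qed

section \<open>The algebras on the orbit space\<close>

context perm_action
begin

lemma approx_agree:
  assumes "h \<in> sup_norm.approx" "k \<in> sup_norm.approx" "\<And>z. z \<in> open_polydisc I \<Longrightarrow> h z = k z"
    and z: "z \<in> topspace (closed_polydisc I)"
  shows "h z = k z"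
proof -
  have "(\<lambda>z. h z - k z) \<in> sup_norm.approx"
    using sup_norm.approx_add[OF assms(1) sup_norm.approx_mult[OF sup_norm.approx_const[of "-1"] assms(2)]] by simp
  from continuous_agree_on_open_polydisc[OF sup_norm.approx_continuous[OF this] _ z] show ?thesis using assms(3) by simp
qed

lemma psi_star_open:
  assumes z: "z \<in> open_polydisc I" and q: "q \<in> G_hat G" shows "psi_star G q z \<in> open_polydisc I"
proof -
  obtain r where r: "0 < r" "r < 1" "\<And>i. i \<in> I \<Longrightarrow> norm (z i) \<le> r" using z unfolding open_polydisc_iff by blast
  have "psi_star G q z \<in> extensional I" by (simp add: psi_star_def)
  then show ?thesis unfolding open_polydisc_iff using r psi_I[OF q]
    by (intro conjI exI[of _ r] ballI) (auto simp: psi_star_apply)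
qed

lemma polydisc_A_approx:
  assumes f: "f \<in> polydisc_A I" and h: "continuous_extension I f h" shows "h \<in> sup_norm.approx"
proof (rule sup_norm.approxI)
  fix e :: real assume "e > 0"
  with gateaux_poly_approx[OF _ h, of e] f
  show "\<exists>p\<in>poly_fun I. sup_bd I (\<lambda>z. h z - p z) e" by (simp add: polydisc_A_def sup_bd_def)
qed

text \<open>
  Elements of \<open>G\<close> act through the profinite group, so \<open>h\<close> is \<open>G\<close>-invariant on the open polydisc and, by continuity, on the closed one.
\<close>

lemma polydisc_A_inv_approx:
  assumes f: "f \<in> polydisc_invariant (polydisc_A I) G" and h: "continuous_extension I f h"
  shows "h \<in> sup_norm.inv_approx"
proof -
  have fA: "f \<in> polydisc_A I" and inv: "\<And>q z. q \<in> G_hat G \<Longrightarrow> z \<in> open_polydisc I \<Longrightarrow> f (psi_star G q z) = f z"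
    using f by (auto simp: polydisc_invariant_def)
  have hf: "h z = f z" if "z \<in> open_polydisc I" for z using h that by (simp add: continuous_extension_def)
  have ha: "h \<in> sup_norm.approx" by (rule polydisc_A_approx[OF fA h])
  have "h (act g z) = h z" if g: "g \<in> G" and z: "z \<in> topspace (closed_polydisc I)" for g z
  proof (rule approx_agree[OF approx_act[OF ha g] ha _ z])
    fix w assume w: "w \<in> open_polydisc I"
    have q: "embed g \<in> G_hat G" by (rule embed_G_hat[OF g])
    have "act g w = psi_star G (embed g) w" using psi_star_embed[OF g] by simp
    then show "h (act g w) = h w"
      using inv[OF q w] hf[OF w] hf[OF psi_star_open[OF w q]] by simp
  qed
  with ha show ?thesis by (simp add: sup_norm.inv_approx_def)
qed

lemma inv_approx_polydisc_A:
  assumes h: "h \<in> sup_norm.inv_approx"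
  shows "restrict h (open_polydisc I) \<in> polydisc_invariant (polydisc_A I) G"
    "continuous_extension I (restrict h (open_polydisc I)) h"
proof -
  let ?f = "restrict h (open_polydisc I)"
  show ext: "continuous_extension I ?f h"
    using sup_norm.approx_continuous[OF sup_norm.inv_approx_approx[OF h]] by (simp add: continuous_extension_def)
  have "gateaux_holomorphic I ?f"
  proof (rule gateaux_if_poly_approx)
    fix e :: real assume "e > 0"
    from sup_norm.approxD[OF sup_norm.inv_approx_approx[OF h] this]
    show "\<exists>p\<in>poly_fun I. \<forall>z\<in>topspace (closed_polydisc I). norm (h z - p z) \<le> e" by (simp add: sup_bd_def)
  qed simp
  then have "?f \<in> polydisc_A I" using ext unfolding polydisc_A_def by (intro CollectI conjI exI[of _ h]) auto
  moreover have "?f (psi_star G q z) = ?f z" if "q \<in> G_hat G" "z \<in> open_polydisc I" for q z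
    using sup_norm.inv_approx_psi_star[OF h that(1) open_polydisc_subset[OF that(2)]] that psi_star_open[OF that(2,1)] by simp
  ultimately show "?f \<in> polydisc_invariant (polydisc_A I) G" by (simp add: polydisc_invariant_def)
qed

text \<open>
  An arbitrary representative of each orbit. Functions that are constant on orbits do not see the choice.
\<close>

definition orbit_section :: "(nat \<Rightarrow> complex) set \<Rightarrow> nat \<Rightarrow> complex" where
  "orbit_section x = (SOME z. z \<in> topspace (closed_polydisc I) \<and> orbit_proj G z = x)"

lemma orbit_section:
  assumes "x \<in> topspace (orbit_space G)"
  shows "orbit_section x \<in> topspace (closed_polydisc I)" "orbit_proj G (orbit_section x) = x"
proof -
  have "\<exists>z. z \<in> topspace (closed_polydisc I) \<and> orbit_proj G z = x"
    using assms unfolding sup_norm.topspace_orbit_space by blast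
  from someI_ex[OF this] show "orbit_section x \<in> topspace (closed_polydisc I)" "orbit_proj G (orbit_section x) = x"
    unfolding orbit_section_def by auto
qed

lemma orbit_proj_topspace: "z \<in> topspace (closed_polydisc I) \<Longrightarrow> orbit_proj G z \<in> topspace (orbit_space G)"
  unfolding sup_norm.topspace_orbit_space by blast

lemma inv_approx_section:
  assumes h: "h \<in> sup_norm.inv_approx" and z: "z \<in> topspace (closed_polydisc I)"
  shows "h (orbit_section (orbit_proj G z)) = h z"
  using orbit_section[OF orbit_proj_topspace[OF z]] sup_norm.orbit_proj_eq_iff[OF _ z] h by blast

text \<open>
  The function induced by \<open>h\<close> on the orbit space is continuous by the universal property of the quotient, and its pullback is \<open>h\<close>.
\<close>

lemma section_orbit_space_algebra:
  assumes h: "h \<in> sup_norm.inv_approx" and f: "f \<in> \<A>" "continuous_extension I f h"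
  shows "(\<lambda>x\<in>topspace (orbit_space G). h (orbit_section x)) \<in> orbit_space_algebra \<A> G"
proof -
  let ?F = "\<lambda>x\<in>topspace (orbit_space G). h (orbit_section x)"
  have eq: "(?F \<circ> orbit_proj G) z = h z" if "z \<in> topspace (closed_polydisc I)" for z
    using inv_approx_section[OF h that] orbit_proj_topspace[OF that] by simp
  have c: "continuous_map (closed_polydisc I) euclidean (?F \<circ> orbit_proj G)"
    by (rule continuous_map_eq[OF sup_norm.approx_continuous[OF sup_norm.inv_approx_approx[OF h]]]) (simp add: eq del: o_apply)
  then have "continuous_map (orbit_space G) euclidean ?F"
    using continuous_compose_quotient_map_eq[OF sup_norm.quotient_map_orbit_proj] by blast
  moreover have "continuous_extension I f (?F \<circ> orbit_proj G)"
    using c f(2) eq open_polydisc_subset unfolding continuous_extension_def by metis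
  ultimately show ?thesis using f(1) unfolding orbit_space_algebra_def by (intro CollectI conjI bexI[of _ f]) auto
qed

lemma orbit_space_algebra_section:
  assumes F: "F \<in> orbit_space_algebra \<A> G" and h: "h \<in> sup_norm.inv_approx"
    and eq: "\<And>z. z \<in> topspace (closed_polydisc I) \<Longrightarrow> F (orbit_proj G z) = h z"
  shows "F = (\<lambda>x\<in>topspace (orbit_space G). h (orbit_section x))"
proof (rule extensionalityI[of _ "topspace (orbit_space G)"])
  fix x assume "x \<in> topspace (orbit_space G)"
  then show "F x = (\<lambda>x\<in>topspace (orbit_space G). h (orbit_section x)) x"
    using orbit_section eq by (metis restrict_apply')
qed (use F in \<open>auto simp: orbit_space_algebra_def\<close>)

lemma realized_orbit_space_A:
  "realized_algebra G (sup_bd I) (topspace (orbit_space G)) orbit_section (orbit_space_A G)"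
proof unfold_locales
  show "orbit_section x \<in> topspace (closed_polydisc I)" if "x \<in> topspace (orbit_space G)" for x
    by (rule orbit_section(1)[OF that])
  show "orbit_space_A G = (\<lambda>h. \<lambda>x\<in>topspace (orbit_space G). h (orbit_section x)) ` sup_norm.inv_approx"
  proof (intro equalityI subsetI)
    fix F assume F: "F \<in> orbit_space_A G"
    then obtain f where f: "f \<in> polydisc_invariant (polydisc_A I) G" "continuous_extension I f (F \<circ> orbit_proj G)"
      unfolding orbit_space_A_def orbit_space_algebra_def by blast
    have "F \<circ> orbit_proj G \<in> sup_norm.inv_approx" by (rule polydisc_A_inv_approx[OF f])
    then have "F = (\<lambda>x\<in>topspace (orbit_space G). (F \<circ> orbit_proj G) (orbit_section x))"
      by (rule orbit_space_algebra_section[OF F[unfolded orbit_space_A_def]]) simp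
    then show "F \<in> (\<lambda>h. \<lambda>x\<in>topspace (orbit_space G). h (orbit_section x)) ` sup_norm.inv_approx"
      using \<open>F \<circ> orbit_proj G \<in> sup_norm.inv_approx\<close> by (rule image_eqI)
  next
    fix F assume "F \<in> (\<lambda>h. \<lambda>x\<in>topspace (orbit_space G). h (orbit_section x)) ` sup_norm.inv_approx"
    then obtain h where h: "h \<in> sup_norm.inv_approx" "F = (\<lambda>x\<in>topspace (orbit_space G). h (orbit_section x))" by (elim imageE)
    show "F \<in> orbit_space_A G"
      unfolding h(2) orbit_space_A_def by (rule section_orbit_space_algebra[OF h(1) inv_approx_polydisc_A[OF h(1)]])
  qed
  show "h z = 0" if h: "h \<in> sup_norm.inv_approx" and 0: "\<And>x. x \<in> topspace (orbit_space G) \<Longrightarrow> h (orbit_section x) = 0"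
    and z: "z \<in> topspace (closed_polydisc I)" for h z
    using inv_approx_section[OF h z] 0[OF orbit_proj_topspace[OF z]] by simp
qed

text \<open>
  Absolute convergence at the point with all coordinates 1 is absolute summability of the coefficients. Their power series agrees with
  the continuous extension \<open>h\<close> on the open polydisc, hence on the closed one.
\<close>

lemma polydisc_W_l1_bd:
  assumes f: "f \<in> polydisc_W I" and h: "continuous_extension I f h" shows "\<exists>r. l1_bd I h r"
proof -
  let ?A = "{\<alpha>. Poly_Mapping.keys \<alpha> \<subseteq> I}" and ?D = "topspace (closed_polydisc I)"
  obtain c where c: "\<forall>z\<in>?D. (\<lambda>\<alpha>. norm (c \<alpha> * monomial_fun \<alpha> z)) summable_on ?A"
    "\<forall>z\<in>open_polydisc I. ((\<lambda>\<alpha>. c \<alpha> * monomial_fun \<alpha> z) has_sum f z) ?A"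
    using f unfolding polydisc_W_def by auto
  note inj = index_num_bij(1)[OF I_sub] and img = index_num_bij(2)[OF I_sub]
  define a where "a n = (if n \<in> smooth_over I then c (inv_into ?A index_num n) else 0)" for n
  have a: "a (index_num \<alpha>) = c \<alpha>" if "\<alpha> \<in> ?A" for \<alpha>
    using that inv_into_f_f[OF inj that] index_num_smooth[OF _ I_sub] by (simp add: a_def)
  have a0: "a n = 0" if "n \<notin> smooth_over I" for n using that by (simp add: a_def)
  have "(\<lambda>\<alpha>. norm (c \<alpha> * monomial_fun \<alpha> (\<lambda>i\<in>I. 1))) summable_on ?A"
    using c(1) by (rule bspec) (rule closed_polydiscI, auto)
  then have "(\<lambda>\<alpha>. norm (c \<alpha>)) summable_on ?A"
    by (rule summable_on_cong[THEN iffD1, rotated]) (auto simp: monomial_fun_def subset_iff intro!: prod.neutral)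
  then obtain T where T: "((\<lambda>\<alpha>. norm (c \<alpha>)) has_sum T) ?A" by (auto simp: summable_on_def)
  have "(((\<lambda>n. norm (a n)) \<circ> index_num) has_sum T) ?A"
    by (rule has_sum_cong[THEN iffD1, OF _ T]) (simp add: a)
  then have T': "((\<lambda>n. norm (a n)) has_sum T) (smooth_over I)" using has_sum_reindex[OF inj] img by metis
  have al: "l1_coeffs I a T"
    unfolding l1_coeffs_def
  proof (intro conjI allI impI a0)
    fix F :: "nat set" assume F: "finite F"
    have "(\<Sum>n\<in>F. norm (a n)) = (\<Sum>n\<in>F \<inter> smooth_over I. norm (a n))"
      by (rule sum.mono_neutral_right) (use F a0 in auto)
    also have "\<dots> \<le> T" using F by (intro finite_sum_le_has_sum[OF T']) auto
    finally show "(\<Sum>n\<in>F. norm (a n)) \<le> T" .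
  qed
  define k where "k z = (\<Sum>\<^sub>\<infinity>n. a n * bohr_monomial z n)" for z
  have k: "l1_bd I k T" by (rule l1_bdI[OF al]) (simp add: k_def l1_has_sum[OF al])
  have ha: "h \<in> sup_norm.approx" by (rule polydisc_A_approx[OF _ h]) (use f in \<open>simp add: polydisc_W_def\<close>)
  have "k z = h z" if "z \<in> ?D" for z
  proof (rule approx_agree[OF l1_approx_approx[OF l1_bd_approx[OF k]] ha _ that])
    fix z assume z: "z \<in> open_polydisc I"
    have "((\<lambda>\<alpha>. a (index_num \<alpha>) * monomial_fun \<alpha> z) has_sum f z) ?A"
      by (rule has_sum_cong[THEN iffD1, OF _ bspec[OF c(2) z]]) (simp add: a)
    then have "((\<lambda>n. a n * bohr_monomial z n) has_sum f z) UNIV" using has_sum_multi_index[OF I_sub, of a z "f z"] a0 by blast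
    then have "k z = f z" unfolding k_def by (rule infsumI)
    then show "k z = h z" using h z by (simp add: continuous_extension_def)
  qed
  then have "l1_bd I h T" using l1_norm.bd_cong[OF _ k] by blast
  then show ?thesis by blast
qed

lemma l1_inv_approx_polydisc_W:
  assumes h: "h \<in> l1_norm.inv_approx"
  shows "restrict h (open_polydisc I) \<in> polydisc_invariant (polydisc_W I) G"
proof -
  let ?A = "{\<alpha>. Poly_Mapping.keys \<alpha> \<subseteq> I}" and ?D = "topspace (closed_polydisc I)"
  obtain r where r: "l1_bd I h r" using l1_norm.approx_bd[OF l1_norm.inv_approx_approx[OF h]] by blast
  obtain a where a: "l1_coeffs I a r" "\<And>z. z \<in> ?D \<Longrightarrow> ((\<lambda>n. a n * bohr_monomial z n) has_sum h z) UNIV"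
    by (rule l1_bdE[OF r]) (rule that)
  note a0 = l1_coeffs_0[OF a(1)]
  have "(\<lambda>\<alpha>. norm (a (index_num \<alpha>) * monomial_fun \<alpha> z)) summable_on ?A" if z: "z \<in> ?D" for z
  proof -
    have "(\<lambda>n. norm (a n * bohr_monomial z n)) summable_on (index_num ` ?A)"
      using l1_summable[OF a(1) z] summable_on_subset_banach by blast
    then have "((\<lambda>n. norm (a n * bohr_monomial z n)) \<circ> index_num) summable_on ?A"
      using summable_on_reindex[OF index_num_bij(1)[OF I_sub]] by blast
    then show ?thesis
      by (rule summable_on_cong[THEN iffD1, rotated]) (use bohr_monomial_index_num I_sub in auto)
  qed
  moreover have "((\<lambda>\<alpha>. a (index_num \<alpha>) * monomial_fun \<alpha> z) has_sum restrict h (open_polydisc I) z) ?A"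
    if z: "z \<in> open_polydisc I" for z
    using a(2)[OF open_polydisc_subset[OF z]] has_sum_multi_index[OF I_sub a0] z by simp
  moreover note inv = inv_approx_polydisc_A(1)[OF l1_inv_approx_sup[OF h]]
  ultimately show ?thesis
    unfolding polydisc_invariant_def polydisc_W_def
    by (intro CollectI conjI exI[of _ "\<lambda>\<alpha>. a (index_num \<alpha>)"]) (auto simp: polydisc_invariant_def)
qed

lemma realized_orbit_space_W:
  "realized_algebra G (l1_bd I) (topspace (orbit_space G)) orbit_section (orbit_space_W G)"
proof unfold_locales
  show "orbit_section x \<in> topspace (closed_polydisc I)" if "x \<in> topspace (orbit_space G)" for x
    by (rule orbit_section(1)[OF that])
  show "orbit_space_W G = (\<lambda>h. \<lambda>x\<in>topspace (orbit_space G). h (orbit_section x)) ` l1_norm.inv_approx"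
  proof (intro equalityI subsetI)
    fix F assume F: "F \<in> orbit_space_W G"
    let ?h = "F \<circ> orbit_proj G"
    obtain f where f: "f \<in> polydisc_invariant (polydisc_W I) G" "continuous_extension I f ?h"
      using F unfolding orbit_space_W_def orbit_space_algebra_def by blast
    have "f \<in> polydisc_invariant (polydisc_A I) G" using f(1) by (auto simp: polydisc_invariant_def polydisc_W_def)
    then have h: "?h \<in> sup_norm.inv_approx" by (rule polydisc_A_inv_approx[OF _ f(2)])
    have "f \<in> polydisc_W I" using f(1) by (simp add: polydisc_invariant_def)
    then obtain r where r: "l1_bd I ?h r" using polydisc_W_l1_bd[OF _ f(2)] by blast
    have "?h \<in> l1_norm.inv_approx" using l1_bd_approx[OF r] sup_norm.inv_approx_inv[OF h] by (simp add: l1_norm.inv_approx_def)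
    moreover have "F = (\<lambda>x\<in>topspace (orbit_space G). ?h (orbit_section x))"
      by (rule orbit_space_algebra_section[OF F[unfolded orbit_space_W_def] h]) simp
    ultimately show "F \<in> (\<lambda>h. \<lambda>x\<in>topspace (orbit_space G). h (orbit_section x)) ` l1_norm.inv_approx"
      by (intro image_eqI[where x = ?h])
  next
    fix F assume "F \<in> (\<lambda>h. \<lambda>x\<in>topspace (orbit_space G). h (orbit_section x)) ` l1_norm.inv_approx"
    then obtain h where h: "h \<in> l1_norm.inv_approx" "F = (\<lambda>x\<in>topspace (orbit_space G). h (orbit_section x))" by (elim imageE)
    show "F \<in> orbit_space_W G"
      unfolding h(2) orbit_space_W_def
      by (rule section_orbit_space_algebra[OF l1_inv_approx_sup[OF h(1)] l1_inv_approx_polydisc_W[OF h(1)] inv_approx_polydisc_A(2)[OF l1_inv_approx_sup[OF h(1)]]])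
  qed
  show "h z = 0" if h: "h \<in> l1_norm.inv_approx" and 0: "\<And>x. x \<in> topspace (orbit_space G) \<Longrightarrow> h (orbit_section x) = 0"
    and z: "z \<in> topspace (closed_polydisc I)" for h z
    using inv_approx_section[OF l1_inv_approx_sup[OF h] z] 0[OF orbit_proj_topspace[OF z]] by simp
qed

end

section \<open>The maximal ideal spaces\<close>

theorem theorem2p15:
  fixes G :: "(nat \<Rightarrow> nat) set"
  assumes "subgroup G (BijGroup {1..})"
  shows
    "(max_ideal_space right_half_plane (dirichlet_invariant dirichlet_W G) homeomorphic_space
        max_ideal_space right_half_plane (dirichlet_invariant dirichlet_A G) \<and>
      max_ideal_space right_half_plane (dirichlet_invariant dirichlet_A G) homeomorphic_space
        max_ideal_space (topspace (orbit_space G)) (orbit_space_W G) \<and>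
      max_ideal_space (topspace (orbit_space G)) (orbit_space_W G) homeomorphic_space
        max_ideal_space (topspace (orbit_space G)) (orbit_space_A G)) \<and>
     homeomorphic_map (orbit_space G) (max_ideal_space (topspace (orbit_space G)) (orbit_space_A G))
        (\<lambda>x. \<lambda>f\<in>orbit_space_A G. f x)"
proof -
  interpret perm_action G by (rule perm_action.intro[OF assms])
  note W = realized_algebra.homeomorphic_orbit_space[OF realized_dirichlet_W]
    and A = realized_algebra.homeomorphic_orbit_space[OF realized_dirichlet_A]
    and OW = realized_algebra.homeomorphic_orbit_space[OF realized_orbit_space_W]
    and OA = realized_algebra.homeomorphic_orbit_space[OF realized_orbit_space_A]
  have "homeomorphic_map (orbit_space G) (max_ideal_space (topspace (orbit_space G)) (orbit_space_A G))
        (\<lambda>x. \<lambda>f\<in>orbit_space_A G. f x)"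
  proof (rule realized_algebra.homeomorphic_map_evaluation[OF realized_orbit_space_A])
    fix h z assume h: "h \<in> sup_norm.inv_approx" and z: "z \<in> topspace (closed_polydisc I)"
    show "(\<lambda>f\<in>orbit_space_A G. f (orbit_proj G z)) (\<lambda>x\<in>topspace (orbit_space G). h (orbit_section x)) = h z"
      using realized_algebra.S_B[OF realized_orbit_space_A h] orbit_proj_topspace[OF z] inv_approx_section[OF h z] by simp
  qed simp
  then show ?thesis
    using homeomorphic_space_trans[OF homeomorphic_space_sym[THEN iffD1, OF W] A]
      homeomorphic_space_trans[OF homeomorphic_space_sym[THEN iffD1, OF A] OW]
      homeomorphic_space_trans[OF homeomorphic_space_sym[THEN iffD1, OF OW] OA] by (intro conjI)
qed

end
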